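(* Let $\mathcal{M}$ be a cofibrantly generated monoidal model category satisfying the strong commutative monoid axiom, and assume that for every commutative monoid $R$ in $\mathcal{M}$ the category $\mathrm{CAlg}(R)$ of commutative $R$-algebras carries the inherited cofibrantly generated model structure described in the context. Then for any commutative monoid $R$, a cofibration in $\mathrm{CAlg}(R)$ whose source is cofibrant in $\mathcal{M}$ is a cofibration in $\mathcal{M}$.
   Context: A monoidal model category is a model category $\mathcal{M}$ with a closed symmetric monoidal structure $(\otimes,S)$ such that: (unit axiom) for every cofibrant $X$ and cofibrant replacement $QS\to S$, the map $QS\otimes X\to S\otimes X\cong X$ is a weak equivalence; (pushout product axiom) for cofibrations $f:X_0\to X_1$, $g:Y_0\to Y_1$, the map $f\,\square\, g: X_0\otimes Y_1\coprod_{X_0\otimes Y_0}X_1\otimes Y_0\to X_1\otimes Y_1$ is a cofibration, trivial if $f$ or $g$ is trivial. For a map $h:K\to L$, $h^{\square n}:Q_n\to L^{\otimes n}$ is the iterated pushout product: $Q_n$ is the colimit of the punctured $n$-cube whose vertices are the words $C_1\otimes\cdots\otimes C_n$ with $C_i\in\{K,L\}$, not all equal to $L$. The group $\Sigma_n$ acts by permuting factors, and $h^{\square n}/\Sigma_n:Q_n/\Sigma_n\to L^{\otimes n}/\Sigma_n$ is the induced map on coinvariants. Strong commutative monoid axiom: if $h$ is a cofibration (resp. trivial cofibration) then $h^{\square n}/\Sigma_n$ is a cofibration (resp. trivial cofibration) for all $n>0$. A commutative $R$-algebra is a commutative monoid in $\mathcal{M}$ equipped with a map of commutative monoids from $R$.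 The inherited model structure on $\mathrm{CAlg}(R)$ has as weak equivalences and fibrations the maps that are weak equivalences, respectively fibrations, in $\mathcal{M}$; its generating (trivial) cofibrations are $R\otimes\mathrm{Sym}(I)$ (resp. $R\otimes \mathrm{Sym}(J)$), where $I,J$ are the generating (trivial) cofibrations of $\mathcal{M}$ and $\mathrm{Sym}(X)=\coprod_{n\ge 0}X^{\otimes n}/\Sigma_n$ is the free commutative monoid functor. *)

theory Defs
  imports Main "HOL-Combinatorics.Permutations"
begin

unbundle cardinal_syntax

section \<open>Size\<close>

text \<open>
  "Small" is relative to a set \<open>U\<close> of strongly inaccessible cardinality: a set is small iff its
  cardinality is strictly below that of \<open>U\<close>, as for a Grothendieck universe. Up to isomorphism all
  small sets, categories and ordinals are carried by subsets of the type of the elements of \<open>U\<close>.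
  The collections of objects and of arrows of a category may be arbitrarily large.
\<close>

definition inaccessible :: "'u set \<Rightarrow> bool" where
  "inaccessible U \<longleftrightarrow> |UNIV :: nat set| <o |U| \<and> regularCard |U| \<and>
     (\<forall>X :: 'u set. |X| <o |U| \<longrightarrow> |Pow X| <o |U| )"

definition small :: "'u set \<Rightarrow> 'a set \<Rightarrow> bool" where
  "small U A \<longleftrightarrow> |A| <o |U|"


section \<open>Categories, limits and colimits\<close>

record ('o, 'm) cat =
  Obj :: "'o set"
  Arr :: "'m set"
  Dom :: "'m \<Rightarrow> 'o"
  Cod :: "'m \<Rightarrow> 'o"
  Idn :: "'o \<Rightarrow> 'm" ("\<i>\<d>\<index>")
  Cmp :: "'m \<Rightarrow> 'm \<Rightarrow> 'm" (infixl "\<cdot>\<index>" 75)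

definition Hom :: "('o, 'm, 'z) cat_scheme \<Rightarrow> 'o \<Rightarrow> 'o \<Rightarrow> 'm set" where
  "Hom C X Y = {f \<in> Arr C. Dom C f = X \<and> Cod C f = Y}"

locale category =
  fixes C :: "('o, 'm, 'z) cat_scheme" (structure)
  assumes dom_cod_closed: "f \<in> Arr C \<Longrightarrow> Dom C f \<in> Obj C \<and> Cod C f \<in> Obj C"
    and id_closed: "X \<in> Obj C \<Longrightarrow> \<i>\<d> X \<in> Hom C X X"
    and comp_closed: "f \<in> Hom C X Y \<Longrightarrow> g \<in> Hom C Y Z \<Longrightarrow> g \<cdot> f \<in> Hom C X Z"
    and comp_id_right: "f \<in> Hom C X Y \<Longrightarrow> f \<cdot> \<i>\<d> X = f"
    and comp_id_left: "f \<in> Hom C X Y \<Longrightarrow> \<i>\<d> Y \<cdot> f = f"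
    and comp_assoc: "f \<in> Hom C W X \<Longrightarrow> g \<in> Hom C X Y \<Longrightarrow> h \<in> Hom C Y Z \<Longrightarrow>
                       (h \<cdot> g) \<cdot> f = h \<cdot> (g \<cdot> f)"

definition locally_small :: "'u set \<Rightarrow> ('o, 'm, 'z) cat_scheme \<Rightarrow> bool" where
  "locally_small U C \<longleftrightarrow> (\<forall>X\<in>Obj C. \<forall>Y\<in>Obj C. small U (Hom C X Y))"

definition op_cat :: "('o, 'm, 'z) cat_scheme \<Rightarrow> ('o, 'm) cat" where
  "op_cat C = \<lparr>Obj = Obj C, Arr = Arr C, Dom = Cod C, Cod = Dom C,
               Idn = Idn C, Cmp = (\<lambda>g f. f \<cdot>\<^bsub>C\<^esub> g)\<rparr>"

definition preorder_cat :: "'a set \<Rightarrow> ('a \<Rightarrow> 'a \<Rightarrow> bool) \<Rightarrow> ('a, 'a \<times> 'a) cat" where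
  "preorder_cat A le = \<lparr>Obj = A, Arr = {(a, b). a \<in> A \<and> b \<in> A \<and> le a b}, Dom = fst, Cod = snd,
                        Idn = (\<lambda>a. (a, a)), Cmp = (\<lambda>g f. (fst f, snd g))\<rparr>"

definition is_inverse :: "('o, 'm, 'z) cat_scheme \<Rightarrow> 'm \<Rightarrow> 'm \<Rightarrow> bool" where
  "is_inverse C f g \<longleftrightarrow> f \<in> Arr C \<and> g \<in> Hom C (Cod C f) (Dom C f) \<and>
     g \<cdot>\<^bsub>C\<^esub> f = Idn C (Dom C f) \<and> f \<cdot>\<^bsub>C\<^esub> g = Idn C (Cod C f)"

definition is_iso :: "('o, 'm, 'z) cat_scheme \<Rightarrow> 'm \<Rightarrow> bool" where
  "is_iso C f \<longleftrightarrow> (\<exists>g. is_inverse C f g)"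

definition inverse_arr :: "('o, 'm, 'z) cat_scheme \<Rightarrow> 'm \<Rightarrow> 'm" where
  "inverse_arr C f = (THE g. is_inverse C f g)"

definition is_functor ::
    "('i, 'a, 'y) cat_scheme \<Rightarrow> ('o, 'm, 'z) cat_scheme \<Rightarrow> ('i \<Rightarrow> 'o) \<Rightarrow> ('a \<Rightarrow> 'm) \<Rightarrow> bool" where
  "is_functor D C FO FA \<longleftrightarrow>
     (\<forall>i\<in>Obj D. FO i \<in> Obj C) \<and>
     (\<forall>a\<in>Arr D. FA a \<in> Hom C (FO (Dom D a)) (FO (Cod D a))) \<and>
     (\<forall>i\<in>Obj D. FA (Idn D i) = Idn C (FO i)) \<and>
     (\<forall>a\<in>Arr D. \<forall>b\<in>Arr D. Cod D a = Dom D b \<longrightarrow> FA (b \<cdot>\<^bsub>D\<^esub> a) = FA b \<cdot>\<^bsub>C\<^esub> FA a)"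

definition is_cocone ::
    "('i, 'a, 'y) cat_scheme \<Rightarrow> ('o, 'm, 'z) cat_scheme \<Rightarrow> ('i \<Rightarrow> 'o) \<Rightarrow> ('a \<Rightarrow> 'm)
      \<Rightarrow> 'o \<Rightarrow> ('i \<Rightarrow> 'm) \<Rightarrow> bool" where
  "is_cocone D C FO FA c \<iota> \<longleftrightarrow>
     c \<in> Obj C \<and> (\<forall>i\<in>Obj D. \<iota> i \<in> Hom C (FO i) c) \<and>
     (\<forall>a\<in>Arr D. \<iota> (Cod D a) \<cdot>\<^bsub>C\<^esub> FA a = \<iota> (Dom D a))"

definition is_colimit ::
    "('i, 'a, 'y) cat_scheme \<Rightarrow> ('o, 'm, 'z) cat_scheme \<Rightarrow> ('i \<Rightarrow> 'o) \<Rightarrow> ('a \<Rightarrow> 'm)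
      \<Rightarrow> 'o \<Rightarrow> ('i \<Rightarrow> 'm) \<Rightarrow> bool" where
  "is_colimit D C FO FA c \<iota> \<longleftrightarrow>
     is_cocone D C FO FA c \<iota> \<and>
     (\<forall>c' \<iota>'. is_cocone D C FO FA c' \<iota>' \<longrightarrow>
        (\<exists>!u. u \<in> Hom C c c' \<and> (\<forall>i\<in>Obj D. u \<cdot>\<^bsub>C\<^esub> \<iota> i = \<iota>' i)))"

definition cocomplete :: "'u set \<Rightarrow> ('o, 'm, 'z) cat_scheme \<Rightarrow> bool" where
  "cocomplete U C \<longleftrightarrow>
     (\<forall>(D :: ('u, 'u) cat) FO FA. category D \<and> small U (Obj D) \<and> small U (Arr D) \<and>
        is_functor D C FO FA \<longrightarrow> (\<exists>c \<iota>. is_colimit D C FO FA c \<iota>))"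

definition complete :: "'u set \<Rightarrow> ('o, 'm, 'z) cat_scheme \<Rightarrow> bool" where
  "complete U C \<longleftrightarrow> cocomplete U (op_cat C)"

definition initial :: "('o, 'm, 'z) cat_scheme \<Rightarrow> 'o \<Rightarrow> bool" where
  "initial C X \<longleftrightarrow> X \<in> Obj C \<and> (\<forall>Y\<in>Obj C. \<exists>!f. f \<in> Hom C X Y)"

text \<open>The square \<open>p \<cdot> f = q \<cdot> g\<close> is a pushout; \<open>p\<close> is the pushout of \<open>g\<close> along \<open>f\<close>.\<close>

definition is_pushout :: "('o, 'm, 'z) cat_scheme \<Rightarrow> 'm \<Rightarrow> 'm \<Rightarrow> 'm \<Rightarrow> 'm \<Rightarrow> bool" where
  "is_pushout C f g p q \<longleftrightarrow>
     f \<in> Arr C \<and> g \<in> Arr C \<and> p \<in> Arr C \<and> q \<in> Arr C \<and>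
     Dom C f = Dom C g \<and> Dom C p = Cod C f \<and> Dom C q = Cod C g \<and> Cod C p = Cod C q \<and>
     p \<cdot>\<^bsub>C\<^esub> f = q \<cdot>\<^bsub>C\<^esub> g \<and>
     (\<forall>Z\<in>Obj C. \<forall>a\<in>Hom C (Cod C f) Z. \<forall>b\<in>Hom C (Cod C g) Z. a \<cdot>\<^bsub>C\<^esub> f = b \<cdot>\<^bsub>C\<^esub> g \<longrightarrow>
        (\<exists>!u. u \<in> Hom C (Cod C p) Z \<and> u \<cdot>\<^bsub>C\<^esub> p = a \<and> u \<cdot>\<^bsub>C\<^esub> q = b))"

text \<open>\<open>q\<close> is the quotient of \<open>X\<close> by a set \<open>G\<close> of endomorphisms, that is, the universal arrow out of
  \<open>X\<close> with \<open>q \<cdot> g = q\<close> for all \<open>g \<in> G\<close>.\<close>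

definition is_coinvariants :: "('o, 'm, 'z) cat_scheme \<Rightarrow> 'o \<Rightarrow> 'm set \<Rightarrow> 'm \<Rightarrow> bool" where
  "is_coinvariants C X G q \<longleftrightarrow>
     q \<in> Arr C \<and> Dom C q = X \<and> (\<forall>g\<in>G. q \<cdot>\<^bsub>C\<^esub> g = q) \<and>
     (\<forall>Z\<in>Obj C. \<forall>a\<in>Hom C X Z. (\<forall>g\<in>G. a \<cdot>\<^bsub>C\<^esub> g = a) \<longrightarrow>
        (\<exists>!u. u \<in> Hom C (Cod C q) Z \<and> u \<cdot>\<^bsub>C\<^esub> q = a))"


section \<open>Transfinite compositions and smallness of objects\<close>

text \<open>An ordinal is a well-order \<open>r\<close>; its elements, the members of \<open>Field r\<close>, play the role of the
  smaller ordinals, and \<open>underS r b\<close> is the set of those below \<open>b\<close>.\<close>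

definition small_ordinal :: "'u set \<Rightarrow> 'u rel \<Rightarrow> bool" where
  "small_ordinal U r \<longleftrightarrow> Well_order r \<and> small U (Field r)"

definition is_zero :: "'u rel \<Rightarrow> 'u \<Rightarrow> bool" where
  "is_zero r a \<longleftrightarrow> a \<in> Field r \<and> underS r a = {}"

definition is_succ :: "'u rel \<Rightarrow> 'u \<Rightarrow> 'u \<Rightarrow> bool" where
  "is_succ r a b \<longleftrightarrow> a \<in> underS r b \<and> (\<forall>d\<in>underS r b. (d, a) \<in> r)"

definition is_limit_element :: "'u rel \<Rightarrow> 'u \<Rightarrow> bool" where
  "is_limit_element r b \<longleftrightarrow> b \<in> Field r \<and> \<not> is_zero r b \<and> (\<nexists>a. is_succ r a b)"

abbreviation ordinal_cat :: "'u set \<Rightarrow> 'u rel \<Rightarrow> ('u, 'u \<times> 'u) cat" where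
  "ordinal_cat A r \<equiv> preorder_cat A (\<lambda>a b. (a, b) \<in> r)"

definition is_sequence ::
    "'u rel \<Rightarrow> ('o, 'm, 'z) cat_scheme \<Rightarrow> ('u \<Rightarrow> 'o) \<Rightarrow> ('u \<times> 'u \<Rightarrow> 'm) \<Rightarrow> bool" where
  "is_sequence r C XO XA \<longleftrightarrow>
     is_functor (ordinal_cat (Field r) r) C XO XA \<and>
     (\<forall>b. is_limit_element r b \<longrightarrow>
        is_colimit (ordinal_cat (underS r b) r) C XO XA (XO b) (\<lambda>a. XA (a, b)))"

text \<open>For a cardinal \<open>k\<close>, an ordinal without greatest element is \<open>k\<close>-filtered if its subsets of
  cardinality at most \<open>k\<close> are bounded, so that their suprema are strictly below the ordinal.\<close>

definition is_filtered :: "'u rel \<Rightarrow> 'u rel \<Rightarrow> bool" where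
  "is_filtered k r \<longleftrightarrow>
     Field r \<noteq> {} \<and> (\<forall>a\<in>Field r. \<exists>b\<in>Field r. a \<noteq> b \<and> (a, b) \<in> r) \<and>
     (\<forall>A \<subseteq> Field r. |A| \<le>o k \<longrightarrow> (\<exists>b\<in>Field r. \<forall>a\<in>A. (a, b) \<in> r))"

text \<open>\<open>A\<close> is small relative to the class \<open>D\<close> of arrows: for some small cardinal \<open>k\<close> and every
  \<open>k\<close>-filtered sequence \<open>X\<close> of arrows of \<open>D\<close>, the map \<open>colim Hom(A, X b) \<rightarrow> Hom(A, colim X)\<close> is
  surjective and injective. The two clauses are its surjectivity and injectivity, a directed
  colimit of sets being the union modulo becoming equal at a later stage.\<close>

definition small_rel ::
    "'u set \<Rightarrow> ('o, 'm, 'z) cat_scheme \<Rightarrow> 'm set \<Rightarrow> 'o \<Rightarrow> bool" where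
  "small_rel U C D A \<longleftrightarrow>
     (\<exists>k :: 'u rel. Card_order k \<and> small U (Field k) \<and>
       (\<forall>r XO XA c \<iota>. small_ordinal U r \<and> is_filtered k r \<and> is_sequence r C XO XA \<and>
            (\<forall>a b. is_succ r a b \<longrightarrow> XA (a, b) \<in> D) \<and>
            is_colimit (ordinal_cat (Field r) r) C XO XA c \<iota> \<longrightarrow>
          (\<forall>f\<in>Hom C A c. \<exists>b\<in>Field r. \<exists>g\<in>Hom C A (XO b). f = \<iota> b \<cdot>\<^bsub>C\<^esub> g) \<and>
          (\<forall>a\<in>Field r. \<forall>b\<in>Field r. \<forall>g\<in>Hom C A (XO a). \<forall>g'\<in>Hom C A (XO b).
             \<iota> a \<cdot>\<^bsub>C\<^esub> g = \<iota> b \<cdot>\<^bsub>C\<^esub> g' \<longrightarrow>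
             (\<exists>d\<in>Field r. (a, d) \<in> r \<and> (b, d) \<in> r \<and>
                XA (a, d) \<cdot>\<^bsub>C\<^esub> g = XA (b, d) \<cdot>\<^bsub>C\<^esub> g'))))"

definition pushouts_of :: "('o, 'm, 'z) cat_scheme \<Rightarrow> 'm set \<Rightarrow> 'm set" where
  "pushouts_of C I = {p. \<exists>i\<in>I. \<exists>f q. is_pushout C f i p q}"

text \<open>Relative \<open>I\<close>-cell complexes: transfinite compositions of pushouts of elements of \<open>I\<close>.\<close>

definition cell :: "'u set \<Rightarrow> ('o, 'm, 'z) cat_scheme \<Rightarrow> 'm set \<Rightarrow> 'm set" where
  "cell U C I =
     {f. \<exists>(r :: 'u rel) XO XA c \<iota> z. small_ordinal U r \<and> is_sequence r C XO XA \<and>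
           (\<forall>a b. is_succ r a b \<longrightarrow> XA (a, b) \<in> pushouts_of C I) \<and>
           is_colimit (ordinal_cat (Field r) r) C XO XA c \<iota> \<and> is_zero r z \<and> f = \<iota> z}"


section \<open>Model categories\<close>

record 'm model_structure =
  Weq :: "'m set"
  Fib :: "'m set"
  Cof :: "'m set"

definition has_lifting :: "('o, 'm, 'z) cat_scheme \<Rightarrow> 'm \<Rightarrow> 'm \<Rightarrow> bool" where
  "has_lifting C i p \<longleftrightarrow>
     (\<forall>u\<in>Hom C (Dom C i) (Dom C p). \<forall>v\<in>Hom C (Cod C i) (Cod C p). p \<cdot>\<^bsub>C\<^esub> u = v \<cdot>\<^bsub>C\<^esub> i \<longrightarrow>
        (\<exists>d\<in>Hom C (Cod C i) (Dom C p). d \<cdot>\<^bsub>C\<^esub> i = u \<and> p \<cdot>\<^bsub>C\<^esub> d = v))"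

definition inj_arrows :: "('o, 'm, 'z) cat_scheme \<Rightarrow> 'm set \<Rightarrow> 'm set" where
  "inj_arrows C I = {p \<in> Arr C. \<forall>i\<in>I. has_lifting C i p}"

definition is_retract :: "('o, 'm, 'z) cat_scheme \<Rightarrow> 'm \<Rightarrow> 'm \<Rightarrow> bool" where
  "is_retract C f g \<longleftrightarrow> f \<in> Arr C \<and> g \<in> Arr C \<and>
     (\<exists>i\<in>Hom C (Dom C f) (Dom C g). \<exists>r\<in>Hom C (Dom C g) (Dom C f).
      \<exists>j\<in>Hom C (Cod C f) (Cod C g). \<exists>s\<in>Hom C (Cod C g) (Cod C f).
        r \<cdot>\<^bsub>C\<^esub> i = Idn C (Dom C f) \<and> s \<cdot>\<^bsub>C\<^esub> j = Idn C (Cod C f) \<and>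
        g \<cdot>\<^bsub>C\<^esub> i = j \<cdot>\<^bsub>C\<^esub> f \<and> f \<cdot>\<^bsub>C\<^esub> r = s \<cdot>\<^bsub>C\<^esub> g)"

locale model_category = category C
  for U :: "'u set" and C :: "('o, 'm, 'z) cat_scheme" (structure) and \<M> :: "'m model_structure" +
  assumes locally_small: "locally_small U C"
    and complete: "complete U C"
    and cocomplete: "cocomplete U C"
    and classes: "Weq \<M> \<subseteq> Arr C" "Fib \<M> \<subseteq> Arr C" "Cof \<M> \<subseteq> Arr C"
    and two_of_three:
      "f \<in> Hom C X Y \<Longrightarrow> g \<in> Hom C Y Z \<Longrightarrow> f \<in> Weq \<M> \<Longrightarrow> g \<in> Weq \<M> \<Longrightarrow> g \<cdot> f \<in> Weq \<M>"
      "f \<in> Hom C X Y \<Longrightarrow> g \<in> Hom C Y Z \<Longrightarrow> f \<in> Weq \<M> \<Longrightarrow> g \<cdot> f \<in> Weq \<M> \<Longrightarrow> g \<in> Weq \<M>"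
      "f \<in> Hom C X Y \<Longrightarrow> g \<in> Hom C Y Z \<Longrightarrow> g \<in> Weq \<M> \<Longrightarrow> g \<cdot> f \<in> Weq \<M> \<Longrightarrow> f \<in> Weq \<M>"
    and retracts:
      "is_retract C f g \<Longrightarrow> g \<in> Weq \<M> \<Longrightarrow> f \<in> Weq \<M>"
      "is_retract C f g \<Longrightarrow> g \<in> Fib \<M> \<Longrightarrow> f \<in> Fib \<M>"
      "is_retract C f g \<Longrightarrow> g \<in> Cof \<M> \<Longrightarrow> f \<in> Cof \<M>"
    and lifting:
      "i \<in> Cof \<M> \<Longrightarrow> p \<in> Fib \<M> \<Longrightarrow> i \<in> Weq \<M> \<or> p \<in> Weq \<M> \<Longrightarrow> has_lifting C i p"
    and factorization:
      "f \<in> Hom C X Y \<Longrightarrow> \<exists>Z. \<exists>i\<in>Hom C X Z. \<exists>p\<in>Hom C Z Y.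
         f = p \<cdot> i \<and> i \<in> Cof \<M> \<and> p \<in> Fib \<M> \<inter> Weq \<M>"
      "f \<in> Hom C X Y \<Longrightarrow> \<exists>Z. \<exists>i\<in>Hom C X Z. \<exists>p\<in>Hom C Z Y.
         f = p \<cdot> i \<and> i \<in> Cof \<M> \<inter> Weq \<M> \<and> p \<in> Fib \<M>"

definition cofibrant :: "('o, 'm, 'z) cat_scheme \<Rightarrow> 'm model_structure \<Rightarrow> 'o \<Rightarrow> bool" where
  "cofibrant C \<M> X \<longleftrightarrow> (\<exists>E f. initial C E \<and> f \<in> Hom C E X \<and> f \<in> Cof \<M>)"

locale cofibrantly_generated = model_category U C \<M>
  for U :: "'u set" and C :: "('o, 'm, 'z) cat_scheme" (structure) and \<M> :: "'m model_structure" +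
  fixes I J :: "'m set"
  assumes generators: "I \<subseteq> Arr C" "J \<subseteq> Arr C" "small U I" "small U J"
    and domains_small:
      "i \<in> I \<Longrightarrow> small_rel U C (cell U C I) (Dom C i)"
      "j \<in> J \<Longrightarrow> small_rel U C (cell U C J) (Dom C j)"
    and fib_eq: "Fib \<M> = inj_arrows C J"
    and trivial_fib_eq: "Fib \<M> \<inter> Weq \<M> = inj_arrows C I"


section \<open>Closed symmetric monoidal categories\<close>

record ('o, 'm) smcat = "('o, 'm) cat" +
  Tensor :: "'o \<Rightarrow> 'o \<Rightarrow> 'o" (infixr "\<otimes>\<index>" 80)
  TensorArr :: "'m \<Rightarrow> 'm \<Rightarrow> 'm" (infixr "\<odot>\<index>" 80)
  Unit :: 'o ("\<one>\<index>")
  Assoc :: "'o \<Rightarrow> 'o \<Rightarrow> 'o \<Rightarrow> 'm" ("\<alpha>\<index>")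
  LUnit :: "'o \<Rightarrow> 'm" ("\<ll>\<index>")
  RUnit :: "'o \<Rightarrow> 'm" ("\<rr>\<index>")
  Braid :: "'o \<Rightarrow> 'o \<Rightarrow> 'm" ("\<beta>\<index>")

locale closed_symmetric_monoidal = category M
  for M :: "('o, 'm, 'z) smcat_scheme" (structure) +
  assumes unit_obj: "\<one> \<in> Obj M"
    and tensor_obj: "X \<in> Obj M \<Longrightarrow> Y \<in> Obj M \<Longrightarrow> X \<otimes> Y \<in> Obj M"
    and tensor_arr: "f \<in> Hom M X X' \<Longrightarrow> g \<in> Hom M Y Y' \<Longrightarrow> f \<odot> g \<in> Hom M (X \<otimes> Y) (X' \<otimes> Y')"
    and tensor_id: "X \<in> Obj M \<Longrightarrow> Y \<in> Obj M \<Longrightarrow> \<i>\<d> X \<odot> \<i>\<d> Y = \<i>\<d> (X \<otimes> Y)"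
    and tensor_comp:
      "f \<in> Hom M X X' \<Longrightarrow> f' \<in> Hom M X' X'' \<Longrightarrow> g \<in> Hom M Y Y' \<Longrightarrow> g' \<in> Hom M Y' Y'' \<Longrightarrow>
         (f' \<cdot> f) \<odot> (g' \<cdot> g) = (f' \<odot> g') \<cdot> (f \<odot> g)"
    and assoc_hom:
      "X \<in> Obj M \<Longrightarrow> Y \<in> Obj M \<Longrightarrow> Z \<in> Obj M \<Longrightarrow>
         \<alpha> X Y Z \<in> Hom M ((X \<otimes> Y) \<otimes> Z) (X \<otimes> (Y \<otimes> Z)) \<and> is_iso M (\<alpha> X Y Z)"
    and assoc_natural:
      "f \<in> Hom M X X' \<Longrightarrow> g \<in> Hom M Y Y' \<Longrightarrow> h \<in> Hom M Z Z' \<Longrightarrow>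
         \<alpha> X' Y' Z' \<cdot> ((f \<odot> g) \<odot> h) = (f \<odot> (g \<odot> h)) \<cdot> \<alpha> X Y Z"
    and lunit_hom: "X \<in> Obj M \<Longrightarrow> \<ll> X \<in> Hom M (\<one> \<otimes> X) X \<and> is_iso M (\<ll> X)"
    and lunit_natural: "f \<in> Hom M X X' \<Longrightarrow> \<ll> X' \<cdot> (\<i>\<d> \<one> \<odot> f) = f \<cdot> \<ll> X"
    and runit_hom: "X \<in> Obj M \<Longrightarrow> \<rr> X \<in> Hom M (X \<otimes> \<one>) X \<and> is_iso M (\<rr> X)"
    and runit_natural: "f \<in> Hom M X X' \<Longrightarrow> \<rr> X' \<cdot> (f \<odot> \<i>\<d> \<one>) = f \<cdot> \<rr> X"
    and braid_hom: "X \<in> Obj M \<Longrightarrow> Y \<in> Obj M \<Longrightarrow> \<beta> X Y \<in> Hom M (X \<otimes> Y) (Y \<otimes> X)"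
    and braid_natural:
      "f \<in> Hom M X X' \<Longrightarrow> g \<in> Hom M Y Y' \<Longrightarrow> \<beta> X' Y' \<cdot> (f \<odot> g) = (g \<odot> f) \<cdot> \<beta> X Y"
    and braid_symmetric: "X \<in> Obj M \<Longrightarrow> Y \<in> Obj M \<Longrightarrow> \<beta> Y X \<cdot> \<beta> X Y = \<i>\<d> (X \<otimes> Y)"
    and pentagon:
      "W \<in> Obj M \<Longrightarrow> X \<in> Obj M \<Longrightarrow> Y \<in> Obj M \<Longrightarrow> Z \<in> Obj M \<Longrightarrow>
         \<alpha> W X (Y \<otimes> Z) \<cdot> \<alpha> (W \<otimes> X) Y Z =
         (\<i>\<d> W \<odot> \<alpha> X Y Z) \<cdot> \<alpha> W (X \<otimes> Y) Z \<cdot> (\<alpha> W X Y \<odot> \<i>\<d> Z)"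
    and triangle:
      "X \<in> Obj M \<Longrightarrow> Y \<in> Obj M \<Longrightarrow> (\<i>\<d> X \<odot> \<ll> Y) \<cdot> \<alpha> X \<one> Y = \<rr> X \<odot> \<i>\<d> Y"
    and hexagon:
      "X \<in> Obj M \<Longrightarrow> Y \<in> Obj M \<Longrightarrow> Z \<in> Obj M \<Longrightarrow>
         \<alpha> Y Z X \<cdot> \<beta> X (Y \<otimes> Z) \<cdot> \<alpha> X Y Z =
         (\<i>\<d> Y \<odot> \<beta> X Z) \<cdot> \<alpha> Y X Z \<cdot> (\<beta> X Y \<odot> \<i>\<d> Z)"
    and closed:
      "X \<in> Obj M \<Longrightarrow> Y \<in> Obj M \<Longrightarrow>
         \<exists>H\<in>Obj M. \<exists>ev\<in>Hom M (H \<otimes> X) Y. \<forall>Z\<in>Obj M. \<forall>f\<in>Hom M (Z \<otimes> X) Y.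
           \<exists>!g. g \<in> Hom M Z H \<and> ev \<cdot> (g \<odot> \<i>\<d> X) = f"

text \<open>\<open>X \<otimes> (Y \<otimes> Z) \<rightarrow> Y \<otimes> (X \<otimes> Z)\<close> and \<open>(W \<otimes> X) \<otimes> (Y \<otimes> Z) \<rightarrow> (W \<otimes> Y) \<otimes> (X \<otimes> Z)\<close>\<close>

definition exchange :: "('o, 'm, 'z) smcat_scheme \<Rightarrow> 'o \<Rightarrow> 'o \<Rightarrow> 'o \<Rightarrow> 'm" where
  "exchange M X Y Z =
     \<alpha>\<^bsub>M\<^esub> Y X Z \<cdot>\<^bsub>M\<^esub> (\<beta>\<^bsub>M\<^esub> X Y \<odot>\<^bsub>M\<^esub> Idn M Z) \<cdot>\<^bsub>M\<^esub> inverse_arr M (\<alpha>\<^bsub>M\<^esub> X Y Z)"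

definition middle_exchange :: "('o, 'm, 'z) smcat_scheme \<Rightarrow> 'o \<Rightarrow> 'o \<Rightarrow> 'o \<Rightarrow> 'o \<Rightarrow> 'm" where
  "middle_exchange M W X Y Z =
     inverse_arr M (\<alpha>\<^bsub>M\<^esub> W Y (X \<otimes>\<^bsub>M\<^esub> Z)) \<cdot>\<^bsub>M\<^esub> (Idn M W \<odot>\<^bsub>M\<^esub> exchange M X Y Z) \<cdot>\<^bsub>M\<^esub>
     \<alpha>\<^bsub>M\<^esub> W X (Y \<otimes>\<^bsub>M\<^esub> Z)"


section \<open>Tensor words and the action of the symmetric groups\<close>

text \<open>\<open>tensor_list M [X1, \<dots>, Xn]\<close> is \<open>X1 \<otimes> (X2 \<otimes> (\<dots> \<otimes> (Xn \<otimes> \<one>)))\<close>.\<close>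

primrec tensor_list :: "('o, 'm, 'z) smcat_scheme \<Rightarrow> 'o list \<Rightarrow> 'o" where
  "tensor_list M [] = \<one>\<^bsub>M\<^esub>"
| "tensor_list M (X # Xs) = X \<otimes>\<^bsub>M\<^esub> tensor_list M Xs"

primrec tensor_arr_list :: "('o, 'm, 'z) smcat_scheme \<Rightarrow> 'm list \<Rightarrow> 'm" where
  "tensor_arr_list M [] = Idn M \<one>\<^bsub>M\<^esub>"
| "tensor_arr_list M (f # fs) = f \<odot>\<^bsub>M\<^esub> tensor_arr_list M fs"

abbreviation tensor_power :: "('o, 'm, 'z) smcat_scheme \<Rightarrow> 'o \<Rightarrow> nat \<Rightarrow> 'o" where
  "tensor_power M X n \<equiv> tensor_list M (replicate n X)"

abbreviation tensor_power_arr :: "('o, 'm, 'z) smcat_scheme \<Rightarrow> 'm \<Rightarrow> nat \<Rightarrow> 'm" where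
  "tensor_power_arr M f n \<equiv> tensor_arr_list M (replicate n f)"

text \<open>The canonical isomorphism from \<open>tensor_list M Xs \<otimes> tensor_list M Ys\<close> to
  \<open>tensor_list M (Xs @ Ys)\<close>.\<close>

primrec append_iso :: "('o, 'm, 'z) smcat_scheme \<Rightarrow> 'o list \<Rightarrow> 'o list \<Rightarrow> 'm" where
  "append_iso M [] Ys = \<ll>\<^bsub>M\<^esub> (tensor_list M Ys)"
| "append_iso M (X # Xs) Ys =
     (Idn M X \<odot>\<^bsub>M\<^esub> append_iso M Xs Ys) \<cdot>\<^bsub>M\<^esub> \<alpha>\<^bsub>M\<^esub> X (tensor_list M Xs) (tensor_list M Ys)"

definition remove_nth :: "nat \<Rightarrow> 'a list \<Rightarrow> 'a list" where
  "remove_nth i xs = take i xs @ drop (Suc i) xs"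

text \<open>Move the factor with index \<open>i\<close> to the front.\<close>

fun pull_iso :: "('o, 'm, 'z) smcat_scheme \<Rightarrow> 'o list \<Rightarrow> nat \<Rightarrow> 'm" where
  "pull_iso M Xs 0 = Idn M (tensor_list M Xs)"
| "pull_iso M (X # Xs) (Suc i) =
     exchange M X (Xs ! i) (tensor_list M (remove_nth i Xs)) \<cdot>\<^bsub>M\<^esub> (Idn M X \<odot>\<^bsub>M\<^esub> pull_iso M Xs i)"
| "pull_iso M [] (Suc i) = undefined"

text \<open>For a permutation \<open>\<sigma>\<close> of \<open>{..<n}\<close> and \<open>n = length Xs\<close>, the symmetry isomorphism from
  \<open>tensor_list M Xs\<close> to \<open>tensor_list M (permute_list \<sigma> Xs)\<close>: the factor with index \<open>\<sigma> 0\<close> is moved to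
  the front and the remaining factors are rearranged recursively, \<open>\<sigma>\<close> being renumbered to skip the
  index \<open>\<sigma> 0\<close>.\<close>

primrec perm_iso :: "('o, 'm, 'z) smcat_scheme \<Rightarrow> nat \<Rightarrow> (nat \<Rightarrow> nat) \<Rightarrow> 'o list \<Rightarrow> 'm" where
  "perm_iso M 0 \<sigma> Xs = Idn M \<one>\<^bsub>M\<^esub>"
| "perm_iso M (Suc n) \<sigma> Xs =
     (Idn M (Xs ! \<sigma> 0) \<odot>\<^bsub>M\<^esub>
        perm_iso M n (\<lambda>j. if \<sigma> (Suc j) < \<sigma> 0 then \<sigma> (Suc j) else \<sigma> (Suc j) - 1)
          (remove_nth (\<sigma> 0) Xs)) \<cdot>\<^bsub>M\<^esub>
     pull_iso M Xs (\<sigma> 0)"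

definition power_action :: "('o, 'm, 'z) smcat_scheme \<Rightarrow> 'o \<Rightarrow> nat \<Rightarrow> 'm set" where
  "power_action M X n = {perm_iso M n \<sigma> (replicate n X) |\<sigma>. \<sigma> permutes {..<n}}"


section \<open>Monoidal model categories and the strong commutative monoid axiom\<close>

locale monoidal_model_category =
  closed_symmetric_monoidal M + model_category U M \<M>
  for U :: "'u set" and M :: "('o, 'm, 'z) smcat_scheme" (structure) and \<M> :: "'m model_structure" +
  assumes unit_axiom:
      "cofibrant M \<M> X \<Longrightarrow> cofibrant M \<M> Q \<Longrightarrow> q \<in> Hom M Q \<one> \<Longrightarrow> q \<in> Fib \<M> \<inter> Weq \<M> \<Longrightarrow>
         \<ll> X \<cdot> (q \<odot> \<i>\<d> X) \<in> Weq \<M>"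
    and pushout_product_axiom:
      "f \<in> Hom M X0 X1 \<Longrightarrow> g \<in> Hom M Y0 Y1 \<Longrightarrow> f \<in> Cof \<M> \<Longrightarrow> g \<in> Cof \<M> \<Longrightarrow>
         is_pushout M (\<i>\<d> X0 \<odot> g) (f \<odot> \<i>\<d> Y0) a b \<Longrightarrow>
         k \<in> Hom M (Cod M a) (X1 \<otimes> Y1) \<Longrightarrow> k \<cdot> a = f \<odot> \<i>\<d> Y1 \<Longrightarrow> k \<cdot> b = \<i>\<d> X1 \<odot> g \<Longrightarrow>
         k \<in> Cof \<M> \<and> (f \<in> Weq \<M> \<or> g \<in> Weq \<M> \<longrightarrow> k \<in> Weq \<M>)"

text \<open>For \<open>h : K \<rightarrow> L\<close>, a vertex of the \<open>n\<close>-cube is a \<open>bool list\<close> of length \<open>n\<close>, where \<open>False\<close>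
  stands for \<open>K\<close> and \<open>True\<close> for \<open>L\<close>.\<close>

definition cube_word :: "('o, 'm, 'z) smcat_scheme \<Rightarrow> 'm \<Rightarrow> bool list \<Rightarrow> 'o list" where
  "cube_word M h w = map (\<lambda>b. if b then Cod M h else Dom M h) w"

definition cube_arr :: "('o, 'm, 'z) smcat_scheme \<Rightarrow> 'm \<Rightarrow> bool list \<times> bool list \<Rightarrow> 'm" where
  "cube_arr M h = (\<lambda>(v, w). tensor_arr_list M
     (map2 (\<lambda>a b. if a then Idn M (Cod M h) else if b then h else Idn M (Dom M h)) v w))"

definition punctured_cube :: "nat \<Rightarrow> (bool list, bool list \<times> bool list) cat" where
  "punctured_cube n = preorder_cat {w. length w = n \<and> w \<noteq> replicate n True} (list_all2 (\<longrightarrow>))"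

text \<open>\<open>k : Q \<rightarrow> tensor_power M L n\<close> is the iterated pushout product of \<open>h : K \<rightarrow> L\<close>, where \<open>Q\<close> is the
  colimit of the punctured cube with coprojections \<open>\<iota>\<close>.\<close>

definition is_iterated_pushout_product ::
    "('o, 'm, 'z) smcat_scheme \<Rightarrow> 'm \<Rightarrow> nat \<Rightarrow> 'o \<Rightarrow> (bool list \<Rightarrow> 'm) \<Rightarrow> 'm \<Rightarrow> bool" where
  "is_iterated_pushout_product M h n Q \<iota> k \<longleftrightarrow>
     is_colimit (punctured_cube n) M (\<lambda>w. tensor_list M (cube_word M h w)) (cube_arr M h) Q \<iota> \<and>
     k \<in> Hom M Q (tensor_power M (Cod M h) n) \<and>
     (\<forall>w\<in>Obj (punctured_cube n). k \<cdot>\<^bsub>M\<^esub> \<iota> w = cube_arr M h (w, replicate n True))"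

definition cube_action ::
    "('o, 'm, 'z) smcat_scheme \<Rightarrow> 'm \<Rightarrow> nat \<Rightarrow> 'o \<Rightarrow> (bool list \<Rightarrow> 'm) \<Rightarrow> 'm set" where
  "cube_action M h n Q \<iota> =
     {g \<in> Hom M Q Q. \<exists>\<sigma>. \<sigma> permutes {..<n} \<and>
        (\<forall>w\<in>Obj (punctured_cube n).
           g \<cdot>\<^bsub>M\<^esub> \<iota> w = \<iota> (permute_list \<sigma> w) \<cdot>\<^bsub>M\<^esub> perm_iso M n \<sigma> (cube_word M h w))}"

definition strong_commutative_monoid_axiom ::
    "('o, 'm, 'z) smcat_scheme \<Rightarrow> 'm model_structure \<Rightarrow> bool" where
  "strong_commutative_monoid_axiom M \<M> \<longleftrightarrow>
     (\<forall>h n Q \<iota> k q p l.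
        h \<in> Cof \<M> \<and> n > 0 \<and> is_iterated_pushout_product M h n Q \<iota> k \<and>
        is_coinvariants M Q (cube_action M h n Q \<iota>) q \<and>
        is_coinvariants M (tensor_power M (Cod M h) n) (power_action M (Cod M h) n) p \<and>
        l \<in> Hom M (Cod M q) (Cod M p) \<and> l \<cdot>\<^bsub>M\<^esub> q = p \<cdot>\<^bsub>M\<^esub> k \<longrightarrow>
        l \<in> Cof \<M> \<and> (h \<in> Weq \<M> \<longrightarrow> l \<in> Weq \<M>))"


section \<open>Commutative monoids and commutative algebras\<close>

record ('o, 'm) cmon =
  Carrier :: 'o
  Mult :: 'm
  One :: 'm

record ('o, 'm) calg = "('o, 'm) cmon" +
  Struct :: 'm

definition commutative_monoid ::
    "('o, 'm, 'z) smcat_scheme \<Rightarrow> ('o, 'm, 'y) cmon_scheme \<Rightarrow> bool" where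
  "commutative_monoid M A \<longleftrightarrow>
     Carrier A \<in> Obj M \<and>
     Mult A \<in> Hom M (Carrier A \<otimes>\<^bsub>M\<^esub> Carrier A) (Carrier A) \<and>
     One A \<in> Hom M \<one>\<^bsub>M\<^esub> (Carrier A) \<and>
     Mult A \<cdot>\<^bsub>M\<^esub> (Mult A \<odot>\<^bsub>M\<^esub> Idn M (Carrier A)) =
       Mult A \<cdot>\<^bsub>M\<^esub> (Idn M (Carrier A) \<odot>\<^bsub>M\<^esub> Mult A) \<cdot>\<^bsub>M\<^esub> \<alpha>\<^bsub>M\<^esub> (Carrier A) (Carrier A) (Carrier A) \<and>
     Mult A \<cdot>\<^bsub>M\<^esub> (One A \<odot>\<^bsub>M\<^esub> Idn M (Carrier A)) = \<ll>\<^bsub>M\<^esub> (Carrier A) \<and>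
     Mult A \<cdot>\<^bsub>M\<^esub> (Idn M (Carrier A) \<odot>\<^bsub>M\<^esub> One A) = \<rr>\<^bsub>M\<^esub> (Carrier A) \<and>
     Mult A \<cdot>\<^bsub>M\<^esub> \<beta>\<^bsub>M\<^esub> (Carrier A) (Carrier A) = Mult A"

definition monoid_hom ::
    "('o, 'm, 'z) smcat_scheme \<Rightarrow> ('o, 'm, 'x) cmon_scheme \<Rightarrow> ('o, 'm, 'y) cmon_scheme
      \<Rightarrow> 'm \<Rightarrow> bool" where
  "monoid_hom M A B f \<longleftrightarrow>
     f \<in> Hom M (Carrier A) (Carrier B) \<and>
     f \<cdot>\<^bsub>M\<^esub> Mult A = Mult B \<cdot>\<^bsub>M\<^esub> (f \<odot>\<^bsub>M\<^esub> f) \<and>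
     f \<cdot>\<^bsub>M\<^esub> One A = One B"

definition commutative_algebra ::
    "('o, 'm, 'z) smcat_scheme \<Rightarrow> ('o, 'm) cmon \<Rightarrow> ('o, 'm) calg \<Rightarrow> bool" where
  "commutative_algebra M R A \<longleftrightarrow> commutative_monoid M A \<and> monoid_hom M R A (Struct A)"

type_synonym ('o, 'm) calg_arr = "('o, 'm) calg \<times> 'm \<times> ('o, 'm) calg"

abbreviation underlying :: "('o, 'm) calg_arr \<Rightarrow> 'm" where
  "underlying \<phi> \<equiv> fst (snd \<phi>)"

definition CAlg ::
    "('o, 'm, 'z) smcat_scheme \<Rightarrow> ('o, 'm) cmon \<Rightarrow> (('o, 'm) calg, ('o, 'm) calg_arr) cat" where
  "CAlg M R = \<lparr>Obj = {A. commutative_algebra M R A},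
     Arr = {(A, f, B). commutative_algebra M R A \<and> commutative_algebra M R B \<and>
              monoid_hom M A B f \<and> f \<cdot>\<^bsub>M\<^esub> Struct A = Struct B},
     Dom = (\<lambda>(A, f, B). A),
     Cod = (\<lambda>(A, f, B). B),
     Idn = (\<lambda>A. (A, Idn M (Carrier A), A)),
     Cmp = (\<lambda>(B', g, B'') (A, f, B). (A, g \<cdot>\<^bsub>M\<^esub> f, B''))\<rparr>"


section \<open>Free commutative algebras\<close>

text \<open>\<open>A\<close> is the free commutative monoid on \<open>X\<close>: with \<open>q n\<close> the quotient arrow from
  \<open>tensor_power M X n\<close> to its coinvariants, \<open>A\<close> is the coproduct of the \<open>Cod M (q n)\<close> over all \<open>n\<close>,
  \<open>\<iota> n\<close> being the composite of \<open>q n\<close> with the \<open>n\<close>-th coprojection, the unit is \<open>\<iota> 0\<close>, and the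
  multiplication is induced by concatenation of tensor words. The latter condition determines the
  multiplication because \<open>\<otimes>\<close> preserves colimits in both variables.\<close>

definition is_Sym ::
    "('o, 'm, 'z) smcat_scheme \<Rightarrow> 'o \<Rightarrow> ('o, 'm) cmon \<Rightarrow> (nat \<Rightarrow> 'm) \<Rightarrow> bool" where
  "is_Sym M X A \<iota> \<longleftrightarrow>
     commutative_monoid M A \<and>
     (\<exists>q j. (\<forall>n. is_coinvariants M (tensor_power M X n) (power_action M X n) (q n)) \<and>
        is_colimit (preorder_cat (UNIV :: nat set) (=)) M
          (\<lambda>n. Cod M (q n)) (\<lambda>(n, _). Idn M (Cod M (q n))) (Carrier A) j \<and>
        (\<forall>n. \<iota> n = j n \<cdot>\<^bsub>M\<^esub> q n)) \<and>
     One A = \<iota> 0 \<and>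
     (\<forall>m n. Mult A \<cdot>\<^bsub>M\<^esub> (\<iota> m \<odot>\<^bsub>M\<^esub> \<iota> n) =
        \<iota> (m + n) \<cdot>\<^bsub>M\<^esub> append_iso M (replicate m X) (replicate n X))"

text \<open>A choice of \<open>Sym X\<close>, which is unique up to unique isomorphism.\<close>

definition Sym_data :: "('o, 'm, 'z) smcat_scheme \<Rightarrow> 'o \<Rightarrow> ('o, 'm) cmon \<times> (nat \<Rightarrow> 'm)" where
  "Sym_data M X = (SOME S. is_Sym M X (fst S) (snd S))"

definition Sym :: "('o, 'm, 'z) smcat_scheme \<Rightarrow> 'o \<Rightarrow> ('o, 'm) cmon" where
  "Sym M X = fst (Sym_data M X)"

definition Sym_in :: "('o, 'm, 'z) smcat_scheme \<Rightarrow> 'o \<Rightarrow> nat \<Rightarrow> 'm" where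
  "Sym_in M X = snd (Sym_data M X)"

definition Sym_arr :: "('o, 'm, 'z) smcat_scheme \<Rightarrow> 'm \<Rightarrow> 'm" where
  "Sym_arr M h = (THE f. f \<in> Hom M (Carrier (Sym M (Dom M h))) (Carrier (Sym M (Cod M h))) \<and>
     (\<forall>n. f \<cdot>\<^bsub>M\<^esub> Sym_in M (Dom M h) n = Sym_in M (Cod M h) n \<cdot>\<^bsub>M\<^esub> tensor_power_arr M h n))"

definition tensor_alg ::
    "('o, 'm, 'z) smcat_scheme \<Rightarrow> ('o, 'm) cmon \<Rightarrow> ('o, 'm) cmon \<Rightarrow> ('o, 'm) calg" where
  "tensor_alg M R A =
     \<lparr>Carrier = Carrier R \<otimes>\<^bsub>M\<^esub> Carrier A,
      Mult = (Mult R \<odot>\<^bsub>M\<^esub> Mult A) \<cdot>\<^bsub>M\<^esub>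
               middle_exchange M (Carrier R) (Carrier A) (Carrier R) (Carrier A),
      One = (One R \<odot>\<^bsub>M\<^esub> One A) \<cdot>\<^bsub>M\<^esub> inverse_arr M (\<ll>\<^bsub>M\<^esub> \<one>\<^bsub>M\<^esub>),
      Struct = (Idn M (Carrier R) \<odot>\<^bsub>M\<^esub> One A) \<cdot>\<^bsub>M\<^esub> inverse_arr M (\<rr>\<^bsub>M\<^esub> (Carrier R))\<rparr>"

definition tensor_Sym_arr ::
    "('o, 'm, 'z) smcat_scheme \<Rightarrow> ('o, 'm) cmon \<Rightarrow> 'm \<Rightarrow> ('o, 'm) calg_arr" where
  "tensor_Sym_arr M R h =
     (tensor_alg M R (Sym M (Dom M h)), Idn M (Carrier R) \<odot>\<^bsub>M\<^esub> Sym_arr M h,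
      tensor_alg M R (Sym M (Cod M h)))"

definition inherited_model_structure ::
    "'u set \<Rightarrow> ('o, 'm, 'z) smcat_scheme \<Rightarrow> 'm model_structure \<Rightarrow> 'm set \<Rightarrow> 'm set
      \<Rightarrow> ('o, 'm) cmon \<Rightarrow> ('o, 'm) calg_arr model_structure \<Rightarrow> bool" where
  "inherited_model_structure U M \<M> I J R \<N> \<longleftrightarrow>
     cofibrantly_generated U (CAlg M R) \<N> (tensor_Sym_arr M R ` I) (tensor_Sym_arr M R ` J) \<and>
     Weq \<N> = {\<phi> \<in> Arr (CAlg M R). underlying \<phi> \<in> Weq \<M>} \<and>
     Fib \<N> = {\<phi> \<in> Arr (CAlg M R). underlying \<phi> \<in> Fib \<M>}"

end

theory Submission
 imports Defs
begin

text \<open>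
Let \<open>W\<close> be the class of maps of \<open>R\<close>-algebras that are cofibrations in \<open>M\<close> if their source is
cofibrant in \<open>M\<close>. By the small object argument (\<open>small_object_argument\<close>) a cofibration of algebras
factors as a transfinite composite of cell complexes on the maps \<open>R \<otimes> Sym h\<close>, \<open>h \<in> I\<close>, followed by a
trivial fibration, hence is a retract of the former. It remains to see that \<open>W\<close> contains the
pushouts of the maps \<open>R \<otimes> Sym h\<close> and is closed under transfinite composition.

Pushouts. Let \<open>h : K \<rightarrow> L\<close> be a cofibration, \<open>R \<otimes> Sym K \<rightarrow> A\<close> an algebra map, \<open>k : K \<rightarrow> A\<close> its
restriction, and \<open>P\<close> the pushout. Let \<open>P0\<close> be the quotient of \<open>E = A \<otimes> Sym L\<close> by the ideal that
identifies \<open>h\<close> with \<open>k\<close>. The pushout property gives an algebra map \<open>P \<rightarrow> P0\<close> under \<open>A\<close>, the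
multiplication of \<open>P\<close> induces \<open>P0 \<rightarrow> P\<close>, and \<open>P \<rightarrow> P0 \<rightarrow> P\<close> is the identity. So \<open>A \<rightarrow> P\<close> is a retract of
\<open>A \<rightarrow> P0\<close>, and only the latter is studied (\<open>pushout_generator_cofibration\<close>).

The usual filtration of \<open>P0\<close>, with stages pushouts of \<open>A \<otimes> (h\<^bsup>\<box>n\<^esup>/\<Sigma>\<^sub>n)\<close>, enters in its dual form.
An arrow \<open>P0 \<rightarrow> Z\<close> is a family of arrows \<open>g n : A \<otimes> L\<^sup>n \<rightarrow> Z\<close>, symmetric in the factors \<open>L\<close>, such that
\<open>g (n+1)\<close> restricts on \<open>A \<otimes> L\<^sup>n \<otimes> K\<close> to \<open>g n\<close> composed with the action of \<open>K\<close> on \<open>A\<close> through \<open>k\<close>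
(\<open>terms_family\<close>, \<open>family_arrow\<close>). A lift of a square from \<open>A \<rightarrow> P0\<close> to a trivial fibration is
therefore constructed term by term. The terms up to \<open>n\<close> determine an equivariant arrow on \<open>A \<otimes> Q\<close>,
with \<open>Q\<close> the colimit of the punctured \<open>(n+1)\<close>-cube, and the next term is a lift against
\<open>A \<otimes> (h\<^bsup>\<box>(n+1)\<^esup>/\<Sigma>\<^sub>n\<^sub>+\<^sub>1)\<close> (\<open>extend_family\<close>). This arrow is a cofibration by the strong commutative
monoid axiom and the pushout product axiom applied to the map from the initial object to \<open>A\<close>
(\<open>tensor_cofibration\<close>).

Transfinite composites. Since \<open>\<otimes>\<close> preserves colimits in both variables, directed colimits of
algebras are colimits in \<open>M\<close> (\<open>chain_colimit_underlying\<close>). Lifts along the stages can be chosen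
compatibly (\<open>sequence_lifting\<close>), and the stages remain cofibrant in \<open>M\<close>
(\<open>sequence_underlying_cofibration\<close>).

Colimits, coinvariants and coequalizers are treated uniformly as presentations \<open>is_glue\<close>. Of the
symmetric groups only the interchanges of adjacent factors are used; all permutation isomorphisms
are composites of these.
\<close>

section \<open>Presentations by generators and relations\<close>

lemma in_Hom [simp]: "f\<in>Hom C X Y \<longleftrightarrow> f\<in>Arr C \<and> Dom C f = X \<and> Cod C f = Y"
 by (simp add: Hom_def)

context category
begin

lemma dom_obj [simp]: "f\<in>Arr C ==> Dom C f\<in>Obj C"
 and cod_obj [simp]: "f\<in>Arr C ==> Cod C f\<in>Obj C"
 using dom_cod_closed by auto

lemma arr_id [simp]: "X\<in>Obj C ==> \<i>\<d> X\<in>Arr C"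
 and dom_id [simp]: "X\<in>Obj C ==> Dom C (\<i>\<d> X) = X"
 and cod_id [simp]: "X\<in>Obj C ==> Cod C (\<i>\<d> X) = X"
 using id_closed by auto

lemma arr_comp [simp]: "f\<in>Arr C ==> g\<in>Arr C ==> Dom C g = Cod C f ==> g\<cdot>f\<in>Arr C"
 and dom_comp [simp]: "f\<in>Arr C ==> g\<in>Arr C ==> Dom C g = Cod C f ==> Dom C (g\<cdot>f) = Dom C f"
 and cod_comp [simp]: "f\<in>Arr C ==> g\<in>Arr C ==> Dom C g = Cod C f ==> Cod C (g\<cdot>f) = Cod C g"
 using comp_closed[of f "Dom C f" "Cod C f" g "Cod C g"] by auto

lemma comp_id [simp]:
 "f\<in>Arr C ==> Dom C f = X ==> f\<cdot>\<i>\<d> X = f"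
 "f\<in>Arr C ==> Cod C f = X ==> \<i>\<d> X\<cdot>f = f"
 using comp_id_right[of f] comp_id_left[of f] by auto

lemma comp_assoc_right [simp]:
 "f\<in>Arr C ==> g\<in>Arr C ==> h\<in>Arr C ==> Dom C g = Cod C f ==> Dom C h = Cod C g ==>
   (h\<cdot>g)\<cdot>f = h\<cdot>(g\<cdot>f)"
 using comp_assoc[of f "Dom C f" "Cod C f" g "Cod C g" h "Cod C h"] by auto

text \<open>Composites are normalized to the right, so that an equation \<open>g\<cdot>f = k\<close> also has to be applied in
 front of a further arrow; the lemmas with suffix \<open>reassoc\<close> are obtained in this way.\<close>

lemma comp_reassoc:
 assumes "g\<cdot>f = k" "f\<in>Arr C" "g\<in>Arr C" "x\<in>Arr C" "Dom C g = Cod C f" "Dom C f = Cod C x"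
 shows "g\<cdot>(f\<cdot>x) = k\<cdot>x"
 using assms comp_assoc_right[of x f g] by auto

lemma is_iso_arr: "is_iso C f ==> f\<in>Arr C"
 by (auto simp: is_iso_def is_inverse_def)

lemma inverse_unique:
 assumes "is_inverse C f g" "is_inverse C f g'" shows "g = g'"
proof -
 have fg: "f\<in>Arr C" "g\<in>Arr C" "Dom C g = Cod C f" "Cod C g = Dom C f" "g\<cdot>f = \<i>\<d> (Dom C f)"
  and fg': "g'\<in>Arr C" "Dom C g' = Cod C f" "Cod C g' = Dom C f" "f\<cdot>g' = \<i>\<d> (Cod C f)"
  using assms by (auto simp: is_inverse_def)
 have "g = g\<cdot>(f\<cdot>g')" using fg(1-4) fg' by simp
 also have "... = (g\<cdot>f)\<cdot>g'" using fg(1-4) fg'(1-3) by simp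
 also have "... = g'" using fg fg'(1-3) by (simp del: comp_assoc_right)
 finally show ?thesis .
qed

lemma is_inverse_inverse_arr: "is_iso C f ==> is_inverse C f (inverse_arr C f)"
 unfolding is_iso_def inverse_arr_def by (metis inverse_unique the_equality)

lemma inverse_arr [simp]:
 assumes "is_iso C f"
 shows "inverse_arr C f\<in>Arr C" "Dom C (inverse_arr C f) = Cod C f"
  "Cod C (inverse_arr C f) = Dom C f"
  "f\<cdot>inverse_arr C f = \<i>\<d> (Cod C f)" "inverse_arr C f\<cdot>f = \<i>\<d> (Dom C f)"
 using is_inverse_inverse_arr[OF assms] by (auto simp: is_inverse_def)

lemma inverse_arr_reassoc [simp]:
 assumes "is_iso C f" "x\<in>Arr C"
 shows "Cod C x = Cod C f ==> f\<cdot>(inverse_arr C f\<cdot>x) = x"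
  "Cod C x = Dom C f ==> inverse_arr C f\<cdot>(f\<cdot>x) = x"
 using assms is_iso_arr[OF assms(1)] comp_reassoc[of f "inverse_arr C f"]
  comp_reassoc[of "inverse_arr C f" f] by auto

lemma is_isoI:
 "f\<in>Arr C ==> g\<in>Arr C ==> Dom C g = Cod C f ==> Cod C g = Dom C f ==>
   g\<cdot>f = \<i>\<d> (Dom C f) ==> f\<cdot>g = \<i>\<d> (Cod C f) ==> is_iso C f"
 by (auto simp: is_iso_def is_inverse_def)

lemma is_iso_id [simp]: "X\<in>Obj C ==> is_iso C (\<i>\<d> X)"
 by (rule is_isoI[of _ "\<i>\<d> X"]) auto

lemma is_iso_inverse [simp]: "is_iso C f ==> is_iso C (inverse_arr C f)"
 by (rule is_isoI[of _ f]) (auto simp: is_iso_arr)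

lemma is_iso_comp [simp]:
 assumes "is_iso C f" "is_iso C g" "Dom C g = Cod C f" shows "is_iso C (g\<cdot>f)"
 using assms by (intro is_isoI[of _ "inverse_arr C f\<cdot>inverse_arr C g"]) (auto simp: is_iso_arr)

lemma iso_cancel_right:
 assumes "f\<cdot>e = g\<cdot>e" "is_iso C e" "f\<in>Arr C" "g\<in>Arr C" "Dom C f = Cod C e" "Dom C g = Cod C e"
 shows "f = g"
proof -
 have "f = (f\<cdot>e)\<cdot>inverse_arr C e" using assms(2,3,5) by (simp add: is_iso_arr)
 also have "... = (g\<cdot>e)\<cdot>inverse_arr C e" using assms(1) by simp
 also have "... = g" using assms(2,4,6) by (simp add: is_iso_arr)
 finally show ?thesis .
qed

lemma iso_cancel_left:
 assumes "e\<cdot>f = e\<cdot>g" "is_iso C e" "f\<in>Arr C" "g\<in>Arr C" "Cod C f = Dom C e" "Cod C g = Dom C e"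
 shows "f = g"
proof -
 have "f = inverse_arr C e\<cdot>(e\<cdot>f)" using assms(2,3,5) by simp
 also have "... = inverse_arr C e\<cdot>(e\<cdot>g)" using assms(1) by simp
 also have "... = g" using assms(2,4,6) by simp
 finally show ?thesis .
qed

text \<open>Universal properties are split into existence and joint epimorphy, because the latter is preserved by
 tensor products and by composition of covers.\<close>

definition jointly_epic :: "'i set => 'o => ('i => 'm) => bool" where
 "jointly_epic T c \<iota> \<longleftrightarrow>
   (\<forall>f g. f\<in>Arr C \<and> g\<in>Arr C \<and> Dom C f = c \<and> Dom C g = c \<and> Cod C f = Cod C g \<and>
    (\<forall>i\<in>T. f\<cdot>\<iota> i = g\<cdot>\<iota> i) --> f = g)"

lemma jointly_epicD:
 assumes "jointly_epic T c \<iota>" "\<And>i. i\<in>T ==> f\<cdot>\<iota> i = g\<cdot>\<iota> i"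
  "f\<in>Arr C" "g\<in>Arr C" "Dom C f = c" "Dom C g = c" "Cod C f = Cod C g"
 shows "f = g"
 using assms unfolding jointly_epic_def by blast

lemma jointly_epic_comp:
 assumes "jointly_epic T c \<iota>" "\<And>i. i\<in>T ==> jointly_epic (T' i) (Dom C (\<iota> i)) (\<kappa> i)"
  "\<And>i. i\<in>T ==> \<iota> i\<in>Arr C \<and> Cod C (\<iota> i) = c"
  "\<And>i j. i\<in>T ==> j\<in>T' i ==> \<kappa> i j\<in>Arr C \<and> Cod C (\<kappa> i j) = Dom C (\<iota> i)"
 shows "jointly_epic (Sigma T T') c (\<lambda>(i, j). \<iota> i\<cdot>\<kappa> i j)"
 unfolding jointly_epic_def
proof safe
 fix f g assume fg: "f\<in>Arr C" "g\<in>Arr C" "c = Dom C f" "Dom C g = Dom C f" "Cod C f = Cod C g"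
  and eq: "\<forall>x\<in>Sigma T T'. f\<cdot>(case x of (i, j) => \<iota> i\<cdot>\<kappa> i j) = g\<cdot>(case x of (i, j) => \<iota> i\<cdot>\<kappa> i j)"
 show "f = g"
 proof (rule jointly_epicD[OF assms(1)])
  fix i assume i: "i\<in>T"
  show "f\<cdot>\<iota> i = g\<cdot>\<iota> i"
  proof (rule jointly_epicD[OF assms(2)[OF i]])
   fix j assume j: "j\<in>T' i"
   then have "f\<cdot>(\<iota> i\<cdot>\<kappa> i j) = g\<cdot>(\<iota> i\<cdot>\<kappa> i j)" using eq i by force
   then show "f\<cdot>\<iota> i\<cdot>\<kappa> i j = g\<cdot>\<iota> i\<cdot>\<kappa> i j"
    using assms(3)[OF i] assms(4)[OF i j] fg by simp
  qed (use assms(3)[OF i] fg in auto)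
 qed (use fg in auto)
qed

end

text \<open>A presentation of an object \<open>c\<close> by generators and relations: the arrows \<open>\<iota> i : F i \<rightarrow> c\<close> are
 universal among the families with \<open>\<iota> i\<cdot>a = \<iota> j\<cdot>b\<close> for every relation \<open>(i, a, j, b)\<close>. Colimits,
 coinvariants and coequalizers are all of this form, so existence and the compatibility with tensor
 products have to be established only once.\<close>

definition glue_cocone ::
  "('o, 'm, 'z) cat_scheme => 'i set => ('i => 'o) => ('i \<times> 'm \<times> 'i \<times> 'm) set => 'o => ('i => 'm) => bool" where
 "glue_cocone C T F Rel c \<iota> \<longleftrightarrow> c\<in>Obj C \<and> (\<forall>i\<in>T. \<iota> i\<in>Hom C (F i) c) \<and>
   (\<forall>(i, a, j, b)\<in>Rel. \<iota> i \<cdot>\<^bsub>C\<^esub> a = \<iota> j \<cdot>\<^bsub>C\<^esub> b)"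

definition is_glue ::
  "('o, 'm, 'z) cat_scheme => 'i set => ('i => 'o) => ('i \<times> 'm \<times> 'i \<times> 'm) set => 'o => ('i => 'm) => bool" where
 "is_glue C T F Rel c \<iota> \<longleftrightarrow> glue_cocone C T F Rel c \<iota> \<and>
   (\<forall>Z \<kappa>. glue_cocone C T F Rel Z \<kappa> --> (\<exists>!u. u\<in>Hom C c Z \<and> (\<forall>i\<in>T. u \<cdot>\<^bsub>C\<^esub> \<iota> i = \<kappa> i)))"

text \<open>The well-formedness of a presentation, kept apart from the universal property.\<close>

definition glue_relations ::
  "('o, 'm, 'z) cat_scheme => 'i set => ('i => 'o) => ('i \<times> 'm \<times> 'i \<times> 'm) set => bool" where
 "glue_relations C T F Rel \<longleftrightarrow> (\<forall>i\<in>T. F i\<in>Obj C) \<and>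
   (\<forall>(i, a, j, b)\<in>Rel. i\<in>T \<and> j\<in>T \<and> a\<in>Arr C \<and> b\<in>Arr C \<and> Dom C a = Dom C b \<and>
    Cod C a = F i \<and> Cod C b = F j)"

context category
begin

lemma is_glue_hom:
 "is_glue C T F Rel c \<iota> ==> i\<in>T ==> \<iota> i\<in>Arr C"
 "is_glue C T F Rel c \<iota> ==> i\<in>T ==> Dom C (\<iota> i) = F i"
 "is_glue C T F Rel c \<iota> ==> i\<in>T ==> Cod C (\<iota> i) = c"
 "is_glue C T F Rel c \<iota> ==> c\<in>Obj C"
 by (auto simp: is_glue_def glue_cocone_def)

lemma glue_relationsD:
 assumes "glue_relations C T F Rel" "(i, a, j, b)\<in>Rel"
 shows "i\<in>T \<and> j\<in>T \<and> a\<in>Arr C \<and> b\<in>Arr C \<and> Dom C a = Dom C b \<and> Cod C a = F i \<and> Cod C b = F j"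
 using assms unfolding glue_relations_def by auto

lemma is_glue_rel:
 "is_glue C T F Rel c \<iota> ==> (i, a, j, b)\<in>Rel ==> \<iota> i\<cdot>a = \<iota> j\<cdot>b"
 by (auto simp: is_glue_def glue_cocone_def)

lemma is_glue_ex:
 assumes "is_glue C T F Rel c \<iota>" "Z\<in>Obj C" "\<And>i. i\<in>T ==> \<kappa> i\<in>Hom C (F i) Z"
  "\<And>i a j b. (i, a, j, b)\<in>Rel ==> \<kappa> i\<cdot>a = \<kappa> j\<cdot>b"
 obtains u where "u\<in>Arr C" "Dom C u = c" "Cod C u = Z" "\<And>i. i\<in>T ==> u\<cdot>\<iota> i = \<kappa> i"
proof -
 have "glue_cocone C T F Rel Z \<kappa>"
  using assms(2,3,4) unfolding glue_cocone_def by auto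
 then obtain u where "u\<in>Hom C c Z" "\<forall>i\<in>T. u\<cdot>\<iota> i = \<kappa> i"
  using assms(1) unfolding is_glue_def by blast
 then show ?thesis by (intro that[of u]) auto
qed

text \<open>Two arrows that agree on the generators are both induced by the same cocone.\<close>

lemma is_glue_epic:
 assumes g: "is_glue C T F Rel c \<iota>" and wf: "glue_relations C T F Rel" shows "jointly_epic T c \<iota>"
 unfolding jointly_epic_def
proof safe
 fix f h assume fh: "f\<in>Arr C" "h\<in>Arr C" "c = Dom C f" "Dom C h = Dom C f" "Cod C f = Cod C h"
  "\<forall>i\<in>T. f\<cdot>\<iota> i = h\<cdot>\<iota> i"
 note H = is_glue_hom[OF g]
 have "glue_cocone C T F Rel (Cod C f) (\<lambda>i. f\<cdot>\<iota> i)"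
  unfolding glue_cocone_def
 proof (intro conjI ballI)
  show "Cod C f\<in>Obj C" using fh by auto
  show "f\<cdot>\<iota> i\<in>Hom C (F i) (Cod C f)" if "i\<in>T" for i using H(1-3)[OF that] fh by auto
  fix r assume r: "r\<in>Rel"
  obtain i a j b where [simp]: "r = (i, a, j, b)" by (cases r)
  have "\<iota> i\<cdot>a = \<iota> j\<cdot>b" using is_glue_rel[OF g] r by simp
  moreover have "i\<in>T" "j\<in>T" "a\<in>Arr C" "b\<in>Arr C" "Cod C a = F i" "Cod C b = F j"
   using wf r unfolding glue_relations_def by auto
  ultimately show "case r of (i, a, j, b) => f\<cdot>\<iota> i\<cdot>a = f\<cdot>\<iota> j\<cdot>b"
   using H fh by simp
 qed
 then have "\<exists>!u. u\<in>Hom C c (Cod C f) \<and> (\<forall>i\<in>T. u\<cdot>\<iota> i = f\<cdot>\<iota> i)"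
  using g unfolding is_glue_def by blast
 then show "f = h" using fh by (metis in_Hom)
qed

lemma is_glueI:
 assumes "c\<in>Obj C" "\<And>i. i\<in>T ==> \<iota> i\<in>Hom C (F i) c"
  "\<And>i a j b. (i, a, j, b)\<in>Rel ==> \<iota> i\<cdot>a = \<iota> j\<cdot>b"
  "\<And>Z \<kappa>. glue_cocone C T F Rel Z \<kappa> ==> \<exists>u. u\<in>Hom C c Z \<and> (\<forall>i\<in>T. u\<cdot>\<iota> i = \<kappa> i)"
  "jointly_epic T c \<iota>"
 shows "is_glue C T F Rel c \<iota>"
 unfolding is_glue_def
proof (intro conjI allI impI)
 show "glue_cocone C T F Rel c \<iota>" using assms(1-3) unfolding glue_cocone_def by auto
 fix Z \<kappa> assume "glue_cocone C T F Rel Z \<kappa>"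
 from assms(4)[OF this] obtain u where u: "u\<in>Hom C c Z" "\<forall>i\<in>T. u\<cdot>\<iota> i = \<kappa> i" by blast
 show "\<exists>!u. u\<in>Hom C c Z \<and> (\<forall>i\<in>T. u\<cdot>\<iota> i = \<kappa> i)"
 proof (rule ex1I[of _ u])
  fix v assume "v\<in>Hom C c Z \<and> (\<forall>i\<in>T. v\<cdot>\<iota> i = \<kappa> i)"
  then show "v = u" using u by - (rule jointly_epicD[OF assms(5)], auto)
 qed (use u in auto)
qed

lemma is_colimit_iff_glue:
 assumes D: "category D" "is_functor D C FO FA"
 defines "Rel \<equiv> {(Cod D a, FA a, Dom D a, \<i>\<d> (FO (Dom D a))) |a. a\<in>Arr D}"
 shows "is_colimit D C FO FA c \<iota> \<longleftrightarrow> is_glue C (Obj D) FO Rel c \<iota>"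
  and "glue_relations C (Obj D) FO Rel"
proof -
 interpret D: category D by fact
 have F: "FO i\<in>Obj C" if "i\<in>Obj D" for i
  using D(2) that unfolding is_functor_def by blast
 have FA: "FA a\<in>Arr C" "Dom C (FA a) = FO (Dom D a)" "Cod C (FA a) = FO (Cod D a)" if "a\<in>Arr D" for a
  using D(2) that unfolding is_functor_def in_Hom by blast+
 have "is_cocone D C FO FA c \<iota> = glue_cocone C (Obj D) FO Rel c \<iota>" for c \<iota>
 proof -
  have "(\<forall>a\<in>Arr D. \<iota> (Cod D a)\<cdot>FA a = \<iota> (Dom D a)) \<longleftrightarrow>
   (\<forall>(i, a, j, b)\<in>Rel. \<iota> i\<cdot>a = \<iota> j\<cdot>b)" if "\<forall>i\<in>Obj D. \<iota> i\<in>Hom C (FO i) c"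
  proof -
   have "\<iota> (Dom D a)\<cdot>\<i>\<d> (FO (Dom D a)) = \<iota> (Dom D a)" if "a\<in>Arr D" for a
    using \<open>\<forall>i\<in>Obj D. \<iota> i\<in>Hom C (FO i) c\<close> that by simp
   then show ?thesis unfolding Rel_def by fastforce
  qed
  then show ?thesis unfolding is_cocone_def glue_cocone_def by blast
 qed
 then show "is_colimit D C FO FA c \<iota> \<longleftrightarrow> is_glue C (Obj D) FO Rel c \<iota>"
  unfolding is_colimit_def is_glue_def by simp
 show "glue_relations C (Obj D) FO Rel"
  unfolding glue_relations_def Rel_def using F FA by auto
qed

lemma is_coinvariants_iff_glue:
 assumes "X\<in>Obj C" "G \<subseteq> Hom C X X"
 defines "Rel \<equiv> {((), g, (), \<i>\<d> X) |g. g\<in>G}"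
 shows "is_coinvariants C X G q \<longleftrightarrow> q\<in>Arr C \<and> is_glue C {()} (\<lambda>_. X) Rel (Cod C q) (\<lambda>_. q)"
  and "glue_relations C {()} (\<lambda>_. X) Rel"
proof -
 have *: "glue_cocone C {()} (\<lambda>_. X) Rel Z \<kappa> \<longleftrightarrow>
   Z\<in>Obj C \<and> \<kappa> ()\<in>Hom C X Z \<and> (\<forall>g\<in>G. \<kappa> ()\<cdot>g = \<kappa> ())" for Z \<kappa>
  unfolding glue_cocone_def Rel_def by auto
 show "is_coinvariants C X G q \<longleftrightarrow> q\<in>Arr C \<and> is_glue C {()} (\<lambda>_. X) Rel (Cod C q) (\<lambda>_. q)"
  (is "?L \<longleftrightarrow> ?R")
 proof
  assume L: ?L
  then have "\<exists>!u. u\<in>Hom C (Cod C q) Z \<and> (\<forall>i\<in>{()}. u\<cdot>q = \<kappa> i)"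
   if "glue_cocone C {()} (\<lambda>_. X) Rel Z \<kappa>" for Z \<kappa>
   using that unfolding * is_coinvariants_def by simp
  moreover have "glue_cocone C {()} (\<lambda>_. X) Rel (Cod C q) (\<lambda>_. q)" and "q\<in>Arr C"
   using L unfolding * is_coinvariants_def by auto
  ultimately show ?R unfolding is_glue_def by blast
 next
  assume R: ?R
  then have c: "glue_cocone C {()} (\<lambda>_. X) Rel (Cod C q) (\<lambda>_. q)"
   and u: "\<And>Z \<kappa>. glue_cocone C {()} (\<lambda>_. X) Rel Z \<kappa> ==>
    \<exists>!u. u\<in>Hom C (Cod C q) Z \<and> (\<forall>i\<in>{()}. u\<cdot>q = \<kappa> i)"
   unfolding is_glue_def by blast+
  have "\<exists>!u. u\<in>Hom C (Cod C q) Z \<and> u\<cdot>q = a"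
   if "Z\<in>Obj C" "a\<in>Hom C X Z" "\<forall>g\<in>G. a\<cdot>g = a" for Z a
   using u[of Z "\<lambda>_. a"] that unfolding * by simp
  then have "\<forall>Z\<in>Obj C. \<forall>a\<in>Hom C X Z. (\<forall>g\<in>G. a\<cdot>g = a) -->
    (\<exists>!u. u\<in>Hom C (Cod C q) Z \<and> u\<cdot>q = a)"
   by (intro ballI impI)
  then show ?L using c unfolding * is_coinvariants_def in_Hom by (elim conjE, intro conjI)
 qed
 show "glue_relations C {()} (\<lambda>_. X) Rel"
  unfolding glue_relations_def Rel_def
 proof (intro conjI ballI)
  fix r assume "r\<in>{((), g, (), \<i>\<d> X) |g. g\<in>G}"
  then obtain g where r: "r = ((), g, (), \<i>\<d> X)" and "g\<in>G" by blast
  then have "g\<in>Hom C X X" using assms(2) by blast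
  then show "case r of (i, a, j, b) => i\<in>{()} \<and> j\<in>{()} \<and> a\<in>Arr C \<and> b\<in>Arr C \<and>
    Dom C a = Dom C b \<and> Cod C a = X \<and> Cod C b = X"
   using assms(1) unfolding r by simp
 qed (use assms(1) in simp)
qed

end

abbreviation (in closed_symmetric_monoidal) whisker_left (infixr "\<rhd>" 80) where "X\<rhd>f \<equiv> \<i>\<d> X\<odot>f"
abbreviation (in closed_symmetric_monoidal) whisker_right (infixl "\<lhd>" 81) where "f\<lhd>X \<equiv> f\<odot>\<i>\<d> X"

section \<open>Coherence in symmetric monoidal categories\<close>

context closed_symmetric_monoidal
begin

declare unit_obj [simp] tensor_obj [simp]

lemma arr_tensor [simp]:
 "f\<in>Arr M ==> g\<in>Arr M ==> f\<odot>g\<in>Arr M"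
 "f\<in>Arr M ==> g\<in>Arr M ==> Dom M (f\<odot>g) = Dom M f\<otimes>Dom M g"
 "f\<in>Arr M ==> g\<in>Arr M ==> Cod M (f\<odot>g) = Cod M f\<otimes>Cod M g"
 using tensor_arr[of f "Dom M f" "Cod M f" g "Dom M g" "Cod M g"] by auto

declare tensor_id [simp]

lemma tensor_merge [simp]:
 "f\<in>Arr M ==> f'\<in>Arr M ==> g\<in>Arr M ==> g'\<in>Arr M ==> Dom M f' = Cod M f ==> Dom M g' = Cod M g ==>
   (f'\<odot>g')\<cdot>(f\<odot>g) = (f'\<cdot>f)\<odot>(g'\<cdot>g)"
 using tensor_comp[of f "Dom M f" "Cod M f" f' "Cod M f'" g "Dom M g" "Cod M g" g' "Cod M g'"] by simp

lemma tensor_merge_reassoc [simp]: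
 "f\<in>Arr M ==> f'\<in>Arr M ==> g\<in>Arr M ==> g'\<in>Arr M ==> Dom M f' = Cod M f ==> Dom M g' = Cod M g ==>
   x\<in>Arr M ==> Cod M x = Dom M f\<otimes>Dom M g ==>
   (f'\<odot>g')\<cdot>((f\<odot>g)\<cdot>x) = ((f'\<cdot>f)\<odot>(g'\<cdot>g))\<cdot>x"
 by (rule comp_reassoc[OF tensor_merge]) auto

lemma is_iso_tensor [simp]:
 assumes "is_iso M f" "is_iso M g" shows "is_iso M (f\<odot>g)"
 using assms
 by (intro is_isoI[of _ "inverse_arr M f\<odot>inverse_arr M g"]) (auto simp: is_iso_arr)

abbreviation assoc_inv ("\<alpha>\<^sup>-") where "\<alpha>\<^sup>- X Y Z \<equiv> inverse_arr M (\<alpha> X Y Z)"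

lemma assoc_arr [simp]:
 assumes "X\<in>Obj M" "Y\<in>Obj M" "Z\<in>Obj M"
 shows "\<alpha> X Y Z\<in>Arr M" "Dom M (\<alpha> X Y Z) = (X\<otimes>Y)\<otimes>Z" "Cod M (\<alpha> X Y Z) = X\<otimes>(Y\<otimes>Z)"
  "is_iso M (\<alpha> X Y Z)"
 using assoc_hom[OF assms] by auto

lemma lunit_arr [simp]:
 assumes "X\<in>Obj M"
 shows "\<ll> X\<in>Arr M" "Dom M (\<ll> X) = \<one>\<otimes>X" "Cod M (\<ll> X) = X" "is_iso M (\<ll> X)"
 using lunit_hom[OF assms] by auto

lemma runit_arr [simp]:
 assumes "X\<in>Obj M"
 shows "\<rr> X\<in>Arr M" "Dom M (\<rr> X) = X\<otimes>\<one>" "Cod M (\<rr> X) = X" "is_iso M (\<rr> X)"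
 using runit_hom[OF assms] by auto

lemma braid_arr [simp]:
 assumes "X\<in>Obj M" "Y\<in>Obj M"
 shows "\<beta> X Y\<in>Arr M" "Dom M (\<beta> X Y) = X\<otimes>Y" "Cod M (\<beta> X Y) = Y\<otimes>X"
 using braid_hom[OF assms] by auto

lemma braid_braid [simp]: "X\<in>Obj M ==> Y\<in>Obj M ==> \<beta> Y X\<cdot>\<beta> X Y = \<i>\<d> (X\<otimes>Y)"
 by (rule braid_symmetric)

lemma braid_braid_reassoc [simp]:
 "X\<in>Obj M ==> Y\<in>Obj M ==> x\<in>Arr M ==> Cod M x = X\<otimes>Y ==> \<beta> Y X\<cdot>(\<beta> X Y\<cdot>x) = x"
 using comp_reassoc[OF braid_braid, of X Y x] by simp

lemma is_iso_braid [simp]: "X\<in>Obj M ==> Y\<in>Obj M ==> is_iso M (\<beta> X Y)"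
 by (rule is_isoI[of _ "\<beta> Y X"]) auto

text \<open>Naturality moves structural arrows towards the source of a composite. The instances with an
 identity of a tensor product are needed because such identities are merged.\<close>

lemma assoc_nat [simp]:
 assumes "f\<in>Arr M" "g\<in>Arr M" "h\<in>Arr M" "Cod M f = X'" "Cod M g = Y'" "Cod M h = Z'"
 shows "\<alpha> X' Y' Z'\<cdot>((f\<odot>g)\<odot>h) = (f\<odot>(g\<odot>h))\<cdot>\<alpha> (Dom M f) (Dom M g) (Dom M h)"
 using assoc_natural[of f "Dom M f" X' g "Dom M g" Y' h "Dom M h" Z'] assms by simp

lemma assoc_nat_reassoc [simp]:
 assumes "f\<in>Arr M" "g\<in>Arr M" "h\<in>Arr M" "Cod M f = X'" "Cod M g = Y'" "Cod M h = Z'"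
  "x\<in>Arr M" "Cod M x = (Dom M f\<otimes>Dom M g)\<otimes>Dom M h"
 shows "\<alpha> X' Y' Z'\<cdot>(((f\<odot>g)\<odot>h)\<cdot>x) = (f\<odot>(g\<odot>h))\<cdot>(\<alpha> (Dom M f) (Dom M g) (Dom M h)\<cdot>x)"
 using comp_reassoc[OF assoc_nat[OF assms(1-6)], of x] assms by auto

lemma assoc_nat_id [simp]:
 assumes "h\<in>Arr M" "Cod M h = Z'" "X\<in>Obj M" "Y\<in>Obj M"
 shows "\<alpha> X Y Z'\<cdot>((X\<otimes>Y)\<rhd>h) = (X\<rhd>(Y\<rhd>h))\<cdot>\<alpha> X Y (Dom M h)"
 using assoc_nat[of "\<i>\<d> X" "\<i>\<d> Y" h X Y Z'] assms by simp

lemma assoc_nat_id_reassoc [simp]: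
 assumes "h\<in>Arr M" "Cod M h = Z'" "X\<in>Obj M" "Y\<in>Obj M" "x\<in>Arr M" "Cod M x = (X\<otimes>Y)\<otimes>Dom M h"
 shows "\<alpha> X Y Z'\<cdot>(((X\<otimes>Y)\<rhd>h)\<cdot>x) = (X\<rhd>(Y\<rhd>h))\<cdot>(\<alpha> X Y (Dom M h)\<cdot>x)"
 using assoc_nat_reassoc[of "\<i>\<d> X" "\<i>\<d> Y" h X Y Z' x] assms by simp

lemma assoc_inv_nat [simp]:
 assumes "f\<in>Arr M" "g\<in>Arr M" "h\<in>Arr M" "Cod M f = X'" "Cod M g = Y'" "Cod M h = Z'"
 shows "\<alpha>\<^sup>- X' Y' Z'\<cdot>(f\<odot>(g\<odot>h)) = ((f\<odot>g)\<odot>h)\<cdot>\<alpha>\<^sup>- (Dom M f) (Dom M g) (Dom M h)"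
 by (rule iso_cancel_left[of "\<alpha> X' Y' Z'"], rule iso_cancel_right[of _ "\<alpha> (Dom M f) (Dom M g) (Dom M h)"])
  (use assms in auto)

lemma assoc_inv_nat_reassoc [simp]:
 assumes "f\<in>Arr M" "g\<in>Arr M" "h\<in>Arr M" "Cod M f = X'" "Cod M g = Y'" "Cod M h = Z'"
  "x\<in>Arr M" "Cod M x = Dom M f\<otimes>(Dom M g\<otimes>Dom M h)"
 shows "\<alpha>\<^sup>- X' Y' Z'\<cdot>((f\<odot>(g\<odot>h))\<cdot>x) = ((f\<odot>g)\<odot>h)\<cdot>(\<alpha>\<^sup>- (Dom M f) (Dom M g) (Dom M h)\<cdot>x)"
 using comp_reassoc[OF assoc_inv_nat[OF assms(1-6)], of x] assms by auto

lemma assoc_inv_nat_id [simp]: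
 assumes "f\<in>Arr M" "Cod M f = X'" "Y\<in>Obj M" "Z\<in>Obj M"
 shows "\<alpha>\<^sup>- X' Y Z\<cdot>(f\<lhd>(Y\<otimes>Z)) = ((f\<lhd>Y)\<lhd>Z)\<cdot>\<alpha>\<^sup>- (Dom M f) Y Z"
 using assoc_inv_nat[of f "\<i>\<d> Y" "\<i>\<d> Z" X' Y Z] assms by simp

lemma assoc_inv_nat_id_reassoc [simp]:
 assumes "f\<in>Arr M" "Cod M f = X'" "Y\<in>Obj M" "Z\<in>Obj M" "x\<in>Arr M" "Cod M x = Dom M f\<otimes>(Y\<otimes>Z)"
 shows "\<alpha>\<^sup>- X' Y Z\<cdot>((f\<lhd>(Y\<otimes>Z))\<cdot>x) = ((f\<lhd>Y)\<lhd>Z)\<cdot>(\<alpha>\<^sup>- (Dom M f) Y Z\<cdot>x)"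
 using assoc_inv_nat_reassoc[of f "\<i>\<d> Y" "\<i>\<d> Z" X' Y Z x] assms by simp

lemma braid_nat [simp]:
 assumes "f\<in>Arr M" "g\<in>Arr M" "Cod M f = X'" "Cod M g = Y'"
 shows "\<beta> X' Y'\<cdot>(f\<odot>g) = (g\<odot>f)\<cdot>\<beta> (Dom M f) (Dom M g)"
 using braid_natural[of f "Dom M f" X' g "Dom M g" Y'] assms by simp

lemma braid_nat_reassoc [simp]:
 assumes "f\<in>Arr M" "g\<in>Arr M" "Cod M f = X'" "Cod M g = Y'" "x\<in>Arr M" "Cod M x = Dom M f\<otimes>Dom M g"
 shows "\<beta> X' Y'\<cdot>((f\<odot>g)\<cdot>x) = (g\<odot>f)\<cdot>(\<beta> (Dom M f) (Dom M g)\<cdot>x)"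
 using comp_reassoc[OF braid_nat[OF assms(1-4)], of x] assms by auto

lemma lunit_nat [simp]:
 assumes "f\<in>Arr M" "Cod M f = X'" shows "\<ll> X'\<cdot>(\<one>\<rhd>f) = f\<cdot>\<ll> (Dom M f)"
 using lunit_natural[of f "Dom M f" X'] assms by simp

lemma lunit_nat_reassoc [simp]:
 assumes "f\<in>Arr M" "Cod M f = X'" "x\<in>Arr M" "Cod M x = \<one>\<otimes>Dom M f"
 shows "\<ll> X'\<cdot>((\<one>\<rhd>f)\<cdot>x) = f\<cdot>(\<ll> (Dom M f)\<cdot>x)"
 using comp_reassoc[OF lunit_nat[OF assms(1-2)], of x] assms by auto

lemma runit_nat [simp]:
 assumes "f\<in>Arr M" "Cod M f = X'" shows "\<rr> X'\<cdot>(f\<lhd>\<one>) = f\<cdot>\<rr> (Dom M f)"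
 using runit_natural[of f "Dom M f" X'] assms by simp

lemma runit_nat_reassoc [simp]:
 assumes "f\<in>Arr M" "Cod M f = X'" "x\<in>Arr M" "Cod M x = Dom M f\<otimes>\<one>"
 shows "\<rr> X'\<cdot>((f\<lhd>\<one>)\<cdot>x) = f\<cdot>(\<rr> (Dom M f)\<cdot>x)"
 using comp_reassoc[OF runit_nat[OF assms(1-2)], of x] assms by auto

lemma triangle_simp [simp]:
 "X\<in>Obj M ==> Y\<in>Obj M ==> (X\<rhd>\<ll> Y)\<cdot>\<alpha> X \<one> Y = \<rr> X\<lhd>Y"
 by (rule triangle)

lemma pentagon3:
 "W\<in>Obj M ==> X\<in>Obj M ==> Y\<in>Obj M ==> Z\<in>Obj M ==>
   (W\<rhd>\<alpha> X Y Z)\<cdot>(\<alpha> W (X\<otimes>Y) Z\<cdot>(\<alpha> W X Y\<lhd>Z)) = \<alpha> W X (Y\<otimes>Z)\<cdot>\<alpha> (W\<otimes>X) Y Z"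
 using pentagon[of W X Y Z] by simp

lemma pentagon3_reassoc:
 assumes "W\<in>Obj M" "X\<in>Obj M" "Y\<in>Obj M" "Z\<in>Obj M" "x\<in>Arr M" "Cod M x = ((W\<otimes>X)\<otimes>Y)\<otimes>Z"
 shows "(W\<rhd>\<alpha> X Y Z)\<cdot>(\<alpha> W (X\<otimes>Y) Z\<cdot>((\<alpha> W X Y\<lhd>Z)\<cdot>x)) =
   \<alpha> W X (Y\<otimes>Z)\<cdot>(\<alpha> (W\<otimes>X) Y Z\<cdot>x)"
 using arg_cong[OF pentagon3[OF assms(1-4)], of "\<lambda>u. u\<cdot>x"] assms by simp

text \<open>Tensoring with the unit is isomorphic to the identity functor, hence faithful; Kelly's
 derivation of the unit coherences below rests on this.\<close>

lemma unit_tensor_cancel: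
 assumes "\<one>\<rhd>f = \<one>\<rhd>g" "f\<in>Arr M" "g\<in>Arr M" "Dom M f = Dom M g" "Cod M f = Cod M g"
 shows "f = g"
proof (rule iso_cancel_right[of _ "\<ll> (Dom M f)"])
 show "f\<cdot>\<ll> (Dom M f) = g\<cdot>\<ll> (Dom M f)"
  using lunit_nat[of f "Cod M f"] lunit_nat[of g "Cod M f"] assms by simp
qed (use assms in auto)

lemma tensor_unit_cancel:
 assumes "f\<lhd>\<one> = g\<lhd>\<one>" "f\<in>Arr M" "g\<in>Arr M" "Dom M f = Dom M g" "Cod M f = Cod M g"
 shows "f = g"
proof (rule iso_cancel_right[of _ "\<rr> (Dom M f)"])
 show "f\<cdot>\<rr> (Dom M f) = g\<cdot>\<rr> (Dom M f)"
  using runit_nat[of f "Cod M f"] runit_nat[of g "Cod M f"] assms by simp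
qed (use assms in auto)

text \<open>After tensoring with \<open>\<one>\<close>, both sides are compared by the pentagon and the triangle (Kelly).\<close>

lemma lunit_tensor:
 assumes [simp]: "X\<in>Obj M" "Y\<in>Obj M"
 shows "\<ll> (X\<otimes>Y)\<cdot>\<alpha> \<one> X Y = \<ll> X\<lhd>Y"
proof (rule unit_tensor_cancel)
 let ?e = "\<alpha> \<one> (\<one>\<otimes>X) Y\<cdot>(\<alpha> \<one> \<one> X\<lhd>Y)"
 show "\<one>\<rhd>(\<ll> (X\<otimes>Y)\<cdot>\<alpha> \<one> X Y) = \<one>\<rhd>(\<ll> X\<lhd>Y)"
 proof (rule iso_cancel_right[of _ ?e])
  have "(\<one>\<rhd>(\<ll> (X\<otimes>Y)\<cdot>\<alpha> \<one> X Y))\<cdot>?e = (\<one>\<rhd>\<ll> (X\<otimes>Y))\<cdot>((\<one>\<rhd>\<alpha> \<one> X Y)\<cdot>?e)"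
   by simp
  also have "... = (\<one>\<rhd>\<ll> (X\<otimes>Y))\<cdot>(\<alpha> \<one> \<one> (X\<otimes>Y)\<cdot>\<alpha> (\<one>\<otimes>\<one>) X Y)"
   by (subst pentagon3) auto
  also have "... = ((\<one>\<rhd>\<ll> (X\<otimes>Y))\<cdot>\<alpha> \<one> \<one> (X\<otimes>Y))\<cdot>\<alpha> (\<one>\<otimes>\<one>) X Y"
   by (subst comp_assoc_right) auto
  also have "... = \<alpha> \<one> X Y\<cdot>((\<rr> \<one>\<lhd>X)\<lhd>Y)" by (subst triangle) auto
  also have "... = \<alpha> \<one> X Y\<cdot>(((\<one>\<rhd>\<ll> X)\<lhd>Y)\<cdot>(\<alpha> \<one> \<one> X\<lhd>Y))" by simp
  also have "... = (\<one>\<rhd>(\<ll> X\<lhd>Y))\<cdot>?e"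
   by (subst assoc_nat_reassoc) auto
  finally show "(\<one>\<rhd>(\<ll> (X\<otimes>Y)\<cdot>\<alpha> \<one> X Y))\<cdot>?e = (\<one>\<rhd>(\<ll> X\<lhd>Y))\<cdot>?e" .
 qed auto
qed auto

lemma runit_tensor:
 assumes [simp]: "X\<in>Obj M" "Y\<in>Obj M"
 shows "(X\<rhd>\<rr> Y)\<cdot>\<alpha> X Y \<one> = \<rr> (X\<otimes>Y)"
proof (rule tensor_unit_cancel)
 show "((X\<rhd>\<rr> Y)\<cdot>\<alpha> X Y \<one>)\<lhd>\<one> = \<rr> (X\<otimes>Y)\<lhd>\<one>"
 proof (rule iso_cancel_left[of "\<alpha> X Y \<one>"])
  have "\<alpha> X Y \<one>\<cdot>(((X\<rhd>\<rr> Y)\<cdot>\<alpha> X Y \<one>)\<lhd>\<one>) =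
    \<alpha> X Y \<one>\<cdot>(((X\<rhd>\<rr> Y)\<lhd>\<one>)\<cdot>(\<alpha> X Y \<one>\<lhd>\<one>))" by (subst tensor_merge) auto
  also have "... = (X\<rhd>(\<rr> Y\<lhd>\<one>))\<cdot>(\<alpha> X (Y\<otimes>\<one>) \<one>\<cdot>(\<alpha> X Y \<one>\<lhd>\<one>))"
   by (subst assoc_nat_reassoc) auto
  also have "... = (X\<rhd>((Y\<rhd>\<ll> \<one>)\<cdot>\<alpha> Y \<one> \<one>))\<cdot>(\<alpha> X (Y\<otimes>\<one>) \<one>\<cdot>(\<alpha> X Y \<one>\<lhd>\<one>))"
   by (subst triangle) auto
  also have "... = (X\<rhd>(Y\<rhd>\<ll> \<one>))\<cdot>((X\<rhd>\<alpha> Y \<one> \<one>)\<cdot>(\<alpha> X (Y\<otimes>\<one>) \<one>\<cdot>(\<alpha> X Y \<one>\<lhd>\<one>)))"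
   by (subst tensor_merge_reassoc) auto
  also have "... = (X\<rhd>(Y\<rhd>\<ll> \<one>))\<cdot>(\<alpha> X Y (\<one>\<otimes>\<one>)\<cdot>\<alpha> (X\<otimes>Y) \<one> \<one>)"
   by (subst pentagon3) auto
  also have "... = \<alpha> X Y \<one>\<cdot>(((X\<otimes>Y)\<rhd>\<ll> \<one>)\<cdot>\<alpha> (X\<otimes>Y) \<one> \<one>)"
   by (subst assoc_nat_id_reassoc) auto
  also have "... = \<alpha> X Y \<one>\<cdot>(\<rr> (X\<otimes>Y)\<lhd>\<one>)" by simp
  finally show "\<alpha> X Y \<one>\<cdot>(((X\<rhd>\<rr> Y)\<cdot>\<alpha> X Y \<one>)\<lhd>\<one>) = \<alpha> X Y \<one>\<cdot>(\<rr> (X\<otimes>Y)\<lhd>\<one>)" .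
 qed auto
qed auto

text \<open>Naturality of \<open>\<ll>\<close> along \<open>\<ll> \<one>\<close> gives \<open>\<ll> (\<one>\<otimes>\<one>) = \<one>\<rhd>\<ll> \<one>\<close>, which turns \<open>lunit_tensor\<close> into the triangle.\<close>

lemma lunit_unit: "\<ll> \<one> = \<rr> \<one>"
proof (rule tensor_unit_cancel)
 have "\<ll> (\<one>\<otimes>\<one>) = \<one>\<rhd>\<ll> \<one>"
  by (rule iso_cancel_left[of "\<ll> \<one>"]) auto
 then have "\<ll> \<one>\<lhd>\<one> = (\<one>\<rhd>\<ll> \<one>)\<cdot>\<alpha> \<one> \<one> \<one>" using lunit_tensor[of \<one> \<one>] by simp
 then show "\<ll> \<one>\<lhd>\<one> = \<rr> \<one>\<lhd>\<one>" by simp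
qed auto

lemma hexagon_simp:
 "X\<in>Obj M ==> Y\<in>Obj M ==> Z\<in>Obj M ==>
   \<alpha> Y Z X\<cdot>(\<beta> X (Y\<otimes>Z)\<cdot>\<alpha> X Y Z) = (Y\<rhd>\<beta> X Z)\<cdot>(\<alpha> Y X Z\<cdot>(\<beta> X Y\<lhd>Z))"
 using hexagon[of X Y Z] by simp

text \<open>The hexagon for \<open>X\<close> and two unit factors is evaluated by the triangle and \<open>runit_tensor\<close>.\<close>

lemma lunit_braid:
 assumes [simp]: "X\<in>Obj M" shows "\<ll> X\<cdot>\<beta> X \<one> = \<rr> X"
proof (rule unit_tensor_cancel)
 let ?e = "\<alpha> \<one> X \<one>\<cdot>(\<beta> X \<one>\<lhd>\<one>)"
 show "\<one>\<rhd>(\<ll> X\<cdot>\<beta> X \<one>) = \<one>\<rhd>\<rr> X"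
 proof (rule iso_cancel_right[of _ ?e])
  have "(\<one>\<rhd>(\<ll> X\<cdot>\<beta> X \<one>))\<cdot>?e = (\<one>\<rhd>\<ll> X)\<cdot>((\<one>\<rhd>\<beta> X \<one>)\<cdot>?e)" by simp
  also have "... = (\<one>\<rhd>\<ll> X)\<cdot>(\<alpha> \<one> \<one> X\<cdot>(\<beta> X (\<one>\<otimes>\<one>)\<cdot>\<alpha> X \<one> \<one>))"
   by (subst hexagon_simp) auto
  also have "... = ((\<one>\<rhd>\<ll> X)\<cdot>\<alpha> \<one> \<one> X)\<cdot>(\<beta> X (\<one>\<otimes>\<one>)\<cdot>\<alpha> X \<one> \<one>)"
   by (subst comp_assoc_right) auto
  also have "... = \<beta> X \<one>\<cdot>((X\<rhd>\<rr> \<one>)\<cdot>\<alpha> X \<one> \<one>)" by (subst triangle) auto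
  also have "... = \<beta> X \<one>\<cdot>\<rr> (X\<otimes>\<one>)" by (subst runit_tensor) auto
  also have "... = \<rr> (\<one>\<otimes>X)\<cdot>(\<beta> X \<one>\<lhd>\<one>)" by simp
  also have "... = (\<one>\<rhd>\<rr> X)\<cdot>?e" by (subst runit_tensor[symmetric]) auto
  finally show "(\<one>\<rhd>(\<ll> X\<cdot>\<beta> X \<one>))\<cdot>?e = (\<one>\<rhd>\<rr> X)\<cdot>?e" .
 qed auto
qed auto

lemma runit_braid:
 assumes [simp]: "X\<in>Obj M" shows "\<rr> X\<cdot>\<beta> \<one> X = \<ll> X"
 by (subst lunit_braid[symmetric]) auto

end

context closed_symmetric_monoidal
begin

lemma exchange_arr [simp]:
 assumes [simp]: "X\<in>Obj M" "Y\<in>Obj M" "Z\<in>Obj M"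
 shows "exchange M X Y Z\<in>Arr M" "Dom M (exchange M X Y Z) = X\<otimes>(Y\<otimes>Z)"
  "Cod M (exchange M X Y Z) = Y\<otimes>(X\<otimes>Z)" "is_iso M (exchange M X Y Z)"
 by (auto simp: exchange_def)

lemma exchange_nat:
 assumes "f\<in>Arr M" "g\<in>Arr M" "h\<in>Arr M" "Cod M f = X'" "Cod M g = Y'" "Cod M h = Z'"
 shows "exchange M X' Y' Z'\<cdot>(f\<odot>(g\<odot>h)) = (g\<odot>(f\<odot>h))\<cdot>exchange M (Dom M f) (Dom M g) (Dom M h)"
proof -
 let ?X = "Dom M f" and ?Y = "Dom M g" and ?Z = "Dom M h"
 have "exchange M X' Y' Z'\<cdot>(f\<odot>(g\<odot>h)) =
   \<alpha> Y' X' Z'\<cdot>(((g\<odot>f)\<odot>h)\<cdot>((\<beta> ?X ?Y\<lhd>?Z)\<cdot>\<alpha>\<^sup>- ?X ?Y ?Z))"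
  using assms by (auto simp: exchange_def)
 also have "... = (g\<odot>(f\<odot>h))\<cdot>exchange M ?X ?Y ?Z"
  using assms by (subst assoc_nat_reassoc) (auto simp: exchange_def)
 finally show ?thesis .
qed

lemma exchange_nat_reassoc:
 assumes "f\<in>Arr M" "g\<in>Arr M" "h\<in>Arr M" "Cod M f = X'" "Cod M g = Y'" "Cod M h = Z'"
  "x\<in>Arr M" "Cod M x = Dom M f\<otimes>(Dom M g\<otimes>Dom M h)"
 shows "exchange M X' Y' Z'\<cdot>((f\<odot>(g\<odot>h))\<cdot>x) =
  (g\<odot>(f\<odot>h))\<cdot>(exchange M (Dom M f) (Dom M g) (Dom M h)\<cdot>x)"
 using comp_reassoc[OF exchange_nat[OF assms(1-6)], of x] assms by auto

lemma lunit_exchange: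
 assumes [simp]: "X\<in>Obj M" "Z\<in>Obj M"
 shows "\<ll> (X\<otimes>Z)\<cdot>exchange M X \<one> Z = X\<rhd>\<ll> Z"
proof (rule iso_cancel_right[of _ "\<alpha> X \<one> Z"])
 have "(\<ll> (X\<otimes>Z)\<cdot>exchange M X \<one> Z)\<cdot>\<alpha> X \<one> Z = (\<ll> (X\<otimes>Z)\<cdot>\<alpha> \<one> X Z)\<cdot>(\<beta> X \<one>\<lhd>Z)"
  by (simp add: exchange_def)
 also have "... = (\<ll> X\<cdot>\<beta> X \<one>)\<lhd>Z" by (subst lunit_tensor) auto
 also have "... = (X\<rhd>\<ll> Z)\<cdot>\<alpha> X \<one> Z" by (simp add: lunit_braid)
 finally show "(\<ll> (X\<otimes>Z)\<cdot>exchange M X \<one> Z)\<cdot>\<alpha> X \<one> Z = (X\<rhd>\<ll> Z)\<cdot>\<alpha> X \<one> Z" .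
qed auto

text \<open>The hexagon for the inverse braiding, which is the braiding again.\<close>

lemma braid_tensor_left:
 assumes [simp]: "X\<in>Obj M" "Y\<in>Obj M" "Z\<in>Obj M"
 shows "\<beta> (X\<otimes>Y) Z = exchange M X Z Y\<cdot>((X\<rhd>\<beta> Y Z)\<cdot>\<alpha> X Y Z)"
proof (rule iso_cancel_right[of _ "\<beta> Z (X\<otimes>Y)\<cdot>\<alpha> Z X Y"])
 have "(exchange M X Z Y\<cdot>((X\<rhd>\<beta> Y Z)\<cdot>\<alpha> X Y Z))\<cdot>(\<beta> Z (X\<otimes>Y)\<cdot>\<alpha> Z X Y) =
   exchange M X Z Y\<cdot>((X\<rhd>\<beta> Y Z)\<cdot>(\<alpha> X Y Z\<cdot>(\<beta> Z (X\<otimes>Y)\<cdot>\<alpha> Z X Y)))"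
  by simp
 also have "... = \<alpha> Z X Y"
  by (subst hexagon_simp) (auto simp: exchange_def)
 finally show "\<beta> (X\<otimes>Y) Z\<cdot>(\<beta> Z (X\<otimes>Y)\<cdot>\<alpha> Z X Y) =
   (exchange M X Z Y\<cdot>((X\<rhd>\<beta> Y Z)\<cdot>\<alpha> X Y Z))\<cdot>(\<beta> Z (X\<otimes>Y)\<cdot>\<alpha> Z X Y)"
  by simp
qed auto

text \<open>Moving \<open>X\<close> past a product is moving it past the two factors in turn; the hexagon and three pentagons.\<close>

lemma exchange_tensor_middle:
 assumes [simp]: "X\<in>Obj M" "Y\<in>Obj M" "Z\<in>Obj M" "W\<in>Obj M"
 shows "\<alpha> Y Z (X\<otimes>W)\<cdot>exchange M X (Y\<otimes>Z) W =
  (Y\<rhd>exchange M X Z W)\<cdot>(exchange M X Y (Z\<otimes>W)\<cdot>(X\<rhd>\<alpha> Y Z W))"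
proof (rule iso_cancel_right[of _ "\<alpha> X (Y\<otimes>Z) W\<cdot>(\<alpha> X Y Z\<lhd>W)"])
 let ?e = "\<alpha> X (Y\<otimes>Z) W\<cdot>(\<alpha> X Y Z\<lhd>W)"
 let ?m = "(Y\<rhd>\<alpha> Z X W)\<cdot>((Y\<rhd>(\<beta> X Z\<lhd>W))\<cdot>(\<alpha> Y (X\<otimes>Z) W \<cdot>
   ((\<alpha> Y X Z\<lhd>W)\<cdot>((\<beta> X Y\<lhd>Z)\<lhd>W))))"
 have "(\<alpha> Y Z (X\<otimes>W)\<cdot>exchange M X (Y\<otimes>Z) W)\<cdot>?e =
   (\<alpha> Y Z (X\<otimes>W)\<cdot>\<alpha> (Y\<otimes>Z) X W)\<cdot>((\<beta> X (Y\<otimes>Z)\<cdot>\<alpha> X Y Z)\<lhd>W)"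
  by (simp add: exchange_def)
 also have "... = ((Y\<rhd>\<alpha> Z X W)\<cdot>(\<alpha> Y (Z\<otimes>X) W\<cdot>(\<alpha> Y Z X\<lhd>W))) \<cdot>
   ((\<beta> X (Y\<otimes>Z)\<cdot>\<alpha> X Y Z)\<lhd>W)"
  by (subst pentagon3) auto
 also have "... = (Y\<rhd>\<alpha> Z X W)\<cdot>(\<alpha> Y (Z\<otimes>X) W \<cdot>
   ((\<alpha> Y Z X\<cdot>(\<beta> X (Y\<otimes>Z)\<cdot>\<alpha> X Y Z))\<lhd>W))" by simp
 also have "... = (Y\<rhd>\<alpha> Z X W)\<cdot>(\<alpha> Y (Z\<otimes>X) W \<cdot>
   (((Y\<rhd>\<beta> X Z)\<cdot>(\<alpha> Y X Z\<cdot>(\<beta> X Y\<lhd>Z)))\<lhd>W))"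
  by (subst hexagon_simp) auto
 also have "... = (Y\<rhd>\<alpha> Z X W)\<cdot>(\<alpha> Y (Z\<otimes>X) W \<cdot>
   (((Y\<rhd>\<beta> X Z)\<lhd>W)\<cdot>((\<alpha> Y X Z\<cdot>(\<beta> X Y\<lhd>Z))\<lhd>W)))"
  by simp
 also have "... = ?m" by (subst assoc_nat_reassoc) auto
 finally have l: "(\<alpha> Y Z (X\<otimes>W)\<cdot>exchange M X (Y\<otimes>Z) W)\<cdot>?e = ?m" .
 have "((Y\<rhd>exchange M X Z W)\<cdot>(exchange M X Y (Z\<otimes>W)\<cdot>(X\<rhd>\<alpha> Y Z W)))\<cdot>?e =
   (Y\<rhd>exchange M X Z W)\<cdot>(exchange M X Y (Z\<otimes>W)\<cdot>((X\<rhd>\<alpha> Y Z W)\<cdot>?e))" by simp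
 also have "... = (Y\<rhd>exchange M X Z W)\<cdot>((\<alpha> Y X (Z\<otimes>W)\<cdot>\<alpha> (Y\<otimes>X) Z W)\<cdot>((\<beta> X Y\<lhd>Z)\<lhd>W))"
  by (subst pentagon3) (auto simp: exchange_def)
 also have "... = (Y\<rhd>exchange M X Z W)\<cdot>(((Y\<rhd>\<alpha> X Z W)\<cdot>(\<alpha> Y (X\<otimes>Z) W\<cdot>(\<alpha> Y X Z\<lhd>W)))
   \<cdot>((\<beta> X Y\<lhd>Z)\<lhd>W))" by (subst pentagon3) auto
 also have "... = ?m" by (simp add: exchange_def)
 finally show "(\<alpha> Y Z (X\<otimes>W)\<cdot>exchange M X (Y\<otimes>Z) W)\<cdot>?e =
  ((Y\<rhd>exchange M X Z W)\<cdot>(exchange M X Y (Z\<otimes>W)\<cdot>(X\<rhd>\<alpha> Y Z W)))\<cdot>?e" using l by simp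
qed auto

text \<open>Multilinear combinatorics is carried out on left-bracketed products
 \<open>((B\<otimes>X)\<otimes>Y)\<otimes>\<dots>\<close>; this is the interchange of their last two factors.\<close>

definition right_swap :: "'o => 'o => 'o => 'm" ("\<tau>") where
 "\<tau> B X Y = \<alpha>\<^sup>- B Y X\<cdot>((B\<rhd>\<beta> X Y)\<cdot>\<alpha> B X Y)"

lemma right_swap_arr [simp]:
 assumes [simp]: "B\<in>Obj M" "X\<in>Obj M" "Y\<in>Obj M"
 shows "\<tau> B X Y\<in>Arr M" "Dom M (\<tau> B X Y) = (B\<otimes>X)\<otimes>Y" "Cod M (\<tau> B X Y) = (B\<otimes>Y)\<otimes>X"
  "is_iso M (\<tau> B X Y)"
 by (auto simp: right_swap_def)

lemma right_swap_swap [simp]: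
 assumes [simp]: "B\<in>Obj M" "X\<in>Obj M" "Y\<in>Obj M"
 shows "\<tau> B Y X\<cdot>\<tau> B X Y = \<i>\<d> ((B\<otimes>X)\<otimes>Y)"
 by (simp add: right_swap_def)

lemma right_swap_nat:
 assumes "f\<in>Arr M" "g\<in>Arr M" "h\<in>Arr M" "Cod M f = B'" "Cod M g = X'" "Cod M h = Y'"
 shows "\<tau> B' X' Y'\<cdot>((f\<odot>g)\<odot>h) = ((f\<odot>h)\<odot>g)\<cdot>\<tau> (Dom M f) (Dom M g) (Dom M h)"
proof -
 let ?B = "Dom M f" and ?X = "Dom M g" and ?Y = "Dom M h"
 have "\<tau> B' X' Y'\<cdot>((f\<odot>g)\<odot>h) =
   \<alpha>\<^sup>- B' Y' X'\<cdot>((f\<odot>(h\<odot>g))\<cdot>((?B\<rhd>\<beta> ?X ?Y)\<cdot>\<alpha> ?B ?X ?Y))"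
  using assms by (auto simp: right_swap_def)
 also have "... = ((f\<odot>h)\<odot>g)\<cdot>\<tau> ?B ?X ?Y"
  using assms by (subst assoc_inv_nat_reassoc) (auto simp: right_swap_def)
 finally show ?thesis .
qed

lemma right_swap_nat_reassoc:
 assumes "f\<in>Arr M" "g\<in>Arr M" "h\<in>Arr M" "Cod M f = B'" "Cod M g = X'" "Cod M h = Y'"
  "x\<in>Arr M" "Cod M x = (Dom M f\<otimes>Dom M g)\<otimes>Dom M h"
 shows "\<tau> B' X' Y'\<cdot>(((f\<odot>g)\<odot>h)\<cdot>x) = ((f\<odot>h)\<odot>g)\<cdot>(\<tau> (Dom M f) (Dom M g) (Dom M h)\<cdot>x)"
 using comp_reassoc[OF right_swap_nat[OF assms(1-6)], of x] assms by auto

lemma assoc_right_swap: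
 assumes [simp]: "B\<in>Obj M" "X\<in>Obj M" "Y\<in>Obj M"
 shows "\<alpha> B Y X\<cdot>\<tau> B X Y = (B\<rhd>\<beta> X Y)\<cdot>\<alpha> B X Y"
 by (simp add: right_swap_def)

text \<open>Interchange of \<open>Z\<close> with a product \<open>X\<otimes>Y\<close> is performed factor by factor.\<close>

lemma right_swap_tensor:
 assumes [simp]: "B\<in>Obj M" "X\<in>Obj M" "Y\<in>Obj M" "Z\<in>Obj M"
 shows "\<tau> B (X\<otimes>Y) Z\<cdot>(\<alpha> B X Y\<lhd>Z) =
  \<alpha> (B\<otimes>Z) X Y\<cdot>((\<tau> B X Z\<lhd>Y)\<cdot>\<tau> (B\<otimes>X) Y Z)"
proof (rule iso_cancel_left[of "\<alpha> B Z (X\<otimes>Y)"])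
 let ?h = "\<alpha> Z X Y\<cdot>((\<beta> X Z\<lhd>Y)\<cdot>(\<alpha>\<^sup>- X Z Y\<cdot>(X\<rhd>\<beta> Y Z)))"
 have "\<alpha> B Z (X\<otimes>Y)\<cdot>(\<tau> B (X\<otimes>Y) Z\<cdot>(\<alpha> B X Y\<lhd>Z)) =
   (B\<rhd>\<beta> (X\<otimes>Y) Z)\<cdot>(\<alpha> B (X\<otimes>Y) Z\<cdot>(\<alpha> B X Y\<lhd>Z))"
  by (simp add: right_swap_def)
 also have "... = (B\<rhd>?h)\<cdot>((B\<rhd>\<alpha> X Y Z)\<cdot>(\<alpha> B (X\<otimes>Y) Z\<cdot>(\<alpha> B X Y\<lhd>Z)))"
  by (simp add: braid_tensor_left exchange_def)
 also have "... = (B\<rhd>?h)\<cdot>(\<alpha> B X (Y\<otimes>Z)\<cdot>\<alpha> (B\<otimes>X) Y Z)"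
  by (subst pentagon3) auto
 finally have l: "\<alpha> B Z (X\<otimes>Y)\<cdot>(\<tau> B (X\<otimes>Y) Z\<cdot>(\<alpha> B X Y\<lhd>Z)) =
  (B\<rhd>?h)\<cdot>(\<alpha> B X (Y\<otimes>Z)\<cdot>\<alpha> (B\<otimes>X) Y Z)" .
 have "\<alpha> B Z (X\<otimes>Y)\<cdot>(\<alpha> (B\<otimes>Z) X Y\<cdot>((\<tau> B X Z\<lhd>Y)\<cdot>\<tau> (B\<otimes>X) Y Z)) =
   (\<alpha> B Z (X\<otimes>Y)\<cdot>\<alpha> (B\<otimes>Z) X Y)\<cdot>((\<tau> B X Z\<lhd>Y)\<cdot>\<tau> (B\<otimes>X) Y Z)" by simp
 also have "... = ((B\<rhd>\<alpha> Z X Y)\<cdot>(\<alpha> B (Z\<otimes>X) Y\<cdot>(\<alpha> B Z X\<lhd>Y))) \<cdot>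
   ((\<tau> B X Z\<lhd>Y)\<cdot>\<tau> (B\<otimes>X) Y Z)" by (subst pentagon3) auto
 also have "... = (B\<rhd>\<alpha> Z X Y)\<cdot>(\<alpha> B (Z\<otimes>X) Y\<cdot>(((B\<rhd>\<beta> X Z)\<cdot>\<alpha> B X Z)\<lhd>Y)\<cdot>\<tau> (B\<otimes>X) Y Z)"
  by (simp add: assoc_right_swap)
 also have "... = (B\<rhd>\<alpha> Z X Y)\<cdot>(\<alpha> B (Z\<otimes>X) Y\<cdot>(((B\<rhd>\<beta> X Z)\<lhd>Y) \<cdot>
   ((\<alpha> B X Z\<lhd>Y)\<cdot>\<tau> (B\<otimes>X) Y Z)))" by simp
 also have "... = (B\<rhd>(\<alpha> Z X Y\<cdot>(\<beta> X Z\<lhd>Y))) \<cdot>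
   (\<alpha> B (X\<otimes>Z) Y\<cdot>((\<alpha> B X Z\<lhd>Y)\<cdot>\<tau> (B\<otimes>X) Y Z))"
  by (subst assoc_nat_reassoc) auto
 also have "... = (B\<rhd>(\<alpha> Z X Y\<cdot>((\<beta> X Z\<lhd>Y)\<cdot>\<alpha>\<^sup>- X Z Y)))\<cdot>((B\<rhd>\<alpha> X Z Y) \<cdot>
   (\<alpha> B (X\<otimes>Z) Y\<cdot>((\<alpha> B X Z\<lhd>Y)\<cdot>\<tau> (B\<otimes>X) Y Z)))" by simp
 also have "... = (B\<rhd>(\<alpha> Z X Y\<cdot>((\<beta> X Z\<lhd>Y)\<cdot>\<alpha>\<^sup>- X Z Y))) \<cdot>
   (\<alpha> B X (Z\<otimes>Y)\<cdot>(\<alpha> (B\<otimes>X) Z Y\<cdot>\<tau> (B\<otimes>X) Y Z))"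
  by (subst pentagon3_reassoc) auto
 also have "... = (B\<rhd>?h)\<cdot>(\<alpha> B X (Y\<otimes>Z)\<cdot>\<alpha> (B\<otimes>X) Y Z)"
  by (simp add: assoc_right_swap)
 finally show "\<alpha> B Z (X\<otimes>Y)\<cdot>(\<tau> B (X\<otimes>Y) Z\<cdot>(\<alpha> B X Y\<lhd>Z)) =
  \<alpha> B Z (X\<otimes>Y)\<cdot>(\<alpha> (B\<otimes>Z) X Y\<cdot>((\<tau> B X Z\<lhd>Y)\<cdot>\<tau> (B\<otimes>X) Y Z))" using l by simp
qed auto

text \<open>The relation \<open>s t s = t s t\<close> of adjacent interchanges. It follows from naturality of the interchange
 with \<open>X\<otimes>Y\<close>, read before and after braiding the two factors.\<close>

lemma yang_baxter:
 assumes [simp]: "B\<in>Obj M" "X\<in>Obj M" "Y\<in>Obj M" "Z\<in>Obj M"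
 shows "(\<tau> B Y Z\<lhd>X)\<cdot>(\<tau> (B\<otimes>Y) X Z\<cdot>(\<tau> B X Y\<lhd>Z)) =
  \<tau> (B\<otimes>Z) X Y\<cdot>((\<tau> B X Z\<lhd>Y)\<cdot>\<tau> (B\<otimes>X) Y Z)"
proof (rule iso_cancel_left[of "\<alpha> (B\<otimes>Z) Y X"])
 have "\<alpha> (B\<otimes>Z) Y X\<cdot>((\<tau> B Y Z\<lhd>X)\<cdot>(\<tau> (B\<otimes>Y) X Z\<cdot>(\<tau> B X Y\<lhd>Z))) =
   (\<alpha> (B\<otimes>Z) Y X\<cdot>((\<tau> B Y Z\<lhd>X)\<cdot>\<tau> (B\<otimes>Y) X Z))\<cdot>(\<tau> B X Y\<lhd>Z)" by simp
 also have "... = \<tau> B (Y\<otimes>X) Z\<cdot>((\<alpha> B Y X\<cdot>\<tau> B X Y)\<lhd>Z)"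
  by (subst right_swap_tensor[symmetric]) auto
 also have "... = \<tau> B (Y\<otimes>X) Z\<cdot>(((B\<rhd>\<beta> X Y)\<lhd>Z)\<cdot>(\<alpha> B X Y\<lhd>Z))"
  by (simp add: assoc_right_swap)
 also have "... = ((B\<otimes>Z)\<rhd>\<beta> X Y)\<cdot>(\<tau> B (X\<otimes>Y) Z\<cdot>(\<alpha> B X Y\<lhd>Z))"
  by (subst right_swap_nat_reassoc) auto
 also have "... = (((B\<otimes>Z)\<rhd>\<beta> X Y)\<cdot>\<alpha> (B\<otimes>Z) X Y)\<cdot>((\<tau> B X Z\<lhd>Y)\<cdot>\<tau> (B\<otimes>X) Y Z)"
  by (subst right_swap_tensor) auto
 also have "... = (\<alpha> (B\<otimes>Z) Y X\<cdot>\<tau> (B\<otimes>Z) X Y)\<cdot>((\<tau> B X Z\<lhd>Y)\<cdot>\<tau> (B\<otimes>X) Y Z)"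
  by (subst assoc_right_swap) auto
 finally show "\<alpha> (B\<otimes>Z) Y X\<cdot>((\<tau> B Y Z\<lhd>X)\<cdot>(\<tau> (B\<otimes>Y) X Z\<cdot>(\<tau> B X Y\<lhd>Z))) =
  \<alpha> (B\<otimes>Z) Y X\<cdot>(\<tau> (B\<otimes>Z) X Y\<cdot>((\<tau> B X Z\<lhd>Y)\<cdot>\<tau> (B\<otimes>X) Y Z))" by simp
qed auto

text \<open>Translates interchanges in right-bracketed words into interchanges in left-bracketed products.\<close>

lemma exchange_right_swap:
 assumes [simp]: "B\<in>Obj M" "X\<in>Obj M" "Y\<in>Obj M" "Z\<in>Obj M"
 shows "(B\<rhd>exchange M X Y Z)\<cdot>(\<alpha> B X (Y\<otimes>Z)\<cdot>\<alpha> (B\<otimes>X) Y Z) =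
  \<alpha> B Y (X\<otimes>Z)\<cdot>(\<alpha> (B\<otimes>Y) X Z\<cdot>(\<tau> B X Y\<lhd>Z))"
proof -
 have "\<alpha> B Y (X\<otimes>Z)\<cdot>(\<alpha> (B\<otimes>Y) X Z\<cdot>(\<tau> B X Y\<lhd>Z)) =
   (\<alpha> B Y (X\<otimes>Z)\<cdot>\<alpha> (B\<otimes>Y) X Z)\<cdot>(\<tau> B X Y\<lhd>Z)" by simp
 also have "... = ((B\<rhd>\<alpha> Y X Z)\<cdot>(\<alpha> B (Y\<otimes>X) Z\<cdot>(\<alpha> B Y X\<lhd>Z)))\<cdot>(\<tau> B X Y\<lhd>Z)"
  by (subst pentagon3) auto
 also have "... = (B\<rhd>\<alpha> Y X Z)\<cdot>(\<alpha> B (Y\<otimes>X) Z\<cdot>(((B\<rhd>\<beta> X Y)\<lhd>Z)\<cdot>(\<alpha> B X Y\<lhd>Z)))"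
  by (simp add: assoc_right_swap)
 also have "... = (B\<rhd>(\<alpha> Y X Z\<cdot>(\<beta> X Y\<lhd>Z)))\<cdot>(\<alpha> B (X\<otimes>Y) Z\<cdot>(\<alpha> B X Y\<lhd>Z))"
  by (subst assoc_nat_reassoc) auto
 also have "... = (B\<rhd>exchange M X Y Z)\<cdot>((B\<rhd>\<alpha> X Y Z)\<cdot>(\<alpha> B (X\<otimes>Y) Z\<cdot>(\<alpha> B X Y\<lhd>Z)))"
  by (simp add: exchange_def)
 also have "... = (B\<rhd>exchange M X Y Z)\<cdot>(\<alpha> B X (Y\<otimes>Z)\<cdot>\<alpha> (B\<otimes>X) Y Z)"
  by (subst pentagon3) auto
 finally show ?thesis by simp
qed

lemma runit_right_swap:
 assumes [simp]: "B\<in>Obj M" "K\<in>Obj M"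
 shows "\<rr> (B\<otimes>K)\<cdot>\<tau> B \<one> K = \<rr> B\<lhd>K"
proof -
 have "\<rr> (B\<otimes>K)\<cdot>\<tau> B \<one> K = (B\<rhd>\<rr> K)\<cdot>(\<alpha> B K \<one>\<cdot>\<tau> B \<one> K)"
  by (simp add: runit_tensor[symmetric])
 also have "... = (B\<rhd>(\<rr> K\<cdot>\<beta> \<one> K))\<cdot>\<alpha> B \<one> K" by (simp add: assoc_right_swap)
 also have "... = \<rr> B\<lhd>K" by (simp add: runit_braid)
 finally show ?thesis .
qed

end

section \<open>Tensor words and interchanges of adjacent factors\<close>

text \<open>The words are right-bracketed, so that an adjacent interchange acts on \<open>X\<otimes>(Y\<otimes>Z)\<close>.\<close>

fun adj_iso :: "('o, 'm, 'z) smcat_scheme => 'o list => nat => 'm" where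
 "adj_iso M (X # Y # Xs) 0 = exchange M X Y (tensor_list M Xs)"
| "adj_iso M (X # Xs) (Suc i) = Idn M X \<odot>\<^bsub>M\<^esub> adj_iso M Xs i"
| "adj_iso M _ _ = undefined"

fun swap_at :: "nat => 'a list => 'a list" where
 "swap_at 0 (x # y # xs) = y # x # xs"
| "swap_at (Suc i) (x # xs) = x # swap_at i xs"
| "swap_at _ xs = xs"

lemma length_swap_at [simp]: "length (swap_at i xs) = length xs"
 by (induction i xs rule: swap_at.induct) auto

lemma map_swap_at: "map f (swap_at i xs) = swap_at i (map f xs)"
 by (induction i xs rule: swap_at.induct) auto

lemma set_swap_at [simp]: "set (swap_at i xs) = set xs"
 by (induction i xs rule: swap_at.induct) auto

lemma swap_at_replicate [simp]: "swap_at i (replicate n x) = replicate n x"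
proof (induction n arbitrary: i)
 case (Suc n) then show ?case by (cases i; cases n) auto
qed auto

context closed_symmetric_monoidal
begin

abbreviation TL :: "'o list => 'o" where "TL \<equiv> tensor_list M"

lemma TL_obj [simp]: "set Xs \<subseteq> Obj M ==> TL Xs\<in>Obj M"
 by (induction Xs) auto

lemma adj_iso_arr [simp]:
 assumes "set Xs \<subseteq> Obj M" "Suc i < length Xs"
 shows "adj_iso M Xs i\<in>Arr M" "Dom M (adj_iso M Xs i) = TL Xs" "Cod M (adj_iso M Xs i) = TL (swap_at i Xs)"
 using assms by (induction i Xs rule: swap_at.induct) auto

text \<open>Composites of adjacent interchanges. The words are lists of labels instead of lists of objects, so
 that the same path acts on the words of a cube and on their labels simultaneously.\<close>

inductive swap_path :: "('b => 'o) => 'b list => 'm => 'b list => bool" for ob where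
 refl: "swap_path ob w (\<i>\<d> (TL (map ob w))) w"
| step: "swap_path ob w t w' ==> Suc i < length w' ==>
  swap_path ob w (adj_iso M (map ob w') i\<cdot>t) (swap_at i w')"

lemma swap_path_arr:
 assumes "swap_path ob w t w'" "\<And>x. ob x\<in>Obj M"
 shows "t\<in>Arr M" "Dom M t = TL (map ob w)" "Cod M t = TL (map ob w')" "length w' = length w"
 using assms(1)
 by (induction) (use assms(2) in \<open>auto simp: image_subset_iff map_swap_at\<close>)

lemma swap_path_trans:
 assumes "swap_path ob w' t' w''" "swap_path ob w t w'" "\<And>x. ob x\<in>Obj M"
 shows "swap_path ob w (t'\<cdot>t) w''"
 using assms(1,2)
proof induction
 case (refl w)
 then show ?case using swap_path_arr[OF refl assms(3)] by simp
next
 case (step w' t' w'' i)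
 note A = swap_path_arr[OF step(1) assms(3)] swap_path_arr[OF step(4) assms(3)]
 have "swap_path ob w (adj_iso M (map ob w'') i\<cdot>(t'\<cdot>t)) (swap_at i w'')"
  by (rule swap_path.step[OF step(3)[OF step(4)] step(2)])
 then show ?case using A step(2) assms(3) by (simp add: image_subset_iff)
qed

lemma swap_path_cons:
 assumes "swap_path ob w t w'" "\<And>x. ob x\<in>Obj M"
 shows "swap_path ob (x # w) (ob x\<rhd>t) (x # w')"
 using assms(1)
proof induction
 case (refl w)
 then show ?case using swap_path.refl[of ob "x # w"] assms(2) by (simp add: image_subset_iff)
next
 case (step w t w' i)
 note A = swap_path_arr[OF step(1) assms(2)]
 have "swap_path ob (x # w) (adj_iso M (map ob (x # w')) (Suc i)\<cdot>(ob x\<rhd>t)) (swap_at (Suc i) (x # w'))"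
  by (rule swap_path.step[OF step(3)]) (use step(2) in simp)
 then show ?case using A step(2) assms(2) by (simp add: image_subset_iff)
qed

lemma swap_path_exchange:
 assumes "\<And>x. ob x\<in>Obj M"
 shows "swap_path ob (x # y # w) (exchange M (ob x) (ob y) (TL (map ob w))) (y # x # w)"
 using swap_path.step[OF swap_path.refl[of ob "x # y # w"], of 0] assms by (simp add: image_subset_iff)

text \<open>Moving a factor to the front passes it over one neighbour at a time.\<close>

lemma swap_path_pull:
 assumes "\<And>x. ob x\<in>Obj M" "i < length w"
 shows "swap_path ob w (pull_iso M (map ob w) i) (w ! i # remove_nth i w)"
 using assms(2)
proof (induction w arbitrary: i)
 case (Cons x w)
 show ?case
 proof (cases i)
  case 0
  then show ?thesis using swap_path.refl[of ob "x # w"] by (simp add: remove_nth_def)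
 next
  case (Suc j)
  then have j: "j < length w" using Cons(2) by simp
  have r: "map ob (remove_nth j w) = remove_nth j (map ob w)"
   by (simp add: remove_nth_def take_map drop_map)
  have "swap_path ob (x # w) (exchange M (ob x) (ob (w ! j)) (TL (map ob (remove_nth j w))) \<cdot>
    (ob x\<rhd>pull_iso M (map ob w) j)) (w ! j # x # remove_nth j w)"
   by (intro swap_path_trans[OF swap_path_exchange] swap_path_cons Cons.IH j assms(1))
  then show ?thesis using Suc j r by (simp add: remove_nth_def)
 qed
qed simp

text \<open>The recursion of \<open>perm_iso\<close> pulls one factor to the front and permutes the rest. The hypothesis is
 injectivity on an interval instead of \<open>permutes\<close>, which is what the renumbered permutation of the
 recursive call inherits.\<close>

lemma swap_path_perm:
 assumes "\<And>x. ob x\<in>Obj M" "inj_on \<sigma> {..<n}" "\<sigma> ` {..<n} \<subseteq> {..<n}" "length w = n"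
 shows "swap_path ob w (perm_iso M n \<sigma> (map ob w)) (map (\<lambda>i. w ! \<sigma> i) [0..<n])"
 using assms(2-)
proof (induction n arbitrary: \<sigma> w)
 case 0
 then show ?case using swap_path.refl[of ob "[]"] by simp
next
 case (Suc n)
 let ?s = "\<lambda>j. if \<sigma> (Suc j) < \<sigma> 0 then \<sigma> (Suc j) else \<sigma> (Suc j) - 1" and ?w = "remove_nth (\<sigma> 0) w"
 have s0: "\<sigma> 0 < length w" using Suc(3,4) by auto
 have ne: "\<sigma> (Suc j) \<noteq> \<sigma> 0" "\<sigma> (Suc j) < Suc n" if "j < n" for j
  using inj_onD[OF Suc(2), of "Suc j" 0] Suc(3) that by auto
 have "inj_on ?s {..<n}"
 proof (rule inj_onI)
  fix i j assume ij: "i\<in>{..<n}" "j\<in>{..<n}" "?s i = ?s j"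
  then have "\<sigma> (Suc i) = \<sigma> (Suc j)" using ne[of i] ne[of j] by (auto split: if_splits)
  then show "i = j" using inj_onD[OF Suc(2), of "Suc i" "Suc j"] ij by auto
 qed
 moreover have "?s ` {..<n} \<subseteq> {..<n}"
  using ne s0 Suc(4) by (auto split: if_splits) (metis Suc_pred less_Suc_eq not_less_eq zero_less_Suc linorder_neqE_nat gr0I not_less0)+
 moreover have lw: "length ?w = n" using s0 Suc(4) by (simp add: remove_nth_def)
 ultimately have IH: "swap_path ob ?w (perm_iso M n ?s (map ob ?w)) (map (\<lambda>i. ?w ! ?s i) [0..<n])"
  by (rule Suc.IH)
 have "?w ! ?s j = w ! \<sigma> (Suc j)" if "j < n" for j
  using ne[OF that] s0 Suc(4) by (auto simp: remove_nth_def nth_append min_def)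
 then have m: "map (\<lambda>i. ?w ! ?s i) [0..<n] = map (\<lambda>i. w ! \<sigma> (Suc i)) [0..<n]" by simp
 have r: "map ob ?w = remove_nth (\<sigma> 0) (map ob w)"
  by (simp add: remove_nth_def take_map drop_map)
 have "swap_path ob w (((ob (w ! \<sigma> 0))\<rhd>perm_iso M n ?s (map ob ?w))\<cdot>pull_iso M (map ob w) (\<sigma> 0))
   (w ! \<sigma> 0 # map (\<lambda>i. w ! \<sigma> (Suc i)) [0..<n])"
  unfolding m[symmetric] by (intro swap_path_trans[OF swap_path_cons swap_path_pull] IH s0 assms(1))
 moreover have "map (\<lambda>i. w ! \<sigma> i) [0..<Suc n] = w ! \<sigma> 0 # map (\<lambda>i. w ! \<sigma> (Suc i)) [0..<n]"
  by (subst upt_conv_Cons) (auto simp: map_Suc_upt[symmetric] simp del: map_Suc_upt upt_Suc)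
 ultimately show ?case using s0 r by simp
qed

lemma swap_path_permute:
 assumes "\<And>x. ob x\<in>Obj M" "\<sigma> permutes {..<n}" "length w = n"
 shows "swap_path ob w (perm_iso M n \<sigma> (map ob w)) (permute_list \<sigma> w)"
 using swap_path_perm[OF assms(1) _ _ assms(3), of \<sigma>] permutes_inj_on[OF assms(2)] permutes_image[OF assms(2)] assms(3)
 by (simp add: permute_list_def)

lemma perm_iso_id:
 assumes "set Xs \<subseteq> Obj M" "length Xs = n" "\<And>i. i < n ==> \<sigma> i = i"
 shows "perm_iso M n \<sigma> Xs = \<i>\<d> (TL Xs)"
 using assms
proof (induction n arbitrary: \<sigma> Xs)
 case (Suc n)
 then obtain X Ys where X: "Xs = X # Ys" by (cases Xs) auto
 have "perm_iso M n (\<lambda>j. if \<sigma> (Suc j) < \<sigma> 0 then \<sigma> (Suc j) else \<sigma> (Suc j) - 1) Ys = \<i>\<d> (TL Ys)"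
  using Suc X by (intro Suc.IH) auto
 then show ?case using Suc X by (simp add: remove_nth_def)
qed simp

text \<open>Conversely, the adjacent interchanges are permutation isomorphisms, so that invariance under the group
 action implies invariance under them.\<close>

lemma perm_iso_transpose:
 assumes "set Xs \<subseteq> Obj M" "length Xs = n" "Suc i < n" "\<And>j. j < n ==> \<sigma> j = transpose i (Suc i) j"
 shows "perm_iso M n \<sigma> Xs = adj_iso M Xs i"
 using assms
proof (induction n arbitrary: \<sigma> Xs i)
 case (Suc n)
 then obtain X Ys where X: "Xs = X # Ys" by (cases Xs) auto
 show ?case
 proof (cases i)
  case 0
  then obtain Y Zs where Y: "Ys = Y # Zs" using Suc X by (cases Ys) auto
  have s: "\<sigma> 0 = 1" "\<sigma> (Suc 0) = 0" "\<And>j. Suc (Suc j) < Suc n ==> \<sigma> (Suc (Suc j)) = Suc (Suc j)"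
   using Suc(5)[of 0] Suc(5)[of 1] Suc(5)[of "Suc (Suc _)"] Suc(2,3,4) 0 by (auto simp: transpose_def)
  have "perm_iso M n (\<lambda>j. if \<sigma> (Suc j) < \<sigma> 0 then \<sigma> (Suc j) else \<sigma> (Suc j) - 1) (X # Zs) = \<i>\<d> (TL (X # Zs))"
  proof (rule perm_iso_id)
   fix j assume "j < n"
   then show "(if \<sigma> (Suc j) < \<sigma> 0 then \<sigma> (Suc j) else \<sigma> (Suc j) - 1) = j"
    using s by (cases j) auto
  qed (use Suc X Y in auto)
  then show ?thesis using X Y 0 s Suc(2) by (simp add: remove_nth_def)
 next
  case (Suc k)
  have s: "\<sigma> 0 = 0" "\<And>j. j < n ==> \<sigma> (Suc j) = Suc (transpose k (Suc k) j)"
   using Suc.prems(4)[of 0] Suc.prems(4)[of "Suc _"] Suc by (auto simp: transpose_def)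
  have "perm_iso M n (\<lambda>j. if \<sigma> (Suc j) < \<sigma> 0 then \<sigma> (Suc j) else \<sigma> (Suc j) - 1) Ys = adj_iso M Ys k"
   using Suc.prems X Suc s by (intro Suc.IH) auto
  then show ?thesis using X Suc s Suc.prems by (simp add: remove_nth_def)
 qed
qed simp

text \<open>Invariance under the symmetric group may be tested on adjacent transpositions: every
 permutation isomorphism is by construction a composite of such interchanges.\<close>

lemma swap_path_invariant:
 assumes "swap_path ob w t w'" "\<And>x. ob x\<in>Obj M" "\<And>w. length w = n ==> a w\<in>Arr M \<and> Dom M (a w) = TL (map ob w)"
  "\<And>w i. length w = n ==> Suc i < n ==> a (swap_at i w)\<cdot>adj_iso M (map ob w) i = a w"
  "length w = n"
 shows "a w'\<cdot>t = a w"
 using assms(1,5)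
proof induction
 case (refl w)
 then show ?case using assms(2,3) by auto
next
 case (step w t w' i)
 note A = swap_path_arr[OF step(1) assms(2)]
 have "a (swap_at i w')\<cdot>(adj_iso M (map ob w') i\<cdot>t) = (a (swap_at i w')\<cdot>adj_iso M (map ob w') i)\<cdot>t"
  using assms(2) assms(3)[of "swap_at i w'"] A step by (subst comp_assoc_right) (auto simp: image_subset_iff map_swap_at)
 also have "... = a w'\<cdot>t" using assms(4)[of w' i] step A by simp
 finally show ?case using step by simp
qed

lemma power_action_iff:
 assumes [simp]: "X\<in>Obj M" and a: "a\<in>Arr M" "Dom M a = tensor_power M X n"
 shows "(\<forall>g\<in>power_action M X n. a\<cdot>g = a) \<longleftrightarrow> (\<forall>i. Suc i < n --> a\<cdot>adj_iso M (replicate n X) i = a)"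
proof safe
 fix i assume inv: "\<forall>g\<in>power_action M X n. a\<cdot>g = a" and i: "Suc i < n"
 have "transpose i (Suc i) permutes {..<n}" using i by (intro permutes_swap_id) auto
 moreover have "perm_iso M n (transpose i (Suc i)) (replicate n X) = adj_iso M (replicate n X) i"
  using i by (intro perm_iso_transpose) auto
 ultimately show "a\<cdot>adj_iso M (replicate n X) i = a"
  using inv unfolding power_action_def by (metis (mono_tags, lifting) mem_Collect_eq)
next
 fix g assume adj: "\<forall>i. Suc i < n --> a\<cdot>adj_iso M (replicate n X) i = a" and "g\<in>power_action M X n"
 then obtain \<sigma> where \<sigma>: "\<sigma> permutes {..<n}" "g = perm_iso M n \<sigma> (replicate n X)"
  by (auto simp: power_action_def)
 have w: "w = replicate n ()" if "length w = n" for w using that by (simp add: list_eq_iff_nth_eq)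
 have "swap_path (\<lambda>_::unit. X) (replicate n ()) g (permute_list \<sigma> (replicate n ()))"
  using swap_path_permute[of "\<lambda>_::unit. X" \<sigma> n "replicate n ()"] \<sigma> by simp
 from swap_path_invariant[OF this, of n "\<lambda>_. a"] show "a\<cdot>g = a"
  using a adj w by (simp add: map_replicate_const)
qed

lemma power_action_hom:
 assumes "X\<in>Obj M" shows "power_action M X n \<subseteq> Hom M (tensor_power M X n) (tensor_power M X n)"
proof
 fix g assume "g\<in>power_action M X n"
 then obtain \<sigma> where \<sigma>: "\<sigma> permutes {..<n}" "g = perm_iso M n \<sigma> (replicate n X)"
  by (auto simp: power_action_def)
 have "swap_path (\<lambda>_::unit. X) (replicate n ()) g (permute_list \<sigma> (replicate n ()))"
  using swap_path_permute[of "\<lambda>_::unit. X" \<sigma> n "replicate n ()"] \<sigma> assms by simp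
 from swap_path_arr[OF this] assms show "g\<in>Hom M (tensor_power M X n) (tensor_power M X n)"
  by (simp add: map_replicate_const)
qed

lemma append_iso_arr [simp]:
 assumes "set Xs \<subseteq> Obj M" "set Ys \<subseteq> Obj M"
 shows "append_iso M Xs Ys\<in>Arr M" "Dom M (append_iso M Xs Ys) = TL Xs\<otimes>TL Ys"
  "Cod M (append_iso M Xs Ys) = TL (Xs @ Ys)" "is_iso M (append_iso M Xs Ys)"
 using assms(1) by (induction Xs) (use assms(2) in auto)

lemma append_iso_assoc:
 assumes "set Xs \<subseteq> Obj M" "set Ys \<subseteq> Obj M" "set Zs \<subseteq> Obj M"
 shows "append_iso M (Xs @ Ys) Zs\<cdot>(append_iso M Xs Ys\<lhd>TL Zs) =
  append_iso M Xs (Ys @ Zs)\<cdot>((TL Xs\<rhd>append_iso M Ys Zs)\<cdot>\<alpha> (TL Xs) (TL Ys) (TL Zs))"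
 using assms(1)
proof (induction Xs)
 case Nil
 have "append_iso M Ys Zs\<cdot>(\<ll> (TL Ys)\<lhd>TL Zs) =
   append_iso M Ys Zs\<cdot>(\<ll> (TL Ys\<otimes>TL Zs)\<cdot>\<alpha> \<one> (TL Ys) (TL Zs))"
  using assms by (subst lunit_tensor) auto
 then show ?case using assms by simp
next
 case (Cons X Xs)
 let ?x = "TL Xs" and ?y = "TL Ys" and ?z = "TL Zs"
 have [simp]: "X\<in>Obj M" "?x\<in>Obj M" "?y\<in>Obj M" "?z\<in>Obj M" "set Xs \<subseteq> Obj M"
  "set Ys \<subseteq> Obj M" "set Zs \<subseteq> Obj M" "TL (Xs @ Ys)\<in>Obj M"
  using Cons assms by auto
 have "append_iso M ((X # Xs) @ Ys) Zs\<cdot>(append_iso M (X # Xs) Ys\<lhd>?z) =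
   (X\<rhd>append_iso M (Xs @ Ys) Zs)\<cdot>(\<alpha> X (TL (Xs @ Ys)) ?z \<cdot>
    (((X\<rhd>append_iso M Xs Ys)\<lhd>?z)\<cdot>(\<alpha> X ?x ?y\<lhd>?z)))" by simp
 also have "... = (X\<rhd>(append_iso M (Xs @ Ys) Zs\<cdot>(append_iso M Xs Ys\<lhd>?z))) \<cdot>
   (\<alpha> X (?x\<otimes>?y) ?z\<cdot>(\<alpha> X ?x ?y\<lhd>?z))"
  by (subst assoc_nat_reassoc) auto
 also have "... = (X\<rhd>(append_iso M Xs (Ys @ Zs)\<cdot>(?x\<rhd>append_iso M Ys Zs))) \<cdot>
   ((X\<rhd>\<alpha> ?x ?y ?z)\<cdot>(\<alpha> X (?x\<otimes>?y) ?z\<cdot>(\<alpha> X ?x ?y\<lhd>?z)))"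
  using Cons by simp
 also have "... = (X\<rhd>(append_iso M Xs (Ys @ Zs)\<cdot>(?x\<rhd>append_iso M Ys Zs))) \<cdot>
   (\<alpha> X ?x (?y\<otimes>?z)\<cdot>\<alpha> (X\<otimes>?x) ?y ?z)" by (subst pentagon3) auto
 also have "... = append_iso M (X # Xs) (Ys @ Zs)\<cdot>(((TL (X # Xs))\<rhd>append_iso M Ys Zs) \<cdot>
   \<alpha> (TL (X # Xs)) ?y ?z)" by simp
 finally show ?case .
qed

lemma append_iso_Nil:
 assumes "set Xs \<subseteq> Obj M" shows "append_iso M Xs [] = \<rr> (TL Xs)"
 using assms by (induction Xs) (auto simp: lunit_unit runit_tensor)

text \<open>In the base case the pentagon rebrackets the word before and after the braiding of the first two letters.\<close>

lemma append_iso_adj_left: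
 assumes "set Xs \<subseteq> Obj M" "set Ys \<subseteq> Obj M" "Suc i < length Xs"
 shows "append_iso M (swap_at i Xs) Ys\<cdot>(adj_iso M Xs i\<lhd>TL Ys) =
  adj_iso M (Xs @ Ys) i\<cdot>append_iso M Xs Ys"
 using assms
proof (induction i Xs rule: swap_at.induct)
 case (1 X Y Xs)
 let ?x = "TL Xs" and ?y = "TL Ys" and ?a = "append_iso M Xs Ys"
 have [simp]: "X\<in>Obj M" "Y\<in>Obj M" "set Xs \<subseteq> Obj M" "?x\<in>Obj M" "?y\<in>Obj M" "TL (Xs @ Ys)\<in>Obj M"
  "set Ys \<subseteq> Obj M"
  using 1 by auto
 let ?m = "(Y\<rhd>(X\<rhd>?a))\<cdot>((Y\<rhd>\<alpha> X ?x ?y)\<cdot>(\<alpha> Y (X\<otimes>?x) ?y\<cdot>((\<alpha> Y X ?x\<lhd>?y) \<cdot>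
   (((\<beta> X Y\<lhd>?x)\<cdot>\<alpha>\<^sup>- X Y ?x)\<lhd>?y))))"
 have "adj_iso M ((X # Y # Xs) @ Ys) 0\<cdot>append_iso M (X # Y # Xs) Ys = exchange M X Y (TL (Xs @ Ys)) \<cdot>
   ((X\<rhd>(Y\<rhd>?a))\<cdot>((X\<rhd>\<alpha> Y ?x ?y)\<cdot>\<alpha> X (Y\<otimes>?x) ?y))" by simp
 also have "... = (Y\<rhd>(X\<rhd>?a))\<cdot>(exchange M X Y (?x\<otimes>?y) \<cdot>
   ((X\<rhd>\<alpha> Y ?x ?y)\<cdot>(\<alpha> X (Y\<otimes>?x) ?y\<cdot>((\<alpha> X Y ?x\<lhd>?y)\<cdot>(\<alpha>\<^sup>- X Y ?x\<lhd>?y)))))"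
  by (subst exchange_nat_reassoc) auto
 also have "... = (Y\<rhd>(X\<rhd>?a))\<cdot>(exchange M X Y (?x\<otimes>?y) \<cdot>
   (\<alpha> X Y (?x\<otimes>?y)\<cdot>(\<alpha> (X\<otimes>Y) ?x ?y\<cdot>(\<alpha>\<^sup>- X Y ?x\<lhd>?y))))"
  by (subst pentagon3_reassoc) auto
 also have "... = (Y\<rhd>(X\<rhd>?a))\<cdot>(\<alpha> Y X (?x\<otimes>?y)\<cdot>((\<beta> X Y\<lhd>(?x\<otimes>?y)) \<cdot>
   (\<alpha> (X\<otimes>Y) ?x ?y\<cdot>(\<alpha>\<^sup>- X Y ?x\<lhd>?y))))" by (simp add: exchange_def)
 also have "... = (Y\<rhd>(X\<rhd>?a))\<cdot>(\<alpha> Y X (?x\<otimes>?y)\<cdot>(\<alpha> (Y\<otimes>X) ?x ?y \<cdot>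
   (((\<beta> X Y\<lhd>?x)\<lhd>?y)\<cdot>(\<alpha>\<^sup>- X Y ?x\<lhd>?y))))"
  by (subst assoc_nat_reassoc) auto
 also have "... = (Y\<rhd>(X\<rhd>?a))\<cdot>(\<alpha> Y X (?x\<otimes>?y)\<cdot>(\<alpha> (Y\<otimes>X) ?x ?y \<cdot>
   (((\<beta> X Y\<lhd>?x)\<cdot>\<alpha>\<^sup>- X Y ?x)\<lhd>?y)))" by simp
 also have "... = ?m" by (subst pentagon3_reassoc) auto
 also have "?m = (Y\<rhd>(X\<rhd>?a))\<cdot>((Y\<rhd>\<alpha> X ?x ?y)\<cdot>(\<alpha> Y (X\<otimes>?x) ?y\<cdot>(exchange M X Y ?x\<lhd>?y)))"
  by (simp add: exchange_def)
 finally show ?case by simp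
next
 case (2 i X Xs)
 let ?y = "TL Ys"
 have [simp]: "X\<in>Obj M" "set Xs \<subseteq> Obj M" "set Ys \<subseteq> Obj M" using 2 by auto
 have l: "Suc i < length Xs" using 2 by auto
 have "append_iso M (swap_at (Suc i) (X # Xs)) Ys\<cdot>(adj_iso M (X # Xs) (Suc i)\<lhd>?y) =
   (X\<rhd>(append_iso M (swap_at i Xs) Ys\<cdot>(adj_iso M Xs i\<lhd>?y)))\<cdot>\<alpha> X (TL Xs) ?y"
  using l by simp
 then show ?case using 2 l by simp
qed auto

lemma append_iso_adj_right:
 assumes "set Xs \<subseteq> Obj M" "set Ys \<subseteq> Obj M" "Suc i < length Ys"
 shows "append_iso M Xs (swap_at i Ys)\<cdot>(TL Xs\<rhd>adj_iso M Ys i) =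
  adj_iso M (Xs @ Ys) (length Xs + i)\<cdot>append_iso M Xs Ys"
 using assms(1)
proof (induction Xs)
 case (Cons X Xs)
 then have "append_iso M (X # Xs) (swap_at i Ys)\<cdot>((TL (X # Xs))\<rhd>adj_iso M Ys i) =
   (X\<rhd>(append_iso M Xs (swap_at i Ys)\<cdot>(TL Xs\<rhd>adj_iso M Ys i)))\<cdot>\<alpha> X (TL Xs) (TL Ys)"
  using assms by simp
 then show ?case using Cons assms by simp
qed (use assms in auto)

text \<open>Moving one factor past a block, and one block past another, is a composite of adjacent
 interchanges. This is what makes the multiplication of the free commutative monoid commutative.\<close>

lemma append_iso_exchange:
 assumes ob [simp]: "\<And>x. ob x\<in>Obj M"
 shows "\<exists>t. swap_path ob (x # v @ u) t (v @ x # u) \<and>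
  append_iso M (map ob v) (map ob (x # u))\<cdot>exchange M (ob x) (TL (map ob v)) (TL (map ob u)) =
  t\<cdot>(ob x\<rhd>append_iso M (map ob v) (map ob u))"
proof (induction v)
 case Nil
 have "set (map ob u) \<subseteq> Obj M" by auto
 then show ?case
  by (intro exI[of _ "\<i>\<d> (TL (map ob (x # u)))"])
   (use swap_path.refl[of ob "x # u"] in \<open>auto simp: lunit_exchange\<close>)
next
 case (Cons y v)
 then obtain t where t: "swap_path ob (x # v @ u) t (v @ x # u)"
  "append_iso M (map ob v) (map ob (x # u))\<cdot>exchange M (ob x) (TL (map ob v)) (TL (map ob u)) =
  t\<cdot>(ob x\<rhd>append_iso M (map ob v) (map ob u))" by blast
 let ?x = "ob x" and ?y = "ob y" and ?v = "TL (map ob v)" and ?u = "TL (map ob u)"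
 let ?a = "append_iso M (map ob v) (map ob u)" and ?b = "append_iso M (map ob v) (?x # map ob u)"
 have [simp]: "set (map ob w) \<subseteq> Obj M" "ob ` set w \<subseteq> Obj M" for w by auto
 have [simp]: "?v\<in>Obj M" "?u\<in>Obj M" "TL (map ob v @ map ob u)\<in>Obj M" "t\<in>Arr M"
  "Dom M t = ?x\<otimes>TL (map ob v @ map ob u)" "Cod M t = TL (map ob v @ ?x # map ob u)"
  using swap_path_arr[OF t(1)] by auto
 let ?e = "exchange M ?x ?y (TL (map ob v @ map ob u))"
 have "append_iso M (map ob (y # v)) (?x # map ob u)\<cdot>exchange M ?x (TL (map ob (y # v))) ?u =
   (?y\<rhd>?b)\<cdot>(\<alpha> ?y ?v (?x\<otimes>?u)\<cdot>exchange M ?x (?y\<otimes>?v) ?u)" by simp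
 also have "... = (?y\<rhd>(?b\<cdot>exchange M ?x ?v ?u))\<cdot>(exchange M ?x ?y (?v\<otimes>?u)\<cdot>(?x\<rhd>\<alpha> ?y ?v ?u))"
  by (subst exchange_tensor_middle) auto
 also have "... = (?y\<rhd>t)\<cdot>((?y\<rhd>(?x\<rhd>?a))\<cdot>(exchange M ?x ?y (?v\<otimes>?u)\<cdot>(?x\<rhd>\<alpha> ?y ?v ?u)))"
  unfolding t(2)[simplified] by simp
 also have "... = ((?y\<rhd>t)\<cdot>?e)\<cdot>(?x\<rhd>append_iso M (map ob (y # v)) (map ob u))"
  using exchange_nat_reassoc[of "\<i>\<d> ?x" "\<i>\<d> ?y" ?a ?x ?y "TL (map ob v @ map ob u)" "?x\<rhd>\<alpha> ?y ?v ?u"] by simp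
 finally show ?case
  using swap_path_trans[OF swap_path_cons[OF t(1), of y] swap_path_exchange[of ob x y "v @ u"]]
  by auto
qed

lemma append_iso_braid:
 assumes ob [simp]: "\<And>x. ob x\<in>Obj M"
 shows "\<exists>t. swap_path ob (u @ v) t (v @ u) \<and>
  append_iso M (map ob v) (map ob u)\<cdot>\<beta> (TL (map ob u)) (TL (map ob v)) =
  t\<cdot>append_iso M (map ob u) (map ob v)"
proof (induction u)
 case Nil
 have "set (map ob v) \<subseteq> Obj M" by auto
 then show ?case
  by (intro exI[of _ "\<i>\<d> (TL (map ob v))"])
   (use swap_path.refl[of ob v] in \<open>auto simp: append_iso_Nil runit_braid\<close>)
next
 case (Cons x u)
 then obtain t where t: "swap_path ob (u @ v) t (v @ u)"
  "append_iso M (map ob v) (map ob u)\<cdot>\<beta> (TL (map ob u)) (TL (map ob v)) =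
  t\<cdot>append_iso M (map ob u) (map ob v)" by blast
 obtain t' where t': "swap_path ob (x # v @ u) t' (v @ x # u)"
  "append_iso M (map ob v) (map ob (x # u))\<cdot>exchange M (ob x) (TL (map ob v)) (TL (map ob u)) =
  t'\<cdot>(ob x\<rhd>append_iso M (map ob v) (map ob u))" using append_iso_exchange[of ob, OF ob] by blast
 let ?x = "ob x" and ?v = "TL (map ob v)" and ?u = "TL (map ob u)"
 let ?a = "append_iso M (map ob v) (map ob u)" and ?b = "append_iso M (map ob v) (?x # map ob u)"
 have [simp]: "set (map ob w) \<subseteq> Obj M" "ob ` set w \<subseteq> Obj M" for w by auto
 have [simp]: "?v\<in>Obj M" "?u\<in>Obj M" "t\<in>Arr M" "Dom M t = TL (map ob u @ map ob v)"
  "Cod M t = TL (map ob v @ map ob u)" "t'\<in>Arr M" "Dom M t' = ?x\<otimes>TL (map ob v @ map ob u)"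
  "Cod M t' = TL (map ob v @ ?x # map ob u)"
  using swap_path_arr[OF t(1)] swap_path_arr[OF t'(1)] by auto
 have "?b\<cdot>\<beta> (?x\<otimes>?u) ?v = (?b\<cdot>exchange M ?x ?v ?u)\<cdot>((?x\<rhd>\<beta> ?u ?v)\<cdot>\<alpha> ?x ?u ?v)"
  by (simp add: braid_tensor_left)
 also have "... = t'\<cdot>((?x\<rhd>(?a\<cdot>\<beta> ?u ?v))\<cdot>\<alpha> ?x ?u ?v)" unfolding t'(2)[simplified] by simp
 also have "... = (t'\<cdot>(?x\<rhd>t))\<cdot>append_iso M (map ob (x # u)) (map ob v)" unfolding t(2)[simplified] by simp
 finally show ?case
  using swap_path_trans[OF t'(1) swap_path_cons[OF t(1), of x]] by auto
qed

end

section \<open>Tensor products of presented objects\<close>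

context closed_symmetric_monoidal
begin

definition is_exponential :: "'o => 'o => 'o => 'm => bool" where
 "is_exponential X Y H ev \<longleftrightarrow> H\<in>Obj M \<and> ev\<in>Hom M (H\<otimes>X) Y \<and>
   (\<forall>Z\<in>Obj M. \<forall>f\<in>Hom M (Z\<otimes>X) Y. \<exists>!g. g\<in>Hom M Z H \<and> ev\<cdot>(g\<lhd>X) = f)"

lemma exponential_exists:
 assumes "X\<in>Obj M" "Y\<in>Obj M" obtains H ev where "is_exponential X Y H ev"
 using closed[OF assms] unfolding is_exponential_def by blast

lemma exponential_arr:
 assumes "is_exponential X Y H ev"
 shows "H\<in>Obj M" "ev\<in>Arr M" "Dom M ev = H\<otimes>X" "Cod M ev = Y"
 using assms unfolding is_exponential_def by auto

lemma exponential_curry: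
 assumes "is_exponential X Y H ev" "f\<in>Arr M" "Z\<in>Obj M" "Dom M f = Z\<otimes>X" "Cod M f = Y"
 shows "\<exists>g. g\<in>Arr M \<and> Dom M g = Z \<and> Cod M g = H \<and> ev\<cdot>(g\<lhd>X) = f"
proof -
 have "f\<in>Hom M (Z\<otimes>X) Y" using assms by simp
 then obtain g where "g\<in>Hom M Z H" "ev\<cdot>(g\<lhd>X) = f"
  using assms(1,3) unfolding is_exponential_def by blast
 then show ?thesis by auto
qed

text \<open>Currying is injective; together with \<open>exponential_curry\<close> this is the adjunction between \<open>\<otimes> X\<close> and
 the internal hom.\<close>

lemma exponential_unique:
 assumes "is_exponential X Y H ev" "g\<in>Arr M" "g'\<in>Arr M" "Dom M g = Z" "Dom M g' = Z"
  "Cod M g = H" "Cod M g' = H" "ev\<cdot>(g\<lhd>X) = ev\<cdot>(g'\<lhd>X)" "X\<in>Obj M"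
 shows "g = g'"
proof -
 note E = exponential_arr[OF assms(1)]
 have Z: "Z\<in>Obj M" using assms(2,4) dom_obj by blast
 have h: "ev\<cdot>(g\<lhd>X)\<in>Hom M (Z\<otimes>X) Y" using assms E by auto
 have "\<exists>!k. k\<in>Hom M Z H \<and> ev\<cdot>(k\<lhd>X) = ev\<cdot>(g\<lhd>X)"
  using assms(1) Z h unfolding is_exponential_def by blast
 moreover have "g\<in>Hom M Z H" "g'\<in>Hom M Z H" using assms by auto
 ultimately show ?thesis using assms(8) by metis
qed

text \<open>Arrows out of \<open>c\<otimes>B\<close> are curried to arrows out of \<open>c\<close>.\<close>

lemma jointly_epic_tensor_right:
 assumes e: "jointly_epic T c \<iota>" and \<iota>: "\<And>i. i\<in>T ==> \<iota> i\<in>Arr M \<and> Cod M (\<iota> i) = c"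
  and B: "B\<in>Obj M" and c: "c\<in>Obj M"
 shows "jointly_epic T (c\<otimes>B) (\<lambda>i. \<iota> i\<lhd>B)"
 unfolding jointly_epic_def
proof safe
 fix f g assume fg: "f\<in>Arr M" "g\<in>Arr M" "Dom M f = c\<otimes>B" "Dom M g = c\<otimes>B" "Cod M f = Cod M g"
  and eq: "\<forall>i\<in>T. f\<cdot>(\<iota> i\<lhd>B) = g\<cdot>(\<iota> i\<lhd>B)"
 have Y: "Cod M f\<in>Obj M" using fg by auto
 obtain H ev where E: "is_exponential B (Cod M f) H ev" using exponential_exists[OF B Y] .
 note H = exponential_arr[OF E] and ex = exponential_curry[OF E] and un = exponential_unique[OF E _ _ _ _ _ _ _ B]
 obtain f' where f': "f'\<in>Arr M" "Dom M f' = c" "Cod M f' = H" "ev\<cdot>(f'\<lhd>B) = f"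
  using ex[of f c] fg c by auto
 obtain g' where g': "g'\<in>Arr M" "Dom M g' = c" "Cod M g' = H" "ev\<cdot>(g'\<lhd>B) = g"
  using ex[of g c] fg c by auto
 have "f'\<cdot>\<iota> i = g'\<cdot>\<iota> i" if i: "i\<in>T" for i
 proof (rule un)
  have "(ev\<cdot>(f'\<lhd>B))\<cdot>(\<iota> i\<lhd>B) = (ev\<cdot>(g'\<lhd>B))\<cdot>(\<iota> i\<lhd>B)"
   using f'(4) g'(4) eq i by simp
  then show "ev\<cdot>((f'\<cdot>\<iota> i)\<lhd>B) = ev\<cdot>((g'\<cdot>\<iota> i)\<lhd>B)"
   using f'(1-3) g'(1-3) H \<iota>[OF i] B by simp
 qed (use \<iota>[OF i] f' g' in auto)
 then have "f' = g'" using f' g' by - (rule jointly_epicD[OF e], auto)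
 then show "f = g" using f' g' by simp
qed

lemma jointly_epic_tensor_left:
 assumes e: "jointly_epic T c \<iota>" and \<iota>: "\<And>i. i\<in>T ==> \<iota> i\<in>Arr M \<and> Cod M (\<iota> i) = c"
  and B: "B\<in>Obj M" and c: "c\<in>Obj M"
 shows "jointly_epic T (B\<otimes>c) (\<lambda>i. B\<rhd>\<iota> i)"
 unfolding jointly_epic_def
proof safe
 fix f g assume fg: "f\<in>Arr M" "g\<in>Arr M" "Dom M f = B\<otimes>c" "Dom M g = B\<otimes>c" "Cod M f = Cod M g"
  and eq: "\<forall>i\<in>T. f\<cdot>(B\<rhd>\<iota> i) = g\<cdot>(B\<rhd>\<iota> i)"
 have "f\<cdot>\<beta> c B = g\<cdot>\<beta> c B"
 proof (rule jointly_epicD[OF jointly_epic_tensor_right[OF assms]])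
  fix i assume i: "i\<in>T"
  have "(f\<cdot>(B\<rhd>\<iota> i))\<cdot>\<beta> (Dom M (\<iota> i)) B = (g\<cdot>(B\<rhd>\<iota> i))\<cdot>\<beta> (Dom M (\<iota> i)) B"
   using eq i by simp
  then show "f\<cdot>\<beta> c B\<cdot>(\<iota> i\<lhd>B) = g\<cdot>\<beta> c B\<cdot>(\<iota> i\<lhd>B)"
   using \<iota>[OF i] fg B c by simp
 qed (use fg B c in auto)
 then show "f = g" using fg B c by - (rule iso_cancel_right[of f "\<beta> c B"], auto)
qed

lemma jointly_epic_tensor:
 assumes "jointly_epic T c \<iota>" and \<iota>: "\<And>i. i\<in>T ==> \<iota> i\<in>Arr M \<and> Cod M (\<iota> i) = c"
  and "jointly_epic T' c' \<iota>'" and \<iota>': "\<And>i. i\<in>T' ==> \<iota>' i\<in>Arr M \<and> Cod M (\<iota>' i) = c'"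
  and c: "c\<in>Obj M" "c'\<in>Obj M"
 shows "jointly_epic (T \<times> T') (c\<otimes>c') (\<lambda>(i, j). \<iota> i\<odot>\<iota>' j)"
proof -
 have "jointly_epic (SIGMA i:T. T') (c\<otimes>c') (\<lambda>(i, j). (\<iota> i\<lhd>c')\<cdot>((Dom M (\<iota> i))\<rhd>\<iota>' j))"
  using assms
  by (intro jointly_epic_comp[of T "c\<otimes>c'" "\<lambda>i. \<iota> i\<lhd>c'" "\<lambda>_. T'" "\<lambda>i j. (Dom M (\<iota> i))\<rhd>\<iota>' j"])
   (auto intro: jointly_epic_tensor_right jointly_epic_tensor_left)
 moreover have "(\<iota> i\<lhd>c')\<cdot>((Dom M (\<iota> i))\<rhd>\<iota>' j) = \<iota> i\<odot>\<iota>' j" if "i\<in>T" "j\<in>T'" for i j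
  using \<iota>[OF that(1)] \<iota>'[OF that(2)] c by simp
 ultimately show ?thesis unfolding jointly_epic_def by auto
qed

text \<open>A left adjoint preserves presentations: a cocone on the \<open>F i\<otimes>B\<close> is curried, glued, and uncurried.\<close>

lemma is_glue_tensor_right:
 assumes g: "is_glue M T F Rel c \<iota>" and wf: "glue_relations M T F Rel" and B: "B\<in>Obj M"
 shows "is_glue M T (\<lambda>i. F i\<otimes>B) ((\<lambda>(i, a, j, b). (i, a\<lhd>B, j, b\<lhd>B)) ` Rel) (c\<otimes>B) (\<lambda>i. \<iota> i\<lhd>B)"
proof (rule is_glueI)
 note G = is_glue_hom[OF g]
 note W = glue_relationsD[OF wf]
 show "c\<otimes>B\<in>Obj M" using G B by simp
 show "\<iota> i\<lhd>B\<in>Hom M (F i\<otimes>B) (c\<otimes>B)" if "i\<in>T" for i using G(1-3)[OF that] B by simp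
 show "jointly_epic T (c\<otimes>B) (\<lambda>i. \<iota> i\<lhd>B)"
  using jointly_epic_tensor_right[OF is_glue_epic[OF g wf]] G B by simp
 fix i a j b assume "(i, a, j, b)\<in>(\<lambda>(i, a, j, b). (i, a\<lhd>B, j, b\<lhd>B)) ` Rel"
 then obtain a' b' where r: "(i, a', j, b')\<in>Rel" "a = a'\<lhd>B" "b = b'\<lhd>B" by auto
 show "(\<iota> i\<lhd>B)\<cdot>a = (\<iota> j\<lhd>B)\<cdot>b"
  using W[OF r(1)] G(1-3)[of i] G(1-3)[of j] r(2,3) B is_glue_rel[OF g r(1)] by simp
next
 fix Z \<kappa>
 note G = is_glue_hom[OF g]
 note W = glue_relationsD[OF wf]
 assume co: "glue_cocone M T (\<lambda>i. F i\<otimes>B) ((\<lambda>(i, a, j, b). (i, a\<lhd>B, j, b\<lhd>B)) ` Rel) Z \<kappa>"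
 then have Z: "Z\<in>Obj M" and \<kappa>: "\<And>i. i\<in>T ==> \<kappa> i\<in>Arr M \<and> Dom M (\<kappa> i) = F i\<otimes>B \<and> Cod M (\<kappa> i) = Z"
  unfolding glue_cocone_def by auto
 have rel: "\<kappa> i\<cdot>(a\<lhd>B) = \<kappa> j\<cdot>(b\<lhd>B)" if "(i, a, j, b)\<in>Rel" for i a j b
  using co that unfolding glue_cocone_def by fastforce
 have F: "F i\<in>Obj M" if "i\<in>T" for i using wf that unfolding glue_relations_def by auto
 obtain H ev where E: "is_exponential B Z H ev" using exponential_exists[OF B Z] .
 note H = exponential_arr[OF E] and ex = exponential_curry[OF E] and un = exponential_unique[OF E _ _ _ _ _ _ _ B]
 have "\<exists>g. g\<in>Arr M \<and> Dom M g = F i \<and> Cod M g = H \<and> ev\<cdot>(g\<lhd>B) = \<kappa> i" if "i\<in>T" for i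
  using ex \<kappa>[OF that] F[OF that] by blast
 then obtain t where t: "\<And>i. i\<in>T ==> t i\<in>Arr M \<and> Dom M (t i) = F i \<and> Cod M (t i) = H \<and> ev\<cdot>(t i\<lhd>B) = \<kappa> i"
  by metis
 obtain u where u: "u\<in>Arr M" "Dom M u = c" "Cod M u = H" "\<And>i. i\<in>T ==> u\<cdot>\<iota> i = t i"
 proof (rule is_glue_ex[OF g H(1), of t])
  fix i a j b assume r: "(i, a, j, b)\<in>Rel"
  note w = W[OF r]
  have tt: "t i\<in>Arr M \<and> Dom M (t i) = F i \<and> Cod M (t i) = H" if "i\<in>T" for i using t[OF that] by blast
  have "(ev\<cdot>(t i\<lhd>B))\<cdot>(a\<lhd>B) = (ev\<cdot>(t j\<lhd>B))\<cdot>(b\<lhd>B)"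
   using rel[OF r] t w by simp
  then have "ev\<cdot>((t i\<cdot>a)\<lhd>B) = ev\<cdot>((t j\<cdot>b)\<lhd>B)"
   using tt[of i] tt[of j] w H B by simp
  then show "t i\<cdot>a = t j\<cdot>b"
   using tt[of i] tt[of j] w by - (rule un[of _ _ "Dom M a"], auto)
 qed (use t in auto)
 have "(ev\<cdot>(u\<lhd>B))\<cdot>(\<iota> i\<lhd>B) = \<kappa> i" if "i\<in>T" for i
 proof -
  have "(ev\<cdot>(u\<lhd>B))\<cdot>(\<iota> i\<lhd>B) = ev\<cdot>((u\<cdot>\<iota> i)\<lhd>B)"
   using u(1-3) H B G(1-3)[OF that] by simp
  then show ?thesis using u(4)[OF that] t[OF that] by simp
 qed
 then show "\<exists>v. v\<in>Hom M (c\<otimes>B) Z \<and> (\<forall>i\<in>T. v\<cdot>(\<iota> i\<lhd>B) = \<kappa> i)"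
  using u H B by (intro exI[of _ "ev\<cdot>(u\<lhd>B)"]) auto
qed

lemma is_glue_tensor_left:
 assumes g: "is_glue M T F Rel c \<iota>" and wf: "glue_relations M T F Rel" and B: "B\<in>Obj M"
 shows "is_glue M T (\<lambda>i. B\<otimes>F i) ((\<lambda>(i, a, j, b). (i, B\<rhd>a, j, B\<rhd>b)) ` Rel) (B\<otimes>c) (\<lambda>i. B\<rhd>\<iota> i)"
proof (rule is_glueI)
 note G = is_glue_hom[OF g]
 note W = glue_relationsD[OF wf]
 show "B\<otimes>c\<in>Obj M" using G B by simp
 show "B\<rhd>\<iota> i\<in>Hom M (B\<otimes>F i) (B\<otimes>c)" if "i\<in>T" for i using G(1-3)[OF that] B by simp
 show "jointly_epic T (B\<otimes>c) (\<lambda>i. B\<rhd>\<iota> i)"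
  using jointly_epic_tensor_left[OF is_glue_epic[OF g wf]] G B by simp
 fix i a j b assume "(i, a, j, b)\<in>(\<lambda>(i, a, j, b). (i, B\<rhd>a, j, B\<rhd>b)) ` Rel"
 then obtain a' b' where r: "(i, a', j, b')\<in>Rel" "a = B\<rhd>a'" "b = B\<rhd>b'" by auto
 show "(B\<rhd>\<iota> i)\<cdot>a = (B\<rhd>\<iota> j)\<cdot>b"
  using W[OF r(1)] G(1-3)[of i] G(1-3)[of j] r(2,3) B is_glue_rel[OF g r(1)] by simp
next
 fix Z \<kappa>
 note G = is_glue_hom[OF g]
 note W = glue_relationsD[OF wf]
 assume co: "glue_cocone M T (\<lambda>i. B\<otimes>F i) ((\<lambda>(i, a, j, b). (i, B\<rhd>a, j, B\<rhd>b)) ` Rel) Z \<kappa>"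
 then have Z: "Z\<in>Obj M" and \<kappa>: "\<And>i. i\<in>T ==> \<kappa> i\<in>Arr M \<and> Dom M (\<kappa> i) = B\<otimes>F i \<and> Cod M (\<kappa> i) = Z"
  unfolding glue_cocone_def by auto
 have rel: "\<kappa> i\<cdot>(B\<rhd>a) = \<kappa> j\<cdot>(B\<rhd>b)" if "(i, a, j, b)\<in>Rel" for i a j b
  using co that unfolding glue_cocone_def by fastforce
 have F: "F i\<in>Obj M" if "i\<in>T" for i using wf that unfolding glue_relations_def by auto
 obtain u where u: "u\<in>Arr M" "Dom M u = c\<otimes>B" "Cod M u = Z"
  "\<And>i. i\<in>T ==> u\<cdot>(\<iota> i\<lhd>B) = \<kappa> i\<cdot>\<beta> (F i) B"
 proof (rule is_glue_ex[OF is_glue_tensor_right[OF g wf B] Z, of "\<lambda>i. \<kappa> i\<cdot>\<beta> (F i) B"])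
  fix i a j b assume "(i, a, j, b)\<in>(\<lambda>(i, a, j, b). (i, a\<lhd>B, j, b\<lhd>B)) ` Rel"
  then obtain a' b' where r: "(i, a', j, b')\<in>Rel" "a = a'\<lhd>B" "b = b'\<lhd>B" by auto
  note w = W[OF r(1)]
  have "(\<kappa> i\<cdot>(B\<rhd>a'))\<cdot>\<beta> (Dom M a') B = (\<kappa> j\<cdot>(B\<rhd>b'))\<cdot>\<beta> (Dom M a') B"
   using rel[OF r(1)] by simp
  then show "\<kappa> i\<cdot>\<beta> (F i) B\<cdot>a = \<kappa> j\<cdot>\<beta> (F j) B\<cdot>b"
   using w \<kappa>[of i] \<kappa>[of j] B F[of i] F[of j] r(2,3) dom_obj[of a'] by auto
 qed (use \<kappa> B F in auto)
 have "(u\<cdot>\<beta> B c)\<cdot>(B\<rhd>\<iota> i) = \<kappa> i" if "i\<in>T" for i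
 proof -
  have "(u\<cdot>\<beta> B c)\<cdot>(B\<rhd>\<iota> i) = (u\<cdot>(\<iota> i\<lhd>B))\<cdot>\<beta> B (F i)"
   using u(1-3) B G(1-3)[OF that] G(4) F[OF that] by simp
  then show ?thesis using u(4)[OF that] \<kappa>[OF that] B F[OF that] by simp
 qed
 then show "\<exists>v. v\<in>Hom M (B\<otimes>c) Z \<and> (\<forall>i\<in>T. v\<cdot>(B\<rhd>\<iota> i) = \<kappa> i)"
  using u B G(4) by (intro exI[of _ "u\<cdot>\<beta> B c"]) auto
qed

text \<open>An arrow out of \<open>c\<otimes>c'\<close> is glued first in the second variable for every generator of \<open>c\<close>, then in the
 first variable.\<close>

lemma is_glue_tensor_ex:
 assumes g: "is_glue M T F Rel c \<iota>" "glue_relations M T F Rel"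
  and g': "is_glue M T' F' Rel' c' \<iota>'" "glue_relations M T' F' Rel'"
  and Z: "Z\<in>Obj M" and \<kappa>: "\<And>i j. i\<in>T ==> j\<in>T' ==> \<kappa> i j\<in>Hom M (F i\<otimes>F' j) Z"
  and rel: "\<And>i a j b k. (i, a, j, b)\<in>Rel ==> k\<in>T' ==> \<kappa> i k\<cdot>(a\<lhd>F' k) = \<kappa> j k\<cdot>(b\<lhd>F' k)"
  and rel': "\<And>i a j b k. (i, a, j, b)\<in>Rel' ==> k\<in>T ==> \<kappa> k i\<cdot>(F k\<rhd>a) = \<kappa> k j\<cdot>(F k\<rhd>b)"
 obtains u where "u\<in>Arr M" "Dom M u = c\<otimes>c'" "Cod M u = Z"
  "\<And>i j. i\<in>T ==> j\<in>T' ==> u\<cdot>(\<iota> i\<odot>\<iota>' j) = \<kappa> i j"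
proof -
 note G = is_glue_hom[OF g(1)] and G' = is_glue_hom[OF g'(1)]
 have F: "F i\<in>Obj M" if "i\<in>T" for i using g(2) that unfolding glue_relations_def by auto
 have F': "F' i\<in>Obj M" if "i\<in>T'" for i using g'(2) that unfolding glue_relations_def by auto
 have W: "i\<in>T \<and> j\<in>T \<and> a\<in>Arr M \<and> b\<in>Arr M \<and> Dom M a = Dom M b \<and> Cod M a = F i \<and> Cod M b = F j"
  if "(i, a, j, b)\<in>Rel" for i a j b using g(2) that unfolding glue_relations_def by auto
 have "\<exists>v. v\<in>Arr M \<and> Dom M v = F i\<otimes>c' \<and> Cod M v = Z \<and> (\<forall>j\<in>T'. v\<cdot>(F i\<rhd>\<iota>' j) = \<kappa> i j)"
  if i: "i\<in>T" for i
 proof -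
  obtain v where "v\<in>Arr M" "Dom M v = F i\<otimes>c'" "Cod M v = Z" "\<And>j. j\<in>T' ==> v\<cdot>(F i\<rhd>\<iota>' j) = \<kappa> i j"
   by (rule is_glue_ex[OF is_glue_tensor_left[OF g' F[OF i]] Z, of "\<kappa> i"])
    (use \<kappa>[OF i] rel'[OF _ i] in auto)
  then show ?thesis by blast
 qed
 then obtain v where v: "\<And>i. i\<in>T ==> v i\<in>Arr M \<and> Dom M (v i) = F i\<otimes>c' \<and> Cod M (v i) = Z"
  "\<And>i j. i\<in>T ==> j\<in>T' ==> v i\<cdot>(F i\<rhd>\<iota>' j) = \<kappa> i j" by metis
 obtain u where u: "u\<in>Arr M" "Dom M u = c\<otimes>c'" "Cod M u = Z" "\<And>i. i\<in>T ==> u\<cdot>(\<iota> i\<lhd>c') = v i"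
 proof (rule is_glue_ex[OF is_glue_tensor_right[OF g G'(4)] Z, of v])
  fix i a j b assume "(i, a, j, b)\<in>(\<lambda>(i, a, j, b). (i, a\<lhd>c', j, b\<lhd>c')) ` Rel"
  then obtain a' b' where r: "(i, a', j, b')\<in>Rel" "a = a'\<lhd>c'" "b = b'\<lhd>c'" by auto
  note w = W[OF r(1)]
  have e: "jointly_epic T' (Dom M a'\<otimes>c') (\<lambda>k. Dom M a'\<rhd>\<iota>' k)"
   using is_glue_epic[OF g'] G' w by (intro jointly_epic_tensor_left) auto
  show "v i\<cdot>a = v j\<cdot>b"
  proof (rule jointly_epicD[OF e])
   fix k assume k: "k\<in>T'"
   have "(v i\<cdot>(F i\<rhd>\<iota>' k))\<cdot>(a'\<lhd>F' k) = (v j\<cdot>(F j\<rhd>\<iota>' k))\<cdot>(b'\<lhd>F' k)"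
    using v(2) w k rel[OF r(1) k] by simp
   then show "v i\<cdot>a\<cdot>(Dom M a'\<rhd>\<iota>' k) = v j\<cdot>b\<cdot>(Dom M a'\<rhd>\<iota>' k)"
    using v(1)[of i] v(1)[of j] w r(2,3) G'(1-3)[OF k] G'(4) F[of i] F[of j] F'[OF k] dom_obj[of a'] by auto
  qed (use v(1)[of i] v(1)[of j] w r(2,3) G'(4) in auto)
 qed (use v in auto)
 have "u\<cdot>(\<iota> i\<odot>\<iota>' j) = \<kappa> i j" if "i\<in>T" "j\<in>T'" for i j
 proof -
  have "u\<cdot>(\<iota> i\<odot>\<iota>' j) = (u\<cdot>(\<iota> i\<lhd>c'))\<cdot>(F i\<rhd>\<iota>' j)"
   using u(1-3) G(1-3)[OF that(1)] G'(1-3)[OF that(2)] G(4) G'(4) F that by simp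
  then show ?thesis using u(4)[OF that(1)] v(2)[OF that] by simp
 qed
 then show ?thesis using that u by blast
qed

end

section \<open>Small sets and small colimits\<close>

lemma small_image: "small U A ==> small U (f ` A)"
 unfolding small_def using card_of_image ordLeq_ordLess_trans by blast

lemma small_subset: "small U B ==> A \<subseteq> B ==> small U A"
 unfolding small_def using card_of_mono1 ordLeq_ordLess_trans by blast

lemma inaccessible_infinite: "inaccessible U ==> infinite U"
 unfolding inaccessible_def using card_of_ordLeq_finite ordLess_imp_ordLeq infinite_UNIV_nat by blast

lemma small_nat: "inaccessible U ==> small U (A :: nat set)"
 by (rule small_subset[of U UNIV]) (auto simp: inaccessible_def small_def)

lemma small_countable: "inaccessible U ==> inj_on (f :: 'a => nat) A ==> small U A"
 using small_image[OF small_nat[of U "f ` A"], of "inv_into A f"] by simp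

lemma small_Plus: "inaccessible U ==> small U A ==> small U B ==> small U (A <+> B)"
 unfolding small_def using card_of_Plus_ordLess_infinite inaccessible_infinite by blast

lemma small_finite:
 fixes A :: "'a set"
 assumes "inaccessible U" "finite A" shows "small U A"
proof -
 obtain f :: "'a => nat" where "inj_on f A" using finite_imp_inj_to_nat_seg[OF assms(2)] by blast
 then show ?thesis by (rule small_countable[OF assms(1)])
qed

text \<open>Unless it is finite, the product embeds into the square of the disjoint union, which is not larger
 than the disjoint union itself.\<close>

lemma small_Times:
 assumes "inaccessible U" "small U A" "small U B" shows "small U (A \<times> B)"
proof (cases "finite (A <+> B)")
 case True
 then show ?thesis using small_finite[OF assms(1), of "A \<times> B"] by (simp add: finite_Plus_iff)
next
 case False
 let ?D = "A <+> B"
 have "small U (?D \<times> ?D)"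
  using small_Plus[OF assms] card_of_Times_same_infinite[OF False] ordIso_ordLess_trans
  unfolding small_def by blast
 then have "small U ((\<lambda>(x, y). (case x of Inl a => a, case y of Inr b => b)) ` (?D \<times> ?D))"
  by (rule small_image)
 moreover have "A \<times> B \<subseteq> (\<lambda>(x, y). (case x of Inl a => a, case y of Inr b => b)) ` (?D \<times> ?D)"
 proof
  fix p assume "p\<in>A \<times> B"
  then show "p\<in>(\<lambda>(x, y). (case x of Inl a => a, case y of Inr b => b)) ` (?D \<times> ?D)"
   by (intro image_eqI[of _ _ "(Inl (fst p), Inr (snd p))"]) auto
 qed
 ultimately show ?thesis by (rule small_subset)
qed

lemma small_embedding:
 assumes "small (U :: 'u set) (A :: 'a set)" obtains e :: "'a => 'u" where "inj_on e A" "e ` A \<subseteq> U"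
 using assms card_of_ordLeq[of A U] ordLess_imp_ordLeq unfolding small_def by blast

text \<open>Cocompleteness refers to diagrams whose shape lives on the type of \<open>U\<close>; small diagrams of any
 other type are renamed along an injection.\<close>

lemma (in category) colimit_exists:
 fixes U :: "'u set" and D :: "('i, 'a, 'y) cat_scheme"
 assumes co: "cocomplete U C" and D: "category D" and s: "small U (Obj D)" "small U (Arr D)"
  and F: "is_functor D C FO FA"
 shows "\<exists>c \<iota>. is_colimit D C FO FA c \<iota>"
proof -
 interpret D: category D by fact
 obtain e :: "'i => 'u" where e: "inj_on e (Obj D)" by (rule small_embedding[OF s(1)])
 obtain k :: "'a => 'u" where k: "inj_on k (Arr D)" by (rule small_embedding[OF s(2)])
 let ?e = "inv_into (Obj D) e" and ?k = "inv_into (Arr D) k"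
 define D' :: "('u, 'u) cat" where "D' = \<lparr>Obj = e ` Obj D, Arr = k ` Arr D, Dom = (\<lambda>x. e (Dom D (?k x))),
  Cod = (\<lambda>x. e (Cod D (?k x))), Idn = (\<lambda>x. k (Idn D (?e x))), Cmp = (\<lambda>x y. k (Cmp D (?k x) (?k y)))\<rparr>"
 have D'[simp]: "Obj D' = e ` Obj D" "Arr D' = k ` Arr D" "Dom D' x = e (Dom D (?k x))"
  "Cod D' x = e (Cod D (?k x))" "Idn D' x = k (Idn D (?e x))" "Cmp D' x y = k (Cmp D (?k x) (?k y))" for x y
  by (auto simp: D'_def)
 have ee[simp]: "i\<in>Obj D ==> ?e (e i) = i" for i using e by simp
 have kk[simp]: "a\<in>Arr D ==> ?k (k a) = a" for a using k by simp
 have ei: "e i = e j \<longleftrightarrow> i = j" if "i\<in>Obj D" "j\<in>Obj D" for i j using e that by (auto dest: inj_onD)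
 have dc: "a\<in>Arr D ==> Dom D a\<in>Obj D" "a\<in>Arr D ==> Cod D a\<in>Obj D" for a
  by (rule D.dom_obj, assumption, rule D.cod_obj)
 have "category D'"
 proof
  show "Dom D' f\<in>Obj D' \<and> Cod D' f\<in>Obj D'" if "f\<in>Arr D'" for f using that by auto
  show "Idn D' X\<in>Hom D' X X" if "X\<in>Obj D'" for X using that by auto
  show "Cmp D' g f\<in>Hom D' X Z" if "f\<in>Hom D' X Y" "g\<in>Hom D' Y Z" for f g X Y Z
   using that by (auto simp: ei dc)
  show "Cmp D' f (Idn D' X) = f" if "f\<in>Hom D' X Y" for f X Y using that by auto
  show "Cmp D' (Idn D' Y) f = f" if "f\<in>Hom D' X Y" for f X Y using that by auto
  show "Cmp D' (Cmp D' h g) f = Cmp D' h (Cmp D' g f)"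
   if "f\<in>Hom D' W X" "g\<in>Hom D' X Y" "h\<in>Hom D' Y Z" for f g h W X Y Z
   using that by (auto simp: ei dc)
 qed
 moreover have "small U (Obj D')" "small U (Arr D')" using s by (auto intro: small_image)
 moreover have "is_functor D' C (FO \<circ> ?e) (FA \<circ> ?k)"
  unfolding is_functor_def
 proof (intro conjI ballI impI)
  show "(FO \<circ> ?e) i\<in>Obj C" if "i\<in>Obj D'" for i using that F unfolding is_functor_def by auto
  show "(FA \<circ> ?k) a\<in>Hom C ((FO \<circ> ?e) (Dom D' a)) ((FO \<circ> ?e) (Cod D' a))" if "a\<in>Arr D'" for a
  proof -
   obtain b where b: "b\<in>Arr D" "a = k b" using \<open>a\<in>Arr D'\<close> by auto
   then show ?thesis using F unfolding is_functor_def by (simp add: dc)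
  qed
  show "(FA \<circ> ?k) (Idn D' i) = \<i>\<d> ((FO \<circ> ?e) i)" if "i\<in>Obj D'" for i
   using that F unfolding is_functor_def by auto
  show "(FA \<circ> ?k) (Cmp D' b a) = (FA \<circ> ?k) b\<cdot>(FA \<circ> ?k) a"
   if ab: "a\<in>Arr D'" "b\<in>Arr D'" "Cod D' a = Dom D' b" for a b
  proof -
   obtain a' b' where b: "b'\<in>Arr D" "b = k b'" "a'\<in>Arr D" "a = k a'"
    using ab(1,2) unfolding D' by blast
   then have c: "Cod D a' = Dom D b'" using ab by (simp add: ei dc)
   then have "FA (Cmp D b' a') = FA b'\<cdot>FA a'" using b F unfolding is_functor_def by blast
   then show ?thesis using b c by simp
  qed
 qed
 ultimately obtain c \<iota> where c: "is_colimit D' C (FO \<circ> ?e) (FA \<circ> ?k) c \<iota>"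
  using co unfolding cocomplete_def by blast
 have 1: "is_cocone D' C (FO \<circ> ?e) (FA \<circ> ?k) c' \<iota>' \<longleftrightarrow> is_cocone D C FO FA c' (\<iota>' \<circ> e)" for c' \<iota>'
  unfolding is_cocone_def by (auto simp: dc)
 have 2: "is_cocone D' C (FO \<circ> ?e) (FA \<circ> ?k) c' (\<iota>' \<circ> ?e)" if "is_cocone D C FO FA c' \<iota>'" for c' \<iota>'
  using that unfolding 1 is_cocone_def by (auto simp: dc)
 have "is_colimit D C FO FA c (\<iota> \<circ> e)"
  unfolding is_colimit_def
 proof (intro conjI allI impI)
  show "is_cocone D C FO FA c (\<iota> \<circ> e)" using c 1 unfolding is_colimit_def by blast
  fix c' \<iota>' assume "is_cocone D C FO FA c' \<iota>'"
  from 2[OF this] have "\<exists>!u. u\<in>Hom C c c' \<and> (\<forall>i\<in>Obj D'. u\<cdot>\<iota> i = (\<iota>' \<circ> ?e) i)"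
   using c unfolding is_colimit_def by blast
  then show "\<exists>!u. u\<in>Hom C c c' \<and> (\<forall>i\<in>Obj D. u\<cdot>(\<iota> \<circ> e) i = \<iota>' i)" by simp
 qed
 then show ?thesis by blast
qed

lemma preorder_cat_simps [simp]:
 "Obj (preorder_cat A le) = A" "f\<in>Arr (preorder_cat A le) \<longleftrightarrow> fst f\<in>A \<and> snd f\<in>A \<and> le (fst f) (snd f)"
 "Dom (preorder_cat A le) = fst" "Cod (preorder_cat A le) = snd" "Idn (preorder_cat A le) a = (a, a)"
 "Cmp (preorder_cat A le) g f = (fst f, snd g)"
 by (auto simp: preorder_cat_def)

lemma category_preorder_cat:
 assumes r: "\<And>a. a\<in>A ==> le a a" and t: "\<And>a b c. a\<in>A ==> b\<in>A ==> c\<in>A ==> le a b ==> le b c ==> le a c"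
 shows "category (preorder_cat A le)"
proof
 let ?P = "preorder_cat A le"
 show "Cmp ?P g f\<in>Hom ?P X Z" if "f\<in>Hom ?P X Y" "g\<in>Hom ?P Y Z" for f g X Y Z
  using that t[of X Y Z] by auto
qed (use r in \<open>auto simp: prod_eq_iff\<close>)

lemma small_preorder_cat:
 assumes "inaccessible U" "small U A"
 shows "small U (Obj (preorder_cat A le))" "small U (Arr (preorder_cat A le))"
 using assms small_subset[OF small_Times[OF assms(1) assms(2) assms(2)], of "Arr (preorder_cat A le)"]
 by (auto simp: preorder_cat_def)

text \<open>The shape of a presentation: one object for every generator and every relation, and two arrows
 from a relation to the generators that it relates.\<close>

definition glue_shape ::
  "'i set => ('i \<times> 'm \<times> 'i \<times> 'm) set => ('i + ('i \<times> 'm \<times> 'i \<times> 'm),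
    ('i + ('i \<times> 'm \<times> 'i \<times> 'm)) + (('i \<times> 'm \<times> 'i \<times> 'm) \<times> bool)) cat" where
 "glue_shape T Rel = \<lparr>Obj = T <+> Rel, Arr = (T <+> Rel) <+> (Rel \<times> UNIV),
   Dom = (\<lambda>x. case x of Inl y => y | Inr (r, b) => Inr r),
   Cod = (\<lambda>x. case x of Inl y => y | Inr ((i, f, j, g), b) => Inl (if b then i else j)),
   Idn = Inl, Cmp = (\<lambda>g f. case f of Inl _ => g | Inr _ => f)\<rparr>"

text \<open>A cocone on the shape of the presentation is determined by its values on the generators, as the value
 at a relation is forced by either of its two arrows.\<close>

lemma (in category) glue_exists:
 fixes U :: "'u set" and T :: "'i set" and Rel :: "('i \<times> 'm \<times> 'i \<times> 'm) set"
 assumes U: "inaccessible U" "cocomplete U C" and s: "small U T" "small U Rel" and wf: "glue_relations C T F Rel"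
 shows "\<exists>c \<iota>. is_glue C T F Rel c \<iota>"
proof -
 note W = glue_relationsD[OF wf]
 have FT: "F i\<in>Obj C" if "i\<in>T" for i using wf that unfolding glue_relations_def by auto
 let ?D = "glue_shape T Rel"
 have D: "category ?D"
  by unfold_locales (auto simp: glue_shape_def W split: sum.splits prod.splits)
 define FO :: "'i + ('i \<times> 'm \<times> 'i \<times> 'm) => 'o" where "FO = (\<lambda>x. case x of Inl i => F i | Inr (i, a, j, b) => Dom C a)"
 define FA :: "('i + ('i \<times> 'm \<times> 'i \<times> 'm)) + (('i \<times> 'm \<times> 'i \<times> 'm) \<times> bool) => 'm"
  where "FA = (\<lambda>x. case x of Inl y => \<i>\<d> (FO y) | Inr ((i, f, j, g), b) => if b then f else g)"
 have FO: "FO x\<in>Obj C" if "x\<in>T <+> Rel" for x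
  using that FT W by (auto simp: FO_def)
 have fn: "is_functor ?D C FO FA"
  unfolding is_functor_def
 proof (intro conjI ballI impI)
  show "FO i\<in>Obj C" if "i\<in>Obj ?D" for i using that FO by (simp add: glue_shape_def)
  show "FA a\<in>Hom C (FO (Dom ?D a)) (FO (Cod ?D a))" if "a\<in>Arr ?D" for a
   using that FO FT W by (auto simp: FA_def FO_def glue_shape_def)
  show "FA (Idn ?D i) = \<i>\<d> (FO i)" for i by (simp add: FA_def glue_shape_def)
  show "FA (Cmp ?D b a) = FA b\<cdot>FA a" if "a\<in>Arr ?D" "b\<in>Arr ?D" "Cod ?D a = Dom ?D b" for a b
   using that FO FT W by (auto simp: FA_def FO_def glue_shape_def)
 qed
 have s1: "small U (T <+> Rel)" using small_Plus[OF U(1) s] .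
 have "small U (Arr ?D)"
  using small_Plus[OF U(1) s1 small_Times[OF U(1) s(2) small_finite[OF U(1), of "UNIV :: bool set"]]]
  by (simp add: glue_shape_def)
 then obtain c \<iota> where c: "is_colimit ?D C FO FA c \<iota>"
  using colimit_exists[OF U(2) D _ _ fn] s1 by (auto simp: glue_shape_def)
 have sh: "Obj ?D = T <+> Rel" by (simp add: glue_shape_def)
 have co: "is_cocone ?D C FO FA Z \<kappa> \<longleftrightarrow> glue_cocone C T F Rel Z (\<kappa> \<circ> Inl) \<and>
   (\<forall>(i, a, j, b)\<in>Rel. \<kappa> (Inr (i, a, j, b)) = \<kappa> (Inl i)\<cdot>a)" for Z \<kappa>
 proof
  assume L: "is_cocone ?D C FO FA Z \<kappa>"
  have 1: "\<kappa> x\<in>Hom C (FO x) Z" if "x\<in>T <+> Rel" for x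
   using L that unfolding is_cocone_def sh by blast
  have 2: "\<kappa> (Cod ?D x)\<cdot>FA x = \<kappa> (Dom ?D x)" if "x\<in>Arr ?D" for x
   using L that unfolding is_cocone_def by blast
  have 3: "\<kappa> (Inl i)\<cdot>a = \<kappa> (Inr (i, a, j, b))" "\<kappa> (Inl j)\<cdot>b = \<kappa> (Inr (i, a, j, b))"
   if "(i, a, j, b)\<in>Rel" for i a j b
   using that 2[of "Inr ((i, a, j, b), True)"] 2[of "Inr ((i, a, j, b), False)"]
   by (auto simp: glue_shape_def FA_def)
  show "glue_cocone C T F Rel Z (\<kappa> \<circ> Inl) \<and> (\<forall>(i, a, j, b)\<in>Rel. \<kappa> (Inr (i, a, j, b)) = \<kappa> (Inl i)\<cdot>a)"
   unfolding glue_cocone_def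
  proof (intro conjI ballI)
   show "Z\<in>Obj C" using L unfolding is_cocone_def by blast
   show "(\<kappa> \<circ> Inl) i\<in>Hom C (F i) Z" if "i\<in>T" for i using 1[OF InlI[OF that]] by (simp add: FO_def)
   fix r assume "r\<in>Rel"
   then show "case r of (i, a, j, b) => (\<kappa> \<circ> Inl) i\<cdot>a = (\<kappa> \<circ> Inl) j\<cdot>b"
    "case r of (i, a, j, b) => \<kappa> (Inr (i, a, j, b)) = \<kappa> (Inl i)\<cdot>a"
    using 3 by (auto split: prod.splits)
  qed
 next
  assume R: "glue_cocone C T F Rel Z (\<kappa> \<circ> Inl) \<and> (\<forall>(i, a, j, b)\<in>Rel. \<kappa> (Inr (i, a, j, b)) = \<kappa> (Inl i)\<cdot>a)"
  have Z: "Z\<in>Obj C" and 1: "\<kappa> (Inl i)\<in>Arr C" "Dom C (\<kappa> (Inl i)) = F i" "Cod C (\<kappa> (Inl i)) = Z" if "i\<in>T" for i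
   using R that unfolding glue_cocone_def by auto
  have 2: "\<kappa> (Inr (i, a, j, b)) = \<kappa> (Inl i)\<cdot>a" "\<kappa> (Inl i)\<cdot>a = \<kappa> (Inl j)\<cdot>b" if "(i, a, j, b)\<in>Rel" for i a j b
   using R that unfolding glue_cocone_def by fastforce+
  show "is_cocone ?D C FO FA Z \<kappa>"
   unfolding is_cocone_def
  proof (intro conjI ballI)
   show "Z\<in>Obj C" using R unfolding glue_cocone_def by blast
   show "\<kappa> x\<in>Hom C (FO x) Z" if "x\<in>Obj ?D" for x
    using that W by (auto simp: sh FO_def 1 2(1))
   fix x assume x: "x\<in>Arr ?D"
   show "\<kappa> (Cod ?D x)\<cdot>FA x = \<kappa> (Dom ?D x)"
    using x W FT by (auto simp: glue_shape_def FA_def FO_def 1 2(1)) (metis 2)+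
  qed
 qed
 have W2: "\<And>i a j b. (i, a, j, b)\<in>Rel ==> i\<in>T" using W by blast
 have "is_glue C T F Rel c (\<iota> \<circ> Inl)"
  unfolding is_glue_def
 proof (intro conjI allI impI)
  have cc: "is_cocone ?D C FO FA c \<iota>" using c unfolding is_colimit_def by blast
  then show gc: "glue_cocone C T F Rel c (\<iota> \<circ> Inl)" unfolding co by blast
  have \<iota>r: "\<iota> (Inr (i, a, j, b)) = \<iota> (Inl i)\<cdot>a" if "(i, a, j, b)\<in>Rel" for i a j b
   using cc that unfolding co by blast
  have \<iota>l: "\<iota> (Inl i)\<in>Arr C" "Dom C (\<iota> (Inl i)) = F i" "Cod C (\<iota> (Inl i)) = c" if "i\<in>T" for i
   using gc that unfolding glue_cocone_def by auto
  fix Z \<kappa> assume k: "glue_cocone C T F Rel Z \<kappa>"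
  define \<kappa>' :: "'i + ('i \<times> 'm \<times> 'i \<times> 'm) => 'm" where "\<kappa>' = (\<lambda>x. case x of Inl i => \<kappa> i | Inr (i, a, j, b) => \<kappa> i\<cdot>a)"
  have "\<kappa>' \<circ> Inl = \<kappa>" by (auto simp: \<kappa>'_def)
  moreover have "\<forall>(i, a, j, b)\<in>Rel. \<kappa>' (Inr (i, a, j, b)) = \<kappa>' (Inl i)\<cdot>a"
   unfolding \<kappa>'_def by auto
  ultimately have "is_cocone ?D C FO FA Z \<kappa>'" using k unfolding co by simp
  then have ex: "\<exists>!u. u\<in>Hom C c Z \<and> (\<forall>x\<in>Obj ?D. u\<cdot>\<iota> x = \<kappa>' x)"
   using c unfolding is_colimit_def by blast
  have "(\<forall>x\<in>Obj ?D. u\<cdot>\<iota> x = \<kappa>' x) \<longleftrightarrow> (\<forall>i\<in>T. u\<cdot>(\<iota> \<circ> Inl) i = \<kappa> i)" if "u\<in>Hom C c Z" for u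
  proof -
   have "u\<cdot>\<iota> (Inr (i, a, j, b)) = \<kappa>' (Inr (i, a, j, b))"
    if "\<forall>i\<in>T. u\<cdot>\<iota> (Inl i) = \<kappa> i" and r: "(i, a, j, b)\<in>Rel" for i a j b
   proof -
    have "u\<cdot>\<iota> (Inr (i, a, j, b)) = (u\<cdot>\<iota> (Inl i))\<cdot>a"
     using \<iota>r[OF r] \<iota>l[OF W2[OF r]] W[OF r] \<open>u\<in>Hom C c Z\<close> by simp
    then show ?thesis using that W2[OF r] by (simp add: \<kappa>'_def)
   qed
   note r = this
   have l: "\<kappa>' (Inl i) = \<kappa> i" for i by (simp add: \<kappa>'_def)
   show ?thesis
   proof
    assume "\<forall>x\<in>Obj ?D. u\<cdot>\<iota> x = \<kappa>' x"
    then show "\<forall>i\<in>T. u\<cdot>(\<iota> \<circ> Inl) i = \<kappa> i" unfolding sh using l by force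
   next
    assume A: "\<forall>i\<in>T. u\<cdot>(\<iota> \<circ> Inl) i = \<kappa> i"
    show "\<forall>x\<in>Obj ?D. u\<cdot>\<iota> x = \<kappa>' x"
     unfolding sh
    proof
     fix x assume x: "x\<in>T <+> Rel"
     show "u\<cdot>\<iota> x = \<kappa>' x"
     proof (cases x)
      case (Inl i)
      then show ?thesis using A l x by auto
     next
      case (Inr y)
      obtain i a j b where y: "y = (i, a, j, b)" by (cases y) blast
      have "y\<in>Rel" using x Inr by auto
      then show ?thesis unfolding Inr y by - (rule r, use A in auto)
     qed
    qed
   qed
  qed
  then show "\<exists>!u. u\<in>Hom C c Z \<and> (\<forall>i\<in>T. u\<cdot>(\<iota> \<circ> Inl) i = \<kappa> i)" using ex by metis
 qed
 then show ?thesis by blast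
qed

text \<open>Local smallness bounds the number of relations.\<close>

lemma (in category) coinvariants_exist:
 assumes "inaccessible U" "cocomplete U C" "locally_small U C" "X\<in>Obj C" "G \<subseteq> Hom C X X"
 shows "\<exists>q. is_coinvariants C X G q"
proof -
 let ?Rel = "{((), g, (), \<i>\<d> X) |g. g\<in>G}"
 have "small U G" using assms small_subset unfolding locally_small_def by blast
 then have "small U ?Rel" using small_image[of U G "\<lambda>g. ((), g, (), \<i>\<d> X)"] by (simp add: setcompr_eq_image)
 then obtain c \<iota> where "is_glue C {()} (\<lambda>_. X) ?Rel c \<iota>"
  using glue_exists[OF assms(1,2) small_finite[OF assms(1)], of "{()}" ?Rel "\<lambda>_. X"]
   is_coinvariants_iff_glue(2)[OF assms(4,5)] by auto
 note G = this
 have "\<iota> ()\<in>Arr C" "Cod C (\<iota> ()) = c" using is_glue_hom(1,3)[OF G, of "()"] by simp_all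
 moreover have "\<iota> = (\<lambda>_. \<iota> ())" by (rule ext) simp
 ultimately have "is_coinvariants C X G (\<iota> ())"
  unfolding is_coinvariants_iff_glue(1)[OF assms(4,5)] using G by simp
 then show ?thesis by blast
qed

lemma (in category) coinvariants_arr:
 assumes "is_coinvariants C X G q" "X\<in>Obj C" "G \<subseteq> Hom C X X"
 shows "q\<in>Arr C" "Dom C q = X" "\<And>g. g\<in>G ==> q\<cdot>g = q" "jointly_epic {()} (Cod C q) (\<lambda>_. q)"
proof -
 show "q\<in>Arr C" "Dom C q = X" "\<And>g. g\<in>G ==> q\<cdot>g = q" using assms(1) unfolding is_coinvariants_def by auto
 show "jointly_epic {()} (Cod C q) (\<lambda>_. q)"
  using assms(1) is_coinvariants_iff_glue[OF assms(2,3)] is_glue_epic by blast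
qed

lemma (in category) coinvariants_ex:
 assumes "is_coinvariants C X G q" "a\<in>Arr C" "Dom C a = X" "\<And>g. g\<in>G ==> a\<cdot>g = a"
 obtains u where "u\<in>Arr C" "Dom C u = Cod C q" "Cod C u = Cod C a" "u\<cdot>q = a"
proof -
 have a: "Cod C a\<in>Obj C" "a\<in>Hom C X (Cod C a)" "\<forall>g\<in>G. a\<cdot>g = a" using assms(2-4) by auto
 have U: "\<forall>Z\<in>Obj C. \<forall>a\<in>Hom C X Z. (\<forall>g\<in>G. a\<cdot>g = a) -->
   (\<exists>!u. u\<in>Hom C (Cod C q) Z \<and> u\<cdot>q = a)"
  using assms(1) unfolding is_coinvariants_def by (elim conjE)
 obtain u where "u\<in>Hom C (Cod C q) (Cod C a)" "u\<cdot>q = a"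
  using ex1_implies_ex[OF bspec[OF bspec[OF U a(1)] a(2), THEN mp, OF a(3)]] by (elim exE conjE)
 then show ?thesis by (intro that[of u]) auto
qed

section \<open>Free commutative monoids\<close>

context closed_symmetric_monoidal
begin

lemma jointly_epic_cover:
 assumes "jointly_epic T c \<iota>" "\<And>i. i\<in>T ==> \<exists>j\<in>T'. \<iota>' j = \<iota> i"
 shows "jointly_epic T' c \<iota>'"
 unfolding jointly_epic_def
proof (intro allI impI, elim conjE)
 fix f g assume fg: "f\<in>Arr M" "g\<in>Arr M" "Dom M f = c" "Dom M g = c" "Cod M f = Cod M g"
  and eq: "\<forall>j\<in>T'. f\<cdot>\<iota>' j = g\<cdot>\<iota>' j"
 show "f = g"
 proof (rule jointly_epicD[OF assms(1)])
  fix i assume "i\<in>T"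
  then obtain j where "j\<in>T'" "\<iota>' j = \<iota> i" using assms(2) by blast
  then show "f\<cdot>\<iota> i = g\<cdot>\<iota> i" using eq by metis
 qed (rule fg)+
qed

lemma tensor_arr_list_arr [simp]:
 assumes "set fs \<subseteq> Arr M"
 shows "tensor_arr_list M fs\<in>Arr M" "Dom M (tensor_arr_list M fs) = TL (map (Dom M) fs)"
  "Cod M (tensor_arr_list M fs) = TL (map (Cod M) fs)"
 using assms by (induction fs) auto

lemma adj_iso_nat:
 assumes "set fs \<subseteq> Arr M" "Suc i < length fs"
 shows "adj_iso M (map (Cod M) fs) i\<cdot>tensor_arr_list M fs =
  tensor_arr_list M (swap_at i fs)\<cdot>adj_iso M (map (Dom M) fs) i"
 using assms
proof (induction i fs rule: swap_at.induct)
 case (1 f g fs)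
 then show ?case using exchange_nat[of f g "tensor_arr_list M fs"] by simp
next
 case (2 i f fs)
 then have "set (map (Cod M) fs) \<subseteq> Obj M" "set (map (Dom M) fs) \<subseteq> Obj M" by auto
 then show ?case using 2 by (simp add: map_swap_at)
qed auto

text \<open>The axioms are tested on generators. The index sets \<open>T2\<close> and \<open>T3\<close> allow for sparser generating families
 of the powers of the carrier, such as the diagonal ones for directed colimits.\<close>

lemma monoid_from_generators:
 assumes A: "Carrier A\<in>Obj M" "Mult A\<in>Hom M (Carrier A\<otimes>Carrier A) (Carrier A)" "One A\<in>Hom M \<one> (Carrier A)"
  and \<iota>: "\<And>i. i\<in>T ==> \<iota> i\<in>Hom M (F i) (Carrier A)" and F: "\<And>i. i\<in>T ==> F i\<in>Obj M"
  and e1: "jointly_epic T (Carrier A) \<iota>"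
  and e2: "jointly_epic T2 (Carrier A\<otimes>Carrier A) (\<lambda>(i, j). \<iota> i\<odot>\<iota> j)" "T2 \<subseteq> T \<times> T"
  and e3: "jointly_epic T3 ((Carrier A\<otimes>Carrier A)\<otimes>Carrier A) (\<lambda>(i, j, k). (\<iota> i\<odot>\<iota> j)\<odot>\<iota> k)" "T3 \<subseteq> T \<times> T \<times> T"
  and unit: "\<And>i. i\<in>T ==> Mult A\<cdot>(One A\<odot>\<iota> i) = \<iota> i\<cdot>\<ll> (F i)"
  and comm: "\<And>i j. (i, j)\<in>T2 ==> Mult A\<cdot>((\<iota> j\<odot>\<iota> i)\<cdot>\<beta> (F i) (F j)) = Mult A\<cdot>(\<iota> i\<odot>\<iota> j)"
  and assoc: "\<And>i j k. (i, j, k)\<in>T3 ==> Mult A\<cdot>((Mult A\<cdot>(\<iota> i\<odot>\<iota> j))\<odot>\<iota> k) =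
    Mult A\<cdot>((\<iota> i\<odot>(Mult A\<cdot>(\<iota> j\<odot>\<iota> k)))\<cdot>\<alpha> (F i) (F j) (F k))"
 shows "commutative_monoid M A"
proof -
 let ?Q = "Carrier A" and ?m = "Mult A" and ?u = "One A"
 have [simp]: "?Q\<in>Obj M" "?m\<in>Arr M" "Dom M ?m = ?Q\<otimes>?Q" "Cod M ?m = ?Q" "?u\<in>Arr M"
  "Dom M ?u = \<one>" "Cod M ?u = ?Q" using A by auto
 note I = \<iota>[unfolded in_Hom]
 have c: "?m\<cdot>\<beta> ?Q ?Q = ?m"
 proof (rule jointly_epicD[OF e2(1)])
  fix p assume p: "p\<in>T2"
  obtain i j where [simp]: "p = (i, j)" by (cases p)
  have "i\<in>T" "j\<in>T" using p e2(2) by auto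
  then show "?m\<cdot>\<beta> ?Q ?Q\<cdot>(case p of (i, j) => \<iota> i\<odot>\<iota> j) = ?m\<cdot>(case p of (i, j) => \<iota> i\<odot>\<iota> j)"
   using comm[of i j] p I[of i] I[of j] F by simp
 qed auto
 have l: "?m\<cdot>(?u\<lhd>?Q) = \<ll> ?Q"
 proof (rule jointly_epicD[OF jointly_epic_tensor_left[OF e1, of \<one>]])
  fix i assume i: "i\<in>T"
  then show "?m\<cdot>(?u\<lhd>?Q)\<cdot>(\<one>\<rhd>\<iota> i) = \<ll> ?Q\<cdot>(\<one>\<rhd>\<iota> i)"
   using unit[OF i] I[OF i] F by simp
 qed (use I in auto)
 have "?m\<cdot>(?Q\<rhd>?u) = (?m\<cdot>\<beta> ?Q ?Q)\<cdot>(?Q\<rhd>?u)" using c by simp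
 also have "... = (?m\<cdot>(?u\<lhd>?Q))\<cdot>\<beta> ?Q \<one>" by simp
 also have "... = \<rr> ?Q" unfolding l by (simp add: lunit_braid)
 finally have r: "?m\<cdot>(?Q\<rhd>?u) = \<rr> ?Q" .
 have a: "?m\<cdot>(?m\<lhd>?Q) = ?m\<cdot>(?Q\<rhd>?m)\<cdot>\<alpha> ?Q ?Q ?Q"
 proof (rule jointly_epicD[OF e3(1)])
  fix p assume p: "p\<in>T3"
  obtain i j k where [simp]: "p = (i, j, k)" by (cases p)
  have ijk: "i\<in>T" "j\<in>T" "k\<in>T" using p e3(2) by auto
  have "?m\<cdot>(?m\<lhd>?Q)\<cdot>((\<iota> i\<odot>\<iota> j)\<odot>\<iota> k) = ?m\<cdot>((?m\<cdot>(\<iota> i\<odot>\<iota> j))\<odot>\<iota> k)"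
   using I ijk by simp
  also have "... = ?m\<cdot>((\<iota> i\<odot>(?m\<cdot>(\<iota> j\<odot>\<iota> k)))\<cdot>\<alpha> (F i) (F j) (F k))" using assoc p by simp
  also have "... = ?m\<cdot>(?Q\<rhd>?m)\<cdot>\<alpha> ?Q ?Q ?Q\<cdot>((\<iota> i\<odot>\<iota> j)\<odot>\<iota> k)"
   using I[OF ijk(1)] I[OF ijk(2)] I[OF ijk(3)] F ijk by simp
  finally show "?m\<cdot>(?m\<lhd>?Q)\<cdot>(case p of (i, j, k) => (\<iota> i\<odot>\<iota> j)\<odot>\<iota> k) =
   ?m\<cdot>(?Q\<rhd>?m)\<cdot>\<alpha> ?Q ?Q ?Q\<cdot>(case p of (i, j, k) => (\<iota> i\<odot>\<iota> j)\<odot>\<iota> k)" by simp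
 qed auto
 show ?thesis unfolding commutative_monoid_def using A a l r c by simp
qed

text \<open>The object and the arrows \<open>X\<^sup>n \<rightarrow> c\<close> underlying a free commutative monoid.\<close>

definition sym_cocone :: "'o => 'o => (nat => 'm) => bool" where
 "sym_cocone X c \<iota> \<longleftrightarrow>
   (\<exists>q j. (\<forall>n. is_coinvariants M (tensor_power M X n) (power_action M X n) (q n)) \<and>
    is_colimit (preorder_cat (UNIV :: nat set) (=)) M
     (\<lambda>n. Cod M (q n)) (\<lambda>(n, _). Idn M (Cod M (q n))) c j \<and>
    (\<forall>n. \<iota> n = j n\<cdot>q n))"

text \<open>By \<open>power_action_iff\<close> the adjacent interchanges present the coinvariants of all powers at once.\<close>

definition sym_relations :: "'o => (nat \<times> 'm \<times> nat \<times> 'm) set" where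
 "sym_relations X =
   {(n, adj_iso M (replicate n X) i, n, \<i>\<d> (tensor_power M X n)) |n i. Suc i < n}"

lemma tensor_power_obj [simp]: "X\<in>Obj M ==> tensor_power M X n\<in>Obj M"
 by (induction n) auto

lemma glue_relations_sym:
 assumes "X\<in>Obj M" shows "glue_relations M UNIV (tensor_power M X) (sym_relations X)"
 unfolding glue_relations_def sym_relations_def using assms by auto

lemma discrete_functor:
 assumes "\<And>n :: nat. F n\<in>Obj M"
 shows "is_functor (preorder_cat UNIV (=)) M F (\<lambda>(n, _). \<i>\<d> (F n))"
 unfolding is_functor_def using assms by auto

text \<open>A coproduct of quotients is the quotient of the coproduct, presented by all relations together.\<close>

lemma sym_cocone_glue:
 assumes X: "X\<in>Obj M" and s: "sym_cocone X c \<iota>"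
 shows "is_glue M UNIV (tensor_power M X) (sym_relations X) c \<iota>"
proof -
 obtain q j where q: "\<And>n. is_coinvariants M (tensor_power M X n) (power_action M X n) (q n)"
  and j: "is_colimit (preorder_cat (UNIV :: nat set) (=)) M (\<lambda>n. Cod M (q n)) (\<lambda>(n, _). Idn M (Cod M (q n))) c j"
  and \<iota>: "\<And>n. \<iota> n = j n\<cdot>q n" using s unfolding sym_cocone_def by blast
 note Q = coinvariants_arr[OF q tensor_power_obj[OF X] power_action_hom[OF X]]
 have "\<And>n. Cod M (q n)\<in>Obj M" using Q(1) by auto
 note D = is_colimit_iff_glue[OF category_preorder_cat discrete_functor, of "\<lambda>n. Cod M (q n)", simplified, OF this]
 define R where "R = {(b, \<i>\<d> (Cod M (q a)), a, \<i>\<d> (Cod M (q a))) |a b. a = b}"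
 note g = D(1)[THEN iffD1, OF j] and gr = D(2)
 note J = is_glue_hom[OF g] and Je = is_glue_epic[OF g gr]
 have [simp]: "j n\<in>Arr M" "Dom M (j n) = Cod M (q n)" "Cod M (j n) = c" "q n\<in>Arr M" "Dom M (q n) = tensor_power M X n" for n
  using J(1-3)[of n] Q by auto
 have c: "c\<in>Obj M" using J(4) .
 have qi: "q n\<cdot>adj_iso M (replicate n X) i = q n" if "Suc i < n" for n i
  using power_action_iff[OF X, of "q n" n] Q(3) that by simp
 show ?thesis
 proof (rule is_glueI)
  show "c\<in>Obj M" by fact
  show "\<iota> n\<in>Hom M (tensor_power M X n) c" for n by (simp add: \<iota>)
  show "\<iota> n\<cdot>a = \<iota> m\<cdot>b" if "(n, a, m, b)\<in>sym_relations X" for n a m b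
   using that X by (auto simp: sym_relations_def \<iota> qi)
 next
  fix Z \<kappa> assume k: "glue_cocone M UNIV (tensor_power M X) (sym_relations X) Z \<kappa>"
  then have Z: "Z\<in>Obj M" and \<kappa>: "\<And>n. \<kappa> n\<in>Arr M" "\<And>n. Dom M (\<kappa> n) = tensor_power M X n" "\<And>n. Cod M (\<kappa> n) = Z"
   unfolding glue_cocone_def by auto
  have inv: "\<kappa> n\<cdot>adj_iso M (replicate n X) i = \<kappa> n" if "Suc i < n" for n i
  proof -
   have "(n, adj_iso M (replicate n X) i, n, \<i>\<d> (tensor_power M X n))\<in>sym_relations X"
    using that unfolding sym_relations_def by blast
   then have "\<kappa> n\<cdot>adj_iso M (replicate n X) i = \<kappa> n\<cdot>\<i>\<d> (tensor_power M X n)"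
    using k unfolding glue_cocone_def by blast
   then show ?thesis using \<kappa> by simp
  qed
  have "\<exists>u. u\<in>Arr M \<and> Dom M u = Cod M (q n) \<and> Cod M u = Z \<and> u\<cdot>q n = \<kappa> n" for n
  proof (rule coinvariants_ex[OF q \<kappa>(1) \<kappa>(2)])
   show "\<kappa> n\<cdot>g = \<kappa> n" if "g\<in>power_action M X n" for g
    using power_action_iff[OF X \<kappa>(1) \<kappa>(2)] inv that by blast
  qed (auto simp: \<kappa>)
  then obtain k' where k': "\<And>n. k' n\<in>Arr M" "\<And>n. Dom M (k' n) = Cod M (q n)" "\<And>n. Cod M (k' n) = Z"
   "\<And>n. k' n\<cdot>q n = \<kappa> n" by metis
  obtain u where u: "u\<in>Arr M" "Dom M u = c" "Cod M u = Z" "\<And>n. n\<in>UNIV ==> u\<cdot>j n = k' n"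
   by (rule is_glue_ex[OF g Z, of k']) (use k' in auto)
  have "u\<cdot>\<iota> n = \<kappa> n" for n
  proof -
   have "u\<cdot>\<iota> n = (u\<cdot>j n)\<cdot>q n" using u(1-3) by (simp add: \<iota>)
   then show ?thesis using u(4) k' by simp
  qed
  then show "\<exists>u. u\<in>Hom M c Z \<and> (\<forall>i\<in>UNIV. u\<cdot>\<iota> i = \<kappa> i)" using u(1-3) by auto
 next
  show "jointly_epic UNIV c \<iota>"
   unfolding jointly_epic_def
  proof safe
   fix f g assume fg: "f\<in>Arr M" "g\<in>Arr M" "c = Dom M f" "Dom M g = Dom M f" "Cod M f = Cod M g"
    and eq: "\<forall>i\<in>UNIV. f\<cdot>\<iota> i = g\<cdot>\<iota> i"
   show "f = g"
   proof (rule jointly_epicD[OF Je])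
    fix n
    show "f\<cdot>j n = g\<cdot>j n"
    proof (rule jointly_epicD[OF Q(4)])
     show "f\<cdot>j n\<cdot>q n = g\<cdot>j n\<cdot>q n" using eq fg by (simp add: \<iota>)
    qed (use fg in auto)
   qed (use fg in auto)
  qed
 qed
qed

lemma sym_cocone_invariant:
 assumes "X\<in>Obj M" "sym_cocone X c \<iota>" "Suc i < n"
 shows "\<iota> n\<cdot>adj_iso M (replicate n X) i = \<iota> n"
proof -
 note g = sym_cocone_glue[OF assms(1,2)]
 have "(n, adj_iso M (replicate n X) i, n, \<i>\<d> (tensor_power M X n))\<in>sym_relations X"
  using assms(3) unfolding sym_relations_def by blast
 then show ?thesis using is_glue_rel[OF g] is_glue_hom(1,2)[OF g, of n] by simp
qed

text \<open>Concatenation respects the relations because an interchange in a subword is an interchange in the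
 whole word. It is commutative because the block interchange is a composite of adjacent ones, which
 become trivial in \<open>c\<close>.\<close>

lemma free_commutative_monoid:
 assumes X: "X\<in>Obj M" and s: "sym_cocone X c \<iota>"
 shows "\<exists>A. Carrier A = c \<and> is_Sym M X A \<iota>"
proof -
 note g = sym_cocone_glue[OF X s] and gr = glue_relations_sym[OF X]
 note G = is_glue_hom[OF g] and Ge = is_glue_epic[OF g gr]
 have [simp]: "c\<in>Obj M" "\<iota> n\<in>Arr M" "Dom M (\<iota> n) = tensor_power M X n" "Cod M (\<iota> n) = c" for n
  using G(4) G(1-3)[of n] by auto
 let ?P = "\<lambda>n. replicate n X"
 have P [simp]: "set (?P n) \<subseteq> Obj M" for n using X by auto
 let ?a = "\<lambda>m n. append_iso M (?P m) (?P n)"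
 have ap [simp]: "?a m n\<in>Arr M" "Dom M (?a m n) = tensor_power M X m\<otimes>tensor_power M X n"
  "Cod M (?a m n) = tensor_power M X (m + n)" for m n
  by (auto simp: replicate_add)
 obtain u where u: "u\<in>Arr M" "Dom M u = c\<otimes>c" "Cod M u = c"
  "\<And>m n. m\<in>UNIV ==> n\<in>UNIV ==> u\<cdot>(\<iota> m\<odot>\<iota> n) = \<iota> (m + n)\<cdot>?a m n"
 proof (rule is_glue_tensor_ex[OF g gr g gr, of c "\<lambda>m n. \<iota> (m + n)\<cdot>?a m n"])
  fix m a m' b n assume "(m, a, m', b)\<in>sym_relations X"
  then obtain i where i: "m' = m" "a = adj_iso M (?P m) i" "b = \<i>\<d> (tensor_power M X m)" "Suc i < m"
   unfolding sym_relations_def by auto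
  have "?a m n\<cdot>(adj_iso M (?P m) i\<lhd>tensor_power M X n) = adj_iso M (?P (m + n)) i\<cdot>?a m n"
   using append_iso_adj_left[OF P P, of i m n] i by (simp add: replicate_add)
  then have "\<iota> (m + n)\<cdot>?a m n\<cdot>(adj_iso M (?P m) i\<lhd>tensor_power M X n) =
    (\<iota> (m + n)\<cdot>adj_iso M (?P (m + n)) i)\<cdot>?a m n"
   using i X by simp
  then show "\<iota> (m + n)\<cdot>?a m n\<cdot>(a\<lhd>tensor_power M X n) =
    \<iota> (m' + n)\<cdot>?a m' n\<cdot>(b\<lhd>tensor_power M X n)"
   using i sym_cocone_invariant[OF X s, of i "m + n"] X by simp
 next
  fix m a m' b n assume "(m, a, m', b)\<in>sym_relations X"
  then obtain i where i: "m' = m" "a = adj_iso M (?P m) i" "b = \<i>\<d> (tensor_power M X m)" "Suc i < m"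
   unfolding sym_relations_def by auto
  have "?a n m\<cdot>(tensor_power M X n\<rhd>adj_iso M (?P m) i) = adj_iso M (?P (n + m)) (n + i)\<cdot>?a n m"
   using append_iso_adj_right[OF P P, of i m n] i by (simp add: replicate_add)
  then have "\<iota> (n + m)\<cdot>?a n m\<cdot>(tensor_power M X n\<rhd>adj_iso M (?P m) i) =
    (\<iota> (n + m)\<cdot>adj_iso M (?P (n + m)) (n + i))\<cdot>?a n m"
   using i X by simp
  then show "\<iota> (n + m)\<cdot>?a n m\<cdot>(tensor_power M X n\<rhd>a) =
    \<iota> (n + m')\<cdot>?a n m'\<cdot>(tensor_power M X n\<rhd>b)"
   using i sym_cocone_invariant[OF X s, of "n + i" "n + m"] X by simp
 qed auto
 then have um: "u\<cdot>(\<iota> m\<odot>\<iota> n) = \<iota> (m + n)\<cdot>?a m n" for m n by simp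
 define A where "A = \<lparr>Carrier = c, Mult = u, One = \<iota> 0\<rparr>"
 have A [simp]: "Carrier A = c" "Mult A = u" "One A = \<iota> 0" by (auto simp: A_def)
 have je2: "jointly_epic (UNIV \<times> UNIV) (c\<otimes>c) (\<lambda>(i, j). \<iota> i\<odot>\<iota> j)"
  by (rule jointly_epic_tensor[OF Ge _ Ge]) auto
 have je3: "jointly_epic ((UNIV \<times> UNIV) \<times> UNIV) ((c\<otimes>c)\<otimes>c) (\<lambda>(p, k). (case p of (i, j) => \<iota> i\<odot>\<iota> j)\<odot>\<iota> k)"
  by (rule jointly_epic_tensor[OF je2 _ Ge]) auto
 have je3': "jointly_epic (UNIV \<times> UNIV \<times> UNIV) ((c\<otimes>c)\<otimes>c) (\<lambda>(i, j, k). (\<iota> i\<odot>\<iota> j)\<odot>\<iota> k)"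
  by (rule jointly_epic_cover[OF je3]) auto
 have "commutative_monoid M A"
 proof (rule monoid_from_generators[where T = UNIV and \<iota> = \<iota> and F = "tensor_power M X" and
    ?T2.0 = "UNIV \<times> UNIV" and ?T3.0 = "UNIV \<times> UNIV \<times> UNIV"])
  show "Mult A\<cdot>(One A\<odot>\<iota> n) = \<iota> n\<cdot>\<ll> (tensor_power M X n)" for n using um[of 0 n] by simp
  show "Mult A\<cdot>((\<iota> n\<odot>\<iota> m)\<cdot>\<beta> (tensor_power M X m) (tensor_power M X n)) = Mult A\<cdot>(\<iota> m\<odot>\<iota> n)" for m n
  proof -
   obtain t where t: "swap_path (\<lambda>_::unit. X) (replicate m () @ replicate n ()) t (replicate n () @ replicate m ())"
    and at: "?a n m\<cdot>\<beta> (tensor_power M X m) (tensor_power M X n) = t\<cdot>?a m n"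
    using append_iso_braid[of "\<lambda>_::unit. X" "replicate m ()" "replicate n ()"] X by auto
   have T: "t\<in>Arr M" "Dom M t = tensor_power M X (m + n)" "Cod M t = tensor_power M X (m + n)"
    using swap_path_arr[OF t] X by (auto simp: map_replicate_const replicate_add[symmetric] add.commute)
   have "\<iota> (m + n)\<cdot>t = \<iota> (m + n)"
   proof (rule swap_path_invariant[OF t, of "m + n" "\<lambda>_. \<iota> (m + n)"])
    show "\<iota> (m + n)\<cdot>adj_iso M (map (\<lambda>_. X) w) i = \<iota> (m + n)"
     if "length w = m + n" "Suc i < m + n" for w :: "unit list" and i
     using sym_cocone_invariant[OF X s that(2)] that(1) by (simp add: map_replicate_const)
   qed (use X in \<open>auto simp: map_replicate_const\<close>)
   have "u\<cdot>((\<iota> n\<odot>\<iota> m)\<cdot>\<beta> (tensor_power M X m) (tensor_power M X n)) =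
     (u\<cdot>(\<iota> n\<odot>\<iota> m))\<cdot>\<beta> (tensor_power M X m) (tensor_power M X n)" using u(1-3) X by simp
   also have "... = \<iota> (m + n)\<cdot>(?a n m\<cdot>\<beta> (tensor_power M X m) (tensor_power M X n))"
    unfolding um using X by (simp add: add.commute)
   also have "... = (\<iota> (m + n)\<cdot>t)\<cdot>?a m n" unfolding at using T X by simp
   finally show ?thesis using um \<open>\<iota> (m + n)\<cdot>t = \<iota> (m + n)\<close> by simp
  qed
  show "Mult A\<cdot>((Mult A\<cdot>(\<iota> l\<odot>\<iota> m))\<odot>\<iota> n) = Mult A\<cdot>((\<iota> l\<odot>(Mult A\<cdot>(\<iota> m\<odot>\<iota> n))) \<cdot>
    \<alpha> (tensor_power M X l) (tensor_power M X m) (tensor_power M X n))" for l m n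
  proof -
   have "u\<cdot>((u\<cdot>(\<iota> l\<odot>\<iota> m))\<odot>\<iota> n) = (u\<cdot>(\<iota> (l + m)\<odot>\<iota> n))\<cdot>(?a l m\<lhd>tensor_power M X n)"
    unfolding um[of l m] using u(1-3) X by simp
   also have "... = \<iota> (l + m + n)\<cdot>(?a (l + m) n\<cdot>(?a l m\<lhd>tensor_power M X n))"
    unfolding um using X by simp
   also have "... = \<iota> (l + (m + n))\<cdot>(?a l (m + n)\<cdot>((tensor_power M X l\<rhd>?a m n) \<cdot>
     \<alpha> (tensor_power M X l) (tensor_power M X m) (tensor_power M X n)))"
    using append_iso_assoc[OF P P P, of l m n] by (simp add: replicate_add add.assoc)
   also have "... = (u\<cdot>(\<iota> l\<odot>\<iota> (m + n)))\<cdot>((tensor_power M X l\<rhd>?a m n) \<cdot>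
     \<alpha> (tensor_power M X l) (tensor_power M X m) (tensor_power M X n))"
    unfolding um using X by simp
   also have "... = u\<cdot>((\<iota> l\<odot>(u\<cdot>(\<iota> m\<odot>\<iota> n))) \<cdot>
     \<alpha> (tensor_power M X l) (tensor_power M X m) (tensor_power M X n))"
    unfolding um[of m n] using u(1-3) X by simp
   finally show ?thesis by simp
  qed
 qed (use u(1-3) X je2 je3' Ge in auto)
 then have "is_Sym M X A \<iota>"
  using s um unfolding is_Sym_def sym_cocone_def by simp
 then show ?thesis using A by blast
qed

lemma is_Sym_cocone: "is_Sym M X A \<iota> ==> sym_cocone X (Carrier A) \<iota>"
 unfolding is_Sym_def sym_cocone_def by blast

lemma is_Sym_exists:
 assumes U: "inaccessible U" "cocomplete U M" "locally_small U M" and X: "X\<in>Obj M"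
 shows "is_Sym M X (Sym M X) (Sym_in M X)"
proof -
 have "\<exists>q. is_coinvariants M (tensor_power M X n) (power_action M X n) q" for n
  using coinvariants_exist[OF U tensor_power_obj[OF X] power_action_hom[OF X]] .
 then obtain q where q: "\<And>n. is_coinvariants M (tensor_power M X n) (power_action M X n) (q n)" by metis
 have o: "Cod M (q n)\<in>Obj M" for n
  using coinvariants_arr(1)[OF q tensor_power_obj[OF X] power_action_hom[OF X]] by simp
 have d: "category (preorder_cat (UNIV :: nat set) (=))" by (rule category_preorder_cat) auto
 obtain c j where "is_colimit (preorder_cat (UNIV :: nat set) (=)) M (\<lambda>n. Cod M (q n)) (\<lambda>(n, _). Idn M (Cod M (q n))) c j"
  using colimit_exists[OF U(2) d small_preorder_cat[OF U(1) small_nat[OF U(1)]] discrete_functor[of "\<lambda>n. Cod M (q n)", OF o]] by blast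
 then have "sym_cocone X c (\<lambda>n. j n\<cdot>q n)" using q unfolding sym_cocone_def by blast
 then obtain A where "is_Sym M X A (\<lambda>n. j n\<cdot>q n)" using free_commutative_monoid[OF X] by blast
 then have "\<exists>S. is_Sym M X (fst S) (snd S)" by (intro exI[of _ "(A, \<lambda>n. j n\<cdot>q n)"]) simp
 then show ?thesis unfolding Sym_def Sym_in_def Sym_data_def by (rule someI_ex)
qed

text \<open>The tensor powers of \<open>h\<close> commute with adjacent interchanges, hence descend to the coinvariants.\<close>

lemma Sym_arr_props:
 assumes S: "\<And>X. X\<in>Obj M ==> is_Sym M X (Sym M X) (Sym_in M X)" and h: "h\<in>Arr M"
 shows "Sym_arr M h\<in>Hom M (Carrier (Sym M (Dom M h))) (Carrier (Sym M (Cod M h)))"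
  "Sym_arr M h\<cdot>Sym_in M (Dom M h) n = Sym_in M (Cod M h) n\<cdot>tensor_power_arr M h n"
proof -
 let ?K = "Dom M h" and ?L = "Cod M h"
 have K: "?K\<in>Obj M" and L: "?L\<in>Obj M" using h by auto
 note sK = is_Sym_cocone[OF S[OF K]] and sL = is_Sym_cocone[OF S[OF L]]
 note gK = sym_cocone_glue[OF K sK] and gL = sym_cocone_glue[OF L sL]
 note GL = is_glue_hom[OF gL]
 have hn: "tensor_power_arr M h n\<in>Arr M" "Dom M (tensor_power_arr M h n) = tensor_power M ?K n"
  "Cod M (tensor_power_arr M h n) = tensor_power M ?L n" for n
 proof -
  have "set (replicate n h) \<subseteq> Arr M" using h by auto
  from tensor_arr_list_arr[OF this] show "tensor_power_arr M h n\<in>Arr M"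
   "Dom M (tensor_power_arr M h n) = tensor_power M ?K n" "Cod M (tensor_power_arr M h n) = tensor_power M ?L n"
   by simp_all
 qed
 have co: "glue_cocone M UNIV (tensor_power M ?K) (sym_relations ?K) (Carrier (Sym M ?L))
   (\<lambda>n. Sym_in M ?L n\<cdot>tensor_power_arr M h n)"
  unfolding glue_cocone_def
 proof (intro conjI ballI)
  show "Carrier (Sym M ?L)\<in>Obj M" using GL(4) .
  show "Sym_in M ?L n\<cdot>tensor_power_arr M h n\<in>Hom M (tensor_power M ?K n) (Carrier (Sym M ?L))" for n
   using GL(1-3)[of n] hn by simp
  fix r assume "r\<in>sym_relations ?K"
  then obtain n i where r: "r = (n, adj_iso M (replicate n ?K) i, n, \<i>\<d> (tensor_power M ?K n))" "Suc i < n"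
   unfolding sym_relations_def by blast
  have "adj_iso M (replicate n ?L) i\<cdot>tensor_power_arr M h n = tensor_power_arr M h n\<cdot>adj_iso M (replicate n ?K) i"
   using adj_iso_nat[of "replicate n h" i] h r(2) by (auto simp: map_replicate_const)
  then have "Sym_in M ?L n\<cdot>(tensor_power_arr M h n\<cdot>adj_iso M (replicate n ?K) i) =
    (Sym_in M ?L n\<cdot>adj_iso M (replicate n ?L) i)\<cdot>tensor_power_arr M h n"
   using GL(1-3)[of n] hn r(2) K L by simp
  also have "... = Sym_in M ?L n\<cdot>tensor_power_arr M h n"
   using sym_cocone_invariant[OF L sL r(2)] by simp
  finally show "case r of (i, a, j, b) => Sym_in M ?L i\<cdot>tensor_power_arr M h i\<cdot>a =
    Sym_in M ?L j\<cdot>tensor_power_arr M h j\<cdot>b"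
   unfolding r using GL(1-3)[of n] hn K r(2) by simp
 qed
 have "\<exists>!f. f\<in>Hom M (Carrier (Sym M ?K)) (Carrier (Sym M ?L)) \<and>
   (\<forall>n. f\<cdot>Sym_in M ?K n = Sym_in M ?L n\<cdot>tensor_power_arr M h n)"
  using gK co unfolding is_glue_def by (elim conjE, drule_tac spec, drule_tac spec, drule_tac mp) auto
 from theI'[OF this] show "Sym_arr M h\<in>Hom M (Carrier (Sym M ?K)) (Carrier (Sym M ?L))"
  "Sym_arr M h\<cdot>Sym_in M ?K n = Sym_in M ?L n\<cdot>tensor_power_arr M h n"
  unfolding Sym_arr_def by blast+
qed

end

section \<open>Symmetric families of arrows\<close>

text \<open>The action \<open>a\<close> of \<open>K\<close> on \<open>A\<close> abstracts from \<open>x \<otimes> y \<mapsto> x k(y)\<close> for a monoid \<open>A\<close>. Of associativity and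
 commutativity only \<open>a_comm\<close> remains: the actions of two elements of \<open>K\<close> commute.\<close>

locale attaching = closed_symmetric_monoidal M
 for M :: "('o, 'm, 'z) smcat_scheme" (structure) +
 fixes A :: 'o and h :: 'm and a :: 'm
 assumes A_obj [simp]: "A\<in>Obj M" and h_arr [simp]: "h\<in>Arr M"
  and a_arr [simp]: "a\<in>Arr M" "Dom M a = A\<otimes>Dom M h" "Cod M a = A"
  and a_comm: "a\<cdot>((a\<lhd>Dom M h)\<cdot>\<tau> A (Dom M h) (Dom M h)) = a\<cdot>(a\<lhd>Dom M h)"
begin

abbreviation K where "K \<equiv> Dom M h"
abbreviation L where "L \<equiv> Cod M h"
abbreviation W where "W w \<equiv> TL (cube_word M h w)"

text \<open>The product \<open>(A\<otimes>L)\<otimes>\<dots>\<otimes>L\<close> with \<open>j\<close> factors \<open>L\<close>. Bracketing to the left makes the action on \<open>A\<close> and the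
 passage from \<open>j\<close> to \<open>j + 1\<close> elementary.\<close>

primrec Bp :: "nat => 'o" where
 "Bp 0 = A"
| "Bp (Suc j) = Bp j\<otimes>L"

text \<open>The action of \<open>K\<close> on the factor \<open>A\<close> of \<open>Bp j\<close>; the new factor \<open>K\<close> is first moved past the factors \<open>L\<close>.\<close>

primrec act :: "nat => 'm" where
 "act 0 = a"
| "act (Suc j) = (act j\<lhd>L)\<cdot>\<tau> (Bp j) L K"

text \<open>The interchanges of adjacent factors \<open>L\<close> of \<open>Bp j\<close>.\<close>

inductive last_swap :: "nat => 'm => bool" where
 "last_swap (Suc (Suc j)) (\<tau> (Bp j) L L)"
| "last_swap j s ==> last_swap (Suc j) (s\<lhd>L)"

text \<open>The arrow on \<open>Bp j\<otimes>W w\<close> determined by a family \<open>g\<close>: a letter \<open>L\<close> of the word is absorbed into \<open>Bp j\<close>,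
 a letter \<open>K\<close> acts on \<open>A\<close>.\<close>

primrec contract :: "(nat => 'm) => bool list => nat => 'm" where
 "contract g [] j = g j\<cdot>\<rr> (Bp j)"
| "contract g (b # w) j = (if b then contract g w (Suc j)\<cdot>\<alpha>\<^sup>- (Bp j) L (W w)
   else contract g w j\<cdot>((act j\<lhd>W w)\<cdot>\<alpha>\<^sup>- (Bp j) K (W w)))"

text \<open>Symmetric families that are compatible with the attaching data, up to stage \<open>N\<close>.\<close>

definition family :: "nat => 'o => (nat => 'm) => bool" where
 "family N Z g \<longleftrightarrow> (\<forall>j\<le>N. g j\<in>Hom M (Bp j) Z \<and> (\<forall>s. last_swap j s --> g j\<cdot>s = g j)) \<and>
   (\<forall>j<N. g (Suc j)\<cdot>(Bp j\<rhd>h) = g j\<cdot>act j)"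

abbreviation trues :: "bool list => nat" where "trues w \<equiv> length (filter (\<lambda>b. b) w)"

lemma Bp_obj [simp]: "Bp j\<in>Obj M"
 by (induction j) auto

lemma act_arr [simp]: "act j\<in>Arr M" "Dom M (act j) = Bp j\<otimes>K" "Cod M (act j) = Bp j"
 by (induction j) auto

lemma cube_word_simps [simp]: "cube_word M h [] = []" "cube_word M h (b # w) = (if b then L else K) # cube_word M h w"
 "cube_word M h (v @ w) = cube_word M h v @ cube_word M h w"
 "length (cube_word M h w) = length w" "cube_word M h (replicate n b) = replicate n (if b then L else K)"
 by (auto simp: cube_word_def)

lemma cube_word_swap_at: "cube_word M h (swap_at i w) = swap_at i (cube_word M h w)"
 by (simp add: cube_word_def map_swap_at)

lemma set_cube_word [simp]: "set (cube_word M h w) \<subseteq> Obj M"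
 by (auto simp: cube_word_def)

lemma W_obj [simp]: "W w\<in>Obj M"
 by simp

lemma last_swap_arr: "last_swap j s ==> s\<in>Arr M \<and> Dom M s = Bp j \<and> Cod M s = Bp j"
 by (induction rule: last_swap.induct) auto

text \<open>By Yang-Baxter the interchange of the two factors \<open>K\<close> is carried past the factors \<open>L\<close> down to \<open>A\<close>,
 where it is absorbed by \<open>a_comm\<close>.\<close>

lemma act_comm: "act j\<cdot>((act j\<lhd>K)\<cdot>\<tau> (Bp j) K K) = act j\<cdot>(act j\<lhd>K)"
proof (induction j)
 case 0
 show ?case using a_comm by simp
next
 case (Suc j)
 let ?B = "Bp j"
 have n: "\<tau> ?B L K\<cdot>((act j\<lhd>L)\<lhd>K) = ((act j\<lhd>K)\<lhd>L)\<cdot>\<tau> (?B\<otimes>K) L K"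
  by (subst right_swap_nat) auto
 have m: "act (Suc j)\<cdot>(act (Suc j)\<lhd>K) =
   ((act j\<cdot>(act j\<lhd>K))\<lhd>L)\<cdot>(\<tau> (?B\<otimes>K) L K\<cdot>(\<tau> ?B L K\<lhd>K))"
 proof -
  have "act (Suc j)\<cdot>(act (Suc j)\<lhd>K) =
    (act j\<lhd>L)\<cdot>((\<tau> ?B L K\<cdot>((act j\<lhd>L)\<lhd>K))\<cdot>(\<tau> ?B L K\<lhd>K))" by simp
  then show ?thesis unfolding n by simp
 qed
 have "act (Suc j)\<cdot>((act (Suc j)\<lhd>K)\<cdot>\<tau> (Bp (Suc j)) K K) =
   (act (Suc j)\<cdot>(act (Suc j)\<lhd>K))\<cdot>\<tau> (?B\<otimes>L) K K" by simp
 also have "... = ((act j\<cdot>(act j\<lhd>K))\<lhd>L)\<cdot>(\<tau> (?B\<otimes>K) L K\<cdot>((\<tau> ?B L K\<lhd>K)\<cdot>\<tau> (?B\<otimes>L) K K))"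
  unfolding m by simp
 also have "... = ((act j\<cdot>(act j\<lhd>K))\<lhd>L)\<cdot>((\<tau> ?B K K\<lhd>L)\<cdot>(\<tau> (?B\<otimes>K) L K\<cdot>(\<tau> ?B L K\<lhd>K)))"
  by (subst yang_baxter) auto
 also have "... = ((act j\<cdot>((act j\<lhd>K)\<cdot>\<tau> ?B K K))\<lhd>L)\<cdot>(\<tau> (?B\<otimes>K) L K\<cdot>(\<tau> ?B L K\<lhd>K))"
  by simp
 also have "... = act (Suc j)\<cdot>(act (Suc j)\<lhd>K)" unfolding Suc m ..
 finally show ?case .
qed

lemma act_last_swap: "last_swap j s ==> act j\<cdot>(s\<lhd>K) = s\<cdot>act j"
proof (induction rule: last_swap.induct)
 case (1 j)
 let ?B = "Bp j"
 have "act (Suc (Suc j))\<cdot>(\<tau> ?B L L\<lhd>K) =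
   ((act j\<lhd>L)\<lhd>L)\<cdot>((\<tau> ?B L K\<lhd>L)\<cdot>(\<tau> (?B\<otimes>L) L K\<cdot>(\<tau> ?B L L\<lhd>K)))" by simp
 also have "... = ((act j\<lhd>L)\<lhd>L)\<cdot>(\<tau> (?B\<otimes>K) L L\<cdot>((\<tau> ?B L K\<lhd>L)\<cdot>\<tau> (?B\<otimes>L) L K))"
  by (subst yang_baxter) auto
 also have "... = (((act j\<lhd>L)\<lhd>L)\<cdot>\<tau> (?B\<otimes>K) L L)\<cdot>((\<tau> ?B L K\<lhd>L)\<cdot>\<tau> (?B\<otimes>L) L K)" by simp
 also have "... = (\<tau> ?B L L\<cdot>((act j\<lhd>L)\<lhd>L))\<cdot>((\<tau> ?B L K\<lhd>L)\<cdot>\<tau> (?B\<otimes>L) L K)"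
  by (subst right_swap_nat) auto
 also have "... = \<tau> ?B L L\<cdot>act (Suc (Suc j))" by simp
 finally show ?case .
next
 case (2 j s)
 note s = last_swap_arr[OF 2(1)]
 have "act (Suc j)\<cdot>((s\<lhd>L)\<lhd>K) = (act j\<lhd>L)\<cdot>(\<tau> (Bp j) L K\<cdot>((s\<lhd>L)\<lhd>K))"
  using s by simp
 also have "... = ((act j\<cdot>(s\<lhd>K))\<lhd>L)\<cdot>\<tau> (Bp j) L K"
  using s by (subst right_swap_nat) auto
 also have "... = (s\<lhd>L)\<cdot>act (Suc j)" unfolding 2 using s by simp
 finally show ?case .
qed

lemma familyD:
 assumes "family N Z g"
 shows "j \<le> N ==> g j\<in>Arr M" "j \<le> N ==> Dom M (g j) = Bp j" "j \<le> N ==> Cod M (g j) = Z"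
  "j \<le> N ==> last_swap j s ==> g j\<cdot>s = g j" "j < N ==> g (Suc j)\<cdot>(Bp j\<rhd>h) = g j\<cdot>act j"
 using assms unfolding family_def by auto

lemma contract_arr:
 assumes g: "\<And>j. j \<le> N ==> g j\<in>Arr M \<and> Dom M (g j) = Bp j \<and> Cod M (g j) = Z" and "j + trues w \<le> N"
 shows "contract g w j\<in>Arr M" "Dom M (contract g w j) = Bp j\<otimes>W w" "Cod M (contract g w j) = Z"
proof -
 have "contract g w j\<in>Arr M \<and> Dom M (contract g w j) = Bp j\<otimes>W w \<and> Cod M (contract g w j) = Z"
  using assms(2)
 proof (induction w arbitrary: j)
  case Nil
  then show ?case using g[of j] by simp
 next
  case (Cons b w)
  show ?case
  proof (cases b)
   case True
   then show ?thesis using Cons.IH[of "Suc j"] Cons.prems by simp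
  next
   case False
   then show ?thesis using Cons.IH[of j] Cons.prems by simp
  qed
 qed
 then show "contract g w j\<in>Arr M" "Dom M (contract g w j) = Bp j\<otimes>W w" "Cod M (contract g w j) = Z" by auto
qed

lemma family_contract_arr:
 assumes "family N Z g" "j + trues w \<le> N"
 shows "contract g w j\<in>Arr M" "Dom M (contract g w j) = Bp j\<otimes>W w" "Cod M (contract g w j) = Z"
 using contract_arr[of N g Z j w] familyD(1-3)[OF assms(1)] assms(2) by auto

text \<open>Symmetry in the factors already absorbed persists when further letters are contracted.\<close>

lemma contract_swap:
 assumes f: "family N Z g" and "j + trues w \<le> N" "last_swap j s"
 shows "contract g w j\<cdot>(s\<lhd>W w) = contract g w j"
 using assms(2,3)
proof (induction w arbitrary: j s)
 case Nil
 then have j: "j \<le> N" by simp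
 note s = last_swap_arr[OF Nil(2)] and g = familyD(1-3)[OF f j]
 have "contract g [] j\<cdot>(s\<lhd>(W [])) = (g j\<cdot>s)\<cdot>\<rr> (Bp j)" using s g by simp
 then show ?case using familyD(4)[OF f j Nil(2)] by simp
next
 case (Cons b w)
 note s = last_swap_arr[OF Cons(3)]
 show ?case
 proof (cases b)
  case True
  then have jw: "Suc j + trues w \<le> N" using Cons by simp
  note m = family_contract_arr[OF f jw]
  have "contract g (b # w) j\<cdot>(s\<lhd>(W (b # w))) =
    (contract g w (Suc j)\<cdot>((s\<lhd>L)\<lhd>W w))\<cdot>\<alpha>\<^sup>- (Bp j) L (W w)"
   using True s m by simp
  then show ?thesis using Cons.IH[OF jw last_swap.intros(2)[OF Cons(3)]] True by simp
 next
  case False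
  then have jw: "j + trues w \<le> N" using Cons by simp
  note m = family_contract_arr[OF f jw]
  have "contract g (b # w) j\<cdot>(s\<lhd>(W (b # w))) =
    contract g w j\<cdot>(((act j\<cdot>(s\<lhd>K))\<lhd>W w)\<cdot>\<alpha>\<^sup>- (Bp j) K (W w))"
   using False s m by simp
  also have "... = (contract g w j\<cdot>(s\<lhd>W w))\<cdot>((act j\<lhd>W w)\<cdot>\<alpha>\<^sup>- (Bp j) K (W w))"
   unfolding act_last_swap[OF Cons(3)] using s m by simp
  finally show ?thesis using Cons.IH[OF jw Cons(3)] False by simp
 qed
qed

text \<open>The factor \<open>L\<close> which comes from \<open>K\<close> through \<open>h\<close> need not be the last one absorbed; by symmetry of the
 family it can be moved there.\<close>

lemma contract_act:
 assumes f: "family N Z g" and "Suc j + trues w \<le> N"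
 shows "contract g w (Suc j)\<cdot>((Bp j\<rhd>h)\<lhd>W w) = contract g w j\<cdot>(act j\<lhd>W w)"
 using assms(2)
proof (induction w arbitrary: j)
 case Nil
 then have jN: "Suc j \<le> N" "j \<le> N" "j < N" by auto
 note g = familyD(1-3)[OF f jN(1)] familyD(1-3)[OF f jN(2)]
 have "contract g [] (Suc j)\<cdot>((Bp j\<rhd>h)\<lhd>(W [])) =
   (g (Suc j)\<cdot>(Bp j\<rhd>h))\<cdot>\<rr> (Bp j\<otimes>K)" using g by simp
 then show ?case unfolding familyD(5)[OF f jN(3)] using g by simp
next
 case (Cons b w)
 let ?B = "Bp j" and ?w = "W w"
 show ?case
 proof (cases b)
  case True
  then have jw: "Suc (Suc j) + trues w \<le> N" "Suc j + trues w \<le> N" using Cons by auto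
  note m = family_contract_arr[OF f jw(1)] family_contract_arr[OF f jw(2)]
  have "contract g (b # w) (Suc j)\<cdot>((?B\<rhd>h)\<lhd>(W (b # w))) =
    contract g w (Suc (Suc j))\<cdot>((((?B\<rhd>h)\<lhd>L)\<lhd>?w)\<cdot>\<alpha>\<^sup>- (?B\<otimes>K) L ?w)"
   using True m by simp
  \<comment> \<open>The last two factors \<open>L\<close> are interchanged so that \<open>h\<close> acts on the last one.\<close>
  also have "... = (contract g w (Suc (Suc j))\<cdot>(\<tau> ?B L L\<lhd>?w)) \<cdot>
    ((((?B\<rhd>h)\<lhd>L)\<lhd>?w)\<cdot>\<alpha>\<^sup>- (?B\<otimes>K) L ?w)"
   using contract_swap[OF f jw(1) last_swap.intros(1)] by simp
  also have "... = contract g w (Suc (Suc j))\<cdot>(((\<tau> ?B L L\<cdot>((?B\<rhd>h)\<lhd>L))\<lhd>?w)\<cdot>\<alpha>\<^sup>- (?B\<otimes>K) L ?w)"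
   using m by simp
  also have "... = contract g w (Suc (Suc j))\<cdot>(((((?B\<rhd>\<i>\<d> L)\<odot>h)\<cdot>\<tau> ?B K L)\<lhd>?w)\<cdot>\<alpha>\<^sup>- (?B\<otimes>K) L ?w)"
   by (subst right_swap_nat) auto
  also have "... = (contract g w (Suc (Suc j))\<cdot>(((Bp (Suc j))\<rhd>h)\<lhd>?w)) \<cdot>
    ((\<tau> ?B K L\<lhd>?w)\<cdot>\<alpha>\<^sup>- (?B\<otimes>K) L ?w)"
   using m by simp
  also have "... = (contract g w (Suc j)\<cdot>(act (Suc j)\<lhd>?w))\<cdot>((\<tau> ?B K L\<lhd>?w)\<cdot>\<alpha>\<^sup>- (?B\<otimes>K) L ?w)"
   using Cons.IH[OF jw(1)] by simp
  also have "... = contract g (b # w) j\<cdot>(act j\<lhd>(W (b # w)))"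
   using True m by simp
  finally show ?thesis .
 next
  case False
  then have jw: "Suc j + trues w \<le> N" "j + trues w \<le> N" using Cons by auto
  note m = family_contract_arr[OF f jw(1)] family_contract_arr[OF f jw(2)]
  have "contract g (b # w) (Suc j)\<cdot>((?B\<rhd>h)\<lhd>(W (b # w))) =
    contract g w (Suc j)\<cdot>(((act j\<lhd>L)\<lhd>?w)\<cdot>(((\<tau> ?B L K\<cdot>((?B\<rhd>h)\<lhd>K))\<lhd>?w) \<cdot>
     \<alpha>\<^sup>- (?B\<otimes>K) K ?w))"
   using False m by simp
  also have "... = contract g w (Suc j)\<cdot>(((act j\<lhd>L)\<lhd>?w)\<cdot>(((((?B\<rhd>\<i>\<d> K)\<odot>h)\<cdot>\<tau> ?B K K)\<lhd>?w) \<cdot>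
     \<alpha>\<^sup>- (?B\<otimes>K) K ?w))"
   by (subst right_swap_nat) auto
  also have "... = (contract g w (Suc j)\<cdot>((?B\<rhd>h)\<lhd>?w)) \<cdot>
    ((((act j\<lhd>K)\<cdot>\<tau> ?B K K)\<lhd>?w)\<cdot>\<alpha>\<^sup>- (?B\<otimes>K) K ?w)"
   using m by simp
  also have "... = (contract g w j\<cdot>(act j\<lhd>?w)) \<cdot>
    ((((act j\<lhd>K)\<cdot>\<tau> ?B K K)\<lhd>?w)\<cdot>\<alpha>\<^sup>- (?B\<otimes>K) K ?w)"
   using Cons.IH[OF jw(1)] by simp
  also have "... = contract g w j\<cdot>(((act j\<cdot>((act j\<lhd>K)\<cdot>\<tau> ?B K K))\<lhd>?w)\<cdot>\<alpha>\<^sup>- (?B\<otimes>K) K ?w)"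
   using m by simp
  also have "... = contract g (b # w) j\<cdot>(act j\<lhd>(W (b # w)))"
   unfolding act_comm using False m by simp
  finally show ?thesis .
 qed
qed

lemma cube_arr_simps [simp]:
 "cube_arr M h ([], []) = \<i>\<d> \<one>"
 "cube_arr M h (x # v, y # w) = (if x then \<i>\<d> L else if y then h else \<i>\<d> K)\<odot>cube_arr M h (v, w)"
 by (auto simp: cube_arr_def)

lemma cube_arr_arr:
 assumes "list_all2 (-->) v w"
 shows "cube_arr M h (v, w)\<in>Arr M" "Dom M (cube_arr M h (v, w)) = W v" "Cod M (cube_arr M h (v, w)) = W w"
 using assms by (induction rule: list_all2_induct) auto

text \<open>Contractions are compatible with the arrows of the cube: replacing a letter \<open>K\<close> by \<open>L\<close> along \<open>h\<close> is
 \<open>contract_act\<close>.\<close>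

lemma contract_cube:
 assumes f: "family N Z g" and "list_all2 (-->) v w" "j + trues w \<le> N"
 shows "contract g w j\<cdot>(Bp j\<rhd>cube_arr M h (v, w)) = contract g v j"
 using assms(2,3)
proof (induction v w arbitrary: j rule: list_all2_induct)
 case Nil
 then have "j \<le> N" by simp
 then show ?case using familyD(1-3)[OF f, of j] by simp
next
 case (Cons x v y w)
 note c = cube_arr_arr[OF Cons(2)]
 let ?c = "cube_arr M h (v, w)" and ?B = "Bp j"
 consider "x" "y" | "\<not> x" "y" | "\<not> x" "\<not> y" using Cons(1) by blast
 then show ?case
 proof cases
  case 1
  then have jw: "Suc j + trues w \<le> N" using Cons by simp
  note m = family_contract_arr[OF f jw]
  have "contract g (y # w) j\<cdot>(?B\<rhd>cube_arr M h (x # v, y # w)) =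
    (contract g w (Suc j)\<cdot>((Bp (Suc j))\<rhd>?c))\<cdot>\<alpha>\<^sup>- ?B L (W v)"
   using 1 c m by simp
  then show ?thesis using Cons.IH[OF jw] 1 by simp
 next
  case 2
  then have jw: "Suc j + trues w \<le> N" "j + trues w \<le> N" using Cons by auto
  note m = family_contract_arr[OF f jw(1)] family_contract_arr[OF f jw(2)]
  have "contract g (y # w) j\<cdot>(?B\<rhd>cube_arr M h (x # v, y # w)) =
    (contract g w (Suc j)\<cdot>((?B\<rhd>h)\<lhd>W w))\<cdot>(((?B\<otimes>K)\<rhd>?c)\<cdot>\<alpha>\<^sup>- ?B K (W v))"
   using 2 c m by simp
  also have "... = (contract g w j\<cdot>(?B\<rhd>?c))\<cdot>((act j\<lhd>W v)\<cdot>\<alpha>\<^sup>- ?B K (W v))"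
   unfolding contract_act[OF f jw(1)] using c m by simp
  finally show ?thesis using Cons.IH[OF jw(2)] 2 by simp
 next
  case 3
  then have jw: "j + trues w \<le> N" using Cons by simp
  note m = family_contract_arr[OF f jw]
  have "contract g (y # w) j\<cdot>(?B\<rhd>cube_arr M h (x # v, y # w)) =
    (contract g w j\<cdot>(?B\<rhd>?c))\<cdot>((act j\<lhd>W v)\<cdot>\<alpha>\<^sup>- ?B K (W v))"
   using 3 c m by simp
  then show ?thesis using Cons.IH[OF jw] 3 by simp
 qed
qed

lemma trues_swap_at [simp]: "trues (swap_at i w) = trues w"
 by (induction i w rule: swap_at.induct) auto

text \<open>There are four cases for the two letters: two letters \<open>L\<close> by symmetry of \<open>g\<close>, two letters \<open>K\<close> because the
 actions commute, and the mixed ones by the definition of \<open>act\<close>.\<close>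

lemma contract_adj:
 assumes f: "family N Z g" and "Suc i < length w" "j + trues w \<le> N"
 shows "contract g (swap_at i w) j\<cdot>(Bp j\<rhd>adj_iso M (cube_word M h w) i) = contract g w j"
 using assms(2,3)
proof (induction i w arbitrary: j rule: swap_at.induct)
 case (1 x y w)
 let ?B = "Bp j" and ?w = "W w" and ?X = "if x then L else K" and ?Y = "if y then L else K"
 let ?e = "\<alpha> ?B ?X (?Y\<otimes>?w)\<cdot>\<alpha> (?B\<otimes>?X) ?Y ?w"
 have o: "?X\<in>Obj M" "?Y\<in>Obj M" by auto
 have jw: "j + trues (x # y # w) \<le> N" "j + trues (y # x # w) \<le> N" using 1 by auto
 note m = family_contract_arr[OF f jw(1)] family_contract_arr[OF f jw(2)]
 have m': "contract g (y # x # w) j\<cdot>(\<alpha> ?B ?Y (?X\<otimes>?w)\<cdot>(\<alpha> (?B\<otimes>?Y) ?X ?w\<cdot>(\<tau> ?B ?X ?Y\<lhd>?w))) =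
   contract g (x # y # w) j\<cdot>?e"
 proof -
  consider "x" "y" | "\<not> x" "y" | "x" "\<not> y" | "\<not> x" "\<not> y" by blast
  then show ?thesis
  proof cases
   case 1
   then have k: "Suc (Suc j) + trues w \<le> N" using jw by simp
   show ?thesis using 1 family_contract_arr[OF f k] contract_swap[OF f k last_swap.intros(1)] by simp
  next
   case 2
   then have k: "Suc j + trues w \<le> N" using jw by simp
   show ?thesis using 2 family_contract_arr[OF f k] by simp
  next
   case 3
   then have k: "Suc j + trues w \<le> N" using jw by simp
   show ?thesis using 3 family_contract_arr[OF f k] by simp
  next
   case 4
   then have k: "j + trues w \<le> N" using jw by simp
   show ?thesis using 4 family_contract_arr[OF f k] act_comm[of j] by simp
  qed
 qed
 show ?case
 proof (rule iso_cancel_right[of _ ?e])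
  have "(contract g (swap_at 0 (x # y # w)) j\<cdot>(?B\<rhd>adj_iso M (cube_word M h (x # y # w)) 0))\<cdot>?e =
    contract g (y # x # w) j\<cdot>((?B\<rhd>exchange M ?X ?Y ?w)\<cdot>?e)"
   using m o by (simp del: contract.simps)
  also have "... = contract g (x # y # w) j\<cdot>?e"
   by (subst exchange_right_swap) (use o m' in \<open>auto simp del: contract.simps\<close>)
  finally show "(contract g (swap_at 0 (x # y # w)) j\<cdot>(?B\<rhd>adj_iso M (cube_word M h (x # y # w)) 0))\<cdot>?e =
   contract g (x # y # w) j\<cdot>?e" .
 qed (use m o in \<open>auto simp del: contract.simps\<close>)
next
 case (2 i x w)
 have l: "Suc i < length w" using 2 by simp
 have l': "Suc i < length (cube_word M h w)" using l by simp
 note ad = adj_iso_arr[OF set_cube_word l']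
 let ?B = "Bp j" and ?t = "adj_iso M (cube_word M h w) i"
 have c: "tensor_list M (swap_at i (cube_word M h w)) = W (swap_at i w)" by (simp add: cube_word_swap_at)
 show ?case
 proof (cases x)
  case True
  then have jw: "Suc j + trues w \<le> N" "Suc j + trues (swap_at i w) \<le> N" using 2 by auto
  note m = family_contract_arr[OF f jw(1)] family_contract_arr[OF f jw(2)]
  have "contract g (swap_at (Suc i) (x # w)) j\<cdot>(?B\<rhd>adj_iso M (cube_word M h (x # w)) (Suc i)) =
    (contract g (swap_at i w) (Suc j)\<cdot>((Bp (Suc j))\<rhd>?t))\<cdot>\<alpha>\<^sup>- ?B L (W w)"
   using True m ad c by simp
  then show ?thesis using 2(1)[OF l jw(1)] True by simp
 next
  case False
  then have jw: "j + trues w \<le> N" "j + trues (swap_at i w) \<le> N" using 2 by auto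
  note m = family_contract_arr[OF f jw(1)] family_contract_arr[OF f jw(2)]
  have "contract g (swap_at (Suc i) (x # w)) j\<cdot>(?B\<rhd>adj_iso M (cube_word M h (x # w)) (Suc i)) =
    (contract g (swap_at i w) j\<cdot>(?B\<rhd>?t))\<cdot>((act j\<lhd>W w)\<cdot>\<alpha>\<^sup>- ?B K (W w))"
   using False m ad c by simp
  then show ?thesis using 2(1)[OF l jw(1)] False by simp
 qed
qed auto

lemma contract_post:
 assumes "\<And>j. j \<le> N ==> g j\<in>Arr M \<and> Dom M (g j) = Bp j \<and> Cod M (g j) = Z"
  and p: "p\<in>Arr M" "Dom M p = Z" and "\<And>j. j \<le> N ==> p\<cdot>g j = g' j" "j + trues w \<le> N"
 shows "p\<cdot>contract g w j = contract g' w j"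
 using assms(5)
proof (induction w arbitrary: j)
 case Nil
 then have j: "j \<le> N" by simp
 have "p\<cdot>contract g [] j = (p\<cdot>g j)\<cdot>\<rr> (Bp j)" using assms(1)[OF j] p by simp
 then show ?case using assms(4)[OF j] by simp
next
 case (Cons b w)
 show ?case
 proof (cases b)
  case True
  then have jw: "Suc j + trues w \<le> N" using Cons by simp
  have "p\<cdot>contract g (b # w) j = (p\<cdot>contract g w (Suc j))\<cdot>\<alpha>\<^sup>- (Bp j) L (W w)"
   using contract_arr[OF assms(1) jw] True p by simp
  then show ?thesis using Cons.IH[OF jw] True by simp
 next
  case False
  then have jw: "j + trues w \<le> N" using Cons by simp
  have "p\<cdot>contract g (b # w) j = (p\<cdot>contract g w j)\<cdot>((act j\<lhd>W w)\<cdot>\<alpha>\<^sup>- (Bp j) K (W w))"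
   using contract_arr[OF assms(1) jw] False p by simp
  then show ?thesis using Cons.IH[OF jw] False by simp
 qed
qed

end

context attaching
begin

text \<open>The isomorphism \<open>Bp j\<otimes>L\<^sup>n \<cong> Bp (j + n)\<close> between right- and left-bracketed products.\<close>

primrec flat :: "nat => nat => 'm" where
 "flat 0 j = \<rr> (Bp j)"
| "flat (Suc n) j = flat n (Suc j)\<cdot>\<alpha>\<^sup>- (Bp j) L (tensor_power M L n)"

text \<open>The same for a word that ends with one letter \<open>K\<close>; this is the vertex of the punctured cube on which the
 compatibility of the new term of a family is tested.\<close>

primrec bump :: "nat => nat => 'm" where
 "bump 0 j = \<rr> (Bp j\<otimes>K)\<cdot>\<alpha>\<^sup>- (Bp j) K \<one>"
| "bump (Suc n) j = bump n (Suc j)\<cdot>\<alpha>\<^sup>- (Bp j) L (W (replicate n True @ [False]))"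

text \<open>An endomorphism of \<open>Bp j\<close> is extended by the identity of \<open>m\<close> further factors \<open>L\<close>.\<close>

primrec stab :: "nat => 'm => 'm" where
 "stab 0 s = s"
| "stab (Suc m) s = stab m (s\<lhd>L)"

lemma flat_arr [simp]: "flat n j\<in>Arr M" "Dom M (flat n j) = Bp j\<otimes>tensor_power M L n"
 "Cod M (flat n j) = Bp (j + n)" "is_iso M (flat n j)"
 by (induction n arbitrary: j) auto

lemma bump_arr [simp]: "bump n j\<in>Arr M" "Dom M (bump n j) = Bp j\<otimes>W (replicate n True @ [False])"
 "Cod M (bump n j) = Bp (j + n)\<otimes>K" "is_iso M (bump n j)"
proof -
 have [simp]: "TL (replicate m L @ [K])\<in>Obj M" for m by (rule TL_obj) auto
 show "bump n j\<in>Arr M" "Dom M (bump n j) = Bp j\<otimes>W (replicate n True @ [False])"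
 "Cod M (bump n j) = Bp (j + n)\<otimes>K" "is_iso M (bump n j)"
  by (induction n arbitrary: j) auto
qed

lemma stab_Suc: "stab m s\<lhd>L = stab (Suc m) s"
 by (induction m arbitrary: s) auto

lemma stab_arr:
 "s\<in>Arr M ==> Dom M s = Bp j ==> Cod M s = Bp j ==>
   stab m s\<in>Arr M \<and> Dom M (stab m s) = Bp (j + m) \<and> Cod M (stab m s) = Bp (j + m)"
proof (induction m arbitrary: s j)
 case (Suc m)
 then show ?case using Suc.IH[of "s\<lhd>L" "Suc j"] by simp
qed simp

lemma flat_nat:
 assumes "s\<in>Arr M" "Dom M s = Bp j" "Cod M s = Bp j"
 shows "flat n j\<cdot>(s\<lhd>tensor_power M L n) = stab n s\<cdot>flat n j"
 using assms
proof (induction n arbitrary: s j)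
 case (Suc n)
 have "flat (Suc n) j\<cdot>(s\<lhd>(tensor_power M L (Suc n))) =
   (flat n (Suc j)\<cdot>((s\<lhd>L)\<lhd>tensor_power M L n))\<cdot>\<alpha>\<^sup>- (Bp j) L (tensor_power M L n)"
  using Suc.prems by simp
 also have "... = (stab n (s\<lhd>L)\<cdot>flat n (Suc j))\<cdot>\<alpha>\<^sup>- (Bp j) L (tensor_power M L n)"
  using Suc.IH[of "s\<lhd>L" "Suc j"] Suc.prems by simp
 finally show ?case using stab_arr[of "s\<lhd>L" "Suc j" n] Suc.prems by simp
qed simp

text \<open>The translation of interchanges between the two bracketings.\<close>

lemma flat_adj:
 "flat (Suc (Suc (i + m))) j\<cdot>(Bp j\<rhd>adj_iso M (replicate (Suc (Suc (i + m))) L) i) =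
   stab m (\<tau> (Bp (j + i)) L L)\<cdot>flat (Suc (Suc (i + m))) j"
proof (induction i arbitrary: j)
 case 0
 let ?w = "tensor_power M L m" and ?B = "Bp j"
 let ?e = "\<alpha> ?B L (L\<otimes>?w)\<cdot>\<alpha> (?B\<otimes>L) L ?w"
 note s = stab_arr[of "\<tau> ?B L L" "Suc (Suc j)" m]
 have "(flat (Suc (Suc m)) j\<cdot>(?B\<rhd>exchange M L L ?w))\<cdot>?e =
   flat (Suc (Suc m)) j\<cdot>((?B\<rhd>exchange M L L ?w)\<cdot>?e)" by simp
 also have "... = flat m (Suc (Suc j))\<cdot>(\<tau> ?B L L\<lhd>?w)"
  by (subst exchange_right_swap) auto
 also have "... = stab m (\<tau> ?B L L)\<cdot>flat m (Suc (Suc j))" by (rule flat_nat) auto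
 also have "... = (stab m (\<tau> ?B L L)\<cdot>flat (Suc (Suc m)) j)\<cdot>?e" using s by simp
 finally have "(flat (Suc (Suc m)) j\<cdot>(?B\<rhd>exchange M L L ?w))\<cdot>?e =
   (stab m (\<tau> ?B L L)\<cdot>flat (Suc (Suc m)) j)\<cdot>?e" .
 then have "flat (Suc (Suc m)) j\<cdot>(?B\<rhd>exchange M L L ?w) = stab m (\<tau> ?B L L)\<cdot>flat (Suc (Suc m)) j"
  by (rule iso_cancel_right) (use s in auto)
 then show ?case by simp
next
 case (Suc i)
 let ?n = "Suc (Suc (i + m))" and ?s = "stab m (\<tau> (Bp (j + Suc i)) L L)"
 have s: "?s\<in>Arr M" "Dom M ?s = Bp (Suc (Suc (j + Suc i)) + m)" 
  using stab_arr[of "\<tau> (Bp (j + Suc i)) L L" "Suc (Suc (j + Suc i))" m] by auto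
 have "set (replicate ?n L) \<subseteq> Obj M" by auto
 note ad = adj_iso_arr[OF this, of i]
 let ?a = "adj_iso M (replicate ?n L) i"
 have ad: "?a\<in>Arr M" "Dom M ?a = tensor_power M L ?n" "Cod M ?a = tensor_power M L ?n"
  using ad by (auto simp del: replicate_Suc)
 have "flat (Suc ?n) j\<cdot>(Bp j\<rhd>(L\<rhd>?a)) =
   (flat ?n (Suc j)\<cdot>((Bp (Suc j))\<rhd>?a))\<cdot>\<alpha>\<^sup>- (Bp j) L (tensor_power M L ?n)"
  unfolding flat.simps(2)[of ?n] using ad by (simp del: flat.simps replicate_Suc tensor_list.simps)
 also have "... = ?s\<cdot>flat (Suc ?n) j"
  unfolding Suc[of "Suc j"] flat.simps(2)[of ?n] using s
  by (simp del: flat.simps replicate_Suc tensor_list.simps add: add.assoc)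
 finally show ?case by (simp del: flat.simps)
qed

lemma last_swap_form:
 "last_swap n s ==> \<exists>i m. n = Suc (Suc (i + m)) \<and> s = stab m (\<tau> (Bp i) L L)"
proof (induction rule: last_swap.induct)
 case (1 j)
 then show ?case by (intro exI[of _ j] exI[of _ 0]) simp
next
 case (2 j s)
 then obtain i m where "j = Suc (Suc (i + m))" "s = stab m (\<tau> (Bp i) L L)" by blast
 then show ?case by (intro exI[of _ i] exI[of _ "Suc m"]) (simp add: stab_Suc)
qed

text \<open>Invariance under interchanges of right-bracketed tensor words is invariance under interchanges
 of the factors of \<open>Bp n\<close>.\<close>

lemma last_swap_invariant:
 assumes g: "g\<in>Arr M" "Dom M g = Bp n"
  and inv: "\<And>i. Suc i < n ==> (g\<cdot>flat n 0)\<cdot>(A\<rhd>adj_iso M (replicate n L) i) = g\<cdot>flat n 0"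
  and s: "last_swap n s"
 shows "g\<cdot>s = g"
proof (rule iso_cancel_right[of _ "flat n 0"])
 obtain i m where n: "n = Suc (Suc (i + m))" and s': "s = stab m (\<tau> (Bp i) L L)" using last_swap_form[OF s] by blast
 note S = last_swap_arr[OF s]
 have "set (replicate n L) \<subseteq> Obj M" by auto
 note ad = adj_iso_arr[OF this, of i]
 have i: "Suc i < n" using n by simp
 have "(g\<cdot>s)\<cdot>flat n 0 = g\<cdot>(s\<cdot>flat n 0)" using g S by simp
 also have "s\<cdot>flat n 0 = flat n 0\<cdot>(A\<rhd>adj_iso M (replicate n L) i)"
  using flat_adj[of i m 0] unfolding n[symmetric] s' by simp
 also have "g\<cdot>(flat n 0\<cdot>(A\<rhd>adj_iso M (replicate n L) i)) =
   (g\<cdot>flat n 0)\<cdot>(A\<rhd>adj_iso M (replicate n L) i)"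
  using g ad i by simp
 finally show "(g\<cdot>s)\<cdot>flat n 0 = g\<cdot>flat n 0" using inv[OF i] by simp
qed (use g last_swap_arr[OF s] in auto)

text \<open>On the terminal vertex of the cube the contraction is the term of the family itself.\<close>

lemma contract_trues:
 assumes "g (j + n)\<in>Arr M" "Dom M (g (j + n)) = Bp (j + n)"
 shows "contract g (replicate n True) j = g (j + n)\<cdot>flat n j"
 using assms by (induction n arbitrary: j) auto

lemma contract_bump:
 assumes "g (j + n)\<in>Arr M" "Dom M (g (j + n)) = Bp (j + n)"
 shows "contract g (replicate n True @ [False]) j = g (j + n)\<cdot>(act (j + n)\<cdot>bump n j)"
 using assms
proof (induction n arbitrary: j)
 case 0
 then show ?case by simp
next
 case (Suc n)
 have [simp]: "TL (replicate m L @ [K])\<in>Obj M" for m by (rule TL_obj) auto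
 show ?case using Suc.IH[of "Suc j"] Suc.prems bump_arr[of n "Suc j"] by simp
qed

lemma flat_bump:
 "flat (Suc n) j\<cdot>(Bp j\<rhd>cube_arr M h (replicate n True @ [False], replicate (Suc n) True)) =
   ((Bp (j + n))\<rhd>h)\<cdot>bump n j"
proof (induction n arbitrary: j)
 case 0
 then show ?case by simp
next
 case (Suc n)
 let ?c = "cube_arr M h (replicate n True @ [False], replicate (Suc n) True)" and ?w = "replicate n True @ [False]"
 have "list_all2 (-->) ?w (replicate (Suc n) True)"
  by (auto simp: list_all2_conv_all_nth simp del: replicate_Suc)
 note c = cube_arr_arr[OF this]
 have [simp]: "TL (replicate m L @ [K])\<in>Obj M" for m by (rule TL_obj) auto
 have "flat (Suc (Suc n)) j\<cdot>(Bp j\<rhd>cube_arr M h (replicate (Suc n) True @ [False], replicate (Suc (Suc n)) True)) =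
   flat (Suc n) (Suc j)\<cdot>(\<alpha>\<^sup>- (Bp j) L (tensor_power M L (Suc n))\<cdot>(Bp j\<rhd>(L\<rhd>?c)))"
  using c unfolding flat.simps(2)[of "Suc n"] by (simp del: flat.simps)
 also have "... = (flat (Suc n) (Suc j)\<cdot>((Bp (Suc j))\<rhd>?c))\<cdot>\<alpha>\<^sup>- (Bp j) L (W ?w)"
  using c by (simp del: flat.simps)
 also have "... = ((Bp (j + Suc n))\<rhd>h)\<cdot>bump (Suc n) j"
  unfolding Suc[of "Suc j"] using bump_arr[of n "Suc j"] by simp
 finally show ?case .
qed

text \<open>Absorbing one more factor at the end; this computes the product with a generator of \<open>Sym L\<close>.\<close>

lemma flat_append:
 "flat (Suc n) j\<cdot>((Bp j\<rhd>append_iso M (replicate n L) [L])\<cdot>\<alpha> (Bp j) (tensor_power M L n) (L\<otimes>\<one>)) =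
   flat n j\<odot>\<rr> L"
proof (induction n arbitrary: j)
 case 0
 have "\<rr> (Bp j\<otimes>L)\<cdot>\<alpha>\<^sup>- (Bp j) L \<one> = Bp j\<rhd>\<rr> L"
  by (simp add: runit_tensor[symmetric])
 then have "flat (Suc 0) j\<cdot>((Bp j\<rhd>append_iso M (replicate 0 L) [L])\<cdot>\<alpha> (Bp j) \<one> (L\<otimes>\<one>)) =
   (Bp j\<rhd>\<rr> L)\<cdot>((Bp j\<rhd>\<ll> (L\<otimes>\<one>))\<cdot>\<alpha> (Bp j) \<one> (L\<otimes>\<one>))" by simp
 also have "... = flat 0 j\<odot>\<rr> L" by (subst triangle) auto
 finally show ?case by simp
next
 case (Suc n)
 let ?B = "Bp j" and ?w = "tensor_power M L n" and ?u = "L\<otimes>\<one>"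
 let ?a = "append_iso M (replicate n L) [L]"
 have P: "set (replicate n L) \<subseteq> Obj M" "set [L] \<subseteq> Obj M" by auto
 note ap = append_iso_arr(1,2)[OF P]
 have ap': "Cod M ?a = L\<otimes>?w" using append_iso_arr(3)[OF P] by (simp add: replicate_append_same)
 have "\<alpha>\<^sup>- ?B L (?w\<otimes>?u)\<cdot>((?B\<rhd>\<alpha> L ?w ?u)\<cdot>\<alpha> ?B (L\<otimes>?w) ?u) =
   \<alpha> (?B\<otimes>L) ?w ?u\<cdot>(\<alpha>\<^sup>- ?B L ?w\<lhd>?u)"
 proof (rule iso_cancel_right[of _ "\<alpha> ?B L ?w\<lhd>?u"])
  have "(\<alpha>\<^sup>- ?B L (?w\<otimes>?u)\<cdot>((?B\<rhd>\<alpha> L ?w ?u)\<cdot>\<alpha> ?B (L\<otimes>?w) ?u))\<cdot>(\<alpha> ?B L ?w\<lhd>?u) =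
    \<alpha>\<^sup>- ?B L (?w\<otimes>?u)\<cdot>((?B\<rhd>\<alpha> L ?w ?u)\<cdot>(\<alpha> ?B (L\<otimes>?w) ?u\<cdot>(\<alpha> ?B L ?w\<lhd>?u)))" by simp
  also have "... = (\<alpha> (?B\<otimes>L) ?w ?u\<cdot>(\<alpha>\<^sup>- ?B L ?w\<lhd>?u))\<cdot>(\<alpha> ?B L ?w\<lhd>?u)"
   by (subst pentagon3) auto
  finally show "(\<alpha>\<^sup>- ?B L (?w\<otimes>?u)\<cdot>((?B\<rhd>\<alpha> L ?w ?u)\<cdot>\<alpha> ?B (L\<otimes>?w) ?u))\<cdot>(\<alpha> ?B L ?w\<lhd>?u) =
   (\<alpha> (?B\<otimes>L) ?w ?u\<cdot>(\<alpha>\<^sup>- ?B L ?w\<lhd>?u))\<cdot>(\<alpha> ?B L ?w\<lhd>?u)" .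
 qed auto
 note pent = this
 have "flat (Suc (Suc n)) j\<cdot>((?B\<rhd>append_iso M (replicate (Suc n) L) [L])\<cdot>\<alpha> ?B (tensor_power M L (Suc n)) ?u) =
   flat (Suc n) (Suc j)\<cdot>(\<alpha>\<^sup>- ?B L (tensor_power M L (Suc n))\<cdot>((?B\<rhd>(L\<rhd>?a)) \<cdot>
    ((?B\<rhd>\<alpha> L ?w ?u)\<cdot>\<alpha> ?B (L\<otimes>?w) ?u)))"
  using ap ap' unfolding flat.simps(2)[of "Suc n"] by (simp del: flat.simps)
 also have "... = flat (Suc n) (Suc j)\<cdot>(((?B\<otimes>L)\<rhd>?a) \<cdot>
    (\<alpha>\<^sup>- ?B L (?w\<otimes>?u)\<cdot>((?B\<rhd>\<alpha> L ?w ?u)\<cdot>\<alpha> ?B (L\<otimes>?w) ?u)))"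
  using ap ap' by (subst assoc_inv_nat_reassoc) (auto simp del: flat.simps)
 also have "... = (flat (Suc n) (Suc j)\<cdot>(((Bp (Suc j))\<rhd>?a)\<cdot>\<alpha> (Bp (Suc j)) ?w ?u))\<cdot>(\<alpha>\<^sup>- ?B L ?w\<lhd>?u)"
  unfolding pent using ap ap' by (simp del: flat.simps)
 also have "... = flat (Suc n) j\<odot>\<rr> L" unfolding Suc by simp
 finally show ?case .
qed

text \<open>This computes the product with an element of \<open>A\<close>.\<close>

lemma flat_act:
 "act (j + n)\<cdot>(flat n j\<lhd>K) =
   flat n j\<cdot>((act j\<lhd>tensor_power M L n)\<cdot>\<tau> (Bp j) (tensor_power M L n) K)"
proof (induction n arbitrary: j)
 case 0
 have "act j\<cdot>(\<rr> (Bp j)\<lhd>K) = (act j\<cdot>\<rr> (Bp j\<otimes>K))\<cdot>\<tau> (Bp j) \<one> K"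
  by (simp add: runit_right_swap)
 then show ?case by simp
next
 case (Suc n)
 let ?B = "Bp j" and ?w = "tensor_power M L n"
 have t: "\<alpha>\<^sup>- (?B\<otimes>K) L ?w\<cdot>\<tau> ?B (L\<otimes>?w) K =
   (\<tau> ?B L K\<lhd>?w)\<cdot>(\<tau> (?B\<otimes>L) ?w K\<cdot>(\<alpha>\<^sup>- ?B L ?w\<lhd>K))"
 proof (rule iso_cancel_right[of _ "\<alpha> ?B L ?w\<lhd>K"])
  have "(\<alpha>\<^sup>- (?B\<otimes>K) L ?w\<cdot>\<tau> ?B (L\<otimes>?w) K)\<cdot>(\<alpha> ?B L ?w\<lhd>K) =
   \<alpha>\<^sup>- (?B\<otimes>K) L ?w\<cdot>(\<tau> ?B (L\<otimes>?w) K\<cdot>(\<alpha> ?B L ?w\<lhd>K))" by simp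
  also have "... = ((\<tau> ?B L K\<lhd>?w)\<cdot>(\<tau> (?B\<otimes>L) ?w K\<cdot>(\<alpha>\<^sup>- ?B L ?w\<lhd>K)))\<cdot>(\<alpha> ?B L ?w\<lhd>K)"
   by (subst right_swap_tensor) auto
  finally show "(\<alpha>\<^sup>- (?B\<otimes>K) L ?w\<cdot>\<tau> ?B (L\<otimes>?w) K)\<cdot>(\<alpha> ?B L ?w\<lhd>K) =
   ((\<tau> ?B L K\<lhd>?w)\<cdot>(\<tau> (?B\<otimes>L) ?w K\<cdot>(\<alpha>\<^sup>- ?B L ?w\<lhd>K)))\<cdot>(\<alpha> ?B L ?w\<lhd>K)" .
 qed auto
 have "act (j + Suc n)\<cdot>(flat (Suc n) j\<lhd>K) =
   (act (Suc j + n)\<cdot>(flat n (Suc j)\<lhd>K))\<cdot>(\<alpha>\<^sup>- ?B L ?w\<lhd>K)"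
  by (simp del: act.simps)
 also have "... = flat n (Suc j)\<cdot>(((act j\<lhd>L)\<lhd>?w)\<cdot>((\<tau> ?B L K\<lhd>?w) \<cdot>
   (\<tau> (?B\<otimes>L) ?w K\<cdot>(\<alpha>\<^sup>- ?B L ?w\<lhd>K))))"
  unfolding Suc by simp
 also have "... = flat (Suc n) j\<cdot>((act j\<lhd>(tensor_power M L (Suc n)))\<cdot>\<tau> ?B (tensor_power M L (Suc n)) K)"
  unfolding t[symmetric] by simp
 finally show ?case .
qed

abbreviation vertex :: "bool => 'o" where "vertex b \<equiv> (if b then L else K)"

lemma map_vertex: "map vertex w = cube_word M h w"
 by (simp add: cube_word_def)

text \<open>Equivariance of the contractions under permutations of the letters.\<close>

lemma contract_swap_path:
 assumes f: "family N Z g" and "swap_path vertex w t w'" "trues w \<le> N"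
 shows "contract g w' 0\<cdot>(A\<rhd>t) = contract g w 0 \<and> trues w' = trues w"
 using assms(2,3)
proof induction
 case (refl w)
 then show ?case using family_contract_arr[OF f, of 0 w] by (simp add: map_vertex)
next
 case (step w t w' i)
 have o: "vertex x\<in>Obj M" for x by simp
 note P = swap_path_arr[OF step(1) o, unfolded map_vertex]
 have i: "Suc i < length (cube_word M h w')" using step(2) by simp
 note ad = adj_iso_arr[OF set_cube_word i]
 have tr: "0 + trues w' \<le> N" "0 + trues (swap_at i w') \<le> N" using step by auto
 note m = family_contract_arr[OF f tr(1)] family_contract_arr[OF f tr(2)]
 have "contract g (swap_at i w') 0\<cdot>(A\<rhd>(adj_iso M (cube_word M h w') i\<cdot>t)) =
   (contract g (swap_at i w') 0\<cdot>(Bp 0\<rhd>adj_iso M (cube_word M h w') i))\<cdot>(A\<rhd>t)"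
  using P ad m by (simp add: cube_word_swap_at)
 then show ?case using contract_adj[OF f step(2) tr(1)] step(3)[OF step(4)] unfolding map_vertex by simp
qed

lemma cube_arr_trues:
 "length w = n ==> cube_arr M h (w, replicate n True) = tensor_arr_list M (map (\<lambda>b. if b then \<i>\<d> L else h) w)"
 by (induction w arbitrary: n) auto

lemma list_all2_trues: "length w = n ==> list_all2 (-->) w (replicate n True)"
 by (simp add: list_all2_conv_all_nth)

lemma cube_arr_adj:
 assumes "length w = n" "Suc i < n"
 shows "adj_iso M (replicate n L) i\<cdot>cube_arr M h (w, replicate n True) =
  cube_arr M h (swap_at i w, replicate n True)\<cdot>adj_iso M (cube_word M h w) i"
proof -
 let ?fs = "map (\<lambda>b. if b then \<i>\<d> L else h) w"
 have 1: "map (Cod M) ?fs = replicate n L" using assms(1) by (simp add: list_eq_iff_nth_eq)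
 have 2: "map (Dom M) ?fs = cube_word M h w" by (simp add: list_eq_iff_nth_eq cube_word_def)
 have "set ?fs \<subseteq> Arr M" "Suc i < length ?fs" using assms by auto
 from adj_iso_nat[OF this]
 have "adj_iso M (replicate n L) i\<cdot>tensor_arr_list M ?fs =
   tensor_arr_list M (swap_at i ?fs)\<cdot>adj_iso M (cube_word M h w) i" unfolding 1 2 .
 moreover have "length (swap_at i w) = n" using assms by simp
 ultimately show ?thesis
  by (simp only: cube_arr_trues[OF assms(1)] cube_arr_trues[of "swap_at i w" n] map_swap_at)
qed

lemma cube_arr_id: "cube_arr M h (w, w) = \<i>\<d> (W w)"
 by (induction w) auto

lemma cube_arr_comp:
 assumes "list_all2 (-->) u v" "list_all2 (-->) v w"
 shows "cube_arr M h (v, w)\<cdot>cube_arr M h (u, v) = cube_arr M h (u, w)"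
 using assms
proof (induction u v arbitrary: w rule: list_all2_induct)
 case (Cons x u y v)
 then obtain z w' where w: "w = z # w'" "y --> z" "list_all2 (-->) v w'" by (cases w) auto
 then show ?case
  using Cons cube_arr_arr[OF Cons(2)] cube_arr_arr[OF w(3)] by auto
qed simp

lemma category_punctured_cube: "category (punctured_cube n)"
 unfolding punctured_cube_def
proof (rule category_preorder_cat)
 show "list_all2 (-->) a a" for a by (simp add: list_all2_conv_all_nth)
 show "list_all2 (-->) a c" if "list_all2 (-->) a b" "list_all2 (-->) b c" for a b c :: "bool list"
  using that by (auto simp: list_all2_conv_all_nth)
qed

lemma functor_punctured_cube: "is_functor (punctured_cube n) M W (cube_arr M h)"
 unfolding is_functor_def punctured_cube_def
proof (intro conjI ballI impI)
 fix p q :: "bool list \<times> bool list"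
 let ?P = "preorder_cat {w. length w = n \<and> w \<noteq> replicate n True} (list_all2 (-->))"
 assume "p\<in>Arr ?P"
 then have p: "list_all2 (-->) (fst p) (snd p)" by simp
 then show "cube_arr M h p\<in>Hom M (W (Dom ?P p)) (W (Cod ?P p))" using cube_arr_arr[OF p] by simp
 assume "q\<in>Arr ?P" "Cod ?P p = Dom ?P q"
 then have "list_all2 (-->) (snd p) (snd q)" "fst q = snd p" by auto
 then show "cube_arr M h (q \<cdot>\<^bsub>?P\<^esub> p) = cube_arr M h q\<cdot>cube_arr M h p"
  using cube_arr_comp[OF p] by (cases p; cases q) auto
qed (auto simp: cube_arr_id)

end

section \<open>Extension of a family by one term\<close>

context closed_symmetric_monoidal
begin

text \<open>Coinvariants are a presentation, which \<open>A\<otimes>_\<close> preserves.\<close>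

lemma tensor_coinvariants_ex:
 assumes q: "is_coinvariants M Y G q" "Y\<in>Obj M" "G \<subseteq> Hom M Y Y" and A: "A\<in>Obj M"
  and f: "f\<in>Arr M" "Dom M f = A\<otimes>Y" "\<And>g. g\<in>G ==> f\<cdot>(A\<rhd>g) = f"
 obtains u where "u\<in>Arr M" "Dom M u = A\<otimes>Cod M q" "Cod M u = Cod M f" "u\<cdot>(A\<rhd>q) = f"
proof -
 note g = is_coinvariants_iff_glue(1)[OF q(2,3), of q] is_coinvariants_iff_glue(2)[OF q(2,3)]
 have "is_glue M {()} (\<lambda>_. Y) {((), g, (), \<i>\<d> Y) |g. g\<in>G} (Cod M q) (\<lambda>_. q)" using g(1) q(1) by blast
 note t = is_glue_tensor_left[OF this g(2) A]
 have Z: "Cod M f\<in>Obj M" using f by simp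
 obtain u where "u\<in>Arr M" "Dom M u = A\<otimes>Cod M q" "Cod M u = Cod M f" "\<And>i. i\<in>{()} ==> u\<cdot>(A\<rhd>q) = f"
 proof (rule is_glue_ex[OF t Z, of "\<lambda>_. f"])
  show "f\<in>Hom M (A\<otimes>Y) (Cod M f)" using f by simp
  fix i j :: unit and a b
  assume "(i, a, j, b)\<in>(\<lambda>(i, a, j, b). (i, A\<rhd>a, j, A\<rhd>b)) ` {((), g, (), \<i>\<d> Y) |g. g\<in>G}"
  then obtain g where "g\<in>G" "a = A\<rhd>g" "b = A\<rhd>\<i>\<d> Y" by auto
  then show "f\<cdot>a = f\<cdot>b" using f A q(2) by simp
 qed blast
 then show ?thesis using that by simp
qed

lemma tensor_coinvariants_epic:
 assumes q: "is_coinvariants M Y G q" "Y\<in>Obj M" "G \<subseteq> Hom M Y Y" and A: "A\<in>Obj M"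
  and f: "f\<cdot>(A\<rhd>q) = g\<cdot>(A\<rhd>q)" "f\<in>Arr M" "g\<in>Arr M" "Dom M f = A\<otimes>Cod M q" "Dom M g = A\<otimes>Cod M q"
   "Cod M f = Cod M g"
 shows "f = g"
proof -
 note Q = coinvariants_arr[OF q]
 have "jointly_epic {()} (A\<otimes>Cod M q) (\<lambda>_. A\<rhd>q)"
  using Q by (intro jointly_epic_tensor_left[OF Q(4) _ A]) auto
 then show ?thesis by (rule jointly_epicD) (use f in auto)
qed

end

context attaching
begin

lemma Obj_punctured_cube [simp]: "Obj (punctured_cube n) = {w. length w = n \<and> w \<noteq> replicate n True}"
 by (simp add: punctured_cube_def)

lemma Arr_punctured_cube:
 "x\<in>Arr (punctured_cube n) \<longleftrightarrow> (fst x\<in>Obj (punctured_cube n) \<and> snd x\<in>Obj (punctured_cube n) \<and>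
   list_all2 (-->) (fst x) (snd x))"
 "Dom (punctured_cube n) = fst" "Cod (punctured_cube n) = snd"
 by (auto simp: punctured_cube_def)

lemma trues_full: "trues w \<le> length w \<and> (trues w = length w --> w = replicate (length w) True)"
proof (induction w)
 case (Cons a w)
 then show ?case using length_filter_le[of "\<lambda>b. b" w] by (cases a) (auto simp del: length_filter_le)
qed simp

text \<open>A vertex of the punctured \<open>(n+1)\<close>-cube involves only the terms of a family up to \<open>n\<close>.\<close>

lemma trues_less:
 assumes "w\<in>Obj (punctured_cube (Suc n))" shows "trues w \<le> n"
proof -
 have l: "length w = Suc n" and ne: "w \<noteq> replicate (Suc n) True" using assms unfolding Obj_punctured_cube by blast+
 have "trues w \<noteq> Suc n"
 proof
  assume "trues w = Suc n"
  then have "w = replicate (Suc n) True" using trues_full[of w] unfolding l by blast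
  then show False using ne by contradiction
 qed
 then show ?thesis using trues_full[of w] unfolding l by linarith
qed

lemma iterated_pushout_product_glue:
 assumes "is_iterated_pushout_product M h n Q \<iota> k"
 defines "R \<equiv> {(snd x, cube_arr M h x, fst x, \<i>\<d> (W (fst x))) |x. x\<in>Arr (punctured_cube n)}"
 shows "is_glue M (Obj (punctured_cube n)) W R Q \<iota>" "glue_relations M (Obj (punctured_cube n)) W R"
proof -
 have c: "is_colimit (punctured_cube n) M W (cube_arr M h) Q \<iota>"
  using assms(1) unfolding is_iterated_pushout_product_def by blast
 note D = is_colimit_iff_glue[OF category_punctured_cube[of n] functor_punctured_cube]
 show "is_glue M (Obj (punctured_cube n)) W R Q \<iota>" "glue_relations M (Obj (punctured_cube n)) W R"
  using D(1)[of Q \<iota>] D(2) c unfolding R_def Arr_punctured_cube(2,3) by blast+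
qed

lemma cube_action_hom: "cube_action M h n Q \<iota> \<subseteq> Hom M Q Q"
 unfolding cube_action_def by blast

lemma cube_action_path:
 assumes "g\<in>cube_action M h n Q \<iota>"
 obtains \<sigma> where "\<And>w. length w = n ==> swap_path vertex w (perm_iso M n \<sigma> (cube_word M h w)) (permute_list \<sigma> w)"
  "\<And>w. w\<in>Obj (punctured_cube n) ==> g\<cdot>\<iota> w = \<iota> (permute_list \<sigma> w)\<cdot>perm_iso M n \<sigma> (cube_word M h w)"
  "\<And>w. w\<in>Obj (punctured_cube n) ==> permute_list \<sigma> w\<in>Obj (punctured_cube n)"
proof -
 obtain \<sigma> where s: "\<sigma> permutes {..<n}"
  "\<And>w. w\<in>Obj (punctured_cube n) ==> g\<cdot>\<iota> w = \<iota> (permute_list \<sigma> w)\<cdot>perm_iso M n \<sigma> (cube_word M h w)"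
  using assms unfolding cube_action_def by blast
 have o: "vertex x\<in>Obj M" for x by simp
 show ?thesis
 proof (rule that[of \<sigma>])
  show "swap_path vertex w (perm_iso M n \<sigma> (cube_word M h w)) (permute_list \<sigma> w)" if "length w = n" for w
   using swap_path_permute[of vertex, OF o s(1) that] unfolding map_vertex .
  fix w assume w: "w\<in>Obj (punctured_cube n)"
  have "mset (permute_list \<sigma> w) = mset w" using s(1) w by (intro mset_permute_list) auto
  then have st: "set (permute_list \<sigma> w) = set w" by (rule mset_eq_setD)
  have "permute_list \<sigma> w \<noteq> replicate n True"
  proof
   assume e: "permute_list \<sigma> w = replicate n True"
   have "y = True" if "y\<in>set w" for y
    using that unfolding st[symmetric] e by simp
   then have "w = replicate n True" using w by (intro replicate_eqI) auto
   then show False using w by simp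
  qed
  then show "permute_list \<sigma> w\<in>Obj (punctured_cube n)" using w by simp
 qed (rule s(2))
qed

text \<open>The arrow \<open>p\<cdot>k\<close> is invariant: on the vertices, the action of a permutation on the cube becomes its
 action on \<open>L\<^sup>n\<close>, which \<open>p\<close> equalizes.\<close>

lemma orbit_map_exists:
 assumes po: "is_iterated_pushout_product M h n Q \<iota> k"
  and q: "is_coinvariants M Q (cube_action M h n Q \<iota>) q"
  and p: "is_coinvariants M (tensor_power M L n) (power_action M L n) p"
 shows "\<exists>l. l\<in>Hom M (Cod M q) (Cod M p) \<and> l\<cdot>q = p\<cdot>k"
proof -
 note g = iterated_pushout_product_glue[OF po] and G = is_glue_hom[OF iterated_pushout_product_glue(1)[OF po]]
 have k: "k\<in>Arr M" "Dom M k = Q" "Cod M k = tensor_power M L n"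
  "\<And>w. w\<in>Obj (punctured_cube n) ==> k\<cdot>\<iota> w = cube_arr M h (w, replicate n True)"
  using po unfolding is_iterated_pushout_product_def by auto
 have Lo: "L\<in>Obj M" by simp
 note P = coinvariants_arr[OF p tensor_power_obj[OF Lo] power_action_hom[OF Lo]]
 have pa: "p\<cdot>adj_iso M (replicate n L) i = p" if "Suc i < n" for i
  using power_action_iff[OF Lo P(1,2)] P(3) that by blast
 have o: "vertex x\<in>Obj M" for x by simp
 let ?a = "\<lambda>w. p\<cdot>cube_arr M h (w, replicate n True)"
 have ca: "cube_arr M h (w, replicate n True)\<in>Arr M" "Dom M (cube_arr M h (w, replicate n True)) = W w"
  "Cod M (cube_arr M h (w, replicate n True)) = tensor_power M L n" if "length w = n" for w
  using cube_arr_arr[OF list_all2_trues[OF that]] by auto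
 have "\<exists>u. u\<in>Arr M \<and> Dom M u = Cod M q \<and> Cod M u = Cod M (p\<cdot>k) \<and> u\<cdot>q = p\<cdot>k"
 proof (rule coinvariants_ex[OF q])
  show pk: "p\<cdot>k\<in>Arr M" "Dom M (p\<cdot>k) = Q" using P k by auto
  fix g assume ga: "g\<in>cube_action M h n Q \<iota>"
  have gh: "g\<in>Arr M" "Dom M g = Q" "Cod M g = Q" using ga cube_action_hom[of n Q \<iota>] by auto
  obtain \<sigma> where s: "\<And>w. length w = n ==> swap_path vertex w (perm_iso M n \<sigma> (cube_word M h w)) (permute_list \<sigma> w)"
   "\<And>w. w\<in>Obj (punctured_cube n) ==> g\<cdot>\<iota> w = \<iota> (permute_list \<sigma> w)\<cdot>perm_iso M n \<sigma> (cube_word M h w)"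
   "\<And>w. w\<in>Obj (punctured_cube n) ==> permute_list \<sigma> w\<in>Obj (punctured_cube n)"
   using cube_action_path[OF ga] by metis
  show "p\<cdot>k\<cdot>g = p\<cdot>k"
  proof (rule jointly_epicD[OF is_glue_epic[OF g]])
   fix w assume w: "w\<in>Obj (punctured_cube n)"
   then have wl: "length w = n" "length (permute_list \<sigma> w) = n" by auto
   let ?t = "perm_iso M n \<sigma> (cube_word M h w)"
   note T = swap_path_arr[OF s(1)[OF wl(1)] o, unfolded map_vertex]
   have "p\<cdot>k\<cdot>g\<cdot>\<iota> w = p\<cdot>(k\<cdot>(\<iota> (permute_list \<sigma> w)\<cdot>?t))"
    using s(2)[OF w] P k gh G(1-3)[OF w] by simp
   also have "... = p\<cdot>((k\<cdot>\<iota> (permute_list \<sigma> w))\<cdot>?t)"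
    using P k gh G(1-3)[OF s(3)[OF w]] T by simp
   also have "... = ?a (permute_list \<sigma> w)\<cdot>?t"
    using P k(4)[OF s(3)[OF w]] T ca[OF wl(2)] by simp
   also have "... = ?a w"
   proof (rule swap_path_invariant[OF s(1)[OF wl(1)] o, of n ?a])
    fix w :: "bool list" assume w: "length w = n"
    show "?a w\<in>Arr M \<and> Dom M (?a w) = TL (map vertex w)" using ca[OF w] P by (simp add: map_vertex)
    fix i assume i: "Suc i < n"
    have w': "length (swap_at i w) = n" using w by simp
    have i': "Suc i < length (replicate n L)" "Suc i < length (cube_word M h w)" using i w by auto
    have "set (replicate n L) \<subseteq> Obj M" by auto
    note ad = adj_iso_arr[OF this i'(1)] adj_iso_arr[OF set_cube_word i'(2)]
    have "?a (swap_at i w)\<cdot>adj_iso M (map vertex w) i =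
      p\<cdot>(cube_arr M h (swap_at i w, replicate n True)\<cdot>adj_iso M (cube_word M h w) i)"
     unfolding map_vertex using ca[OF w'] P ad by (simp add: cube_word_swap_at)
    also have "... = (p\<cdot>adj_iso M (replicate n L) i)\<cdot>cube_arr M h (w, replicate n True)"
     unfolding cube_arr_adj[OF w i, symmetric] using ca[OF w] P ad by simp
    finally show "?a (swap_at i w)\<cdot>adj_iso M (map vertex w) i = ?a w" using pa[OF i] by simp
   qed (rule wl(1))
   also have "... = p\<cdot>k\<cdot>\<iota> w" using k(1-3) k(4)[OF w] P G(1-3)[OF w] by simp
   finally show "p\<cdot>k\<cdot>g\<cdot>\<iota> w = p\<cdot>k\<cdot>\<iota> w" .
  qed (use pk gh in auto)
 qed auto
 then show ?thesis using P k by auto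
qed

text \<open>The contractions of the terms up to \<open>n\<close> form a cocone on \<open>A\<close> tensor the punctured cube, because they are
 compatible with its arrows, and the induced arrow descends to the coinvariants, because they are
 equivariant. A lift against \<open>A\<rhd>l\<close> extends it to the coinvariants of \<open>A\<otimes>L\<^bsup>n+1\<^esup>\<close>, that is, to a symmetric
 arrow on \<open>A\<otimes>L\<^bsup>n+1\<^esup>\<close>. That it extends the cocone at the vertex with the single letter \<open>K\<close> in the last
 place is the compatibility of the new term with \<open>h\<close>.\<close>

lemma extend_family:
 assumes po: "is_iterated_pushout_product M h (Suc n) Q \<iota> k"
  and q: "is_coinvariants M Q (cube_action M h (Suc n) Q \<iota>) q"
  and p: "is_coinvariants M (tensor_power M L (Suc n)) (power_action M L (Suc n)) p"
  and l: "l\<in>Hom M (Cod M q) (Cod M p)" "l\<cdot>q = p\<cdot>k"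
  and lift: "has_lifting M (A\<rhd>l) r"
  and g: "family n X g" and r: "r\<in>Arr M" "Dom M r = X" "Cod M r = Y"
  and v: "family (Suc n) Y v" and gv: "\<And>j. j \<le> n ==> r\<cdot>g j = v j"
 shows "\<exists>x. family (Suc n) X (g(Suc n := x)) \<and> r\<cdot>x = v (Suc n)"
proof -
 let ?n = "Suc n" and ?P = "punctured_cube (Suc n)" and ?T = "replicate (Suc n) True"
 note gl = iterated_pushout_product_glue[OF po]
 note G = is_glue_hom[OF gl(1)]
 note gt = is_glue_tensor_left[OF gl A_obj]
 have et: "jointly_epic (Obj ?P) (A\<otimes>Q) (\<lambda>w. A\<rhd>\<iota> w)"
  using G by (intro jointly_epic_tensor_left[OF is_glue_epic[OF gl]]) auto
 have k: "k\<in>Arr M" "Dom M k = Q" "Cod M k = tensor_power M L ?n"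
  "\<And>w. w\<in>Obj ?P ==> k\<cdot>\<iota> w = cube_arr M h (w, ?T)"
  using po unfolding is_iterated_pushout_product_def by auto
 have Lo: "L\<in>Obj M" and Qo: "Q\<in>Obj M" using G by auto
 have po: "tensor_power M L m\<in>Obj M" for m by simp
 note P = coinvariants_arr[OF p po power_action_hom[OF Lo]]
 note Q = coinvariants_arr[OF q Qo cube_action_hom]
 have pa: "p\<cdot>adj_iso M (replicate ?n L) i = p" if "Suc i < ?n" for i
  using power_action_iff[OF Lo P(1,2)] P(3) that by blast
 have l': "l\<in>Arr M" "Dom M l = Cod M q" "Cod M l = Cod M p" using l(1) by auto
 have X: "X\<in>Obj M" and Y: "Y\<in>Obj M" using r by auto
 have o: "vertex x\<in>Obj M" for x by simp
 have tr: "0 + trues w \<le> n" if "w\<in>Obj ?P" for w using trues_less[OF that] by simp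
 have ca: "cube_arr M h (w, ?T)\<in>Arr M" "Dom M (cube_arr M h (w, ?T)) = W w"
  "Cod M (cube_arr M h (w, ?T)) = tensor_power M L ?n" if "length w = ?n" for w
  using cube_arr_arr[OF list_all2_trues[OF that]] by auto
 note cg = family_contract_arr[OF g tr]
 \<comment> \<open>The cocone of contractions on the punctured cube.\<close>
 obtain th where th: "th\<in>Arr M" "Dom M th = A\<otimes>Q" "Cod M th = X"
  "\<And>w. w\<in>Obj ?P ==> th\<cdot>(A\<rhd>\<iota> w) = contract g w 0"
 proof (rule is_glue_ex[OF gt X, of "\<lambda>w. contract g w 0"])
  show "contract g w 0\<in>Hom M (A\<otimes>W w) X" if "w\<in>Obj ?P" for w using cg[OF that] by simp
  fix w a v b
  assume "(w, a, v, b)\<in>(\<lambda>(i, a, j, b). (i, A\<rhd>a, j, A\<rhd>b)) `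
   {(snd x, cube_arr M h x, fst x, \<i>\<d> (W (fst x))) |x. x\<in>Arr ?P}"
  then obtain x where x: "x\<in>Arr ?P" "w = snd x" "v = fst x" "a = A\<rhd>cube_arr M h x" "b = A\<rhd>\<i>\<d> (W v)"
   by auto
  then have xw: "x = (v, w)" by (cases x) simp
  have vw: "list_all2 (-->) v w" "v\<in>Obj ?P" "w\<in>Obj ?P" using x(1) unfolding xw Arr_punctured_cube by auto
  show "contract g w 0\<cdot>a = contract g v 0\<cdot>b"
   using contract_cube[OF g vw(1) tr[OF vw(3)]] cg[OF vw(2)] x(4,5) unfolding xw by simp
 qed auto
 have inv: "th\<cdot>(A\<rhd>c) = th" if c: "c\<in>cube_action M h ?n Q \<iota>" for c
 proof -
  have ch: "c\<in>Arr M" "Dom M c = Q" "Cod M c = Q" using c cube_action_hom[of ?n Q \<iota>] by auto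
  obtain \<sigma> where s: "\<And>w. length w = ?n ==> swap_path vertex w (perm_iso M ?n \<sigma> (cube_word M h w)) (permute_list \<sigma> w)"
   "\<And>w. w\<in>Obj ?P ==> c\<cdot>\<iota> w = \<iota> (permute_list \<sigma> w)\<cdot>perm_iso M ?n \<sigma> (cube_word M h w)"
   "\<And>w. w\<in>Obj ?P ==> permute_list \<sigma> w\<in>Obj ?P"
   using cube_action_path[OF c] by metis
  show ?thesis
  proof (rule jointly_epicD[OF et])
   fix w assume w: "w\<in>Obj ?P"
   then have wl: "length w = ?n" by simp
   let ?t = "perm_iso M ?n \<sigma> (cube_word M h w)" and ?w = "permute_list \<sigma> w"
   note t = swap_path_arr[OF s(1)[OF wl] o, unfolded map_vertex]
   have "th\<cdot>(A\<rhd>c)\<cdot>(A\<rhd>\<iota> w) = th\<cdot>(A\<rhd>(\<iota> ?w\<cdot>?t))"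
    using th(1-3) ch G(1-3)[OF w] s(2)[OF w] by simp
   also have "... = (th\<cdot>(A\<rhd>\<iota> ?w))\<cdot>(A\<rhd>?t)"
    using th(1-3) G(1-3)[OF s(3)[OF w]] t by simp
   also have "... = th\<cdot>(A\<rhd>\<iota> w)"
    using th(4)[OF s(3)[OF w]] th(4)[OF w] contract_swap_path[OF g s(1)[OF wl]] tr[OF w] by simp
   finally show "th\<cdot>(A\<rhd>c)\<cdot>(A\<rhd>\<iota> w) = th\<cdot>(A\<rhd>\<iota> w)" .
  qed (use th ch in auto)
 qed
 obtain th' where th': "th'\<in>Arr M" "Dom M th' = A\<otimes>Cod M q" "Cod M th' = X" "th'\<cdot>(A\<rhd>q) = th"
  using tensor_coinvariants_ex[OF q Qo cube_action_hom A_obj th(1,2) inv] th(3) by metis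
 let ?V = "contract v ?T 0"
 have tT: "0 + trues ?T \<le> ?n" by (simp add: filter_replicate)
 note V = family_contract_arr[OF v tT]
 have V': "Dom M ?V = A\<otimes>tensor_power M L ?n" using V(2) by (simp del: replicate_Suc)
 \<comment> \<open>The top terms are symmetric, hence live on the coinvariants.\<close>
 have Vinv: "?V\<cdot>(A\<rhd>c) = ?V" if "c\<in>power_action M L ?n" for c
 proof -
  obtain \<sigma> where s: "\<sigma> permutes {..<?n}" "c = perm_iso M ?n \<sigma> (replicate ?n L)"
   using \<open>c\<in>power_action M L ?n\<close> unfolding power_action_def by blast
  have "swap_path vertex ?T (perm_iso M ?n \<sigma> (map vertex ?T)) (permute_list \<sigma> ?T)"
   by (rule swap_path_permute[OF o s(1)]) simp
  moreover have "permute_list \<sigma> ?T = ?T" unfolding permute_list_def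
  proof (rule nth_equalityI)
   fix i assume "i < length (map (\<lambda>i. ?T ! \<sigma> i) [0..<length ?T])"
   then have "i < ?n" "\<sigma> i < ?n" using permutes_in_image[OF s(1), of i] by auto
   then show "map (\<lambda>i. ?T ! \<sigma> i) [0..<length ?T] ! i = ?T ! i" by (simp del: replicate_Suc upt_Suc)
  qed simp
  ultimately have "swap_path vertex ?T c ?T" using s(2) by (simp add: map_vertex del: replicate_Suc)
  then show ?thesis using contract_swap_path[OF v] tT by (simp del: contract.simps replicate_Suc)
 qed
 obtain V' where V': "V'\<in>Arr M" "Dom M V' = A\<otimes>Cod M p" "Cod M V' = Y" "V'\<cdot>(A\<rhd>p) = ?V"
  using tensor_coinvariants_ex[OF p po power_action_hom[OF Lo] A_obj V(1) V' Vinv] V(3) by metis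
 have lq: "(A\<rhd>l)\<cdot>(A\<rhd>q) = (A\<rhd>p)\<cdot>(A\<rhd>k)" using l(2) l' P Q k by simp
 have sq: "r\<cdot>th' = V'\<cdot>(A\<rhd>l)"
 proof (rule tensor_coinvariants_epic[OF q Qo cube_action_hom A_obj])
  show "r\<cdot>th'\<cdot>(A\<rhd>q) = V'\<cdot>(A\<rhd>l)\<cdot>(A\<rhd>q)"
  proof (rule jointly_epicD[OF et])
   fix w assume w: "w\<in>Obj ?P"
   then have wl: "length w = ?n" by simp
   have "r\<cdot>th'\<cdot>(A\<rhd>q)\<cdot>(A\<rhd>\<iota> w) = r\<cdot>((th'\<cdot>(A\<rhd>q))\<cdot>(A\<rhd>\<iota> w))"
    using r th'(1-3) Q(1,2) G(1-3)[OF w] by simp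
   also have "... = r\<cdot>contract g w 0" unfolding th'(4) using th(4)[OF w] by simp
   also have "... = contract v w 0"
    by (rule contract_post[of n g X]) (use familyD(1-3)[OF g] r gv tr[OF w] in auto)
   also have "... = ?V\<cdot>(A\<rhd>cube_arr M h (w, ?T))"
    using contract_cube[OF v list_all2_trues[OF wl] tT] by simp
   also have "... = (V'\<cdot>(A\<rhd>p))\<cdot>(A\<rhd>(k\<cdot>\<iota> w))" using V'(4) k(4)[OF w] by simp
   also have "... = V'\<cdot>((A\<rhd>p)\<cdot>(A\<rhd>k))\<cdot>(A\<rhd>\<iota> w)"
    using V'(1-3) P(1,2) k(1-3) G(1-3)[OF w] by simp
   also have "... = V'\<cdot>(A\<rhd>l)\<cdot>(A\<rhd>q)\<cdot>(A\<rhd>\<iota> w)"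
    unfolding lq[symmetric] using V'(1-3) P(1,2) l' Q(1,2) G(1-3)[OF w] by simp
   finally show "r\<cdot>th'\<cdot>(A\<rhd>q)\<cdot>(A\<rhd>\<iota> w) = V'\<cdot>(A\<rhd>l)\<cdot>(A\<rhd>q)\<cdot>(A\<rhd>\<iota> w)" .
  qed (use r th' V' l' Q(1,2) in auto)
 qed (use r th' V' l' Q(1,2) in auto)
 have Al: "A\<rhd>l\<in>Arr M" "Dom M (A\<rhd>l) = A\<otimes>Cod M q" "Cod M (A\<rhd>l) = A\<otimes>Cod M p" using l' by auto
 obtain d where d: "d\<in>Arr M" "Dom M d = A\<otimes>Cod M p" "Cod M d = X" "d\<cdot>(A\<rhd>l) = th'" "r\<cdot>d = V'"
 proof -
  have "th'\<in>Hom M (Dom M (A\<rhd>l)) (Dom M r)" "V'\<in>Hom M (Cod M (A\<rhd>l)) (Cod M r)"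
   using th' V' r Al by auto
  then obtain d where "d\<in>Hom M (Cod M (A\<rhd>l)) (Dom M r)" "d\<cdot>(A\<rhd>l) = th'" "r\<cdot>d = V'"
   using lift sq unfolding has_lifting_def by blast
  then show ?thesis using r Al by (intro that[of d]) auto
 qed
 let ?G = "d\<cdot>(A\<rhd>p)"
 have Gh: "?G\<in>Arr M" "Dom M ?G = A\<otimes>tensor_power M L ?n" "Cod M ?G = X"
  using d(1-3) P(1,2) by auto
 have Gc: "?G\<cdot>(A\<rhd>cube_arr M h (w, ?T)) = contract g w 0" if w: "w\<in>Obj ?P" for w
 proof -
  have "?G\<cdot>(A\<rhd>cube_arr M h (w, ?T)) = d\<cdot>((A\<rhd>p)\<cdot>(A\<rhd>k))\<cdot>(A\<rhd>\<iota> w)"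
   unfolding k(4)[OF w, symmetric] using d(1-3) P(1,2) k(1-3) G(1-3)[OF w] by simp
  also have "... = ((d\<cdot>(A\<rhd>l))\<cdot>(A\<rhd>q))\<cdot>(A\<rhd>\<iota> w)"
   unfolding lq[symmetric] using d(1-3) P(1,2) l' Q(1,2) G(1-3)[OF w] by simp
  also have "... = contract g w 0" unfolding d(4) th'(4) by (rule th(4)[OF w])
  finally show ?thesis .
 qed
 let ?f = "flat ?n 0"
 note F = flat_arr[of ?n 0]
 define x where "x = ?G\<cdot>inverse_arr M ?f"
 have xh: "x\<in>Arr M" "Dom M x = Bp ?n" "Cod M x = X" using Gh F unfolding x_def by (auto simp del: flat.simps)
 have xf: "x\<cdot>?f = ?G" using Gh F unfolding x_def by (simp del: flat.simps)
 have "family ?n X (g(?n := x))"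
  unfolding family_def
 proof (intro conjI allI impI)
  fix j assume j: "j \<le> ?n"
  show "(g(?n := x)) j\<in>Hom M (Bp j) X" using j familyD(1-3)[OF g, of j] xh by auto
  fix s assume s: "last_swap j s"
  show "(g(?n := x)) j\<cdot>s = (g(?n := x)) j"
  proof (cases "j = ?n")
   case True
   have "x\<cdot>s = x"
   proof (rule last_swap_invariant[OF xh(1,2)])
    show "last_swap ?n s" using s True by simp
    fix i assume i: "Suc i < ?n"
    have "set (replicate ?n L) \<subseteq> Obj M" by auto
    note ad = adj_iso_arr[OF this, of i]
    have "?G\<cdot>(A\<rhd>adj_iso M (replicate ?n L) i) = d\<cdot>(A\<rhd>(p\<cdot>adj_iso M (replicate ?n L) i))"
     using d(1-3) P(1,2) ad i by (simp del: replicate_Suc)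
    then show "x\<cdot>?f\<cdot>(A\<rhd>adj_iso M (replicate ?n L) i) = x\<cdot>?f"
     unfolding xf pa[OF i] .
   qed
   then show ?thesis using True by simp
  next
   case False
   then show ?thesis using familyD(4)[OF g _ s] j by simp
  qed
 next
  fix j assume j: "j < ?n"
  show "(g(?n := x)) (Suc j)\<cdot>(Bp j\<rhd>h) = (g(?n := x)) j\<cdot>act j"
  proof (cases "j = n")
   case False
   then show ?thesis using familyD(5)[OF g, of j] j by simp
  next
   case True
   let ?w = "replicate n True @ [False]"
   have "?w ! n \<noteq> replicate (Suc n) True ! n" by (simp add: nth_append del: replicate_Suc)
   then have "?w \<noteq> replicate (Suc n) True" by metis
   then have w: "?w\<in>Obj ?P" by simp
   have gn: "g n\<in>Arr M" "Dom M (g n) = Bp n" "Cod M (g n) = X" using familyD(1-3)[OF g] by auto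
   have wl: "length ?w = ?n" by simp
   \<comment> \<open>The compatibility with \<open>h\<close> is read off at the vertex with the letter \<open>K\<close> in the last place only.\<close>
   have "(x\<cdot>(Bp n\<rhd>h))\<cdot>bump n 0 = x\<cdot>(?f\<cdot>(A\<rhd>cube_arr M h (?w, ?T)))"
    using flat_bump[of n 0] xh bump_arr[of n 0] by (simp del: flat.simps replicate_Suc)
   also have "... = (x\<cdot>?f)\<cdot>(A\<rhd>cube_arr M h (?w, ?T))"
    using xh F ca[OF wl] by (simp del: flat.simps replicate_Suc)
   also have "... = contract g ?w 0" unfolding xf by (rule Gc[OF w])
   also have "... = (g n\<cdot>act n)\<cdot>bump n 0" using contract_bump[of g 0 n] gn bump_arr[of n 0] by simp
   finally have "x\<cdot>(Bp n\<rhd>h) = g n\<cdot>act n"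
    by (rule iso_cancel_right) (use bump_arr[of n 0] xh gn in auto)
   then show ?thesis using True by simp
  qed
 qed
 moreover have "r\<cdot>x = v ?n"
 proof -
  have vn: "v ?n\<in>Arr M" "Dom M (v ?n) = Bp ?n" using familyD(1,2)[OF v, of ?n] by auto
  have "r\<cdot>x = ((r\<cdot>d)\<cdot>(A\<rhd>p))\<cdot>inverse_arr M ?f"
   unfolding x_def using d(1-3) P(1,2) r F by (simp del: flat.simps)
  also have "... = (v ?n\<cdot>?f)\<cdot>inverse_arr M ?f"
   unfolding d(5) V'(4) using contract_trues[of v 0 ?n] vn by (simp del: flat.simps replicate_Suc)
  also have "... = v ?n" using vn F by (simp del: flat.simps)
  finally show ?thesis .
 qed
 ultimately show ?thesis by blast
qed

end

section \<open>Tensor products and quotients of commutative monoids\<close>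

context closed_symmetric_monoidal
begin

lemma monoidD:
 assumes "commutative_monoid M A"
 shows "Carrier A\<in>Obj M" "Mult A\<in>Arr M" "Dom M (Mult A) = Carrier A\<otimes>Carrier A"
  "Cod M (Mult A) = Carrier A" "One A\<in>Arr M" "Dom M (One A) = \<one>" "Cod M (One A) = Carrier A"
  "Mult A\<cdot>(Mult A\<lhd>Carrier A) =
    Mult A\<cdot>((Carrier A\<rhd>Mult A)\<cdot>\<alpha> (Carrier A) (Carrier A) (Carrier A))"
  "Mult A\<cdot>(One A\<lhd>Carrier A) = \<ll> (Carrier A)"
  "Mult A\<cdot>(Carrier A\<rhd>One A) = \<rr> (Carrier A)"
  "Mult A\<cdot>\<beta> (Carrier A) (Carrier A) = Mult A"
 using assms unfolding commutative_monoid_def by auto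

text \<open>The product of three elements does not depend on the order of the last two.\<close>

lemma monoid_mult_swap:
 assumes "commutative_monoid M A"
 shows "Mult A\<cdot>((Mult A\<lhd>Carrier A)\<cdot>\<tau> (Carrier A) (Carrier A) (Carrier A)) =
  Mult A\<cdot>(Mult A\<lhd>Carrier A)"
proof -
 let ?c = "Carrier A" and ?m = "Mult A"
 note D = monoidD[OF assms]
 have "?m\<cdot>((?m\<lhd>?c)\<cdot>\<tau> ?c ?c ?c) = (?m\<cdot>(?m\<lhd>?c))\<cdot>\<tau> ?c ?c ?c" using D(1-4) by simp
 also have "... = ?m\<cdot>((?c\<rhd>(?m\<cdot>\<beta> ?c ?c))\<cdot>\<alpha> ?c ?c ?c)"
  unfolding D(8) using D(1-4) by (simp add: right_swap_def)
 also have "... = ?m\<cdot>(?m\<lhd>?c)" unfolding D(8) D(11) ..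
 finally show ?thesis .
qed

text \<open>The inclusion of the second factor; the inclusion of the first one is \<open>Struct (tensor_alg M R S)\<close>.\<close>

definition tensor_inr :: "('o, 'm, 'x) cmon_scheme => ('o, 'm, 'y) cmon_scheme => 'm" where
 "tensor_inr R S = (One R\<lhd>Carrier S)\<cdot>inverse_arr M (\<ll> (Carrier S))"

lemma middle_exchange_arr [simp]:
 assumes [simp]: "W\<in>Obj M" "X\<in>Obj M" "Y\<in>Obj M" "Z\<in>Obj M"
 shows "middle_exchange M W X Y Z\<in>Arr M" "Dom M (middle_exchange M W X Y Z) = (W\<otimes>X)\<otimes>(Y\<otimes>Z)"
  "Cod M (middle_exchange M W X Y Z) = (W\<otimes>Y)\<otimes>(X\<otimes>Z)"
 by (auto simp: middle_exchange_def)

lemma middle_exchange_nat: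
 assumes "f\<in>Arr M" "g\<in>Arr M" "h\<in>Arr M" "k\<in>Arr M" "Cod M f = W'" "Cod M g = X'" "Cod M h = Y'" "Cod M k = Z'"
 shows "middle_exchange M W' X' Y' Z'\<cdot>((f\<odot>g)\<odot>(h\<odot>k)) =
  ((f\<odot>h)\<odot>(g\<odot>k))\<cdot>middle_exchange M (Dom M f) (Dom M g) (Dom M h) (Dom M k)"
proof -
 let ?W = "Dom M f" and ?X = "Dom M g" and ?Y = "Dom M h" and ?Z = "Dom M k"
 have "middle_exchange M W' X' Y' Z'\<cdot>((f\<odot>g)\<odot>(h\<odot>k)) =
   \<alpha>\<^sup>- W' Y' (X'\<otimes>Z')\<cdot>((f\<odot>(exchange M X' Y' Z'\<cdot>(g\<odot>(h\<odot>k))))\<cdot>\<alpha> ?W ?X (?Y\<otimes>?Z))"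
  using assms by (auto simp: middle_exchange_def)
 also have "... = \<alpha>\<^sup>- W' Y' (X'\<otimes>Z')\<cdot>((f\<odot>(h\<odot>(g\<odot>k)))\<cdot>((?W\<rhd>exchange M ?X ?Y ?Z)\<cdot>\<alpha> ?W ?X (?Y\<otimes>?Z)))"
  using assms by (subst exchange_nat) auto
 also have "... = ((f\<odot>h)\<odot>(g\<odot>k))\<cdot>middle_exchange M ?W ?X ?Y ?Z"
  using assms by (subst assoc_inv_nat_reassoc) (auto simp: middle_exchange_def)
 finally show ?thesis .
qed

lemma runit_assoc_inv:
 assumes [simp]: "R\<in>Obj M" "Z\<in>Obj M"
 shows "(\<rr> R\<lhd>Z)\<cdot>\<alpha>\<^sup>- R \<one> Z = R\<rhd>\<ll> Z"
 by (simp flip: triangle_simp)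

context
 fixes R :: "('o, 'm) cmon" and S :: "('o, 'm) cmon"
 assumes R: "commutative_monoid M R" and S: "commutative_monoid M S"
begin

private lemma D [simp]:
 "Carrier R\<in>Obj M" "Mult R\<in>Arr M" "Dom M (Mult R) = Carrier R\<otimes>Carrier R" "Cod M (Mult R) = Carrier R"
 "One R\<in>Arr M" "Dom M (One R) = \<one>" "Cod M (One R) = Carrier R"
 "Carrier S\<in>Obj M" "Mult S\<in>Arr M" "Dom M (Mult S) = Carrier S\<otimes>Carrier S" "Cod M (Mult S) = Carrier S"
 "One S\<in>Arr M" "Dom M (One S) = \<one>" "Cod M (One S) = Carrier S"
 using monoidD[OF R] monoidD[OF S] by auto

lemma tensor_alg_simps:
 "Carrier (tensor_alg M R S) = Carrier R\<otimes>Carrier S"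
 "Mult (tensor_alg M R S) = (Mult R\<odot>Mult S)\<cdot>middle_exchange M (Carrier R) (Carrier S) (Carrier R) (Carrier S)"
 "One (tensor_alg M R S) = (One R\<odot>One S)\<cdot>inverse_arr M (\<ll> \<one>)"
 "Struct (tensor_alg M R S) = (Carrier R\<rhd>One S)\<cdot>inverse_arr M (\<rr> (Carrier R))"
 by (auto simp: tensor_alg_def)

lemma tensor_inr_arr [simp]:
 "tensor_inr R S\<in>Arr M" "Dom M (tensor_inr R S) = Carrier S" "Cod M (tensor_inr R S) = Carrier R\<otimes>Carrier S"
 by (auto simp: tensor_inr_def)

lemma tensor_Struct_arr [simp]:
 "Struct (tensor_alg M R S)\<in>Arr M" "Dom M (Struct (tensor_alg M R S)) = Carrier R"
 "Cod M (Struct (tensor_alg M R S)) = Carrier R\<otimes>Carrier S"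
 by (auto simp: tensor_alg_simps)

lemma tensor_Mult_arr [simp]:
 "Mult (tensor_alg M R S)\<in>Arr M"
 "Dom M (Mult (tensor_alg M R S)) = (Carrier R\<otimes>Carrier S)\<otimes>(Carrier R\<otimes>Carrier S)"
 "Cod M (Mult (tensor_alg M R S)) = Carrier R\<otimes>Carrier S"
 by (auto simp: tensor_alg_simps)

lemma tensor_mult_inr:
 "Mult (tensor_alg M R S)\<cdot>((Carrier R\<otimes>Carrier S)\<rhd>tensor_inr R S) =
   (Carrier R\<rhd>Mult S)\<cdot>\<alpha> (Carrier R) (Carrier S) (Carrier S)"
proof -
 let ?r = "Carrier R" and ?s = "Carrier S"
 have n: "middle_exchange M ?r ?s ?r ?s\<cdot>((?r\<otimes>?s)\<rhd>(One R\<lhd>?s)) =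
   ((?r\<rhd>One R)\<lhd>(?s\<otimes>?s))\<cdot>middle_exchange M ?r ?s \<one> ?s"
  using middle_exchange_nat[of "\<i>\<d> ?r" "\<i>\<d> ?s" "One R" "\<i>\<d> ?s" ?r ?s ?r ?s] by simp
 have "Mult (tensor_alg M R S)\<cdot>((?r\<otimes>?s)\<rhd>tensor_inr R S) =
   (Mult R\<odot>Mult S)\<cdot>((middle_exchange M ?r ?s ?r ?s\<cdot>((?r\<otimes>?s)\<rhd>(One R\<lhd>?s))) \<cdot>
    ((?r\<otimes>?s)\<rhd>inverse_arr M (\<ll> ?s)))"
  by (simp add: tensor_alg_simps tensor_inr_def)
 also have "... = ((Mult R\<cdot>(?r\<rhd>One R))\<odot>Mult S)\<cdot>(middle_exchange M ?r ?s \<one> ?s \<cdot>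
    ((?r\<otimes>?s)\<rhd>inverse_arr M (\<ll> ?s)))"
  unfolding n by simp
 also have "... = (?r\<rhd>Mult S)\<cdot>(((\<rr> ?r\<lhd>(?s\<otimes>?s))\<cdot>\<alpha>\<^sup>- ?r \<one> (?s\<otimes>?s)) \<cdot>
   ((?r\<rhd>exchange M ?s \<one> ?s)\<cdot>(\<alpha> ?r ?s (\<one>\<otimes>?s)\<cdot>((?r\<otimes>?s)\<rhd>inverse_arr M (\<ll> ?s)))))"
  unfolding monoidD(10)[OF R] by (simp add: middle_exchange_def)
 also have "... = (?r\<rhd>Mult S)\<cdot>((?r\<rhd>(\<ll> (?s\<otimes>?s)\<cdot>exchange M ?s \<one> ?s)) \<cdot>
   (\<alpha> ?r ?s (\<one>\<otimes>?s)\<cdot>((?r\<otimes>?s)\<rhd>inverse_arr M (\<ll> ?s))))"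
  unfolding runit_assoc_inv[OF D(1) tensor_obj[OF D(8) D(8)]] by simp
 also have "... = (?r\<rhd>Mult S)\<cdot>\<alpha> ?r ?s ?s"
  by (simp add: lunit_exchange)
 finally show ?thesis .
qed

lemma tensor_mult_Struct:
 "Mult (tensor_alg M R S)\<cdot>((Carrier R\<otimes>Carrier S)\<rhd>Struct (tensor_alg M R S)) =
   (Mult R\<lhd>Carrier S)\<cdot>\<tau> (Carrier R) (Carrier S) (Carrier R)"
proof -
 let ?r = "Carrier R" and ?s = "Carrier S"
 have n: "middle_exchange M ?r ?s ?r ?s\<cdot>((?r\<otimes>?s)\<rhd>(?r\<rhd>One S)) =
   ((?r\<otimes>?r)\<rhd>(?s\<rhd>One S))\<cdot>middle_exchange M ?r ?s ?r \<one>"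
  using middle_exchange_nat[of "\<i>\<d> ?r" "\<i>\<d> ?s" "\<i>\<d> ?r" "One S" ?r ?s ?r ?s] by simp
 have ra: "\<rr> (?r\<otimes>?s)\<cdot>\<alpha>\<^sup>- ?r ?s \<one> = ?r\<rhd>\<rr> ?s" "\<rr> (?s\<otimes>?r)\<cdot>\<alpha>\<^sup>- ?s ?r \<one> = ?s\<rhd>\<rr> ?r"
  by (simp_all flip: runit_tensor)
 have e: "(?r\<rhd>\<rr> ?s)\<cdot>exchange M ?s ?r \<one> = \<beta> ?s ?r\<cdot>(?s\<rhd>\<rr> ?r)"
 proof -
  have "(?r\<rhd>\<rr> ?s)\<cdot>exchange M ?s ?r \<one> = ((?r\<rhd>\<rr> ?s)\<cdot>\<alpha> ?r ?s \<one>)\<cdot>((\<beta> ?s ?r\<lhd>\<one>)\<cdot>\<alpha>\<^sup>- ?s ?r \<one>)"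
   by (simp add: exchange_def)
  also have "... = \<beta> ?s ?r\<cdot>(\<rr> (?s\<otimes>?r)\<cdot>\<alpha>\<^sup>- ?s ?r \<one>)" by (subst runit_tensor) auto
  finally show ?thesis unfolding ra .
 qed
 have "Mult (tensor_alg M R S)\<cdot>((?r\<otimes>?s)\<rhd>Struct (tensor_alg M R S)) =
   (Mult R\<odot>Mult S)\<cdot>((middle_exchange M ?r ?s ?r ?s\<cdot>((?r\<otimes>?s)\<rhd>(?r\<rhd>One S))) \<cdot>
    ((?r\<otimes>?s)\<rhd>inverse_arr M (\<rr> ?r)))"
  by (simp add: tensor_alg_simps)
 also have "... = (Mult R\<odot>(Mult S\<cdot>(?s\<rhd>One S)))\<cdot>(middle_exchange M ?r ?s ?r \<one> \<cdot>
    ((?r\<otimes>?s)\<rhd>inverse_arr M (\<rr> ?r)))"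
  unfolding n by simp
 also have "... = (Mult R\<lhd>?s)\<cdot>(((?r\<otimes>?r)\<rhd>\<rr> ?s)\<cdot>(\<alpha>\<^sup>- ?r ?r (?s\<otimes>\<one>) \<cdot>
   ((?r\<rhd>exchange M ?s ?r \<one>)\<cdot>(\<alpha> ?r ?s (?r\<otimes>\<one>)\<cdot>((?r\<otimes>?s)\<rhd>inverse_arr M (\<rr> ?r))))))"
  unfolding monoidD(10)[OF S] by (simp add: middle_exchange_def)
 also have "((?r\<otimes>?r)\<rhd>\<rr> ?s)\<cdot>(\<alpha>\<^sup>- ?r ?r (?s\<otimes>\<one>) \<cdot>
   ((?r\<rhd>exchange M ?s ?r \<one>)\<cdot>(\<alpha> ?r ?s (?r\<otimes>\<one>)\<cdot>((?r\<otimes>?s)\<rhd>inverse_arr M (\<rr> ?r))))) =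
   \<alpha>\<^sup>- ?r ?r ?s\<cdot>((?r\<rhd>((?r\<rhd>\<rr> ?s)\<cdot>exchange M ?s ?r \<one>)) \<cdot>
    (\<alpha> ?r ?s (?r\<otimes>\<one>)\<cdot>((?r\<otimes>?s)\<rhd>inverse_arr M (\<rr> ?r))))"
 proof -
  have c: "((?r\<otimes>?r)\<rhd>\<rr> ?s)\<cdot>(\<alpha>\<^sup>- ?r ?r (?s\<otimes>\<one>)\<cdot>y) =
    \<alpha>\<^sup>- ?r ?r ?s\<cdot>((?r\<rhd>(?r\<rhd>\<rr> ?s))\<cdot>y)"
   if "y\<in>Arr M" "Cod M y = ?r\<otimes>(?r\<otimes>(?s\<otimes>\<one>))" for y
   using that by simp
  show ?thesis by (subst c) auto
 qed
 also have "... = \<tau> ?r ?s ?r" unfolding e by (simp add: right_swap_def)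
 finally show ?thesis .
qed

text \<open>Together with the two lemmas above this reduces computations in the tensor product to the
 factors: it is generated by their images.\<close>

lemma tensor_mult_Struct_inr:
 "Mult (tensor_alg M R S)\<cdot>(Struct (tensor_alg M R S)\<odot>tensor_inr R S) = \<i>\<d> (Carrier R\<otimes>Carrier S)"
proof -
 let ?r = "Carrier R" and ?s = "Carrier S"
 have "Mult (tensor_alg M R S)\<cdot>(Struct (tensor_alg M R S)\<odot>tensor_inr R S) =
   (Mult (tensor_alg M R S)\<cdot>((?r\<otimes>?s)\<rhd>tensor_inr R S))\<cdot>(Struct (tensor_alg M R S)\<lhd>?s)"
  by simp
 also have "... = (?r\<rhd>(Mult S\<cdot>(One S\<lhd>?s)))\<cdot>(\<alpha> ?r \<one> ?s\<cdot>(inverse_arr M (\<rr> ?r)\<lhd>?s))"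
 proof -
  have "\<alpha> ?r ?s ?s\<cdot>(((?r\<rhd>One S)\<lhd>?s)\<cdot>(inverse_arr M (\<rr> ?r)\<lhd>?s)) =
   (?r\<rhd>(One S\<lhd>?s))\<cdot>(\<alpha> ?r \<one> ?s\<cdot>(inverse_arr M (\<rr> ?r)\<lhd>?s))"
   by (subst assoc_nat_reassoc) auto
  then show ?thesis unfolding tensor_mult_inr by (simp add: tensor_alg_simps(4))
 qed
 also have "... = ((?r\<rhd>\<ll> ?s)\<cdot>\<alpha> ?r \<one> ?s)\<cdot>(inverse_arr M (\<rr> ?r)\<lhd>?s)"
  unfolding monoidD(9)[OF S] by (subst comp_assoc_right) auto
 also have "... = \<i>\<d> (?r\<otimes>?s)" unfolding triangle[OF D(1) D(8)] by simp
 finally show ?thesis .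
qed

lemma tensor_inr_mult:
 "tensor_inr R S\<cdot>Mult S = Mult (tensor_alg M R S)\<cdot>(tensor_inr R S\<odot>tensor_inr R S)"
proof -
 let ?r = "Carrier R" and ?s = "Carrier S"
 have l: "\<alpha> \<one> ?s ?s\<cdot>(inverse_arr M (\<ll> ?s)\<lhd>?s) = inverse_arr M (\<ll> (?s\<otimes>?s))"
 proof (rule iso_cancel_left[of "\<ll> (?s\<otimes>?s)"])
  have "\<ll> (?s\<otimes>?s)\<cdot>(\<alpha> \<one> ?s ?s\<cdot>(inverse_arr M (\<ll> ?s)\<lhd>?s)) =
    (\<ll> (?s\<otimes>?s)\<cdot>\<alpha> \<one> ?s ?s)\<cdot>(inverse_arr M (\<ll> ?s)\<lhd>?s)" by simp
  also have "... = \<ll> (?s\<otimes>?s)\<cdot>inverse_arr M (\<ll> (?s\<otimes>?s))" by (subst lunit_tensor) auto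
  finally show "\<ll> (?s\<otimes>?s)\<cdot>(\<alpha> \<one> ?s ?s\<cdot>(inverse_arr M (\<ll> ?s)\<lhd>?s)) =
   \<ll> (?s\<otimes>?s)\<cdot>inverse_arr M (\<ll> (?s\<otimes>?s))" .
 qed auto
 have m: "inverse_arr M (\<ll> ?s)\<cdot>Mult S = (\<one>\<rhd>Mult S)\<cdot>inverse_arr M (\<ll> (?s\<otimes>?s))"
  by (rule iso_cancel_left[of "\<ll> ?s"]) auto
 have "Mult (tensor_alg M R S)\<cdot>(tensor_inr R S\<odot>tensor_inr R S) =
   (Mult (tensor_alg M R S)\<cdot>((?r\<otimes>?s)\<rhd>tensor_inr R S))\<cdot>(tensor_inr R S\<lhd>?s)" by simp
 also have "... = (?r\<rhd>Mult S)\<cdot>(\<alpha> ?r ?s ?s\<cdot>(((One R\<lhd>?s)\<lhd>?s)\<cdot>(inverse_arr M (\<ll> ?s)\<lhd>?s)))"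
  unfolding tensor_mult_inr by (simp add: tensor_inr_def)
 also have "... = (One R\<odot>Mult S)\<cdot>(\<alpha> \<one> ?s ?s\<cdot>(inverse_arr M (\<ll> ?s)\<lhd>?s))"
  by (subst assoc_nat_reassoc) auto
 also have "... = tensor_inr R S\<cdot>Mult S" unfolding l tensor_inr_def using m by simp
 finally show ?thesis by simp
qed

lemma tensor_inr_One: "tensor_inr R S\<cdot>One S = One (tensor_alg M R S)"
proof -
 have "inverse_arr M (\<ll> (Carrier S))\<cdot>One S = (\<one>\<rhd>One S)\<cdot>inverse_arr M (\<ll> \<one>)"
  by (rule iso_cancel_left[of "\<ll> (Carrier S)"]) auto
 then show ?thesis by (simp add: tensor_inr_def tensor_alg_simps)
qed

end

text \<open>Products of four factors are compared; the middle interchange in the multiplication of the tensor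
 product is absorbed by commutativity of \<open>Z\<close>.\<close>

lemma tensor_copair_hom:
 assumes R: "commutative_monoid M R" and S: "commutative_monoid M S" and Z: "commutative_monoid M Z"
  and f: "monoid_hom M R Z f" and g: "monoid_hom M S Z g"
 shows "monoid_hom M (tensor_alg M R S) Z (Mult Z\<cdot>(f\<odot>g))"
proof -
 note r = monoidD(1-7)[OF R] and s = monoidD(1-7)[OF S] and z = monoidD(1-7)[OF Z]
 have fh: "f\<in>Arr M" "Dom M f = Carrier R" "Cod M f = Carrier Z" "f\<cdot>Mult R = Mult Z\<cdot>(f\<odot>f)" "f\<cdot>One R = One Z"
  using f unfolding monoid_hom_def by auto
 have gh: "g\<in>Arr M" "Dom M g = Carrier S" "Cod M g = Carrier Z" "g\<cdot>Mult S = Mult Z\<cdot>(g\<odot>g)" "g\<cdot>One S = One Z"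
  using g unfolding monoid_hom_def by auto
 let ?z = "Carrier Z" and ?m = "Mult Z"
 have mid: "?m\<cdot>((?m\<odot>?m)\<cdot>middle_exchange M ?z ?z ?z ?z) = ?m\<cdot>(?m\<odot>?m)"
 proof -
  have a: "?m\<cdot>(?m\<odot>?m) = ?m\<cdot>((?z\<rhd>(?m\<cdot>(?z\<rhd>?m)))\<cdot>\<alpha> ?z ?z (?z\<otimes>?z))"
  proof -
   have "?m\<cdot>(?m\<odot>?m) = (?m\<cdot>(?m\<lhd>?z))\<cdot>((?z\<otimes>?z)\<rhd>?m)" using z by simp
   also have "... = ?m\<cdot>((?z\<rhd>(?m\<cdot>(?z\<rhd>?m)))\<cdot>\<alpha> ?z ?z (?z\<otimes>?z))"
    unfolding monoidD(8)[OF Z] using z by simp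
   finally show ?thesis .
  qed
  have e: "?m\<cdot>((?z\<rhd>?m)\<cdot>exchange M ?z ?z ?z) = ?m\<cdot>(?z\<rhd>?m)"
  proof -
   have "?m\<cdot>((?z\<rhd>?m)\<cdot>exchange M ?z ?z ?z) =
     (?m\<cdot>((?z\<rhd>?m)\<cdot>\<alpha> ?z ?z ?z))\<cdot>((\<beta> ?z ?z\<lhd>?z)\<cdot>\<alpha>\<^sup>- ?z ?z ?z)"
    using z by (simp add: exchange_def)
   also have "... = ?m\<cdot>(((?m\<cdot>\<beta> ?z ?z)\<lhd>?z)\<cdot>\<alpha>\<^sup>- ?z ?z ?z)"
    unfolding monoidD(8)[OF Z, symmetric] using z by simp
   also have "... = (?m\<cdot>(?m\<lhd>?z))\<cdot>\<alpha>\<^sup>- ?z ?z ?z" unfolding monoidD(11)[OF Z] using z by simp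
   also have "... = ?m\<cdot>(?z\<rhd>?m)" unfolding monoidD(8)[OF Z] using z by simp
   finally show ?thesis .
  qed
  have "?m\<cdot>((?m\<odot>?m)\<cdot>middle_exchange M ?z ?z ?z ?z) = (?m\<cdot>(?m\<odot>?m))\<cdot>middle_exchange M ?z ?z ?z ?z"
   using z by simp
  also have "... = ?m\<cdot>((?z\<rhd>(?m\<cdot>((?z\<rhd>?m)\<cdot>exchange M ?z ?z ?z)))\<cdot>\<alpha> ?z ?z (?z\<otimes>?z))"
   unfolding a using z by (simp add: middle_exchange_def)
  finally show ?thesis unfolding e a .
 qed
 have "(?m\<cdot>(f\<odot>g))\<cdot>Mult (tensor_alg M R S) = ?m\<cdot>(((f\<cdot>Mult R)\<odot>(g\<cdot>Mult S)) \<cdot>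
   middle_exchange M (Carrier R) (Carrier S) (Carrier R) (Carrier S))"
  using r s z fh(1-3) gh(1-3) by (simp add: tensor_alg_def)
 also have "... = ?m\<cdot>((?m\<odot>?m)\<cdot>(((f\<odot>f)\<odot>(g\<odot>g))\<cdot>middle_exchange M (Carrier R) (Carrier S) (Carrier R) (Carrier S)))"
  unfolding fh(4) gh(4) using r s z fh(1-3) gh(1-3) by simp
 also have "... = ?m\<cdot>((?m\<odot>?m)\<cdot>(middle_exchange M ?z ?z ?z ?z\<cdot>((f\<odot>g)\<odot>(f\<odot>g))))"
  using r s z fh(1-3) gh(1-3) by (subst middle_exchange_nat) auto
 also have "... = (?m\<cdot>((?m\<odot>?m)\<cdot>middle_exchange M ?z ?z ?z ?z))\<cdot>((f\<odot>g)\<odot>(f\<odot>g))"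
  using r s z fh(1-3) gh(1-3) by simp
 also have "... = ?m\<cdot>((?m\<cdot>(f\<odot>g))\<odot>(?m\<cdot>(f\<odot>g)))"
  unfolding mid using r s z fh(1-3) gh(1-3) by simp
 finally have mu: "(?m\<cdot>(f\<odot>g))\<cdot>Mult (tensor_alg M R S) = ?m\<cdot>((?m\<cdot>(f\<odot>g))\<odot>(?m\<cdot>(f\<odot>g)))" .
 have "(?m\<cdot>(f\<odot>g))\<cdot>One (tensor_alg M R S) = ?m\<cdot>(((f\<cdot>One R)\<odot>(g\<cdot>One S))\<cdot>inverse_arr M (\<ll> \<one>))"
  using r s z fh(1-3) gh(1-3) by (simp add: tensor_alg_def)
 also have "... = (?m\<cdot>(One Z\<lhd>?z))\<cdot>((\<one>\<rhd>One Z)\<cdot>inverse_arr M (\<ll> \<one>))"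
  unfolding fh(5) gh(5) using z by simp
 also have "... = One Z" unfolding monoidD(9)[OF Z] using z by simp
 finally have "(?m\<cdot>(f\<odot>g))\<cdot>One (tensor_alg M R S) = One Z" .
 then show ?thesis unfolding monoid_hom_def using mu r s z fh gh by (simp add: tensor_alg_def)
qed

text \<open>This is the quotient by the ideal generated by the differences of \<open>a\<close> and \<open>b\<close>. The relations are closed
 under multiplication from both sides, by associativity and commutativity, so the multiplication descends
 along \<open>q\<odot>q\<close>, which is again a quotient. The axioms are inherited since its tensor powers are epic.\<close>

lemma quotient_monoid:
 assumes E: "commutative_monoid M E" and a: "a\<in>Hom M K (Carrier E)" and b: "b\<in>Hom M K (Carrier E)"
  and g: "is_glue M {()} (\<lambda>_. Carrier E)
   {((), Mult E\<cdot>(Carrier E\<rhd>a), (), Mult E\<cdot>(Carrier E\<rhd>b))} Q (\<lambda>_. q)"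
 shows "\<exists>m. commutative_monoid M \<lparr>Carrier = Q, Mult = m, One = q\<cdot>One E\<rparr> \<and> m\<cdot>(q\<odot>q) = q\<cdot>Mult E"
proof -
 let ?e = "Carrier E" and ?m = "Mult E"
 note e = monoidD(1-7)[OF E]
 have a: "a\<in>Arr M" "Dom M a = K" "Cod M a = ?e" and b: "b\<in>Arr M" "Dom M b = K" "Cod M b = ?e" using a b by auto
 have K: "K\<in>Obj M" using a by auto
 have wf: "glue_relations M {()} (\<lambda>_. ?e) {((), ?m\<cdot>(?e\<rhd>a), (), ?m\<cdot>(?e\<rhd>b))}"
  unfolding glue_relations_def using e a b by simp
 have G: "q\<in>Arr M" "Dom M q = ?e" "Cod M q = Q" "Q\<in>Obj M" using is_glue_hom(1-3)[OF g, of "()"] is_glue_hom(4)[OF g] by auto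
 have qe: "jointly_epic {()} Q (\<lambda>_. q)" by (rule is_glue_epic[OF g wf])
 have qr: "q\<cdot>(?m\<cdot>(?e\<rhd>a)) = q\<cdot>(?m\<cdot>(?e\<rhd>b))" using is_glue_rel[OF g] by blast
 have r1: "q\<cdot>?m\<cdot>((?m\<cdot>(?e\<rhd>c))\<lhd>?e) = (q\<cdot>(?m\<cdot>(?e\<rhd>c)))\<cdot>((?m\<lhd>K)\<cdot>\<tau> ?e K ?e)"
  if c: "c\<in>Arr M" "Dom M c = K" "Cod M c = ?e" for c
 proof -
  have "q\<cdot>?m\<cdot>((?m\<cdot>(?e\<rhd>c))\<lhd>?e) = q\<cdot>((?m\<cdot>(?m\<lhd>?e))\<cdot>((?e\<rhd>c)\<lhd>?e))"
   using e G c K by simp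
  also have "... = q\<cdot>(?m\<cdot>((?m\<lhd>?e)\<cdot>(\<tau> ?e ?e ?e\<cdot>((?e\<rhd>c)\<lhd>?e))))"
   unfolding monoid_mult_swap[OF E, symmetric] using e G c K by simp
  also have "... = q\<cdot>(?m\<cdot>((?m\<lhd>?e)\<cdot>(((?e\<rhd>\<i>\<d> ?e)\<odot>c)\<cdot>\<tau> ?e K ?e)))"
   using e G c K by (subst right_swap_nat) auto
  also have "... = (q\<cdot>(?m\<cdot>(?e\<rhd>c)))\<cdot>((?m\<lhd>K)\<cdot>\<tau> ?e K ?e)"
   using e G c K by simp
  finally show ?thesis .
 qed
 have r2: "q\<cdot>?m\<cdot>(?e\<rhd>(?m\<cdot>(?e\<rhd>c))) = (q\<cdot>(?m\<cdot>(?e\<rhd>c)))\<cdot>((?m\<lhd>K)\<cdot>\<alpha>\<^sup>- ?e ?e K)"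
  if c: "c\<in>Arr M" "Dom M c = K" "Cod M c = ?e" for c
 proof -
  have "q\<cdot>?m\<cdot>(?e\<rhd>(?m\<cdot>(?e\<rhd>c))) =
    q\<cdot>((?m\<cdot>((?e\<rhd>?m)\<cdot>\<alpha> ?e ?e ?e))\<cdot>(((?e\<rhd>\<i>\<d> ?e)\<odot>c)\<cdot>\<alpha>\<^sup>- ?e ?e K))"
   using e G c K by simp
  also have "... = (q\<cdot>(?m\<cdot>(?e\<rhd>c)))\<cdot>((?m\<lhd>K)\<cdot>\<alpha>\<^sup>- ?e ?e K)"
   unfolding monoidD(8)[OF E, symmetric] using e G c K by simp
  finally show ?thesis .
 qed
 obtain m where m: "m\<in>Arr M" "Dom M m = Q\<otimes>Q" "Cod M m = Q"
  "\<And>i j. i\<in>{()} ==> j\<in>{()} ==> m\<cdot>(q\<odot>q) = q\<cdot>?m"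
  by (rule is_glue_tensor_ex[OF g wf g wf G(4), of "\<lambda>_ _. q\<cdot>?m"])
   (use e G qr r1[OF a] r1[OF b] r2[OF a] r2[OF b] in auto)
 then have mq: "m\<cdot>(q\<odot>q) = q\<cdot>?m" by simp
 let ?A = "\<lparr>Carrier = Q, Mult = m, One = q\<cdot>One E\<rparr>"
 have e2: "jointly_epic ({()} \<times> {()}) (Q\<otimes>Q) (\<lambda>(i, j). q\<odot>q)"
  by (rule jointly_epic_tensor[OF qe _ qe]) (use G in auto)
 have e3: "jointly_epic (({()} \<times> {()}) \<times> {()}) ((Q\<otimes>Q)\<otimes>Q) (\<lambda>(p, k). (case p of (i, j) => q\<odot>q)\<odot>q)"
  by (rule jointly_epic_tensor[OF e2 _ qe]) (use G in auto)
 have e3': "jointly_epic ({()} \<times> {()} \<times> {()}) ((Q\<otimes>Q)\<otimes>Q) (\<lambda>(i, j, k). (q\<odot>q)\<odot>q)"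
  by (rule jointly_epic_cover[OF e3]) auto
 have "commutative_monoid M ?A"
 proof (rule monoid_from_generators[where T = "{()}" and \<iota> = "\<lambda>_. q" and F = "\<lambda>_. ?e" and
    ?T2.0 = "{()} \<times> {()}" and ?T3.0 = "{()} \<times> {()} \<times> {()}"])
  have "m\<cdot>((q\<cdot>One E)\<odot>q) = (m\<cdot>(q\<odot>q))\<cdot>(One E\<lhd>?e)" using m(1-3) G e by simp
  also have "... = q\<cdot>\<ll> ?e" unfolding mq using monoidD(9)[OF E] G e by simp
  finally show "Mult ?A\<cdot>(One ?A\<odot>q) = q\<cdot>\<ll> ?e" by simp
  have "m\<cdot>((q\<odot>q)\<cdot>\<beta> ?e ?e) = (m\<cdot>(q\<odot>q))\<cdot>\<beta> ?e ?e" using m(1-3) G e by simp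
  also have "... = m\<cdot>(q\<odot>q)" unfolding mq using monoidD(11)[OF E] G e by simp
  finally show "Mult ?A\<cdot>((q\<odot>q)\<cdot>\<beta> ?e ?e) = Mult ?A\<cdot>(q\<odot>q)" by simp
  have "m\<cdot>((m\<cdot>(q\<odot>q))\<odot>q) = m\<cdot>((q\<cdot>?m)\<odot>q)" by (simp only: mq)
  also have "... = (m\<cdot>(q\<odot>q))\<cdot>(?m\<lhd>?e)" using m(1-3) G e by simp
  also have "... = q\<cdot>(?m\<cdot>(?m\<lhd>?e))" unfolding mq using G e by simp
  also have "... = (q\<cdot>?m)\<cdot>((?e\<rhd>?m)\<cdot>\<alpha> ?e ?e ?e)" unfolding monoidD(8)[OF E] using G e by simp
  also have "... = (m\<cdot>(q\<odot>q))\<cdot>((?e\<rhd>?m)\<cdot>\<alpha> ?e ?e ?e)" by (simp only: mq)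
  also have "... = m\<cdot>((q\<odot>(q\<cdot>?m))\<cdot>\<alpha> ?e ?e ?e)" using m(1-3) G e by simp
  also have "... = m\<cdot>((q\<odot>(m\<cdot>(q\<odot>q)))\<cdot>\<alpha> ?e ?e ?e)" by (simp only: mq)
  finally show "Mult ?A\<cdot>((Mult ?A\<cdot>(q\<odot>q))\<odot>q) = Mult ?A\<cdot>((q\<odot>(Mult ?A\<cdot>(q\<odot>q)))\<cdot>\<alpha> ?e ?e ?e)"
   by simp
 qed (use m(1-3) G e qe e2 e3' in auto)
 then show ?thesis using mq by blast
qed

end

section \<open>Attaching a cell to a commutative monoid\<close>

lemma (in attaching) last_swap_stab: "last_swap (Suc (Suc (i + m))) (stab m (\<tau> (Bp i) L L))"
proof (induction m)
 case 0
 show ?case using last_swap.intros(1)[of i] by simp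
next
 case (Suc m)
 then show ?case using last_swap.intros(2)[OF Suc] stab_Suc[of m] by simp
qed

lemma (in attaching) family_cong:
 assumes f: "family N Z g" and e: "\<And>j. j \<le> N ==> g' j = g j"
 shows "family N Z g'"
 unfolding family_def
proof (intro conjI allI impI)
 show "g' j\<in>Hom M (Bp j) Z" if "j \<le> N" for j using familyD(1-3)[OF f that] e[OF that] by simp
 show "g' j\<cdot>s = g' j" if "j \<le> N" "last_swap j s" for j s using familyD(4)[OF f that] e[OF that(1)] by simp
 show "g' (Suc j)\<cdot>(Bp j\<rhd>h) = g' j\<cdot>act j" if "j < N" for j
  using familyD(5)[OF f that] e[of j] e[of "Suc j"] that by simp
qed

text \<open>The terms are chosen recursively; each choice keeps the previous ones, so the diagonal is a family.\<close>

lemma (in attaching) families_lift: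
 assumes data: "\<And>n. \<exists>Q \<iota> k q p l. is_iterated_pushout_product M h (Suc n) Q \<iota> k \<and>
   is_coinvariants M Q (cube_action M h (Suc n) Q \<iota>) q \<and>
   is_coinvariants M (tensor_power M L (Suc n)) (power_action M L (Suc n)) p \<and>
   l\<in>Hom M (Cod M q) (Cod M p) \<and> l\<cdot>q = p\<cdot>k \<and> has_lifting M (A\<rhd>l) r"
  and r: "r\<in>Arr M" "Dom M r = X" "Cod M r = Y"
  and v: "\<And>N. family N Y v" and u: "u\<in>Hom M A X" "r\<cdot>u = v 0"
 shows "\<exists>g. (\<forall>N. family N X g) \<and> (\<forall>n. r\<cdot>g n = v n) \<and> g 0 = u"
proof -
 define P where "P = (\<lambda>n g. family n X g \<and> (\<forall>j\<le>n. r\<cdot>g j = v j) \<and> g 0 = u)"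
 have "\<exists>g. P 0 g"
 proof
  have "family 0 X (\<lambda>_. u)" unfolding family_def using u(1) by (auto simp: last_swap.simps[of 0])
  then show "P 0 (\<lambda>_. u)" unfolding P_def using u(2) by simp
 qed
 moreover have "\<exists>g'. P (Suc n) g' \<and> (\<forall>j\<le>n. g' j = g j)" if g: "P n g" for n g
 proof -
  obtain Q \<iota> k q p l where d: "is_iterated_pushout_product M h (Suc n) Q \<iota> k"
   "is_coinvariants M Q (cube_action M h (Suc n) Q \<iota>) q"
   "is_coinvariants M (tensor_power M L (Suc n)) (power_action M L (Suc n)) p"
   "l\<in>Hom M (Cod M q) (Cod M p)" "l\<cdot>q = p\<cdot>k" "has_lifting M (A\<rhd>l) r"
   using data[of n] by metis
  have g': "family n X g" "\<And>j. j \<le> n ==> r\<cdot>g j = v j" "g 0 = u" using g unfolding P_def by auto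
  obtain x where x: "family (Suc n) X (g(Suc n := x))" "r\<cdot>x = v (Suc n)"
   using extend_family[OF d g'(1) r v g'(2)] by blast
  have "P (Suc n) (g(Suc n := x))" unfolding P_def using x g' by (auto simp: le_Suc_eq)
  then show ?thesis by (intro exI[of _ "g(Suc n := x)"]) auto
 qed
 ultimately obtain F where F: "\<And>n. P n (F n)" "\<And>n j. j \<le> n ==> F (Suc n) j = F n j"
  using dependent_nat_choice[of P "\<lambda>n g g'. \<forall>j\<le>n. g' j = g j"] by metis
 have st: "F (j + m) j = F j j" for j m
  by (induction m) (use F(2) in auto)
 have st': "F n j = F j j" if "j \<le> n" for j n using st[of j "n - j"] that by simp
 define g where "g = (\<lambda>n. F n n)"
 have "family N X g" for N
 proof -
  have "family N X (F N)" using F(1) unfolding P_def by blast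
  then show ?thesis by (rule family_cong) (unfold g_def, rule st'[symmetric])
 qed
 moreover have "r\<cdot>g n = v n" for n using F(1)[of n] unfolding P_def g_def by blast
 moreover have "g 0 = u" using F(1)[of 0] unfolding P_def g_def by blast
 ultimately show ?thesis by blast
qed

text \<open>Commutativity of the monoid makes the actions of two elements of \<open>K\<close> commute.\<close>

lemma (in closed_symmetric_monoidal) attaching_monoid:
 assumes A: "commutative_monoid M A" and h: "h\<in>Arr M" and k: "k\<in>Hom M (Dom M h) (Carrier A)"
 shows "attaching M (Carrier A) h (Mult A\<cdot>(Carrier A\<rhd>k))"
proof unfold_locales
 let ?c = "Carrier A" and ?m = "Mult A" and ?K = "Dom M h"
 note a = monoidD(1-7)[OF A]
 have K: "?K\<in>Obj M" using h by simp
 have k: "k\<in>Arr M" "Dom M k = ?K" "Cod M k = ?c" using k by auto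
 have e: "(?m\<cdot>(?c\<rhd>k))\<cdot>((?m\<cdot>(?c\<rhd>k))\<lhd>?K) = (?m\<cdot>(?m\<lhd>?c))\<cdot>((?c\<rhd>k)\<odot>k)"
  using a k K by simp
 have "?m\<cdot>(?c\<rhd>k)\<cdot>(((?m\<cdot>(?c\<rhd>k))\<lhd>?K)\<cdot>\<tau> ?c ?K ?K) =
   (?m\<cdot>(?m\<lhd>?c))\<cdot>(((?c\<rhd>k)\<odot>k)\<cdot>\<tau> ?c ?K ?K)"
  using a k K by simp
 also have "... = (?m\<cdot>(?m\<lhd>?c))\<cdot>(\<tau> ?c ?c ?c\<cdot>((?c\<rhd>k)\<odot>k))"
  using a k K by (subst right_swap_nat) auto
 also have "... = (?m\<cdot>((?m\<lhd>?c)\<cdot>\<tau> ?c ?c ?c))\<cdot>((?c\<rhd>k)\<odot>k)" using a k K by simp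
 also have "... = (?m\<cdot>(?c\<rhd>k))\<cdot>((?m\<cdot>(?c\<rhd>k))\<lhd>?K)"
  unfolding monoid_mult_swap[OF A] e ..
 finally show "?m\<cdot>(?c\<rhd>k)\<cdot>(((?m\<cdot>(?c\<rhd>k))\<lhd>?K)\<cdot>\<tau> ?c ?K ?K) =
   ?m\<cdot>(?c\<rhd>k)\<cdot>((?m\<cdot>(?c\<rhd>k))\<lhd>?K)" using a k K by simp
qed (use monoidD[OF A] h k in auto)

text \<open>Here \<open>S\<close> is the free commutative monoid on the codomain of \<open>h\<close>, and the cell is attached along
 \<open>k : Dom M h \<rightarrow> Carrier R\<close>.\<close>

locale cell_attachment = closed_symmetric_monoidal M
 for M :: "('o, 'm, 'z) smcat_scheme" (structure) +
 fixes R S :: "('o, 'm) cmon" and h k :: 'm and \<iota> :: "nat => 'm"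
 assumes R: "commutative_monoid M R" and h: "h\<in>Arr M" and k: "k\<in>Hom M (Dom M h) (Carrier R)"
  and S: "is_Sym M (Cod M h) S \<iota>"

sublocale cell_attachment \<subseteq> attaching M "Carrier R" h "Mult R\<cdot>(Carrier R\<rhd>k)"
 using attaching_monoid[OF R h k] .

context cell_attachment
begin

lemma S_monoid: "commutative_monoid M S"
 using S unfolding is_Sym_def by blast

lemma S_mult: "Mult S\<cdot>(\<iota> m\<odot>\<iota> n) = \<iota> (m + n)\<cdot>append_iso M (replicate m L) (replicate n L)"
 using S unfolding is_Sym_def by blast

lemma S_One: "One S = \<iota> 0"
 using S unfolding is_Sym_def by blast

lemma S_glue: "is_glue M UNIV (tensor_power M L) (sym_relations L) (Carrier S) \<iota>"
 "glue_relations M UNIV (tensor_power M L) (sym_relations L)"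
 using sym_cocone_glue[OF _ is_Sym_cocone[OF S]] glue_relations_sym by auto

lemma R_arr [simp]: "Carrier R\<in>Obj M" "Mult R\<in>Arr M" "Dom M (Mult R) = Carrier R\<otimes>Carrier R"
  "Cod M (Mult R) = Carrier R" "One R\<in>Arr M" "Dom M (One R) = \<one>" "Cod M (One R) = Carrier R"
 using monoidD[OF R] by auto

lemma S_arr [simp]: "Carrier S\<in>Obj M" "Mult S\<in>Arr M" "Dom M (Mult S) = Carrier S\<otimes>Carrier S"
  "Cod M (Mult S) = Carrier S" "One S\<in>Arr M" "Dom M (One S) = \<one>" "Cod M (One S) = Carrier S"
 using monoidD[OF S_monoid] by auto

lemma \<iota>_arr [simp]: "\<iota> n\<in>Arr M" "Dom M (\<iota> n) = tensor_power M L n" "Cod M (\<iota> n) = Carrier S"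
 using is_glue_hom(1-3)[OF S_glue(1), of n] by auto

lemma k_arr [simp]: "k\<in>Arr M" "Dom M k = K" "Cod M k = Carrier R"
 using k by auto

lemma replicate_L [simp]: "set (replicate n L) \<subseteq> Obj M" "L\<in>Obj M" "K\<in>Obj M"
 by auto

abbreviation E where "E \<equiv> tensor_alg M R S"

text \<open>The restriction of the inclusion of \<open>S\<close> to its generators \<open>L\<close>.\<close>

definition inl where "inl = tensor_inr R S\<cdot>(\<iota> 1\<cdot>inverse_arr M (\<rr> L))"

lemmas E_arr [simp] = tensor_inr_arr[OF R S_monoid] tensor_Struct_arr[OF R S_monoid] tensor_Mult_arr[OF R S_monoid]

lemma inl_arr [simp]: "inl\<in>Arr M" "Dom M inl = L" "Cod M inl = Carrier R\<otimes>Carrier S"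
 by (auto simp: inl_def)

text \<open>The two arrows \<open>e \<otimes> y \<mapsto> e h(y)\<close> and \<open>e \<otimes> y \<mapsto> e k(y)\<close> from \<open>E\<otimes>K\<close> to \<open>E\<close>; their coequalizer is the quotient of
 \<open>E\<close> by the ideal that identifies \<open>h\<close> with \<open>k\<close>.\<close>

definition left_rel where "left_rel = Mult E\<cdot>((Carrier R\<otimes>Carrier S)\<rhd>(inl\<cdot>h))"
definition right_rel where "right_rel = Mult E\<cdot>((Carrier R\<otimes>Carrier S)\<rhd>(Struct E\<cdot>k))"

text \<open>The restriction of an arrow on \<open>R\<otimes>S\<close> to \<open>R\<otimes>L\<^sup>n\<close>, with the factors bracketed to the left.\<close>

definition terms :: "'m => nat => 'm" where
 "terms f n = f\<cdot>((Carrier R\<rhd>\<iota> n)\<cdot>inverse_arr M (flat n 0))"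

lemma terms_flat:
 assumes "f\<in>Arr M" "Dom M f = Carrier R\<otimes>Carrier S"
 shows "terms f n\<in>Arr M" "Dom M (terms f n) = Bp n" "Cod M (terms f n) = Cod M f"
  "terms f n\<cdot>flat n 0 = f\<cdot>(Carrier R\<rhd>\<iota> n)"
 using assms flat_arr[of n 0] by (auto simp: terms_def)

text \<open>Multiplication by a generator of \<open>S\<close> appends a factor \<open>L\<close>.\<close>

lemma left_rel_terms:
 assumes f: "f\<in>Arr M" "Dom M f = Carrier R\<otimes>Carrier S"
 shows "f\<cdot>left_rel\<cdot>((Carrier R\<rhd>\<iota> n)\<lhd>K) = (terms f (Suc n)\<cdot>(Bp n\<rhd>h))\<cdot>(flat n 0\<lhd>K)"
proof -
 let ?r = "Carrier R" and ?s = "Carrier S" and ?w = "tensor_power M L n" and ?a = "append_iso M (replicate n L) [L]"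
 let ?ri = "inverse_arr M (\<rr> L)"
 note t = terms_flat[OF f, of "Suc n"] and fl = flat_arr[of n 0] flat_arr[of "Suc n" 0]
 have ap: "?a\<in>Arr M" "Dom M ?a = ?w\<otimes>(L\<otimes>\<one>)" "Cod M ?a = tensor_power M L (Suc n)"
  using append_iso_arr[OF replicate_L(1), of "[L]" n] by (auto simp: replicate_append_same)
 have m1: "Mult S\<cdot>(\<iota> n\<odot>\<iota> 1) = \<iota> (Suc n)\<cdot>?a" using S_mult[of n 1] by simp
 have "f\<cdot>left_rel\<cdot>((?r\<rhd>\<iota> n)\<lhd>K) =
   f\<cdot>((Mult E\<cdot>((?r\<otimes>?s)\<rhd>tensor_inr R S))\<cdot>((?r\<rhd>\<iota> n)\<odot>(\<iota> 1\<cdot>(?ri\<cdot>h))))"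
  using f by (simp add: left_rel_def inl_def)
 also have "... = f\<cdot>((?r\<rhd>Mult S)\<cdot>(\<alpha> ?r ?s ?s\<cdot>(((?r\<rhd>\<iota> n)\<odot>\<iota> 1)\<cdot>((?r\<otimes>?w)\<rhd>(?ri\<cdot>h)))))"
  unfolding tensor_mult_inr[OF R S_monoid] using f by simp
 also have "... = f\<cdot>((?r\<rhd>(Mult S\<cdot>(\<iota> n\<odot>\<iota> 1)))\<cdot>(\<alpha> ?r ?w (L\<otimes>\<one>)\<cdot>((?r\<otimes>?w)\<rhd>(?ri\<cdot>h))))"
  using f by (subst assoc_nat_reassoc) auto
 also have "... = (f\<cdot>(?r\<rhd>\<iota> (Suc n)))\<cdot>(((?r\<rhd>?a)\<cdot>\<alpha> ?r ?w (L\<otimes>\<one>))\<cdot>((?r\<otimes>?w)\<rhd>(?ri\<cdot>h)))"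
  unfolding m1 using f ap by simp
 also have "... = terms f (Suc n)\<cdot>((flat (Suc n) 0\<cdot>((Bp 0\<rhd>?a)\<cdot>\<alpha> (Bp 0) ?w (L\<otimes>\<one>)))\<cdot>((?r\<otimes>?w)\<rhd>(?ri\<cdot>h)))"
  unfolding t(4)[symmetric] using t(1-3) fl ap by (simp del: flat.simps)
 also have "... = (terms f (Suc n)\<cdot>(Bp n\<rhd>h))\<cdot>(flat n 0\<lhd>K)"
  unfolding flat_append using t(1-3) fl(1-4) by simp
 finally show ?thesis .
qed

text \<open>Multiplication by an element of \<open>R\<close> acts on the factor \<open>R\<close>.\<close>

lemma right_rel_terms:
 assumes f: "f\<in>Arr M" "Dom M f = Carrier R\<otimes>Carrier S"
 shows "f\<cdot>right_rel\<cdot>((Carrier R\<rhd>\<iota> n)\<lhd>K) = (terms f n\<cdot>act n)\<cdot>(flat n 0\<lhd>K)"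
proof -
 let ?r = "Carrier R" and ?s = "Carrier S" and ?w = "tensor_power M L n"
 note t = terms_flat[OF f, of n] and fl = flat_arr[of n 0]
 have "f\<cdot>right_rel\<cdot>((?r\<rhd>\<iota> n)\<lhd>K) =
   f\<cdot>((Mult E\<cdot>((?r\<otimes>?s)\<rhd>Struct E))\<cdot>((?r\<rhd>\<iota> n)\<odot>k))"
  using f by (simp add: right_rel_def)
 also have "... = f\<cdot>((Mult R\<lhd>?s)\<cdot>(\<tau> ?r ?s ?r\<cdot>((?r\<rhd>\<iota> n)\<odot>k)))"
  unfolding tensor_mult_Struct[OF R S_monoid] using f by simp
 also have "... = f\<cdot>((Mult R\<lhd>?s)\<cdot>(((?r\<rhd>k)\<odot>\<iota> n)\<cdot>\<tau> ?r ?w K))"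
  by (subst right_swap_nat) auto
 also have "... = (f\<cdot>(?r\<rhd>\<iota> n))\<cdot>((act 0\<lhd>?w)\<cdot>\<tau> (Bp 0) ?w K)" using f by simp
 also have "... = terms f n\<cdot>(flat n 0\<cdot>((act 0\<lhd>?w)\<cdot>\<tau> (Bp 0) ?w K))"
  unfolding t(4)[symmetric] using t(1-3) fl by (simp del: act.simps)
 also have "... = (terms f n\<cdot>act n)\<cdot>(flat n 0\<lhd>K)"
  using flat_act[of 0 n] t(1-3) fl by simp
 finally show ?thesis .
qed

lemma rel_arr [simp]: "left_rel\<in>Arr M" "right_rel\<in>Arr M"
 "Dom M left_rel = (Carrier R\<otimes>Carrier S)\<otimes>K" "Dom M right_rel = (Carrier R\<otimes>Carrier S)\<otimes>K"
 "Cod M left_rel = Carrier R\<otimes>Carrier S" "Cod M right_rel = Carrier R\<otimes>Carrier S"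
 by (auto simp: left_rel_def right_rel_def)

lemma E_epic:
 "jointly_epic UNIV (Carrier R\<otimes>Carrier S) (\<lambda>n. Carrier R\<rhd>\<iota> n)"
 by (rule jointly_epic_tensor_left[OF is_glue_epic[OF S_glue]]) auto

lemma coequalizes_iff:
 assumes f: "f\<in>Arr M" "Dom M f = Carrier R\<otimes>Carrier S"
 shows "f\<cdot>left_rel = f\<cdot>right_rel \<longleftrightarrow> (\<forall>n. terms f (Suc n)\<cdot>(Bp n\<rhd>h) = terms f n\<cdot>act n)"
proof
 assume e: "f\<cdot>left_rel = f\<cdot>right_rel"
 show "\<forall>n. terms f (Suc n)\<cdot>(Bp n\<rhd>h) = terms f n\<cdot>act n"
 proof
  fix n
  note t = terms_flat[OF f, of n] terms_flat[OF f, of "Suc n"]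
  have "(terms f (Suc n)\<cdot>(Bp n\<rhd>h))\<cdot>(flat n 0\<lhd>K) = (terms f n\<cdot>act n)\<cdot>(flat n 0\<lhd>K)"
   unfolding left_rel_terms[OF f, symmetric] right_rel_terms[OF f, symmetric] e ..
  then show "terms f (Suc n)\<cdot>(Bp n\<rhd>h) = terms f n\<cdot>act n"
   by (rule iso_cancel_right) (use t flat_arr[of n 0] in auto)
 qed
next
 assume e: "\<forall>n. terms f (Suc n)\<cdot>(Bp n\<rhd>h) = terms f n\<cdot>act n"
 have j: "jointly_epic UNIV ((Carrier R\<otimes>Carrier S)\<otimes>K) (\<lambda>n. (Carrier R\<rhd>\<iota> n)\<lhd>K)"
  by (rule jointly_epic_tensor_right[OF E_epic]) auto
 show "f\<cdot>left_rel = f\<cdot>right_rel"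
 proof (rule jointly_epicD[OF j])
  show "f\<cdot>left_rel\<cdot>((Carrier R\<rhd>\<iota> n)\<lhd>K) = f\<cdot>right_rel\<cdot>((Carrier R\<rhd>\<iota> n)\<lhd>K)" for n
   unfolding left_rel_terms[OF f] right_rel_terms[OF f] using e by simp
 qed (use f in auto)
qed

lemma terms_family:
 assumes f: "f\<in>Arr M" "Dom M f = Carrier R\<otimes>Carrier S" "f\<cdot>left_rel = f\<cdot>right_rel"
 shows "family N (Cod M f) (terms f)"
 unfolding family_def
proof (intro conjI allI impI)
 note t = terms_flat[OF f(1,2)]
 show "terms f j\<in>Hom M (Bp j) (Cod M f)" for j using t by simp
 show "terms f (Suc j)\<cdot>(Bp j\<rhd>h) = terms f j\<cdot>act j" for j
  using coequalizes_iff[OF f(1,2)] f(3) by blast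
 fix j s assume s: "last_swap j s"
 show "terms f j\<cdot>s = terms f j"
 proof (rule last_swap_invariant[OF t(1,2) _ s])
  fix i assume i: "Suc i < j"
  then have i': "Suc i < length (replicate j L)" by simp
  note ad = adj_iso_arr[OF replicate_L(1) i']
  have "f\<cdot>(Carrier R\<rhd>\<iota> j)\<cdot>(Carrier R\<rhd>adj_iso M (replicate j L) i) =
    f\<cdot>(Carrier R\<rhd>(\<iota> j\<cdot>adj_iso M (replicate j L) i))"
   using f ad by simp
  then show "terms f j\<cdot>flat j 0\<cdot>(Carrier R\<rhd>adj_iso M (replicate j L) i) = terms f j\<cdot>flat j 0"
   unfolding t(4) using sym_cocone_invariant[OF _ is_Sym_cocone[OF S] i] by simp
 qed
qed

text \<open>\<open>R\<otimes>S\<close> is presented by the \<open>R\<otimes>L\<^sup>n\<close> modulo interchanges, so that a symmetric family induces an arrow; it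
 coequalizes the relations because these are the compatibility of consecutive terms.\<close>

lemma family_arrow:
 assumes g: "\<And>N. family N Z g"
 obtains f where "f\<in>Arr M" "Dom M f = Carrier R\<otimes>Carrier S" "Cod M f = Z" "f\<cdot>left_rel = f\<cdot>right_rel"
  "\<And>n. terms f n = g n"
proof -
 have gn: "g n\<in>Arr M" "Dom M (g n) = Bp n" "Cod M (g n) = Z" for n using familyD(1-3)[OF g, of n n] by auto
 have Z: "Z\<in>Obj M" using cod_obj[OF gn(1)[of 0]] gn(3)[of 0] by simp
 note fl = flat_arr
 obtain f where f: "f\<in>Arr M" "Dom M f = Carrier R\<otimes>Carrier S" "Cod M f = Z"
  "\<And>n. n\<in>UNIV ==> f\<cdot>(Carrier R\<rhd>\<iota> n) = g n\<cdot>flat n 0"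
 proof (rule is_glue_ex[OF is_glue_tensor_left[OF S_glue, of "Carrier R"] Z, of "\<lambda>n. g n\<cdot>flat n 0"])
  show "g n\<cdot>flat n 0\<in>Hom M (Carrier R\<otimes>tensor_power M L n) Z" for n using gn fl[of n 0] by simp
  fix i a j b
  assume "(i, a, j, b)\<in>(\<lambda>(i, a, j, b). (i, Carrier R\<rhd>a, j, Carrier R\<rhd>b)) ` sym_relations L"
  then obtain x where x: "Suc x < i" "j = i" "a = Carrier R\<rhd>adj_iso M (replicate i L) x"
   "b = Carrier R\<rhd>\<i>\<d> (tensor_power M L i)"
   unfolding sym_relations_def by auto
  obtain m where m: "i = Suc (Suc (x + m))" using x(1) less_iff_Suc_add[of "Suc x" i] by auto
  have "Suc x < length (replicate i L)" using x(1) by simp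
  note ad = adj_iso_arr[OF replicate_L(1) this]
  let ?s = "stab m (\<tau> (Bp x) L L)"
  have s: "last_swap i ?s" using last_swap_stab[of x m] m by simp
  have "g i\<cdot>flat i 0\<cdot>a = g i\<cdot>(flat i 0\<cdot>(Bp 0\<rhd>adj_iso M (replicate i L) x))"
   using gn fl[of i 0] ad x(3) by simp
  also have "... = g i\<cdot>(?s\<cdot>flat i 0)" using flat_adj[of x m 0] unfolding m[symmetric] by simp
  also have "... = (g i\<cdot>?s)\<cdot>flat i 0" using gn fl[of i 0] last_swap_arr[OF s] by simp
  also have "... = g j\<cdot>flat j 0\<cdot>b" using familyD(4)[OF g _ s, of i] gn fl[of i 0] x(2,4) by simp
  finally show "g i\<cdot>flat i 0\<cdot>a = g j\<cdot>flat j 0\<cdot>b" .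
 qed auto
 have tg: "terms f n = g n" for n
 proof -
  note t = terms_flat[OF f(1,2), of n]
  have "terms f n\<cdot>flat n 0 = g n\<cdot>flat n 0" unfolding t(4) using f(4) by simp
  then show ?thesis by (rule iso_cancel_right) (use t gn fl[of n 0] in auto)
 qed
 have "f\<cdot>left_rel = f\<cdot>right_rel"
  unfolding coequalizes_iff[OF f(1,2)] tg using familyD(5)[OF g] by blast
 then show ?thesis using that f(1-3) tg by blast
qed

text \<open>A square from \<open>q\<cdot>Struct E\<close> to \<open>r\<close> consists of a family in the target of \<open>r\<close> and a lift of its term of
 index \<open>0\<close>. Lifting the family term by term yields the diagonal.\<close>

lemma quotient_lift:
 assumes q: "is_glue M {()} (\<lambda>_. Carrier R\<otimes>Carrier S) {((), left_rel, (), right_rel)} Q (\<lambda>_. q)"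
  and data: "\<And>n. \<exists>Q \<iota> k q p l. is_iterated_pushout_product M h (Suc n) Q \<iota> k \<and>
   is_coinvariants M Q (cube_action M h (Suc n) Q \<iota>) q \<and>
   is_coinvariants M (tensor_power M L (Suc n)) (power_action M L (Suc n)) p \<and>
   l\<in>Hom M (Cod M q) (Cod M p) \<and> l\<cdot>q = p\<cdot>k \<and> has_lifting M (Carrier R\<rhd>l) r"
  and r: "r\<in>Arr M"
 shows "has_lifting M (q\<cdot>Struct E) r"
 unfolding has_lifting_def
proof (intro ballI impI)
 have G: "q\<in>Arr M" "Dom M q = Carrier R\<otimes>Carrier S" "Cod M q = Q" "Q\<in>Obj M"
  using is_glue_hom(1-3)[OF q, of "()"] is_glue_hom(4)[OF q] by auto
 have wf: "glue_relations M {()} (\<lambda>_. Carrier R\<otimes>Carrier S) {((), left_rel, (), right_rel)}"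
  unfolding glue_relations_def by simp
 note qe = is_glue_epic[OF q wf]
 have qr: "q\<cdot>left_rel = q\<cdot>right_rel" using is_glue_rel[OF q] by blast
 let ?X = "Dom M r" and ?Y = "Cod M r"
 fix u V assume u: "u\<in>Hom M (Dom M (q\<cdot>Struct E)) ?X" and V: "V\<in>Hom M (Cod M (q\<cdot>Struct E)) ?Y"
  and e: "r\<cdot>u = V\<cdot>(q\<cdot>Struct E)"
 have u: "u\<in>Arr M" "Dom M u = Carrier R" "Cod M u = ?X" and V: "V\<in>Arr M" "Dom M V = Q" "Cod M V = ?Y"
  using u V G by auto
 have Vq: "V\<cdot>q\<in>Arr M" "Dom M (V\<cdot>q) = Carrier R\<otimes>Carrier S" "Cod M (V\<cdot>q) = ?Y" using V G by auto
 have "V\<cdot>q\<cdot>left_rel = V\<cdot>q\<cdot>right_rel" using qr V G by simp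
 note fam = terms_family[OF Vq(1,2) this, unfolded Vq(3)]
 have st: "Struct E = (Carrier R\<rhd>\<iota> 0)\<cdot>inverse_arr M (flat 0 0)"
  by (simp add: tensor_alg_def S_One)
 have t0: "terms f 0 = f\<cdot>Struct E" for f unfolding terms_def st ..
 have "r\<cdot>u = terms (V\<cdot>q) 0" unfolding t0 e using V G by simp
 then obtain g where g: "\<And>N. family N ?X g" "\<And>n. r\<cdot>g n = terms (V\<cdot>q) n" "g 0 = u"
  using families_lift[OF data r HOL.refl HOL.refl fam _ , of u] u by auto
 obtain f where f: "f\<in>Arr M" "Dom M f = Carrier R\<otimes>Carrier S" "Cod M f = ?X" "f\<cdot>left_rel = f\<cdot>right_rel"
  "\<And>n. terms f n = g n" using family_arrow[OF g(1)] by blast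
 obtain d where d: "d\<in>Arr M" "Dom M d = Q" "Cod M d = ?X" "\<And>i. i\<in>{()} ==> d\<cdot>q = f"
  by (rule is_glue_ex[OF q, of ?X "\<lambda>_. f"]) (use f r in auto)
 then have dq: "d\<cdot>q = f" by simp
 have "d\<cdot>(q\<cdot>Struct E) = (d\<cdot>q)\<cdot>Struct E" using d(1-3) G by simp
 also have "... = u" unfolding dq t0[symmetric] f(5) g(3) ..
 finally have du: "d\<cdot>(q\<cdot>Struct E) = u" .
 have "r\<cdot>d = V"
 proof (rule jointly_epicD[OF qe])
  have "r\<cdot>f = V\<cdot>q"
  proof (rule jointly_epicD[OF E_epic])
   fix n
   note t = terms_flat[OF f(1,2), of n] and tv = terms_flat[OF Vq(1,2), of n] and fl = flat_arr[of n 0]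
   have "r\<cdot>f\<cdot>(Carrier R\<rhd>\<iota> n) = r\<cdot>(f\<cdot>(Carrier R\<rhd>\<iota> n))" using r f by simp
   also have "... = (r\<cdot>terms f n)\<cdot>flat n 0" unfolding t(4)[symmetric] using t(1-3) fl r f by simp
   also have "... = V\<cdot>q\<cdot>(Carrier R\<rhd>\<iota> n)" unfolding f(5) g(2) tv(4) ..
   finally show "r\<cdot>f\<cdot>(Carrier R\<rhd>\<iota> n) = V\<cdot>q\<cdot>(Carrier R\<rhd>\<iota> n)" .
  qed (use r f Vq in auto)
  then show "r\<cdot>d\<cdot>q = V\<cdot>q" using r d(1-3) G dq by simp
 qed (use r d V in auto)
 then show "\<exists>d\<in>Hom M (Cod M (q\<cdot>Struct E)) ?X. d\<cdot>(q\<cdot>Struct E) = u \<and> r\<cdot>d = V"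
  using du d G by (intro bexI[of _ d]) auto
qed

end

section \<open>Free algebras and cofibrations\<close>

context closed_symmetric_monoidal
begin

lemma monoid_homD:
 assumes "monoid_hom M A B f"
 shows "f\<in>Arr M" "Dom M f = Carrier A" "Cod M f = Carrier B" "f\<cdot>Mult A = Mult B\<cdot>(f\<odot>f)" "f\<cdot>One A = One B"
 using assms unfolding monoid_hom_def by auto

lemma monoid_hom_comp:
 assumes A: "commutative_monoid M A" and B: "commutative_monoid M B" and C: "commutative_monoid M C"
  and f: "monoid_hom M A B f" and g: "monoid_hom M B C g"
 shows "monoid_hom M A C (g\<cdot>f)"
proof -
 note f = monoid_homD[OF f] and g = monoid_homD[OF g]
 note a = monoidD(1-7)[OF A] monoidD(1-7)[OF B] monoidD(1-7)[OF C]
 have "(g\<cdot>f)\<cdot>Mult A = g\<cdot>(f\<cdot>Mult A)" using f(1-3) g(1-3) a by simp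
 also have "... = (g\<cdot>Mult B)\<cdot>(f\<odot>f)" unfolding f(4) using f(1-3) g(1-3) a by simp
 also have "... = Mult C\<cdot>((g\<cdot>f)\<odot>(g\<cdot>f))" unfolding g(4) using f(1-3) g(1-3) a by simp
 finally have m: "(g\<cdot>f)\<cdot>Mult A = Mult C\<cdot>((g\<cdot>f)\<odot>(g\<cdot>f))" .
 have "(g\<cdot>f)\<cdot>One A = g\<cdot>(f\<cdot>One A)" using f(1-3) g(1-3) a by simp
 then have "(g\<cdot>f)\<cdot>One A = One C" unfolding f(5) g(5) .
 then show ?thesis unfolding monoid_hom_def using m f(1-3) g(1-3) by simp
qed

lemma tensor_inr_nat:
 assumes R: "commutative_monoid M R" and S: "commutative_monoid M S"
  and R': "commutative_monoid M R'" and S': "commutative_monoid M S'"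
  and f: "f\<in>Arr M" "Dom M f = Carrier R" "Cod M f = Carrier R'" "f\<cdot>One R = One R'"
  and g: "g\<in>Arr M" "Dom M g = Carrier S" "Cod M g = Carrier S'"
 shows "(f\<odot>g)\<cdot>tensor_inr R S = tensor_inr R' S'\<cdot>g"
proof -
 note a = monoidD(1-7)[OF R] monoidD(1-7)[OF S] monoidD(1-7)[OF R'] monoidD(1-7)[OF S']
 have "(\<one>\<rhd>g)\<cdot>inverse_arr M (\<ll> (Carrier S)) = inverse_arr M (\<ll> (Carrier S'))\<cdot>g"
  by (rule iso_cancel_left[of "\<ll> (Carrier S')"]) (use a g in auto)
 moreover have "(f\<odot>g)\<cdot>tensor_inr R S = ((f\<cdot>One R)\<lhd>Carrier S')\<cdot>((\<one>\<rhd>g)\<cdot>inverse_arr M (\<ll> (Carrier S)))"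
  unfolding tensor_inr_def using a f(1-3) g by simp
 ultimately show ?thesis unfolding f(4) tensor_inr_def using a g by simp
qed

lemma tensor_hom:
 assumes R: "commutative_monoid M R" and S: "commutative_monoid M S" and R': "commutative_monoid M R'"
  and f: "monoid_hom M R R' f"
 shows "monoid_hom M (tensor_alg M R S) (tensor_alg M R' S) (f\<lhd>Carrier S)"
proof -
 let ?s = "Carrier S"
 note f = monoid_homD[OF f]
 note a = monoidD(1-7)[OF R] monoidD(1-7)[OF S] monoidD(1-7)[OF R']
 have "(f\<lhd>?s)\<cdot>Mult (tensor_alg M R S) = ((f\<cdot>Mult R)\<odot>Mult S)\<cdot>middle_exchange M (Carrier R) ?s (Carrier R) ?s"
  using a f(1-3) by (simp add: tensor_alg_def)
 also have "... = (Mult R'\<odot>Mult S)\<cdot>(((f\<odot>f)\<odot>(?s\<rhd>\<i>\<d> ?s))\<cdot>middle_exchange M (Carrier R) ?s (Carrier R) ?s)"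
  unfolding f(4) using a f(1-3) by simp
 also have "... = (Mult R'\<odot>Mult S)\<cdot>(middle_exchange M (Carrier R') ?s (Carrier R') ?s\<cdot>((f\<lhd>?s)\<odot>(f\<lhd>?s)))"
  using a f(1-3) by (subst middle_exchange_nat) auto
 also have "... = Mult (tensor_alg M R' S)\<cdot>((f\<lhd>?s)\<odot>(f\<lhd>?s))"
  using a f(1-3) by (simp add: tensor_alg_def)
 finally have m: "(f\<lhd>?s)\<cdot>Mult (tensor_alg M R S) = Mult (tensor_alg M R' S)\<cdot>((f\<lhd>?s)\<odot>(f\<lhd>?s))" .
 have "(f\<lhd>?s)\<cdot>One (tensor_alg M R S) = ((f\<cdot>One R)\<odot>One S)\<cdot>inverse_arr M (\<ll> \<one>)"
  using a f(1-3) by (simp add: tensor_alg_def)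
 also have "... = One (tensor_alg M R' S)" unfolding f(5) by (simp add: tensor_alg_def)
 finally show ?thesis unfolding monoid_hom_def using m a f(1-3) by (simp add: tensor_alg_def)
qed

text \<open>A map out of \<open>R\<otimes>Sym X\<close> is the product of its restrictions to \<open>R\<close> and \<open>Sym X\<close>, and the restriction to \<open>X\<^sup>n\<close> is
 determined inductively by the one to \<open>X\<close>, the multiplication being concatenation.\<close>

lemma free_algebra_hom_unique:
 assumes R: "commutative_monoid M R" and X: "X\<in>Obj M" and S: "is_Sym M X S \<iota>" and Z: "commutative_monoid M Z"
  and x: "monoid_hom M (tensor_alg M R S) Z x" and y: "monoid_hom M (tensor_alg M R S) Z y"
  and st: "x\<cdot>Struct (tensor_alg M R S) = y\<cdot>Struct (tensor_alg M R S)"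
  and one: "x\<cdot>(tensor_inr R S\<cdot>\<iota> 1) = y\<cdot>(tensor_inr R S\<cdot>\<iota> 1)"
 shows "x = y"
proof -
 have Sm: "commutative_monoid M S" and mult: "\<And>m n. Mult S\<cdot>(\<iota> m\<odot>\<iota> n) = \<iota> (m + n)\<cdot>append_iso M (replicate m X) (replicate n X)"
  and One: "One S = \<iota> 0" using S unfolding is_Sym_def by blast+
 note g = sym_cocone_glue[OF X is_Sym_cocone[OF S]] and gr = glue_relations_sym[OF X]
 have \<iota>: "\<iota> n\<in>Arr M" "Dom M (\<iota> n) = tensor_power M X n" "Cod M (\<iota> n) = Carrier S" for n
  using is_glue_hom(1-3)[OF g, of n] by auto
 let ?T = "tensor_alg M R S" and ?i = "tensor_inr R S"
 note a = monoidD(1-7)[OF R] monoidD(1-7)[OF Sm] monoidD(1-7)[OF Z]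
 note t = tensor_inr_arr[OF R Sm] tensor_Struct_arr[OF R Sm] tensor_Mult_arr[OF R Sm]
 have Tc: "Carrier ?T = Carrier R\<otimes>Carrier S" by (simp add: tensor_alg_def)
 have rec: "x\<cdot>(?i\<cdot>(\<iota> (m + n)\<cdot>append_iso M (replicate m X) (replicate n X))) =
   Mult Z\<cdot>((x\<cdot>(?i\<cdot>\<iota> m))\<odot>(x\<cdot>(?i\<cdot>\<iota> n)))"
  if x: "monoid_hom M ?T Z x" for x m n
 proof -
  note x = monoid_homD[OF x, unfolded Tc]
  have "x\<cdot>(?i\<cdot>(\<iota> (m + n)\<cdot>append_iso M (replicate m X) (replicate n X))) = x\<cdot>((?i\<cdot>Mult S)\<cdot>(\<iota> m\<odot>\<iota> n))"
   unfolding mult[symmetric] using x(1-3) t a \<iota> by simp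
  also have "... = (x\<cdot>Mult ?T)\<cdot>((?i\<cdot>\<iota> m)\<odot>(?i\<cdot>\<iota> n))"
   unfolding tensor_inr_mult[OF R Sm] using x(1-3) t a \<iota> by simp
  also have "... = Mult Z\<cdot>((x\<cdot>(?i\<cdot>\<iota> m))\<odot>(x\<cdot>(?i\<cdot>\<iota> n)))"
   unfolding x(4) using x(1-3) t a \<iota> by simp
  finally show ?thesis .
 qed
 note xh = monoid_homD[OF x, unfolded Tc] and yh = monoid_homD[OF y, unfolded Tc]
 have n: "x\<cdot>(?i\<cdot>\<iota> n) = y\<cdot>(?i\<cdot>\<iota> n)" for n
 proof (induction n)
  case 0
  show ?case unfolding One[symmetric] tensor_inr_One[OF R Sm] xh(5) yh(5) ..
 next
  case (Suc n)
  let ?a = "append_iso M (replicate 1 X) (replicate n X)"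
  have P: "set (replicate m X) \<subseteq> Obj M" for m using X by auto
  note ap = append_iso_arr[OF P[of 1] P[of n]]
  have ap': "Cod M ?a = tensor_power M X (Suc n)" using ap(3) by simp
  have "x\<cdot>(?i\<cdot>(\<iota> (1 + n)\<cdot>?a)) = y\<cdot>(?i\<cdot>(\<iota> (1 + n)\<cdot>?a))"
   unfolding rec[OF x] rec[OF y] one Suc ..
  then have "(x\<cdot>(?i\<cdot>\<iota> (Suc n)))\<cdot>?a = (y\<cdot>(?i\<cdot>\<iota> (Suc n)))\<cdot>?a"
   using xh(1-3) yh(1-3) t \<iota>[of "Suc n"] ap(1,2) ap' by simp
  then show ?case by (rule iso_cancel_right) (use xh(1-3) yh(1-3) t \<iota>[of "Suc n"] ap ap' in auto)
 qed
 have "x\<cdot>?i = y\<cdot>?i"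
 proof (rule jointly_epicD[OF is_glue_epic[OF g gr]])
  show "x\<cdot>?i\<cdot>\<iota> n = y\<cdot>?i\<cdot>\<iota> n" for n using n[of n] xh(1-3) yh(1-3) t \<iota> by simp
 qed (use xh(1-3) yh(1-3) t in auto)
 moreover have "z = Mult Z\<cdot>((z\<cdot>Struct ?T)\<odot>(z\<cdot>?i))" if "monoid_hom M ?T Z z" for z
 proof -
  note z = monoid_homD[OF that, unfolded Tc]
  have "Mult Z\<cdot>((z\<cdot>Struct ?T)\<odot>(z\<cdot>?i)) = (z\<cdot>Mult ?T)\<cdot>(Struct ?T\<odot>?i)"
   unfolding z(4) using z(1-3) t a by simp
  also have "... = z\<cdot>(Mult ?T\<cdot>(Struct ?T\<odot>?i))" using z(1-3) t a by simp
  also have "... = z" unfolding tensor_mult_Struct_inr[OF R Sm] using z(1-3) a by simp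
  finally show ?thesis by simp
 qed
 ultimately show ?thesis using x y st by metis
qed

lemma commutative_monoid_cong:
 "Carrier A = Carrier B ==> Mult A = Mult B ==> One A = One B ==> commutative_monoid M A \<longleftrightarrow> commutative_monoid M B"
 unfolding commutative_monoid_def by simp

lemma CAlg_simps:
 "Obj (CAlg M R) = {A. commutative_algebra M R A}"
 "(A, f, B)\<in>Arr (CAlg M R) \<longleftrightarrow> commutative_algebra M R A \<and> commutative_algebra M R B \<and>
   monoid_hom M A B f \<and> f\<cdot>Struct A = Struct B"
 "Dom (CAlg M R) (A, f, B) = A" "Cod (CAlg M R) (A, f, B) = B"
 "Idn (CAlg M R) A = (A, \<i>\<d> (Carrier A), A)"
 "Cmp (CAlg M R) (B', g, B'') (A, f, B) = (A, g\<cdot>f, B'')"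
 by (auto simp: CAlg_def)

lemma CAlg_arrE:
 assumes "\<phi>\<in>Arr (CAlg M R)"
 obtains A f B where "\<phi> = (A, f, B)" "commutative_algebra M R A" "commutative_algebra M R B"
  "monoid_hom M A B f" "f\<cdot>Struct A = Struct B"
 using assms by (cases \<phi>) (auto simp: CAlg_simps)

lemma algebraD:
 assumes "commutative_algebra M R A"
 shows "commutative_monoid M A" "monoid_hom M R A (Struct A)"
 using assms unfolding commutative_algebra_def by auto

end

lemma is_retractI:
 assumes "f\<in>Arr C" "g\<in>Arr C" "i\<in>Hom C (Dom C f) (Dom C g)" "r\<in>Hom C (Dom C g) (Dom C f)"
  "j\<in>Hom C (Cod C f) (Cod C g)" "s\<in>Hom C (Cod C g) (Cod C f)"
  "r \<cdot>\<^bsub>C\<^esub> i = Idn C (Dom C f)" "s \<cdot>\<^bsub>C\<^esub> j = Idn C (Cod C f)" "g \<cdot>\<^bsub>C\<^esub> i = j \<cdot>\<^bsub>C\<^esub> f" "f \<cdot>\<^bsub>C\<^esub> r = s \<cdot>\<^bsub>C\<^esub> g"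
 shows "is_retract C f g"
 using assms unfolding is_retract_def by blast

context model_category
begin

lemma cof_lifting: "f\<in>Cof \<M> ==> p\<in>Fib \<M> \<inter> Weq \<M> ==> has_lifting C f p"
 using lifting by blast

lemma cof_arr: "f\<in>Cof \<M> ==> f\<in>Arr C" and fib_arr: "p\<in>Fib \<M> \<inter> Weq \<M> ==> p\<in>Arr C"
 using classes by auto

lemma has_liftingE:
 assumes "has_lifting C i p" "i\<in>Arr C" "p\<in>Arr C" "u\<in>Arr C" "v\<in>Arr C" "Dom C u = Dom C i" "Cod C u = Dom C p"
  "Dom C v = Cod C i" "Cod C v = Cod C p" "p\<cdot>u = v\<cdot>i"
 obtains d where "d\<in>Arr C" "Dom C d = Cod C i" "Cod C d = Dom C p" "d\<cdot>i = u" "p\<cdot>d = v"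
proof -
 have "u\<in>Hom C (Dom C i) (Dom C p)" "v\<in>Hom C (Cod C i) (Cod C p)" using assms by auto
 then obtain d where "d\<in>Hom C (Cod C i) (Dom C p)" "d\<cdot>i = u" "p\<cdot>d = v"
  using assms(1,10) unfolding has_lifting_def by blast
 then show ?thesis by (intro that[of d]) auto
qed

text \<open>The retract argument: the identity of the codomain is lifted against the trivial fibration of a
 factorization of \<open>f\<close>.\<close>

lemma cofI:
 assumes f: "f\<in>Arr C" and l: "\<And>p. p\<in>Fib \<M> \<inter> Weq \<M> ==> has_lifting C f p"
 shows "f\<in>Cof \<M>"
proof -
 obtain Z i p where ip: "i\<in>Hom C (Dom C f) Z" "p\<in>Hom C Z (Cod C f)" "f = p\<cdot>i" "i\<in>Cof \<M>" "p\<in>Fib \<M> \<inter> Weq \<M>"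
  using factorization(1)[of f "Dom C f" "Cod C f", unfolded in_Hom, OF conjI[OF f conjI[OF HOL.refl HOL.refl]], folded in_Hom]
  by (elim exE bexE conjE)
 have pi: "p\<cdot>i = f" using ip(3) by (rule sym)
 have i: "i\<in>Arr C" "Dom C i = Dom C f" "Cod C i = Z" and p: "p\<in>Arr C" "Dom C p = Z" "Cod C p = Cod C f"
  using ip(1,2) by auto
 obtain d where d: "d\<in>Arr C" "Dom C d = Cod C f" "Cod C d = Z" "d\<cdot>f = i" "p\<cdot>d = \<i>\<d> (Cod C f)"
  using has_liftingE[OF l[OF ip(5)] f p(1) i(1), of "\<i>\<d> (Cod C f)"] i p f pi by auto
 have "is_retract C f i"
  by (rule is_retractI[of f C i "\<i>\<d> (Dom C f)" "\<i>\<d> (Dom C f)" d p]) (simp_all add: d i p f pi)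
 then show ?thesis using retracts(3) ip(4) by blast
qed

lemma has_lifting_comp:
 assumes f: "has_lifting C f p" and g: "has_lifting C g p" and a: "f\<in>Arr C" "g\<in>Arr C" "p\<in>Arr C" "Dom C g = Cod C f"
 shows "has_lifting C (g\<cdot>f) p"
 unfolding has_lifting_def
proof (intro ballI impI)
 fix u v assume u: "u\<in>Hom C (Dom C (g\<cdot>f)) (Dom C p)" and v: "v\<in>Hom C (Cod C (g\<cdot>f)) (Cod C p)" and e: "p\<cdot>u = v\<cdot>(g\<cdot>f)"
 have u: "u\<in>Arr C" "Dom C u = Dom C f" "Cod C u = Dom C p" and v: "v\<in>Arr C" "Dom C v = Cod C g" "Cod C v = Cod C p"
  using u v a by auto
 obtain d where d: "d\<in>Arr C" "Dom C d = Cod C f" "Cod C d = Dom C p" "d\<cdot>f = u" "p\<cdot>d = v\<cdot>g"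
  using has_liftingE[OF f a(1) a(3) u(1), of "v\<cdot>g"] u v a e by auto
 obtain d' where d': "d'\<in>Arr C" "Dom C d' = Cod C g" "Cod C d' = Dom C p" "d'\<cdot>g = d" "p\<cdot>d' = v"
  using has_liftingE[OF g a(2) a(3) d(1) v(1)] d(2,3,5) v a by auto
 have "d'\<cdot>(g\<cdot>f) = (d'\<cdot>g)\<cdot>f" using d'(1-3) a by simp
 then have "d'\<cdot>(g\<cdot>f) = u" unfolding d'(4) d(4) .
 then show "\<exists>d\<in>Hom C (Cod C (g\<cdot>f)) (Dom C p). d\<cdot>(g\<cdot>f) = u \<and> p\<cdot>d = v"
  using d' a by (intro bexI[of _ d']) auto
qed

lemma cof_comp:
 assumes "f\<in>Cof \<M>" "g\<in>Cof \<M>" "Dom C g = Cod C f" shows "g\<cdot>f\<in>Cof \<M>"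
proof (rule cofI)
 note a = cof_arr[OF assms(1)] cof_arr[OF assms(2)]
 show "g\<cdot>f\<in>Arr C" using a assms(3) by simp
 show "has_lifting C (g\<cdot>f) p" if "p\<in>Fib \<M> \<inter> Weq \<M>" for p
  by (rule has_lifting_comp[OF cof_lifting[OF assms(1) that] cof_lifting[OF assms(2) that] a fib_arr[OF that] assms(3)])
qed

lemma cofibrant_cod:
 assumes "cofibrant C \<M> (Dom C f)" "f\<in>Cof \<M>" shows "cofibrant C \<M> (Cod C f)"
proof -
 obtain E g where "initial C E" "g\<in>Hom C E (Dom C f)" "g\<in>Cof \<M>" using assms(1) unfolding cofibrant_def by blast
 then show ?thesis unfolding cofibrant_def using cof_comp[of g f] assms(2) cof_arr[OF assms(2)]
  by (intro exI[of _ E] exI[of _ "f\<cdot>g"]) auto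
qed

end

text \<open>\<open>_\<otimes>Y\<close> has a right adjoint, hence preserves initial objects.\<close>

lemma (in closed_symmetric_monoidal) initial_tensor:
 assumes E: "initial M E" and Y: "Y\<in>Obj M" shows "initial M (E\<otimes>Y)"
proof -
 have Eo: "E\<in>Obj M" using E unfolding initial_def by blast
 show ?thesis
  unfolding initial_def
 proof (intro conjI ballI)
  show "E\<otimes>Y\<in>Obj M" using Eo Y by simp
  fix Z assume Z: "Z\<in>Obj M"
  obtain H ev where X: "is_exponential Y Z H ev" using exponential_exists[OF Y Z] .
  note H = exponential_arr[OF X]
  have u: "\<exists>!f. f\<in>Hom M E H" using E H(1) unfolding initial_def by blast
  then obtain f where f: "f\<in>Arr M" "Dom M f = E" "Cod M f = H" by auto
  show "\<exists>!f. f\<in>Hom M (E\<otimes>Y) Z"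
  proof (rule ex1I[of _ "ev\<cdot>(f\<lhd>Y)"])
   show "ev\<cdot>(f\<lhd>Y)\<in>Hom M (E\<otimes>Y) Z" using f H Y by simp
   fix g assume g: "g\<in>Hom M (E\<otimes>Y) Z"
   then obtain g' where g': "g'\<in>Arr M" "Dom M g' = E" "Cod M g' = H" "ev\<cdot>(g'\<lhd>Y) = g"
    using exponential_curry[OF X, of g E] Eo by auto
   have "g' = f" using u f g'(1-3) by auto
   then show "g = ev\<cdot>(f\<lhd>Y)" using g'(4) by simp
  qed
 qed
qed

lemma (in category) initial_unique:
 assumes "initial C E" "f\<in>Arr C" "g\<in>Arr C" "Dom C f = E" "Dom C g = E" "Cod C f = Cod C g" shows "f = g"
proof -
 have "Cod C f\<in>Obj C" using assms by simp
 then have "\<exists>!k. k\<in>Hom C E (Cod C f)" using assms(1) unfolding initial_def by blast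
 then show ?thesis using assms by auto
qed

text \<open>The pushout product of \<open>l\<close> with the map from the initial object to \<open>A\<close> is \<open>A\<rhd>l\<close>, since the products
 with the initial object are initial.\<close>

lemma (in monoidal_model_category) tensor_cofibration:
 assumes A: "cofibrant M \<M> A" and l: "l\<in>Cof \<M>" shows "A\<rhd>l\<in>Cof \<M>"
proof -
 obtain E f where E: "initial M E" and f: "f\<in>Hom M E A" "f\<in>Cof \<M>" using A unfolding cofibrant_def by blast
 have fa: "f\<in>Arr M" "Dom M f = E" "Cod M f = A" using f by auto
 have la: "l\<in>Arr M" using l by (rule cof_arr)
 let ?Y0 = "Dom M l" and ?Y1 = "Cod M l"
 have o: "E\<in>Obj M" "A\<in>Obj M" "?Y0\<in>Obj M" "?Y1\<in>Obj M" using fa la by auto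
 note I0 = initial_tensor[OF E o(3)] and I1 = initial_tensor[OF E o(4)]
 have "A\<otimes>?Y0\<in>Obj M" using o by simp
 then obtain a where a: "a\<in>Arr M" "Dom M a = E\<otimes>?Y1" "Cod M a = A\<otimes>?Y0"
  using I1 unfolding initial_def by fastforce
 have "is_pushout M (E\<rhd>l) (f\<lhd>?Y0) a (\<i>\<d> (A\<otimes>?Y0))"
  unfolding is_pushout_def
 proof (intro conjI ballI impI)
  show "a\<cdot>(E\<rhd>l) = \<i>\<d> (A\<otimes>?Y0)\<cdot>(f\<lhd>?Y0)"
   by (rule initial_unique[OF I0]) (use a fa la o in auto)
  fix Z x y assume x: "x\<in>Hom M (Cod M (E\<rhd>l)) Z" and y: "y\<in>Hom M (Cod M (f\<lhd>?Y0)) Z"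
  have x: "x\<in>Arr M" "Dom M x = E\<otimes>?Y1" "Cod M x = Z" and y: "y\<in>Arr M" "Dom M y = A\<otimes>?Y0" "Cod M y = Z"
   using x y fa la o by auto
  show "\<exists>!u. u\<in>Hom M (Cod M a) Z \<and> u\<cdot>a = x \<and> u\<cdot>\<i>\<d> (A\<otimes>?Y0) = y"
  proof (rule ex1I[of _ y])
   have "y\<cdot>a = x" by (rule initial_unique[OF I1]) (use a x y in auto)
   then show "y\<in>Hom M (Cod M a) Z \<and> y\<cdot>a = x \<and> y\<cdot>\<i>\<d> (A\<otimes>?Y0) = y" using y a by simp
   show "u = y" if "u\<in>Hom M (Cod M a) Z \<and> u\<cdot>a = x \<and> u\<cdot>\<i>\<d> (A\<otimes>?Y0) = y" for u using that a by auto
  qed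
 qed (use a fa la o in auto)
 moreover have "(A\<rhd>l)\<cdot>a = f\<lhd>?Y1" by (rule initial_unique[OF I1]) (use a fa la o in auto)
 ultimately show ?thesis
  using pushout_product_axiom[of f E A l ?Y0 ?Y1 a "\<i>\<d> (A\<otimes>?Y0)" "A\<rhd>l"] f l fa la o a by simp
qed

lemma (in attaching) iterated_pushout_product_exists:
 assumes U: "inaccessible (U :: 'u set)" "cocomplete U M"
 shows "\<exists>Q \<iota> k. is_iterated_pushout_product M h n Q \<iota> k"
proof -
 let ?P = "punctured_cube n"
 have fin: "finite {w :: bool list. length w = n \<and> w \<noteq> replicate n True}"
  using finite_lists_length_eq[of "UNIV :: bool set" n] by (auto intro: finite_subset[rotated])
 note sm = small_preorder_cat[OF U(1) small_finite[OF U(1) fin], of "list_all2 (-->)", folded punctured_cube_def]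
 obtain Q \<iota> where c: "is_colimit ?P M W (cube_arr M h) Q \<iota>"
  using colimit_exists[OF U(2) category_punctured_cube sm functor_punctured_cube] by blast
 have Lo: "tensor_power M L n\<in>Obj M" by simp
 have "is_cocone ?P M W (cube_arr M h) (tensor_power M L n) (\<lambda>w. cube_arr M h (w, replicate n True))"
  unfolding is_cocone_def
 proof (intro conjI ballI)
  show "cube_arr M h (w, replicate n True)\<in>Hom M (W w) (tensor_power M L n)" if "w\<in>Obj ?P" for w
   using cube_arr_arr[OF list_all2_trues, of w n] that by simp
  fix x assume x: "x\<in>Arr ?P"
  have "list_all2 (-->) (fst x) (snd x)" "length (snd x) = n" using x by (auto simp: Arr_punctured_cube)
  from cube_arr_comp[OF this(1) list_all2_trues[OF this(2)]]
  show "cube_arr M h (Cod ?P x, replicate n True)\<cdot>cube_arr M h x = cube_arr M h (Dom ?P x, replicate n True)"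
   by (simp add: Arr_punctured_cube)
 qed (rule Lo)
 then obtain k where "k\<in>Hom M Q (tensor_power M L n)" "\<forall>w\<in>Obj ?P. k\<cdot>\<iota> w = cube_arr M h (w, replicate n True)"
  using c unfolding is_colimit_def by blast
 then show ?thesis using c unfolding is_iterated_pushout_product_def by blast
qed

text \<open>The orbit map \<open>l\<close> is a cofibration by the strong commutative monoid axiom, and stays one after
 tensoring with the cofibrant object \<open>A\<close>.\<close>

lemma (in attaching) lifting_data:
 assumes mm: "monoidal_model_category U M \<M>" and U: "inaccessible (U :: 'u set)"
  and SA: "strong_commutative_monoid_axiom M \<M>" and A: "cofibrant M \<M> A" and hc: "h\<in>Cof \<M>"
  and r: "r\<in>Fib \<M> \<inter> Weq \<M>"
 shows "\<exists>Q \<iota> k q p l. is_iterated_pushout_product M h (Suc n) Q \<iota> k \<and>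
   is_coinvariants M Q (cube_action M h (Suc n) Q \<iota>) q \<and>
   is_coinvariants M (tensor_power M L (Suc n)) (power_action M L (Suc n)) p \<and>
   l\<in>Hom M (Cod M q) (Cod M p) \<and> l\<cdot>q = p\<cdot>k \<and> has_lifting M (A\<rhd>l) r"
proof -
 interpret MM: monoidal_model_category U M \<M> by fact
 obtain Q \<iota> k where po: "is_iterated_pushout_product M h (Suc n) Q \<iota> k"
  using iterated_pushout_product_exists[OF U MM.cocomplete] by blast
 have Q: "Q\<in>Obj M" using is_glue_hom(4)[OF iterated_pushout_product_glue(1)[OF po]] .
 have L: "L\<in>Obj M" "tensor_power M L (Suc n)\<in>Obj M" by simp_all
 obtain q where q: "is_coinvariants M Q (cube_action M h (Suc n) Q \<iota>) q"
  using coinvariants_exist[OF U MM.cocomplete MM.locally_small Q cube_action_hom] by blast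
 obtain p where p: "is_coinvariants M (tensor_power M L (Suc n)) (power_action M L (Suc n)) p"
  using coinvariants_exist[OF U MM.cocomplete MM.locally_small L(2) power_action_hom[OF L(1)]] by blast
 obtain l where l: "l\<in>Hom M (Cod M q) (Cod M p)" "l\<cdot>q = p\<cdot>k"
  using orbit_map_exists[OF po q p] by blast
 have "l\<in>Cof \<M>" using SA hc po q p l unfolding strong_commutative_monoid_axiom_def by blast
 then have "has_lifting M (A\<rhd>l) r" using MM.cof_lifting[OF MM.tensor_cofibration[OF A] r] by blast
 then show ?thesis using po q p l by blast
qed

section \<open>Pushouts of free maps\<close>

context closed_symmetric_monoidal
begin

lemma monoid_unit_left:
 assumes E: "commutative_monoid M E" and a: "a\<in>Hom M K (Carrier E)"
 shows "Mult E\<cdot>(Carrier E\<rhd>a)\<cdot>((One E\<lhd>K)\<cdot>inverse_arr M (\<ll> K)) = a"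
proof -
 note e = monoidD[OF E]
 have a: "a\<in>Arr M" "Dom M a = K" "Cod M a = Carrier E" "K\<in>Obj M" using a by auto
 have "Mult E\<cdot>(Carrier E\<rhd>a)\<cdot>((One E\<lhd>K)\<cdot>inverse_arr M (\<ll> K)) =
   (Mult E\<cdot>(One E\<lhd>Carrier E))\<cdot>((\<one>\<rhd>a)\<cdot>inverse_arr M (\<ll> K))"
  using e(1-7) a by simp
 also have "... = a\<cdot>\<ll> K\<cdot>inverse_arr M (\<ll> K)"
  using e a lunit_nat[of a] by simp
 finally show ?thesis using a by simp
qed

lemma monoid_hom_unit_right:
 assumes E: "commutative_monoid M E" and a: "a\<in>Hom M K (Carrier E)"
 shows "Mult E\<cdot>(a\<odot>One E)\<cdot>inverse_arr M (\<rr> K) = a" "Mult E\<cdot>(One E\<odot>a)\<cdot>inverse_arr M (\<ll> K) = a"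
proof -
 note e = monoidD[OF E]
 have a: "a\<in>Arr M" "Dom M a = K" "Cod M a = Carrier E" "K\<in>Obj M" using a by auto
 have "Mult E\<cdot>(a\<odot>One E)\<cdot>inverse_arr M (\<rr> K) =
   (Mult E\<cdot>(Carrier E\<rhd>One E))\<cdot>((a\<lhd>\<one>)\<cdot>inverse_arr M (\<rr> K))"
  using e(1-7) a by simp
 also have "... = a\<cdot>\<rr> K\<cdot>inverse_arr M (\<rr> K)"
  using e a runit_nat[of a] by simp
 finally show "Mult E\<cdot>(a\<odot>One E)\<cdot>inverse_arr M (\<rr> K) = a" using a by simp
 have "Mult E\<cdot>(One E\<odot>a)\<cdot>inverse_arr M (\<ll> K) =
   (Mult E\<cdot>(One E\<lhd>Carrier E))\<cdot>((\<one>\<rhd>a)\<cdot>inverse_arr M (\<ll> K))"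
  using e(1-7) a by simp
 also have "... = a\<cdot>\<ll> K\<cdot>inverse_arr M (\<ll> K)"
  using e a lunit_nat[of a] by simp
 finally show "Mult E\<cdot>(One E\<odot>a)\<cdot>inverse_arr M (\<ll> K) = a" using a by simp
qed

lemma copair_Struct:
 assumes R: "commutative_monoid M R" and S: "commutative_monoid M S" and Z: "commutative_monoid M Z"
  and f: "f\<in>Hom M (Carrier R) (Carrier Z)" and g: "g\<in>Hom M (Carrier S) (Carrier Z)"
 shows "g\<cdot>One S = One Z ==> Mult Z\<cdot>(f\<odot>g)\<cdot>Struct (tensor_alg M R S) = f"
  and "f\<cdot>One R = One Z ==> Mult Z\<cdot>(f\<odot>g)\<cdot>tensor_inr R S = g"
proof -
 note a = monoidD(1-7)[OF R] monoidD(1-7)[OF S] monoidD(1-7)[OF Z]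
 have f': "f\<in>Arr M" "Dom M f = Carrier R" "Cod M f = Carrier Z" and g': "g\<in>Arr M" "Dom M g = Carrier S" "Cod M g = Carrier Z"
  using f g by auto
 show "Mult Z\<cdot>(f\<odot>g)\<cdot>Struct (tensor_alg M R S) = f" if o: "g\<cdot>One S = One Z"
 proof -
  have "Mult Z\<cdot>(f\<odot>g)\<cdot>Struct (tensor_alg M R S) = Mult Z\<cdot>(f\<odot>(g\<cdot>One S))\<cdot>inverse_arr M (\<rr> (Carrier R))"
   using a f' g' by (simp add: tensor_alg_def)
  then show ?thesis unfolding o monoid_hom_unit_right[OF Z f] .
 qed
 show "Mult Z\<cdot>(f\<odot>g)\<cdot>tensor_inr R S = g" if o: "f\<cdot>One R = One Z"
 proof -
  have "Mult Z\<cdot>(f\<odot>g)\<cdot>tensor_inr R S = Mult Z\<cdot>((f\<cdot>One R)\<odot>g)\<cdot>inverse_arr M (\<ll> (Carrier S))"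
   using a f' g' by (simp add: tensor_inr_def)
  then show ?thesis unfolding o monoid_hom_unit_right[OF Z g] .
 qed
qed

lemma tensor_inr_hom:
 assumes R: "commutative_monoid M R" and S: "commutative_monoid M S"
 shows "monoid_hom M S (tensor_alg M R S) (tensor_inr R S)"
 unfolding monoid_hom_def using tensor_inr_arr[OF R S] tensor_inr_mult[OF R S] tensor_inr_One[OF R S]
 by (simp add: tensor_alg_simps(1)[OF R S])

text \<open>Compatibility with the multiplication may be tested on \<open>q\<odot>q\<close>, which is epic as a composite of
 whiskerings of \<open>q\<close>.\<close>

lemma quotient_hom:
 assumes E: "commutative_monoid M E" and P: "commutative_monoid M P" and Z: "commutative_monoid M Z"
  and q: "monoid_hom M E P q" and ep: "jointly_epic {()} (Carrier P) (\<lambda>_. q)"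
  and f: "f\<in>Hom M (Carrier P) (Carrier Z)" and fq: "monoid_hom M E Z (f\<cdot>q)"
 shows "monoid_hom M P Z f"
proof -
 note a = monoidD(1-7)[OF E] monoidD(1-7)[OF P] monoidD(1-7)[OF Z]
 note q' = monoid_homD[OF q] and fq' = monoid_homD[OF fq]
 have f': "f\<in>Arr M" "Dom M f = Carrier P" "Cod M f = Carrier Z" using f by auto
 have l: "jointly_epic {()} (Carrier P\<otimes>Carrier E) (\<lambda>_. q\<lhd>Carrier E)"
  by (rule jointly_epic_tensor_right[OF ep]) (use a q' in auto)
 have r: "jointly_epic {()} (Carrier P\<otimes>Carrier P) (\<lambda>_. Carrier P\<rhd>q)"
  by (rule jointly_epic_tensor_left[OF ep]) (use a q' in auto)
 have "f\<cdot>Mult P = Mult Z\<cdot>(f\<odot>f)"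
 proof (rule jointly_epicD[OF r])
  show "f\<cdot>Mult P\<cdot>(Carrier P\<rhd>q) = Mult Z\<cdot>(f\<odot>f)\<cdot>(Carrier P\<rhd>q)"
  proof (rule jointly_epicD[OF l])
   have "f\<cdot>Mult P\<cdot>(Carrier P\<rhd>q)\<cdot>(q\<lhd>Carrier E) = f\<cdot>(Mult P\<cdot>(q\<odot>q))"
    using a q'(1-3) f' by simp
   also have "... = (f\<cdot>q)\<cdot>Mult E" unfolding q'(4)[symmetric] using a q'(1-3) f' by simp
   also have "... = Mult Z\<cdot>(f\<odot>f)\<cdot>(Carrier P\<rhd>q)\<cdot>(q\<lhd>Carrier E)"
    unfolding fq'(4) using a q'(1-3) f' by simp
   finally show "f\<cdot>Mult P\<cdot>(Carrier P\<rhd>q)\<cdot>(q\<lhd>Carrier E) =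
    Mult Z\<cdot>(f\<odot>f)\<cdot>(Carrier P\<rhd>q)\<cdot>(q\<lhd>Carrier E)" .
  qed (use a q'(1-3) f' in auto)
 qed (use a q'(1-3) f' in auto)
 moreover have "f\<cdot>One P = f\<cdot>q\<cdot>One E" unfolding q'(5)[symmetric] using a q'(1-3) f' by simp
 ultimately show ?thesis unfolding monoid_hom_def using f fq'(5) by simp
qed

end

context cell_attachment
begin

text \<open>The ideal contains its generators: the relations are restricted along the unit of \<open>E\<close>.\<close>

lemma rel_generator:
 assumes f: "f\<in>Arr M" "Dom M f = Carrier R\<otimes>Carrier S" "f\<cdot>left_rel = f\<cdot>right_rel"
  and E: "commutative_monoid M E"
 shows "f\<cdot>(inl\<cdot>h) = f\<cdot>(Struct E\<cdot>k)"
proof -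
 let ?u = "(One E\<lhd>K)\<cdot>inverse_arr M (\<ll> K)"
 have c: "Carrier E = Carrier R\<otimes>Carrier S" by (simp add: tensor_alg_def)
 note e = monoidD(5-7)[OF E, unfolded c]
 have l: "left_rel\<cdot>?u = inl\<cdot>h"
  unfolding left_rel_def by (rule monoid_unit_left[OF E, unfolded c]) simp
 have r: "right_rel\<cdot>?u = Struct E\<cdot>k"
  unfolding right_rel_def by (rule monoid_unit_left[OF E, unfolded c]) simp
 have "f\<cdot>(left_rel\<cdot>?u) = f\<cdot>left_rel\<cdot>?u" using f(1,2) e by simp
 also have "... = f\<cdot>(right_rel\<cdot>?u)" unfolding f(3) using f(1,2) e by simp
 finally show ?thesis unfolding l r .
qed

text \<open>A multiplicative arrow that identifies the generators identifies the ideal.\<close>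

lemma generator_rel:
 assumes f: "monoid_hom M E Z f" and Z: "commutative_monoid M Z" and g: "f\<cdot>(inl\<cdot>h) = f\<cdot>(Struct E\<cdot>k)"
 shows "f\<cdot>left_rel = f\<cdot>right_rel"
proof -
 have c: "Carrier E = Carrier R\<otimes>Carrier S" by (simp add: tensor_alg_def)
 note f = monoid_homD[OF f, unfolded c] and z = monoidD(1-7)[OF Z]
 have "f\<cdot>left_rel = (f\<cdot>Mult E)\<cdot>((Carrier R\<otimes>Carrier S)\<rhd>(inl\<cdot>h))"
  unfolding left_rel_def using f(1-3) by simp
 also have "... = Mult Z\<cdot>(f\<odot>(f\<cdot>(inl\<cdot>h)))" unfolding f(4) using f(1-3) z by simp
 also have "... = (Mult Z\<cdot>(f\<odot>f))\<cdot>((Carrier R\<otimes>Carrier S)\<rhd>(Struct E\<cdot>k))" unfolding g using f(1-3) z by simp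
 also have "... = f\<cdot>right_rel" unfolding f(4)[symmetric] right_rel_def using f(1-3) by simp
 finally show ?thesis .
qed

end

text \<open>Naturality of the inclusion of generators \<open>X \<rightarrow> R\<otimes>Sym X\<close>.\<close>

lemma (in closed_symmetric_monoidal) free_square:
 fixes R :: "('o, 'm) cmon"
 assumes R: "commutative_monoid M R" and Sym: "\<And>X. X\<in>Obj M ==> is_Sym M X (Sym M X) (Sym_in M X)" and h: "h\<in>Arr M"
 defines "K \<equiv> Dom M h" and "L \<equiv> Cod M h"
 shows "(Carrier R\<rhd>Sym_arr M h)\<cdot>(tensor_inr R (Sym M K)\<cdot>Sym_in M K 1) =
   (tensor_inr R (Sym M L)\<cdot>(Sym_in M L 1\<cdot>inverse_arr M (\<rr> L)))\<cdot>(h\<cdot>\<rr> K)"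
proof -
 have o: "K\<in>Obj M" "L\<in>Obj M" and h': "h\<in>Arr M" "Dom M h = K" "Cod M h = L" using h by (auto simp: K_def L_def)
 note SK = Sym[OF o(1)] and SL = Sym[OF o(2)]
 have K: "commutative_monoid M (Sym M K)" and L: "commutative_monoid M (Sym M L)" using SK SL unfolding is_Sym_def by blast+
 note p = Sym_arr_props[OF Sym h, folded K_def L_def]
 have s: "Sym_arr M h\<in>Arr M" "Dom M (Sym_arr M h) = Carrier (Sym M K)" "Cod M (Sym_arr M h) = Carrier (Sym M L)"
  using p(1) by auto
 note r = monoidD(1-7)[OF R] and t = tensor_inr_arr[OF R K] tensor_inr_arr[OF R L]
 have i: "Sym_in M K n\<in>Arr M" "Dom M (Sym_in M K n) = tensor_power M K n" "Cod M (Sym_in M K n) = Carrier (Sym M K)"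
  "Sym_in M L n\<in>Arr M" "Dom M (Sym_in M L n) = tensor_power M L n" "Cod M (Sym_in M L n) = Carrier (Sym M L)" for n
  using is_glue_hom(1-3)[OF sym_cocone_glue[OF o(1) is_Sym_cocone[OF SK]], of n]
   is_glue_hom(1-3)[OF sym_cocone_glue[OF o(2) is_Sym_cocone[OF SL]], of n] by auto
 have i1: "Dom M (Sym_in M K 1) = K\<otimes>\<one>" "Dom M (Sym_in M L 1) = L\<otimes>\<one>" using i[of 1] by auto
 have p1: "Sym_arr M h\<cdot>Sym_in M K 1 = Sym_in M L 1\<cdot>(h\<lhd>\<one>)" using p(2)[of 1] by simp
 have n: "(Carrier R\<rhd>Sym_arr M h)\<cdot>tensor_inr R (Sym M K) = tensor_inr R (Sym M L)\<cdot>Sym_arr M h"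
  by (rule tensor_inr_nat[OF R K R L]) (use r s in auto)
 have "(Carrier R\<rhd>Sym_arr M h)\<cdot>(tensor_inr R (Sym M K)\<cdot>Sym_in M K 1) =
   ((Carrier R\<rhd>Sym_arr M h)\<cdot>tensor_inr R (Sym M K))\<cdot>Sym_in M K 1" using r s t i by simp
 also have "... = tensor_inr R (Sym M L)\<cdot>(Sym_arr M h\<cdot>Sym_in M K 1)" unfolding n using r s t i by simp
 also have "... = (tensor_inr R (Sym M L)\<cdot>(Sym_in M L 1\<cdot>inverse_arr M (\<rr> L)))\<cdot>(h\<cdot>\<rr> K)"
 proof -
  have e: "inverse_arr M (\<rr> L)\<cdot>(h\<cdot>\<rr> K) = h\<lhd>\<one>"
   by (rule iso_cancel_left[of "\<rr> L"]) (use h' o runit_nat[OF h] in auto)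
  show ?thesis unfolding p1 e[symmetric] using t i(4,6) i1 h' o by simp
 qed
 finally show ?thesis .
qed

text \<open>The quotient \<open>P0\<close> receives an algebra map from the pushout \<open>B\<close>, because it completes the square, and maps back
 to \<open>B\<close> by multiplication; the composite on \<open>B\<close> is the identity by uniqueness for the pushout. So \<open>A \<rightarrow> B\<close> is a
 retract of \<open>A \<rightarrow> P0\<close>, to which \<open>quotient_lift\<close> applies.\<close>

lemma (in monoidal_model_category) pushout_generator_cofibration:
 assumes U: "inaccessible U" and SA: "strong_commutative_monoid_axiom M \<M>"
  and R: "commutative_monoid M R" and h: "h\<in>Cof \<M>"
  and free: "\<And>A. commutative_monoid M A ==>
   commutative_algebra M A (tensor_alg M A (Sym M (Dom M h))) \<and> commutative_algebra M A (tensor_alg M A (Sym M (Cod M h)))"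
  and po: "is_pushout (CAlg M R) f (tensor_Sym_arr M R h) p q"
  and A: "cofibrant M \<M> (Carrier (Dom (CAlg M R) p))"
  and cat: "category (CAlg M R)"
 shows "underlying p\<in>Cof \<M>"
proof -
 interpret CA: category "CAlg M R" by fact
 have ha: "h\<in>Arr M" using h by (rule cof_arr)
 define K L where "K = Dom M h" and "L = Cod M h"
 have o: "K\<in>Obj M" "L\<in>Obj M" and h': "h\<in>Arr M" "Dom M h = K" "Cod M h = L" using ha by (auto simp: K_def L_def)
 note free = free[folded K_def L_def]
 let ?SK = "Sym M K" and ?SL = "Sym M L" and ?TK = "tensor_alg M R (Sym M K)" and ?TL = "tensor_alg M R (Sym M L)"
 note Sym = is_Sym_exists[OF U cocomplete locally_small]
 note SK = Sym[OF o(1)] and SL = Sym[OF o(2)]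
 have SKm: "commutative_monoid M ?SK" and SLm: "commutative_monoid M ?SL" using SK SL unfolding is_Sym_def by blast+
 let ?g = "tensor_Sym_arr M R h" and ?gu = "Carrier R\<rhd>Sym_arr M h"
 have g: "?g = (?TK, ?gu, ?TL)" unfolding tensor_Sym_arr_def K_def L_def ..
 have P: "f\<in>Arr (CAlg M R)" "?g\<in>Arr (CAlg M R)" "p\<in>Arr (CAlg M R)" "q\<in>Arr (CAlg M R)"
  "Dom (CAlg M R) f = ?TK" "Dom (CAlg M R) p = Cod (CAlg M R) f"
  "Dom (CAlg M R) q = ?TL" "Cod (CAlg M R) p = Cod (CAlg M R) q" "p \<cdot>\<^bsub>CAlg M R\<^esub> f = q \<cdot>\<^bsub>CAlg M R\<^esub> ?g"
  using po unfolding is_pushout_def g CAlg_simps by blast+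
 have univ: "\<exists>!u. u\<in>Hom (CAlg M R) (Cod (CAlg M R) p) Z \<and> u \<cdot>\<^bsub>CAlg M R\<^esub> p = a \<and> u \<cdot>\<^bsub>CAlg M R\<^esub> q = b"
  if "Z\<in>Obj (CAlg M R)" "a\<in>Hom (CAlg M R) (Cod (CAlg M R) f) Z" "b\<in>Hom (CAlg M R) ?TL Z"
   "a \<cdot>\<^bsub>CAlg M R\<^esub> f = b \<cdot>\<^bsub>CAlg M R\<^esub> ?g" for Z a b
  using po that unfolding is_pushout_def g CAlg_simps by blast
 obtain A fu where fd: "f = (?TK, fu, A)" using P(1,5) by (metis CAlg_arrE CAlg_simps(3))
 obtain B pu where pd: "p = (A, pu, B)" using P(3,6) unfolding fd CAlg_simps by (metis CAlg_arrE CAlg_simps(3))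
 obtain qu where qd: "q = (?TL, qu, B)" using P(4,7,8) unfolding pd CAlg_simps by (metis CAlg_arrE CAlg_simps(3,4))
 note univ = univ[unfolded fd pd CAlg_simps]
 have sq: "pu\<cdot>fu = qu\<cdot>?gu" using P(9) unfolding fd pd qd g CAlg_simps by simp
 have TKa: "commutative_algebra M R ?TK" and TLa: "commutative_algebra M R ?TL" and Aa: "commutative_algebra M R A" and Ba: "commutative_algebra M R B"
  and fh: "monoid_hom M ?TK A fu" "fu\<cdot>Struct ?TK = Struct A" and ph: "monoid_hom M A B pu" "pu\<cdot>Struct A = Struct B"
  and qh: "monoid_hom M ?TL B qu" "qu\<cdot>Struct ?TL = Struct B" and gh: "monoid_hom M ?TK ?TL ?gu" "?gu\<cdot>Struct ?TK = Struct ?TL"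
  using P(1-4) unfolding fd pd qd g CAlg_simps by auto
 note TKm = algebraD(1)[OF TKa] and TLm = algebraD(1)[OF TLa] and Am = algebraD(1)[OF Aa] and Bm = algebraD(1)[OF Ba]
 note SA' = algebraD(2)[OF Aa] and SB' = algebraD(2)[OF Ba]
 \<comment> \<open>\<open>A\<close> with its algebra structure forgotten, as a base for algebras.\<close>
 define A' where "A' = \<lparr>Carrier = Carrier A, Mult = Mult A, One = One A\<rparr>"
 have A's: "Carrier A' = Carrier A" "Mult A' = Mult A" "One A' = One A" by (auto simp: A'_def)
 have A'm: "commutative_monoid M A'" using Am commutative_monoid_cong[of A' A] A's by blast
 have hA': "monoid_hom M X A' x \<longleftrightarrow> monoid_hom M X A x" "monoid_hom M A' X x \<longleftrightarrow> monoid_hom M A X x"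
  for x and X :: "('o, 'm) calg" and Y :: "('o, 'm) cmon" unfolding monoid_hom_def A's by simp_all
 have hA'': "monoid_hom M X A' x \<longleftrightarrow> monoid_hom M X A x" for x and X :: "('o, 'm) cmon" unfolding monoid_hom_def A's by simp
 have c: "Carrier ?TK = Carrier R\<otimes>Carrier ?SK" "Carrier ?TL = Carrier R\<otimes>Carrier ?SL" by (auto simp: tensor_alg_def)
 note iK = tensor_inr_arr[OF R SKm] and iL = tensor_inr_arr[OF R SLm]
 have SinK: "Sym_in M K 1\<in>Arr M" "Dom M (Sym_in M K 1) = K\<otimes>\<one>" "Cod M (Sym_in M K 1) = Carrier ?SK"
  and SinL: "Sym_in M L 1\<in>Arr M" "Dom M (Sym_in M L 1) = L\<otimes>\<one>" "Cod M (Sym_in M L 1) = Carrier ?SL"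
  using is_glue_hom(1-3)[OF sym_cocone_glue[OF o(1) is_Sym_cocone[OF SK]], of 1]
   is_glue_hom(1-3)[OF sym_cocone_glue[OF o(2) is_Sym_cocone[OF SL]], of 1] by auto
 note fu = monoid_homD[OF fh(1), unfolded c] and pu = monoid_homD[OF ph(1)] and qu = monoid_homD[OF qh(1), unfolded c]
  and gu = monoid_homD[OF gh(1), unfolded c]
 let ?x1 = "tensor_inr R ?SK\<cdot>Sym_in M K 1"
 define k where "k = fu\<cdot>(?x1\<cdot>inverse_arr M (\<rr> K))"
 have k: "k\<in>Arr M" "Dom M k = K" "Cod M k = Carrier A" using fu iK SinK o by (auto simp: k_def)
 have krr: "k\<cdot>\<rr> K = fu\<cdot>?x1" using fu iK SinK o by (simp add: k_def)
 \<comment> \<open>The cell is attached along the adjoint \<open>k\<close> of the algebra map \<open>fu\<close>.\<close>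
 interpret C: cell_attachment M A' ?SL h k "Sym_in M L"
  by unfold_locales (use A'm ha k SL h' A's in auto)
 have Ea: "commutative_algebra M A' C.E" using free[OF A'm] by blast
 note Em = algebraD(1)[OF Ea] and ES = algebraD(2)[OF Ea, unfolded hA']
 have cE: "Carrier C.E = Carrier A'\<otimes>Carrier ?SL" by (simp add: tensor_alg_def)
 have cE': "Carrier C.E = Carrier A\<otimes>Carrier ?SL" by (simp add: tensor_alg_def A's)
 have wf: "glue_relations M {()} (\<lambda>_. Carrier A'\<otimes>Carrier ?SL) {((), C.left_rel, (), C.right_rel)}"
  unfolding glue_relations_def by simp
 obtain Q q0' where "is_glue M {()} (\<lambda>_. Carrier A'\<otimes>Carrier ?SL) {((), C.left_rel, (), C.right_rel)} Q q0'"
  using glue_exists[OF U cocomplete small_finite[OF U] small_finite[OF U] wf] by auto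
 moreover define q0 where "q0 = q0' ()"
 moreover have "q0' = (\<lambda>_. q0' ())" by (rule ext) simp
 ultimately have G: "is_glue M {()} (\<lambda>_. Carrier A'\<otimes>Carrier ?SL) {((), C.left_rel, (), C.right_rel)} Q (\<lambda>_. q0)"
  by simp
 have q0: "q0\<in>Arr M" "Dom M q0 = Carrier A'\<otimes>Carrier ?SL" "Cod M q0 = Q" "Q\<in>Obj M"
  using is_glue_hom(1-3)[OF G, of "()"] is_glue_hom(4)[OF G] by auto
 have q0r: "q0\<cdot>C.left_rel = q0\<cdot>C.right_rel" using is_glue_rel[OF G] by blast
 have q0e: "jointly_epic {()} (Cod M q0) (\<lambda>_. q0)" using is_glue_epic[OF G wf] q0(3) by simp
 have q0g: "q0\<cdot>(C.inl\<cdot>h) = q0\<cdot>(Struct C.E\<cdot>k)" by (rule C.rel_generator[OF q0(1,2) q0r Em])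
 obtain m where m: "commutative_monoid M \<lparr>Carrier = Q, Mult = m, One = q0\<cdot>One C.E\<rparr>" "m\<cdot>(q0\<odot>q0) = q0\<cdot>Mult C.E"
 proof -
  have "\<exists>m. commutative_monoid M \<lparr>Carrier = Q, Mult = m, One = q0\<cdot>One C.E\<rparr> \<and> m\<cdot>(q0\<odot>q0) = q0\<cdot>Mult C.E"
   by (rule quotient_monoid[OF Em _ _ G[unfolded C.left_rel_def C.right_rel_def, folded cE], of K])
    (use h' k A's cE in auto)
  then show ?thesis using that by blast
 qed
 define x where "x = q0\<cdot>Struct C.E"
 define P0 where "P0 = \<lparr>Carrier = Q, Mult = m, One = q0\<cdot>One C.E, Struct = x\<cdot>Struct A\<rparr>"
 have P0s: "Carrier P0 = Q" "Mult P0 = m" "One P0 = q0\<cdot>One C.E" "Struct P0 = x\<cdot>Struct A" by (auto simp: P0_def)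
 have P0m: "commutative_monoid M P0"
  using m(1) commutative_monoid_cong[of P0 "\<lparr>Carrier = Q, Mult = m, One = q0\<cdot>One C.E\<rparr>"] by (simp add: P0s)
 have q0h: "monoid_hom M C.E P0 q0" unfolding monoid_hom_def P0s cE using q0 m(2) by simp
 have xh: "monoid_hom M A P0 x" unfolding x_def by (rule monoid_hom_comp[OF Am Em P0m ES q0h])
 have P0a: "commutative_algebra M R P0"
  unfolding commutative_algebra_def P0s(4) using P0m monoid_hom_comp[OF R Am P0m SA' xh] by blast
 have xcof: "x\<in>Cof \<M>"
 proof (rule cofI)
  show "x\<in>Arr M" using monoid_homD[OF xh] by simp
  fix r assume r: "r\<in>Fib \<M> \<inter> Weq \<M>"
  have Ac: "cofibrant M \<M> (Carrier A')" using A unfolding pd CAlg_simps A's .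
  show "has_lifting M x r" unfolding x_def
   by (rule C.quotient_lift[OF G C.lifting_data[OF monoidal_model_category_axioms U SA Ac h r] fib_arr[OF r]])
 qed
 note sA = monoid_homD[OF SA'] and sB = monoid_homD[OF SB']
 \<comment> \<open>The maps \<open>x\<close> and \<open>y\<close> complete the pushout square.\<close>
 define y where "y = q0\<cdot>(Struct A\<lhd>Carrier ?SL)"
 have yh: "monoid_hom M ?TL P0 y" unfolding y_def
  by (rule monoid_hom_comp[OF TLm Em P0m _ q0h]) (rule tensor_hom[OF R SLm A'm], simp add: hA'' SA')
 note rA = monoidD(1-7)[OF R] monoidD(1-7)[OF SLm] monoidD(1-7)[OF SKm] monoidD(1-7)[OF Am] monoidD(1-7)[OF Bm]
 have yS: "y\<cdot>Struct ?TL = Struct P0"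
 proof -
  have n: "inverse_arr M (\<rr> (Carrier A))\<cdot>Struct A = (Struct A\<lhd>\<one>)\<cdot>inverse_arr M (\<rr> (Carrier R))"
   by (rule iso_cancel_left[of "\<rr> (Carrier A)"]) (use sA(1-3) rA in auto)
  have "y\<cdot>Struct ?TL = q0\<cdot>((Carrier A\<rhd>One ?SL)\<cdot>((Struct A\<lhd>\<one>)\<cdot>inverse_arr M (\<rr> (Carrier R))))"
   unfolding y_def tensor_alg_def using q0 sA(1-3) rA A's by simp
  also have "... = Struct P0" unfolding n[symmetric] P0s x_def tensor_alg_def using q0 sA(1-3) rA A's by simp
  finally show ?thesis .
 qed
 have sqr: "?gu\<cdot>?x1 = (tensor_inr R ?SL\<cdot>(Sym_in M L 1\<cdot>inverse_arr M (\<rr> L)))\<cdot>(h\<cdot>\<rr> K)"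
  unfolding K_def L_def by (rule free_square[OF R Sym ha])
 have inl: "C.inl = tensor_inr A' ?SL\<cdot>(Sym_in M L 1\<cdot>inverse_arr M (\<rr> L))" unfolding C.inl_def h'(3) ..
 have yinr: "y\<cdot>tensor_inr R ?SL = q0\<cdot>tensor_inr A' ?SL"
 proof -
  have "(Struct A\<lhd>Carrier ?SL)\<cdot>tensor_inr R ?SL = tensor_inr A' ?SL\<cdot>\<i>\<d> (Carrier ?SL)"
   by (rule tensor_inr_nat[OF R SLm A'm SLm]) (use sA rA A's in auto)
  then show ?thesis unfolding y_def using q0 sA(1-3) rA A's iL by simp
 qed
 note xa = monoid_homD(1-3)[OF xh] and ya = monoid_homD(1-3)[OF yh, unfolded c]
 have agree: "x\<cdot>fu = y\<cdot>?gu"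
 proof (rule free_algebra_hom_unique[OF R o(1) SK P0m])
  show "monoid_hom M ?TK P0 (x\<cdot>fu)" by (rule monoid_hom_comp[OF TKm Am P0m fh(1) xh])
  show "monoid_hom M ?TK P0 (y\<cdot>?gu)" by (rule monoid_hom_comp[OF TKm TLm P0m gh(1) yh])
  note st = tensor_Struct_arr[OF R SKm]
  have s1: "x\<cdot>fu\<cdot>Struct ?TK = x\<cdot>(fu\<cdot>Struct ?TK)" by (rule comp_assoc_right) (use xa fu st in auto)
  have s2: "y\<cdot>?gu\<cdot>Struct ?TK = y\<cdot>(?gu\<cdot>Struct ?TK)" by (rule comp_assoc_right) (use ya gu st in auto)
  show "x\<cdot>fu\<cdot>Struct ?TK = y\<cdot>?gu\<cdot>Struct ?TK" unfolding s1 s2 fh(2) gh(2) yS P0s(4) ..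
  have 1: "x\<cdot>fu\<cdot>?x1 = x\<cdot>(k\<cdot>\<rr> K)" unfolding krr using xa fu(1-3) iK SinK by simp
  have 2: "y\<cdot>?gu\<cdot>?x1 = y\<cdot>(?gu\<cdot>?x1)" by (rule comp_assoc_right) (use ya gu(1-3) iK SinK in auto)
  have 3: "... = (y\<cdot>tensor_inr R ?SL)\<cdot>(Sym_in M L 1\<cdot>inverse_arr M (\<rr> L))\<cdot>(h\<cdot>\<rr> K)"
   unfolding sqr using ya iL SinL h' o by simp
  have 4: "... = q0\<cdot>(C.inl\<cdot>h)\<cdot>\<rr> K" unfolding yinr inl using q0 SinL h' o by simp
  have 5: "... = x\<cdot>(k\<cdot>\<rr> K)" unfolding q0g unfolding x_def using q0 k o A's by simp
  show "x\<cdot>fu\<cdot>?x1 = y\<cdot>?gu\<cdot>?x1" unfolding 1 2 3 4 5 ..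
 qed
 obtain wu where w: "(B, wu, P0)\<in>Arr (CAlg M R)" "wu\<cdot>pu = x" "wu\<cdot>qu = y"
 proof -
  have xC: "(A, x, P0)\<in>Hom (CAlg M R) A P0" and yC: "(?TL, y, P0)\<in>Hom (CAlg M R) ?TL P0"
   unfolding Hom_def mem_Collect_eq CAlg_simps using Aa P0a TLa xh yh yS P0s by auto
  obtain w where w: "w\<in>Hom (CAlg M R) B P0" "w \<cdot>\<^bsub>CAlg M R\<^esub> (A, pu, B) = (A, x, P0)" "w \<cdot>\<^bsub>CAlg M R\<^esub> q = (?TL, y, P0)"
   using ex1_implies_ex[OF univ[OF _ xC yC]] P0a agree by (auto simp: g CAlg_simps)
  obtain wu where wd: "w = (B, wu, P0)" using w(1) unfolding Hom_def mem_Collect_eq by (metis CAlg_arrE CAlg_simps(3,4))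
  have "(B, wu, P0)\<in>Arr (CAlg M R)" using w(1) unfolding Hom_def wd by simp
  then show ?thesis using that w(2,3)[unfolded wd qd CAlg_simps] by simp
 qed
 have wh: "monoid_hom M B P0 wu" "wu\<cdot>Struct B = Struct P0" using w(1) unfolding CAlg_simps by auto
 note wu = monoid_homD(1-3)[OF wh(1)]
 let ?v = "qu\<cdot>tensor_inr R ?SL"
 have vh: "monoid_hom M ?SL B ?v" by (rule monoid_hom_comp[OF SLm TLm Bm tensor_inr_hom[OF R SLm] qh(1)])
 note v = monoid_homD[OF vh]
 \<comment> \<open>The map back multiplies the images of \<open>A\<close> and \<open>Sym L\<close> in \<open>B\<close>.\<close>
 define \<psi> where "\<psi> = Mult B\<cdot>(pu\<odot>?v)"
 have \<psi>h: "monoid_hom M C.E B \<psi>" unfolding \<psi>_def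
  by (rule tensor_copair_hom[OF A'm SLm Bm _ vh]) (use ph(1) in \<open>simp add: monoid_hom_def A's\<close>)
 have \<psi>S: "\<psi>\<cdot>Struct C.E = pu" unfolding \<psi>_def
  by (rule copair_Struct(1)[OF A'm SLm Bm]) (use pu v A's in auto)
 have \<psi>i: "\<psi>\<cdot>tensor_inr A' ?SL = ?v" unfolding \<psi>_def
  by (rule copair_Struct(2)[OF A'm SLm Bm]) (use pu v A's in auto)
 note \<psi> = monoid_homD[OF \<psi>h, unfolded cE]
 have "\<psi>\<cdot>(C.inl\<cdot>h) = \<psi>\<cdot>(Struct C.E\<cdot>k)"
 proof (rule iso_cancel_right)
  have "\<psi>\<cdot>(C.inl\<cdot>h)\<cdot>\<rr> K = (\<psi>\<cdot>tensor_inr A' ?SL)\<cdot>((Sym_in M L 1\<cdot>inverse_arr M (\<rr> L))\<cdot>(h\<cdot>\<rr> K))"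
   unfolding inl using \<psi>(1-3) SinL h' o by simp
  also have "... = qu\<cdot>(?gu\<cdot>?x1)"
   unfolding \<psi>i sqr using qu(1-3) iL SinL h' o by simp
  also have "... = (qu\<cdot>?gu)\<cdot>?x1"
   by (rule comp_assoc_right[symmetric]) (use qu(1-3) gu(1-3) iK SinK in auto)
  also have "... = pu\<cdot>(k\<cdot>\<rr> K)" unfolding sq[symmetric] krr using pu(1-3) fu(1-3) iK SinK by simp
  also have "... = \<psi>\<cdot>(Struct C.E\<cdot>k)\<cdot>\<rr> K" unfolding \<psi>S[symmetric] using \<psi>(1-3) k o A's by simp
  finally show "\<psi>\<cdot>(C.inl\<cdot>h)\<cdot>\<rr> K = \<psi>\<cdot>(Struct C.E\<cdot>k)\<cdot>\<rr> K" .
 qed (use \<psi>(1-3) h' k o A's in auto)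
 note \<psi>r = C.generator_rel[OF \<psi>h Bm this]
 obtain \<psi>' where \<psi>': "\<psi>'\<in>Arr M" "Dom M \<psi>' = Q" "Cod M \<psi>' = Carrier B" "\<And>i. i\<in>{()} ==> \<psi>'\<cdot>q0 = \<psi>"
  by (rule is_glue_ex[OF G, of "Carrier B" "\<lambda>_. \<psi>"]) (use \<psi>(1-3) \<psi>r rA in auto)
 then have \<psi>'q: "\<psi>'\<cdot>q0 = \<psi>" by simp
 have \<psi>'h: "monoid_hom M P0 B \<psi>'"
  by (rule quotient_hom[OF Em P0m Bm q0h]) (use q0e q0(3) P0s \<psi>' \<psi>h \<psi>'q in auto)
 have \<psi>'x: "\<psi>'\<cdot>x = pu" unfolding \<psi>S[symmetric] \<psi>'q[symmetric] x_def using q0 \<psi>'(1-3) A's by simp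
 have \<psi>'y: "\<psi>'\<cdot>y = qu"
 proof -
  have "\<psi>'\<cdot>y = \<psi>\<cdot>(Struct A\<lhd>Carrier ?SL)" unfolding \<psi>'q[symmetric] y_def using q0 \<psi>'(1-3) sA rA A's by simp
  also have "... = Mult B\<cdot>((pu\<cdot>Struct A)\<odot>?v)" unfolding \<psi>_def using pu(1-3) v(1-3) sA(1-3) rA qu(1-3) iL by simp
  also have "... = (Mult B\<cdot>(qu\<odot>qu))\<cdot>(Struct ?TL\<odot>tensor_inr R ?SL)"
   unfolding ph(2) qh(2)[symmetric] using rA qu(1-3) iL tensor_Struct_arr[OF R SLm] by simp
  also have "... = qu\<cdot>(Mult ?TL\<cdot>(Struct ?TL\<odot>tensor_inr R ?SL))"
   unfolding qu(4)[symmetric] using rA qu(1-3) iL tensor_Struct_arr[OF R SLm] tensor_Mult_arr[OF R SLm] by simp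
  also have "... = qu" unfolding tensor_mult_Struct_inr[OF R SLm] using qu(1-3) rA by simp
  finally show ?thesis .
 qed
 have \<psi>'S: "\<psi>'\<cdot>Struct P0 = Struct B" unfolding P0s ph(2)[symmetric] \<psi>'x[symmetric] using xa \<psi>'(1-3) sA(1-3) P0s by simp
 have id: "\<psi>'\<cdot>wu = \<i>\<d> (Carrier B)"
 proof -
  let ?u = "(B, \<psi>'\<cdot>wu, B)" and ?i = "(B, \<i>\<d> (Carrier B), B)"
  have e: "\<psi>'\<cdot>wu\<cdot>pu = pu" "\<psi>'\<cdot>wu\<cdot>qu = qu"
   using \<psi>'x \<psi>'y unfolding w(2,3)[symmetric] using \<psi>'(1-3) wu pu(1-3) qu(1-3) P0s by simp_all
  have "\<psi>'\<cdot>wu\<cdot>Struct B = \<psi>'\<cdot>(wu\<cdot>Struct B)" using \<psi>'(1-3) wu sB(1-3) P0s by simp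
  then have uS: "\<psi>'\<cdot>wu\<cdot>Struct B = Struct B" unfolding wh(2) \<psi>'S .
  have u: "?u\<in>Hom (CAlg M R) B B" unfolding Hom_def mem_Collect_eq CAlg_simps
   using Ba uS monoid_hom_comp[OF Bm P0m Bm wh(1) \<psi>'h] by blast
  have "Idn (CAlg M R) B\<in>Hom (CAlg M R) B B" by (rule CA.id_closed) (use Ba in \<open>simp add: CAlg_simps\<close>)
  then have i: "?i\<in>Hom (CAlg M R) B B" unfolding CAlg_simps .
  have "\<exists>!u. u\<in>Hom (CAlg M R) B B \<and> u \<cdot>\<^bsub>CAlg M R\<^esub> (A, pu, B) = (A, pu, B) \<and> u \<cdot>\<^bsub>CAlg M R\<^esub> q = q"
   by (rule univ) (use Ba P(3,4) sq in \<open>auto simp: Hom_def pd qd g CAlg_simps\<close>)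
  moreover have "?u \<cdot>\<^bsub>CAlg M R\<^esub> (A, pu, B) = (A, pu, B) \<and> ?u \<cdot>\<^bsub>CAlg M R\<^esub> q = q"
   unfolding qd CAlg_simps using e by simp
  moreover have "?i \<cdot>\<^bsub>CAlg M R\<^esub> (A, pu, B) = (A, pu, B) \<and> ?i \<cdot>\<^bsub>CAlg M R\<^esub> q = q"
   unfolding qd CAlg_simps using pu(1-3) qu(1-3) by simp
  ultimately have "?u = ?i" using u i by blast
  then show ?thesis by simp
 qed
 have "is_retract M pu x"
  by (rule is_retractI[of pu M x "\<i>\<d> (Carrier A)" "\<i>\<d> (Carrier A)" wu \<psi>'])
   (use pu(1-3) xa wu \<psi>'(1-3) P0s rA id w(2) \<psi>'x in auto)
 then show ?thesis unfolding pd using retracts(3) xcof by auto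
qed

section \<open>Directed colimits of algebras\<close>

context category
begin

lemma preorder_functor_iff:
 "is_functor (preorder_cat A le) C XO XA \<longleftrightarrow>
   (\<forall>a\<in>A. XO a\<in>Obj C) \<and> (\<forall>a\<in>A. \<forall>b\<in>A. le a b --> XA (a, b)\<in>Hom C (XO a) (XO b)) \<and>
   (\<forall>a\<in>A. XA (a, a) = \<i>\<d> (XO a)) \<and>
   (\<forall>a\<in>A. \<forall>b\<in>A. \<forall>c\<in>A. le a b --> le b c --> XA (a, c) = XA (b, c)\<cdot>XA (a, b))"
 unfolding is_functor_def by (simp add: split_paired_Ball_Sigma Ball_def) (auto; blast)

lemma preorder_cocone_iff:
 "is_cocone (preorder_cat A le) C XO XA c \<iota> \<longleftrightarrow>
   c\<in>Obj C \<and> (\<forall>a\<in>A. \<iota> a\<in>Hom C (XO a) c) \<and> (\<forall>a\<in>A. \<forall>b\<in>A. le a b --> \<iota> b\<cdot>XA (a, b) = \<iota> a)"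
 unfolding is_cocone_def by (simp add: Ball_def) blast

lemma is_colimit_ex:
 assumes "is_colimit D C FO FA c \<iota>" "is_cocone D C FO FA Z \<kappa>"
 obtains u where "u\<in>Arr C" "Dom C u = c" "Cod C u = Z" "\<And>i. i\<in>Obj D ==> u\<cdot>\<iota> i = \<kappa> i"
proof -
 obtain u where "u\<in>Hom C c Z" "\<forall>i\<in>Obj D. u\<cdot>\<iota> i = \<kappa> i"
  using assms unfolding is_colimit_def by blast
 then show ?thesis using that[of u] by auto
qed

lemma is_colimit_epic:
 assumes "is_colimit D C FO FA c \<iota>" "category D" "is_functor D C FO FA"
 shows "jointly_epic (Obj D) c \<iota>"
 using is_glue_epic is_colimit_iff_glue[OF assms(2,3)] assms(1) by blast

end

text \<open>Diagrams over a nonempty directed preorder.\<close>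

locale chain = category C
 for C :: "('o, 'm, 'z) cat_scheme" (structure) +
 fixes A :: "'i set" and le :: "'i => 'i => bool" and XO :: "'i => 'o" and XA :: "'i \<times> 'i => 'm"
 assumes nonempty: "A \<noteq> {}"
  and le_refl: "a\<in>A ==> le a a"
  and le_trans: "a\<in>A ==> b\<in>A ==> c\<in>A ==> le a b ==> le b c ==> le a c"
  and directed: "a\<in>A ==> b\<in>A ==> \<exists>d\<in>A. le a d \<and> le b d"
  and functoriality: "is_functor (preorder_cat A le) C XO XA"
begin

lemma shape: "category (preorder_cat A le)"
 using le_refl le_trans by (rule category_preorder_cat)

lemma chain_arr:
 "a\<in>A ==> XO a\<in>Obj C"
 "a\<in>A ==> b\<in>A ==> le a b ==> XA (a, b)\<in>Arr C \<and> Dom C (XA (a, b)) = XO a \<and> Cod C (XA (a, b)) = XO b"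
 "a\<in>A ==> XA (a, a) = \<i>\<d> (XO a)"
 "a\<in>A ==> b\<in>A ==> c\<in>A ==> le a b ==> le b c ==> XA (a, c) = XA (b, c)\<cdot>XA (a, b)"
 using functoriality[unfolded preorder_functor_iff in_Hom] by blast+

lemma cocone_arr:
 assumes "is_cocone (preorder_cat A le) C XO XA c \<iota>"
 shows "c\<in>Obj C" "a\<in>A ==> \<iota> a\<in>Arr C \<and> Dom C (\<iota> a) = XO a \<and> Cod C (\<iota> a) = c"
  "a\<in>A ==> b\<in>A ==> le a b ==> \<iota> b\<cdot>XA (a, b) = \<iota> a"
 using assms[unfolded preorder_cocone_iff in_Hom] by blast+

lemma colimit_cocone: "is_colimit (preorder_cat A le) C XO XA c \<iota> ==> is_cocone (preorder_cat A le) C XO XA c \<iota>"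
 unfolding is_colimit_def by blast

lemma colimit_epic: "is_colimit (preorder_cat A le) C XO XA c \<iota> ==> jointly_epic A c \<iota>"
 using is_colimit_epic[OF _ shape functoriality] by simp

end

text \<open>Existence is transferred along \<open>w\<close> and uniqueness along \<open>v\<close>; the law \<open>w\<cdot>v = id\<close> follows from the
 universal property of \<open>c\<close>.\<close>

lemma (in category) is_colimit_transport:
 assumes c: "is_colimit D C FO FA c \<iota>" and D: "category D" "is_functor D C FO FA"
  and c': "is_cocone D C FO FA c' \<iota>'"
  and v: "v\<in>Arr C" "Dom C v = c" "Cod C v = c'" "\<And>i. i\<in>Obj D ==> v\<cdot>\<iota> i = \<iota>' i"
  and w: "w\<in>Arr C" "Dom C w = c'" "Cod C w = c" "\<And>i. i\<in>Obj D ==> w\<cdot>\<iota>' i = \<iota> i"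
  and vw: "v\<cdot>w = \<i>\<d> c'"
 shows "is_colimit D C FO FA c' \<iota>'"
 unfolding is_colimit_def
proof (intro conjI allI impI)
 fix Z \<kappa> assume \<kappa>: "is_cocone D C FO FA Z \<kappa>"
 obtain u where u: "u\<in>Arr C" "Dom C u = c" "Cod C u = Z" "\<And>i. i\<in>Obj D ==> u\<cdot>\<iota> i = \<kappa> i"
  using is_colimit_ex[OF c \<kappa>] by blast
 have \<iota>': "\<iota>' i\<in>Arr C" "Cod C (\<iota>' i) = c'" if "i\<in>Obj D" for i using c' that unfolding is_cocone_def by auto
 have \<iota>: "\<iota> i\<in>Arr C" "Cod C (\<iota> i) = c" if "i\<in>Obj D" for i using c that unfolding is_colimit_def is_cocone_def by auto
 show "\<exists>!u. u\<in>Hom C c' Z \<and> (\<forall>i\<in>Obj D. u\<cdot>\<iota>' i = \<kappa> i)"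
 proof (rule ex1I[of _ "u\<cdot>w"])
  have "u\<cdot>w\<cdot>\<iota>' i = u\<cdot>(w\<cdot>\<iota>' i)" if "i\<in>Obj D" for i using u(1-3) w(1-3) \<iota>'[OF that] by simp
  then show "u\<cdot>w\<in>Hom C c' Z \<and> (\<forall>i\<in>Obj D. u\<cdot>w\<cdot>\<iota>' i = \<kappa> i)"
   using u w(1-3) w(4) by simp
  fix x assume x: "x\<in>Hom C c' Z \<and> (\<forall>i\<in>Obj D. x\<cdot>\<iota>' i = \<kappa> i)"
  then have x: "x\<in>Arr C" "Dom C x = c'" "Cod C x = Z" "\<And>i. i\<in>Obj D ==> x\<cdot>\<iota>' i = \<kappa> i" by auto
  have "x\<cdot>v = u"
  proof (rule jointly_epicD[OF is_colimit_epic[OF c D]])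
   fix i assume i: "i\<in>Obj D"
   have "x\<cdot>v\<cdot>\<iota> i = x\<cdot>(v\<cdot>\<iota> i)" using x(1-3) v(1-3) \<iota>[OF i] by simp
   then show "x\<cdot>v\<cdot>\<iota> i = u\<cdot>\<iota> i" using v(4)[OF i] x(4)[OF i] u(4)[OF i] by simp
  qed (use x v u in auto)
  have "x = x\<cdot>(v\<cdot>w)" unfolding vw using x by simp
  also have "... = x\<cdot>v\<cdot>w" using x(1-3) v(1-3) w(1-3) by simp
  finally show "x = u\<cdot>w" unfolding \<open>x\<cdot>v = u\<close> .
 qed
qed (rule c')

lemma (in closed_symmetric_monoidal) underlying_arr:
 assumes "\<phi>\<in>Arr (CAlg M R)"
 shows "monoid_hom M (Dom (CAlg M R) \<phi>) (Cod (CAlg M R) \<phi>) (underlying \<phi>)"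
  "underlying \<phi>\<cdot>Struct (Dom (CAlg M R) \<phi>) = Struct (Cod (CAlg M R) \<phi>)"
  "commutative_algebra M R (Dom (CAlg M R) \<phi>)" "commutative_algebra M R (Cod (CAlg M R) \<phi>)"
  "\<phi> = (Dom (CAlg M R) \<phi>, underlying \<phi>, Cod (CAlg M R) \<phi>)"
  "underlying \<phi>\<in>Arr M" "Dom M (underlying \<phi>) = Carrier (Dom (CAlg M R) \<phi>)" "Cod M (underlying \<phi>) = Carrier (Cod (CAlg M R) \<phi>)"
proof -
 obtain A f B where "\<phi> = (A, f, B)" by (cases \<phi>) auto
 then show "monoid_hom M (Dom (CAlg M R) \<phi>) (Cod (CAlg M R) \<phi>) (underlying \<phi>)"
  "underlying \<phi>\<cdot>Struct (Dom (CAlg M R) \<phi>) = Struct (Cod (CAlg M R) \<phi>)"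
  "commutative_algebra M R (Dom (CAlg M R) \<phi>)" "commutative_algebra M R (Cod (CAlg M R) \<phi>)"
  "\<phi> = (Dom (CAlg M R) \<phi>, underlying \<phi>, Cod (CAlg M R) \<phi>)"
  using assms by (auto simp: CAlg_simps)
 then show "underlying \<phi>\<in>Arr M" "Dom M (underlying \<phi>) = Carrier (Dom (CAlg M R) \<phi>)" "Cod M (underlying \<phi>) = Carrier (Cod (CAlg M R) \<phi>)"
  using monoid_homD(1-3) by blast+
qed

lemma (in closed_symmetric_monoidal) underlying_comp:
 "underlying (\<psi> \<cdot>\<^bsub>CAlg M R\<^esub> \<phi>) = underlying \<psi>\<cdot>underlying \<phi>"
 by (cases \<phi>; cases \<psi>) (simp add: CAlg_simps)

text \<open>Directed colimits of algebras are computed in the underlying category: the tensor product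
 preserves colimits in both variables, and the diagonal of a directed set is cofinal in its powers.\<close>

lemma (in closed_symmetric_monoidal) chain_colimit_underlying:
 fixes U :: "'u set" and A :: "'i set" and le and R :: "('o, 'm) cmon"
 assumes ch: "chain (CAlg M R) A le XO XA" and R: "commutative_monoid M R"
  and U: "inaccessible U" "cocomplete U M" "small U A"
  and col: "is_colimit (preorder_cat A le) (CAlg M R) XO XA c \<iota>"
 shows "is_colimit (preorder_cat A le) M (\<lambda>a. Carrier (XO a)) (\<lambda>x. underlying (XA x)) (Carrier c) (\<lambda>a. underlying (\<iota> a))"
proof -
 interpret X: chain "CAlg M R" A le XO XA by fact
 let ?D = "preorder_cat A le" and ?FO = "\<lambda>a. Carrier (XO a)" and ?FA = "\<lambda>x. underlying (XA x)"
 define t where "t = (\<lambda>a b. underlying (XA (a, b)))"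
 have Xm: "commutative_monoid M (XO a)" and Xs: "monoid_hom M R (XO a) (Struct (XO a))" if "a\<in>A" for a
  using X.chain_arr(1)[OF that] algebraD by (auto simp: CAlg_simps)
 have t: "monoid_hom M (XO a) (XO b) (t a b)" "t a b\<cdot>Struct (XO a) = Struct (XO b)" if "a\<in>A" "b\<in>A" "le a b" for a b
  using underlying_arr(1,2)[of "XA (a, b)" R] X.chain_arr(2)[OF that] unfolding t_def by auto
 have tid: "t a a = \<i>\<d> (Carrier (XO a))" if "a\<in>A" for a unfolding t_def X.chain_arr(3)[OF that] by (simp add: CAlg_simps)
 have tc: "t a c = t b c\<cdot>t a b" if "a\<in>A" "b\<in>A" "c\<in>A" "le a b" "le b c" for a b c
  unfolding t_def X.chain_arr(4)[OF that] by (rule underlying_comp)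
 note Xa = monoidD(1-7)[OF Xm] and ta = monoid_homD(1-3)[OF t(1)]
 have fn: "is_functor ?D M ?FO ?FA"
  unfolding preorder_functor_iff using Xa ta tid tc by (simp add: t_def)
 interpret Y: chain M A le ?FO ?FA
  by unfold_locales (rule X.nonempty X.le_refl X.le_trans X.directed fn; assumption?)+
 obtain Q j where Qj: "is_colimit ?D M ?FO ?FA Q j"
  using colimit_exists[OF U(2) Y.shape small_preorder_cat[OF U(1,3)] fn] by blast
 note co = Y.colimit_cocone[OF Qj]
 have Q: "Q\<in>Obj M" and j: "a\<in>A ==> j a\<in>Arr M" "a\<in>A ==> Dom M (j a) = Carrier (XO a)" "a\<in>A ==> Cod M (j a) = Q"
  and jt: "a\<in>A ==> b\<in>A ==> le a b ==> j b\<cdot>t a b = j a" for a b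
  using Y.cocone_arr[OF co] unfolding t_def by auto
 note ep = Y.colimit_epic[OF Qj]
 have jW: "j a\<in>Arr M \<and> Cod M (j a) = Q" if "a\<in>A" for a using j that by blast
 note ep2' = jointly_epic_tensor[OF ep jW ep jW Q Q]
 let ?T2 = "{(a, a) |a. a\<in>A}" and ?T3 = "{(a, a, a) |a. a\<in>A}"
 have ep2: "jointly_epic ?T2 (Q\<otimes>Q) (\<lambda>(a, b). j a\<odot>j b)"
  unfolding jointly_epic_def
 proof (intro allI impI, elim conjE)
  fix f g assume fg: "f\<in>Arr M" "g\<in>Arr M" "Dom M f = Q\<otimes>Q" "Dom M g = Q\<otimes>Q" "Cod M f = Cod M g"
   and e: "\<forall>i\<in>?T2. f\<cdot>(case i of (a, b) => j a\<odot>j b) = g\<cdot>(case i of (a, b) => j a\<odot>j b)"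
  have e: "f\<cdot>(j a\<odot>j a) = g\<cdot>(j a\<odot>j a)" if "a\<in>A" for a using e that by auto
  show "f = g"
  proof (rule jointly_epicD[OF ep2'])
   fix i assume "i\<in>A \<times> A"
   then obtain a b where i: "i = (a, b)" "a\<in>A" "b\<in>A" by blast
   obtain d where d: "d\<in>A" "le a d" "le b d" using X.directed i by blast
   note ta' = ta[OF i(2) d(1,2)] ta[OF i(3) d(1,3)]
   have "f\<cdot>(j a\<odot>j b) = (f\<cdot>(j d\<odot>j d))\<cdot>(t a d\<odot>t b d)" "g\<cdot>(j a\<odot>j b) = (g\<cdot>(j d\<odot>j d))\<cdot>(t a d\<odot>t b d)"
    using fg jt[OF i(2) d(1,2)] jt[OF i(3) d(1,3)] j[OF d(1)] ta' by simp_all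
   then show "f\<cdot>(case i of (a, b) => j a\<odot>j b) = g\<cdot>(case i of (a, b) => j a\<odot>j b)"
    unfolding i(1) prod.case using e[OF d(1)] by simp
  qed (use fg in auto)
 qed
 have jW2: "(case i of (a, b) => j a\<odot>j b)\<in>Arr M \<and> Cod M (case i of (a, b) => j a\<odot>j b) = Q\<otimes>Q" if "i\<in>?T2" for i
  using that j by auto
 have Q2: "Q\<otimes>Q\<in>Obj M" using Q by simp
 note ep3' = jointly_epic_tensor[OF ep2 jW2 ep jW Q2 Q]
 have ep3: "jointly_epic ?T3 ((Q\<otimes>Q)\<otimes>Q) (\<lambda>(a, b, c). (j a\<odot>j b)\<odot>j c)"
  unfolding jointly_epic_def
 proof (intro allI impI, elim conjE)
  fix f g assume fg: "f\<in>Arr M" "g\<in>Arr M" "Dom M f = (Q\<otimes>Q)\<otimes>Q" "Dom M g = (Q\<otimes>Q)\<otimes>Q" "Cod M f = Cod M g"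
   and e: "\<forall>i\<in>?T3. f\<cdot>(case i of (a, b, c) => (j a\<odot>j b)\<odot>j c) = g\<cdot>(case i of (a, b, c) => (j a\<odot>j b)\<odot>j c)"
  have e: "f\<cdot>((j a\<odot>j a)\<odot>j a) = g\<cdot>((j a\<odot>j a)\<odot>j a)" if "a\<in>A" for a using e that by auto
  show "f = g"
  proof (rule jointly_epicD[OF ep3'])
   fix i assume "i\<in>?T2 \<times> A"
   then obtain a b where i: "i = ((a, a), b)" "a\<in>A" "b\<in>A" by blast
   obtain d where d: "d\<in>A" "le a d" "le b d" using X.directed i by blast
   note ta' = ta[OF i(2) d(1,2)] ta[OF i(3) d(1,3)]
   have "f\<cdot>((j a\<odot>j a)\<odot>j b) = (f\<cdot>((j d\<odot>j d)\<odot>j d))\<cdot>((t a d\<odot>t a d)\<odot>t b d)" "g\<cdot>((j a\<odot>j a)\<odot>j b) = (g\<cdot>((j d\<odot>j d)\<odot>j d))\<cdot>((t a d\<odot>t a d)\<odot>t b d)"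
    using fg jt[OF i(2) d(1,2)] jt[OF i(3) d(1,3)] j[OF d(1)] ta' by simp_all
   then show "f\<cdot>(case i of (i, k) => (case i of (a, b) => j a\<odot>j b)\<odot>j k) = g\<cdot>(case i of (i, k) => (case i of (a, b) => j a\<odot>j b)\<odot>j k)"
    unfolding i(1) prod.case using e[OF d(1)] by simp
  qed (use fg in auto)
 qed
 \<comment> \<open>The product of elements of two stages is formed at a common later stage.\<close>
 define up where "up = (\<lambda>a b. SOME d. d\<in>A \<and> le a d \<and> le b d)"
 have up: "up a b\<in>A" "le a (up a b)" "le b (up a b)" if "a\<in>A" "b\<in>A" for a b
  using someI_ex[of "\<lambda>d. d\<in>A \<and> le a d \<and> le b d"] X.directed that unfolding up_def by blast+
 define \<kappa> where "\<kappa> = (\<lambda>a b. j (up a b)\<cdot>(Mult (XO (up a b))\<cdot>(t a (up a b)\<odot>t b (up a b))))"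
 have indep: "j d\<cdot>(Mult (XO d)\<cdot>(t a d\<odot>t b d)) = \<kappa> a b"
  if a: "a\<in>A" "b\<in>A" and d: "d\<in>A" "le a d" "le b d" for a b d
 proof -
  have le: "j e\<cdot>(Mult (XO e)\<cdot>(t a e\<odot>t b e)) = j d\<cdot>(Mult (XO d)\<cdot>(t a d\<odot>t b d))"
   if d: "d\<in>A" "le a d" "le b d" and e: "e\<in>A" "le d e" for d e
  proof -
   note tt = ta[OF a(1) d(1,2)] ta[OF a(2) d(1,3)] ta[OF d(1) e]
   have "j e\<cdot>(Mult (XO e)\<cdot>(t a e\<odot>t b e)) = j e\<cdot>((Mult (XO e)\<cdot>(t d e\<odot>t d e))\<cdot>(t a d\<odot>t b d))"
    unfolding tc[OF a(1) d(1) e(1) d(2) e(2)] tc[OF a(2) d(1) e(1) d(3) e(2)]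
    using tt Xa[OF e(1)] Xa[OF d(1)] by simp
   also have "... = (j e\<cdot>t d e)\<cdot>(Mult (XO d)\<cdot>(t a d\<odot>t b d))"
    unfolding monoid_homD(4)[OF t(1)[OF d(1) e], symmetric] using tt Xa[OF e(1)] Xa[OF d(1)] j[OF e(1)] by simp
   finally show ?thesis unfolding jt[OF d(1) e] .
  qed
  obtain e where e: "e\<in>A" "le d e" "le (up a b) e" using X.directed d(1) up(1)[OF a] by blast
  show ?thesis unfolding \<kappa>_def using le[OF d e(1,2)] le[OF up[OF a] e(1,3)] by simp
 qed
 have \<kappa>: "\<kappa> a b\<in>Hom M (Carrier (XO a)\<otimes>Carrier (XO b)) Q" if "a\<in>A" "b\<in>A" for a b
  unfolding \<kappa>_def using that up[OF that] j ta Xa by simp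
 note gl = is_colimit_iff_glue[OF Y.shape fn]
 have gQ: "is_glue M A ?FO {(Cod ?D x, ?FA x, Dom ?D x, \<i>\<d> (?FO (Dom ?D x))) |x. x\<in>Arr ?D} Q j"
  using Qj gl(1) by simp
 note gw = gl(2)[simplified preorder_cat_simps(1)]
 obtain m where m: "m\<in>Arr M" "Dom M m = Q\<otimes>Q" "Cod M m = Q" "\<And>a b. a\<in>A ==> b\<in>A ==> m\<cdot>(j a\<odot>j b) = \<kappa> a b"
 proof (rule is_glue_tensor_ex[OF gQ gw gQ gw Q, of \<kappa>])
  fix i x k y b assume "(i, x, k, y)\<in>{(Cod ?D x, ?FA x, Dom ?D x, \<i>\<d> (?FO (Dom ?D x))) |x. x\<in>Arr ?D}" and b: "b\<in>A"
  then obtain a a' where i: "i = a'" "x = t a a'" "k = a" "y = \<i>\<d> (Carrier (XO a))" "a\<in>A" "a'\<in>A" "le a a'"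
   by (auto simp: t_def)
  note u = up[OF i(6) b]
  note la = X.le_trans[OF i(5,6) u(1) i(7) u(2)]
  note tt = ta[OF i(5,6,7)] ta[OF i(6) u(1,2)] ta[OF b u(1,3)] ta[OF i(5) u(1) la]
  have 1: "\<kappa> a' b\<cdot>(t a a'\<lhd>(Carrier (XO b))) = \<kappa> a b"
   unfolding indep[OF i(5) b u(1) la u(3), symmetric] unfolding \<kappa>_def tc[OF i(5,6) u(1) i(7) u(2)]
   using tt(1-9) Xa[OF u(1)] Xa[OF b] j[OF u(1)] by simp
  show "\<kappa> i b\<cdot>(x\<lhd>(Carrier (XO b))) = \<kappa> k b\<cdot>(y\<lhd>(Carrier (XO b)))"
   unfolding i(1-4) 1 using \<kappa>[OF i(5) b] Xa[OF b] Xa[OF i(5)] by simp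
  note u = up[OF b i(6)]
  note la = X.le_trans[OF i(5,6) u(1) i(7) u(3)]
  note tt = ta[OF i(5,6,7)] ta[OF i(6) u(1,3)] ta[OF b u(1,2)] ta[OF i(5) u(1) la]
  have 1: "\<kappa> b a'\<cdot>((Carrier (XO b))\<rhd>t a a') = \<kappa> b a"
   unfolding indep[OF b i(5) u(1) u(2) la, symmetric] unfolding \<kappa>_def tc[OF i(5,6) u(1) i(7) u(3)]
   using tt(1-9) Xa[OF u(1)] Xa[OF b] j[OF u(1)] by simp
  show "\<kappa> b i\<cdot>((Carrier (XO b))\<rhd>x) = \<kappa> b k\<cdot>((Carrier (XO b))\<rhd>y)"
   unfolding i(1-4) 1 using \<kappa>[OF b i(5)] Xa[OF b] Xa[OF i(5)] by simp
 qed (use \<kappa> in auto)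
 have mj: "m\<cdot>(j a\<odot>j a) = j a\<cdot>Mult (XO a)" if a: "a\<in>A" for a
  unfolding m(4)[OF a a] indep[OF a a a X.le_refl[OF a] X.le_refl[OF a], symmetric] tid[OF a] using Xa[OF a] j[OF a] by simp
 obtain z where z: "z\<in>A" using X.nonempty by blast
 have one: "j a\<cdot>One (XO a) = j z\<cdot>One (XO z)" and str: "j a\<cdot>Struct (XO a) = j z\<cdot>Struct (XO z)" if a: "a\<in>A" for a
 proof -
  obtain d where d: "d\<in>A" "le a d" "le z d" using X.directed[OF a z] by blast
  have 1: "j b\<cdot>One (XO b) = j d\<cdot>One (XO d)" "j b\<cdot>Struct (XO b) = j d\<cdot>Struct (XO d)" if b: "b\<in>A" "le b d" for b
  proof -
   note tt = monoid_homD[OF t(1)[OF b(1) d(1) b(2)]]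
   have "j b\<cdot>One (XO b) = j d\<cdot>(t b d\<cdot>One (XO b))"
    unfolding jt[OF b(1) d(1) b(2), symmetric] using j[OF d(1)] tt(1-3) Xa[OF b(1)] by simp
   then show "j b\<cdot>One (XO b) = j d\<cdot>One (XO d)" unfolding tt(5) .
   have "j b\<cdot>Struct (XO b) = j d\<cdot>(t b d\<cdot>Struct (XO b))"
    unfolding jt[OF b(1) d(1) b(2), symmetric] using j[OF d(1)] tt(1-3) monoid_homD(1-3)[OF Xs[OF b(1)]] by simp
   then show "j b\<cdot>Struct (XO b) = j d\<cdot>Struct (XO d)" unfolding t(2)[OF b(1) d(1) b(2)] .
  qed
  show "j a\<cdot>One (XO a) = j z\<cdot>One (XO z)" "j a\<cdot>Struct (XO a) = j z\<cdot>Struct (XO z)" using 1 a z d by simp_all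
 qed
 define B where "B = \<lparr>Carrier = Q, Mult = m, One = j z\<cdot>One (XO z), Struct = j z\<cdot>Struct (XO z)\<rparr>"
 have Bs: "Carrier B = Q" "Mult B = m" "One B = j z\<cdot>One (XO z)" "Struct B = j z\<cdot>Struct (XO z)" by (auto simp: B_def)
 have Bm: "commutative_monoid M B"
 proof (rule monoid_from_generators[where T = A and \<iota> = j and F = ?FO and ?T2.0 = ?T2 and ?T3.0 = ?T3])
  show "Carrier B\<in>Obj M" "Mult B\<in>Hom M (Carrier B\<otimes>Carrier B) (Carrier B)" using Q m(1-3) Bs by auto
  show "One B\<in>Hom M \<one> (Carrier B)" using Bs j[OF z] Xa[OF z] by auto
  fix a assume a: "a\<in>A"
  show "j a\<in>Hom M (Carrier (XO a)) (Carrier B)" "Carrier (XO a)\<in>Obj M" using j[OF a] Xa[OF a] Bs by auto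
  have "Mult B\<cdot>(One B\<odot>j a) = (m\<cdot>(j a\<odot>j a))\<cdot>(One (XO a)\<lhd>(Carrier (XO a)))"
   unfolding Bs one[OF a, symmetric] using j[OF a] Xa[OF a] m(1-3) by simp
  also have "... = j a\<cdot>(Mult (XO a)\<cdot>(One (XO a)\<lhd>(Carrier (XO a))))"
   unfolding mj[OF a] using j[OF a] Xa[OF a] by simp
  also have "... = j a\<cdot>\<ll> (Carrier (XO a))" using monoidD[OF Xm[OF a]] by simp
  finally show "Mult B\<cdot>(One B\<odot>j a) = j a\<cdot>\<ll> (Carrier (XO a))" .
 next
  fix a b assume "(a, b)\<in>?T2"
  then have [simp]: "b = a" and a: "a\<in>A" by auto
  have "m\<cdot>(j a\<odot>j a)\<cdot>\<beta> (Carrier (XO a)) (Carrier (XO a)) = j a\<cdot>(Mult (XO a)\<cdot>\<beta> (Carrier (XO a)) (Carrier (XO a)))"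
   unfolding mj[OF a] using j[OF a] Xa[OF a] by simp
  also have "... = m\<cdot>(j a\<odot>j a)" unfolding mj[OF a] using monoidD[OF Xm[OF a]] by simp
  finally show "Mult B\<cdot>((j b\<odot>j a)\<cdot>\<beta> (Carrier (XO a)) (Carrier (XO b))) = Mult B\<cdot>(j a\<odot>j b)"
   using j[OF a] Xa[OF a] m(1-3) Bs by simp
 next
  fix a b c assume "(a, b, c)\<in>?T3"
  then have [simp]: "b = a" "c = a" and a: "a\<in>A" by auto
  let ?c = "Carrier (XO a)" and ?m = "Mult (XO a)"
  have "m\<cdot>((m\<cdot>(j a\<odot>j a))\<odot>j a) = m\<cdot>((j a\<cdot>?m)\<odot>j a)" unfolding mj[OF a] ..
  also have "... = (m\<cdot>(j a\<odot>j a))\<cdot>(?m\<lhd>?c)" using j[OF a] Xa[OF a] m(1-3) by simp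
  also have "... = j a\<cdot>(?m\<cdot>(?m\<lhd>?c))" unfolding mj[OF a] using j[OF a] Xa[OF a] m(1-3) by simp
  also have "... = j a\<cdot>(?m\<cdot>(?c\<rhd>?m)\<cdot>\<alpha> ?c ?c ?c)" using Xm[OF a] unfolding commutative_monoid_def by simp
  also have "... = (m\<cdot>(j a\<odot>j a))\<cdot>((?c\<rhd>?m)\<cdot>\<alpha> ?c ?c ?c)" unfolding mj[OF a] using j[OF a] Xa[OF a] m(1-3) by simp
  also have "... = m\<cdot>((j a\<odot>(j a\<cdot>?m))\<cdot>\<alpha> ?c ?c ?c)" using j[OF a] Xa[OF a] m(1-3) by simp
  also have "... = m\<cdot>((j a\<odot>(m\<cdot>(j a\<odot>j a)))\<cdot>\<alpha> ?c ?c ?c)" unfolding mj[OF a] ..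
  finally show "Mult B\<cdot>((Mult B\<cdot>(j a\<odot>j b))\<odot>j c) =
   Mult B\<cdot>((j a\<odot>(Mult B\<cdot>(j b\<odot>j c)))\<cdot>\<alpha> (Carrier (XO a)) (Carrier (XO b)) (Carrier (XO c)))" unfolding Bs by simp
 qed (use ep ep2 ep3 Bs in auto)
 have jh: "monoid_hom M (XO a) B (j a)" if a: "a\<in>A" for a
  unfolding monoid_hom_def Bs using j[OF a] mj[OF a] one[OF a] by simp
 have Ba: "commutative_algebra M R B"
  unfolding commutative_algebra_def Bs(4) using Bm monoid_hom_comp[OF R Xm[OF z] Bm Xs[OF z] jh[OF z]] by blast
 define J where "J = (\<lambda>a. (XO a, j a, B))"
 have Jc: "is_cocone ?D (CAlg M R) XO XA B J"
  unfolding X.preorder_cocone_iff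
 proof (intro conjI ballI impI)
  show "B\<in>Obj (CAlg M R)" using Ba by (simp add: CAlg_simps)
  show "J a\<in>Hom (CAlg M R) (XO a) B" if a: "a\<in>A" for a
   unfolding J_def Hom_def mem_Collect_eq CAlg_simps
   using X.chain_arr(1)[OF a] Ba jh[OF a] str[OF a] Bs by (simp add: CAlg_simps)
  fix a b assume ab: "a\<in>A" "b\<in>A" "le a b"
  have "XA (a, b) = (XO a, t a b, XO b)" using underlying_arr(5)[of "XA (a, b)" R] X.chain_arr(2)[OF ab] unfolding t_def by auto
  then show "J b \<cdot>\<^bsub>CAlg M R\<^esub> XA (a, b) = J a" unfolding J_def by (simp add: CAlg_simps jt[OF ab])
 qed
 note cc = X.colimit_cocone[OF col]
 have ia: "\<iota> a\<in>Arr (CAlg M R)" "Dom (CAlg M R) (\<iota> a) = XO a" "Cod (CAlg M R) (\<iota> a) = c" if "a\<in>A" for a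
  using X.cocone_arr(2)[OF cc that] by auto
 define i where "i = (\<lambda>a. underlying (\<iota> a))"
 have ih: "monoid_hom M (XO a) c (i a)" "i a\<cdot>Struct (XO a) = Struct c" and ca: "commutative_algebra M R c"
  and id: "\<iota> a = (XO a, i a, c)" if "a\<in>A" for a
  using underlying_arr(1,2,4,5)[OF ia(1)[OF that]] ia(2,3)[OF that] unfolding i_def by auto
 note ca = ca[OF z] note cm = algebraD(1)[OF ca]
 have ic: "is_cocone ?D M ?FO ?FA (Carrier c) i"
  unfolding preorder_cocone_iff
 proof (intro conjI ballI impI)
  show "Carrier c\<in>Obj M" using monoidD(1)[OF cm] .
  show "i a\<in>Hom M (Carrier (XO a)) (Carrier c)" if "a\<in>A" for a using monoid_homD(1-3)[OF ih(1)[OF that]] by simp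
  fix a b assume ab: "a\<in>A" "b\<in>A" "le a b"
  show "i b\<cdot>underlying (XA (a, b)) = i a" unfolding i_def X.cocone_arr(3)[OF cc ab, symmetric] underlying_comp ..
 qed
 \<comment> \<open>The colimit \<open>B\<close> in \<open>M\<close> and the colimit \<open>c\<close> of algebras map to each other.\<close>
 obtain w where w: "w\<in>Arr (CAlg M R)" "Dom (CAlg M R) w = c" "Cod (CAlg M R) w = B" "\<And>a. a\<in>A ==> w \<cdot>\<^bsub>CAlg M R\<^esub> \<iota> a = J a"
  using X.is_colimit_ex[OF col Jc] by auto
 define wu where "wu = underlying w"
 have wd: "w = (c, wu, B)" and wh: "monoid_hom M c B wu" "wu\<cdot>Struct c = Struct B"
  using underlying_arr(1,2,5)[OF w(1)] w(2,3) unfolding wu_def by auto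
 have wi: "wu\<cdot>i a = j a" if "a\<in>A" for a
  using w(4)[OF that] unfolding wd id[OF that] J_def by (simp add: CAlg_simps)
 obtain v where v: "v\<in>Arr M" "Dom M v = Q" "Cod M v = Carrier c" "\<And>a. a\<in>A ==> v\<cdot>j a = i a"
  using is_colimit_ex[OF Qj ic] by auto
 note cs = monoidD(1-7)[OF cm]
 have vh: "monoid_hom M B c v"
  unfolding monoid_hom_def Bs
 proof (intro conjI)
  show "v\<in>Hom M Q (Carrier c)" using v(1-3) by simp
  have "v\<cdot>(j z\<cdot>One (XO z)) = (v\<cdot>j z)\<cdot>One (XO z)" using v(1-3) j[OF z] Xa[OF z] by simp
  then show "v\<cdot>(j z\<cdot>One (XO z)) = One c" unfolding v(4)[OF z] monoid_homD(5)[OF ih(1)[OF z]] .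
  show "v\<cdot>m = Mult c\<cdot>(v\<odot>v)"
  proof (rule jointly_epicD[OF ep2])
   fix p assume "p\<in>?T2"
   then obtain a where p: "p = (a, a)" and a: "a\<in>A" by auto
   have "v\<cdot>m\<cdot>(j a\<odot>j a) = v\<cdot>(m\<cdot>(j a\<odot>j a))" using v(1-3) m(1-3) j[OF a] by simp
   also have "... = (v\<cdot>j a)\<cdot>Mult (XO a)" unfolding mj[OF a] using v(1-3) j[OF a] Xa[OF a] by simp
   also have "... = Mult c\<cdot>((v\<cdot>j a)\<odot>(v\<cdot>j a))" unfolding v(4)[OF a] monoid_homD(4)[OF ih(1)[OF a]] ..
   also have "... = Mult c\<cdot>(v\<odot>v)\<cdot>(j a\<odot>j a)" using v(1-3) j[OF a] cs by simp
   finally show "v\<cdot>m\<cdot>(case p of (a, b) => j a\<odot>j b) = Mult c\<cdot>(v\<odot>v)\<cdot>(case p of (a, b) => j a\<odot>j b)"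
    unfolding p by simp
  qed (use v m cs in auto)
 qed
 have "v\<cdot>(j z\<cdot>Struct (XO z)) = (v\<cdot>j z)\<cdot>Struct (XO z)" using v(1-3) j[OF z] monoid_homD(1-3)[OF Xs[OF z]] by simp
 then have vS: "v\<cdot>Struct B = Struct c" unfolding Bs v(4)[OF z] ih(2)[OF z] .
 have wa: "wu\<in>Arr M" "Dom M wu = Carrier c" "Cod M wu = Q" using monoid_homD(1-3)[OF wh(1)] Bs by auto
 have vw: "v\<cdot>wu = \<i>\<d> (Carrier c)"
 proof -
  have va: "(B, v, c)\<in>Arr (CAlg M R)" unfolding CAlg_simps using Ba ca vh vS by blast
  have "(B, v, c) \<cdot>\<^bsub>CAlg M R\<^esub> w = Idn (CAlg M R) c"
  proof (rule X.jointly_epicD[OF X.colimit_epic[OF col]])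
   fix a assume a: "a\<in>A"
   have "v\<cdot>wu\<cdot>i a = v\<cdot>(wu\<cdot>i a)" using v(1-3) wa monoid_homD(1-3)[OF ih(1)[OF a]] by simp
   then have "v\<cdot>wu\<cdot>i a = i a" unfolding wi[OF a] v(4)[OF a] .
   then show "(B, v, c) \<cdot>\<^bsub>CAlg M R\<^esub> w \<cdot>\<^bsub>CAlg M R\<^esub> \<iota> a = Idn (CAlg M R) c \<cdot>\<^bsub>CAlg M R\<^esub> \<iota> a"
    unfolding wd id[OF a] CAlg_simps using monoid_homD(1-3)[OF ih(1)[OF a]] by simp
  qed (use w va ca CAlg_simps(3,4)[of R B v c] in \<open>simp_all add: CAlg_simps(1)\<close>)
  then show ?thesis unfolding wd CAlg_simps by simp
 qed
 show ?thesis
  using is_colimit_transport[OF Qj Y.shape fn ic v(1-3) _ wa _ vw] v(4) wi unfolding i_def by simp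
qed

section \<open>Transfinite composites of cofibrations\<close>

lemma underS_iff: "a\<in>underS r b \<longleftrightarrow> a \<noteq> b \<and> (a, b)\<in>r"
 unfolding underS_def by blast

lemma wf_strict: "Well_order r ==> wf (r - Id)"
 unfolding well_order_on_def by blast

lemma Well_orderD:
 assumes "Well_order r"
 shows "a\<in>Field r ==> (a, a)\<in>r" "(a, b)\<in>r ==> (b, c)\<in>r ==> (a, c)\<in>r"
  "(a, b)\<in>r ==> (b, a)\<in>r ==> a = b" "a\<in>Field r ==> b\<in>Field r ==> (a, b)\<in>r \<or> (b, a)\<in>r"
  "(a, b)\<in>r ==> a\<in>Field r \<and> b\<in>Field r"
proof -
 have "refl_on (Field r) r" "trans r" "antisym r" "total_on (Field r) r"
  using assms unfolding well_order_on_def linear_order_on_def partial_order_on_def preorder_on_def by blast+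
 note o = this
 show 1: "a\<in>Field r ==> (a, a)\<in>r" by (rule refl_onD[OF o(1)])
 show "(a, b)\<in>r ==> (b, c)\<in>r ==> (a, c)\<in>r" by (rule transD[OF o(2)])
 show "(a, b)\<in>r ==> (b, a)\<in>r ==> a = b" by (rule antisymD[OF o(3)])
 show "a\<in>Field r ==> b\<in>Field r ==> (a, b)\<in>r \<or> (b, a)\<in>r"
  using o(4) 1 unfolding total_on_def by (cases "a = b") blast+
 show "(a, b)\<in>r ==> a\<in>Field r \<and> b\<in>Field r" by (auto simp: Field_def)
qed

lemma is_zero_unique:
 assumes r: "Well_order r" and z: "is_zero r z" "is_zero r b" shows "b = z"
 using Well_orderD(4)[OF r, of b z] z underS_iff[of b r z] underS_iff[of z r b] unfolding is_zero_def by blast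

lemma zero_least: "Well_order r ==> is_zero r z ==> b\<in>Field r ==> (z, b)\<in>r"
 using Well_orderD(4)[of r b z] underS_iff[of b r z] unfolding is_zero_def by (metis Well_orderD(1) empty_iff)

lemma ordinal_cases:
 assumes "b\<in>Field r"
 obtains (zero) "is_zero r b" | (succ) a where "is_succ r a b" | (limit) "is_limit_element r b"
 using assms unfolding is_limit_element_def by blast

lemma is_succD: "is_succ r a b ==> a \<noteq> b \<and> (a, b)\<in>r \<and> (\<forall>d. d \<noteq> b --> (d, b)\<in>r --> (d, a)\<in>r)"
 unfolding is_succ_def Ball_def underS_iff by blast

lemma (in category) ordinal_chain:
 assumes r: "Well_order r" and A: "A \<subseteq> Field r" "A \<noteq> {}"
  and F: "is_functor (ordinal_cat A' r) C XO XA" and s: "A \<subseteq> A'"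
 shows "chain C A (\<lambda>a b. (a, b)\<in>r) XO XA"
proof unfold_locales
 note w = Well_orderD[OF r]
 show "(a, a)\<in>r" if "a\<in>A" for a using w(1) that A by blast
 show "(a, c)\<in>r" if "(a, b)\<in>r" "(b, c)\<in>r" for a b c using w(2) that .
 show "\<exists>d\<in>A. (a, d)\<in>r \<and> (b, d)\<in>r" if "a\<in>A" "b\<in>A" for a b
  using w(4)[of a b] w(1)[of a] w(1)[of b] that A(1) by blast
 show "is_functor (ordinal_cat A r) C XO XA"
  using F s unfolding preorder_functor_iff by (elim conjE, intro conjI) blast+
qed (rule A(2))

text \<open>The left lifting property passes to transfinite composites: lifts out of the stages are chosen
 by transfinite recursion, so that they are compatible.\<close>

lemma (in category) sequence_lifting:
 assumes r: "Well_order r" and z: "is_zero r z" "z\<in>A" and A: "A \<subseteq> Field r" "\<And>b. b\<in>A ==> underS r b \<subseteq> A"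
  and F: "is_functor (ordinal_cat A r) C XO XA"
  and lim: "\<And>b. b\<in>A ==> is_limit_element r b ==>
    is_colimit (ordinal_cat (underS r b) r) C XO XA (XO b) (\<lambda>a. XA (a, b))"
  and col: "is_colimit (ordinal_cat A r) C XO XA c \<iota>"
  and p: "p\<in>Arr C" and step: "\<And>a b. b\<in>A ==> is_succ r a b ==> has_lifting C (XA (a, b)) p"
 shows "has_lifting C (\<iota> z) p"
 unfolding has_lifting_def
proof (intro ballI impI)
 note w = Well_orderD[OF r]
 interpret X: chain C A "\<lambda>a b. (a, b)\<in>r" XO XA
  using ordinal_chain[OF r A(1) _ F] z(2) by blast
 note cc = X.colimit_cocone[OF col] note co = X.cocone_arr[OF cc]
 fix u v assume u: "u\<in>Hom C (Dom C (\<iota> z)) (Dom C p)" and v: "v\<in>Hom C (Cod C (\<iota> z)) (Cod C p)" and e: "p\<cdot>u = v\<cdot>\<iota> z"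
 have u: "u\<in>Arr C" "Dom C u = XO z" "Cod C u = Dom C p" and v: "v\<in>Arr C" "Dom C v = c" "Cod C v = Cod C p"
  using u v co(2)[OF z(2)] by auto
 define P where "P = (\<lambda>f b g. b\<in>A --> g\<in>Arr C \<and> Dom C g = XO b \<and> Cod C g = Dom C p \<and> p\<cdot>g = v\<cdot>\<iota> b \<and>
   (\<forall>a\<in>underS r b. g\<cdot>XA (a, b) = f a) \<and> (b = z --> g = u))"
 have "\<exists>f. \<forall>b. P f b (f b)"
 proof (rule dependent_wf_choice[OF wf_strict[OF r]])
  show "P f b g = P f' b g" if "\<And>a. (a, b)\<in>r - Id ==> f a = f' a" for f f' b g
   using that unfolding P_def by (simp add: underS_iff)
  fix b f assume IH: "\<And>a. (a, b)\<in>r - Id ==> P f a (f a)"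
  show "\<exists>g. P f b g"
  proof (cases "b\<in>A")
   case False
   then show ?thesis unfolding P_def by blast
  next
   case b: True
   have f: "f a\<in>Arr C" "Dom C (f a) = XO a" "Cod C (f a) = Dom C p" "p\<cdot>f a = v\<cdot>\<iota> a" "a\<in>A" "(a, b)\<in>r"
    "\<And>d. d\<in>underS r a ==> f a\<cdot>XA (d, a) = f d" if "a\<in>underS r b" for a
   proof -
    have "(a, b)\<in>r - Id" using that unfolding underS_iff by simp
    moreover have "a\<in>A" using A(2)[OF b] that by blast
    ultimately show "f a\<in>Arr C" "Dom C (f a) = XO a" "Cod C (f a) = Dom C p" "p\<cdot>f a = v\<cdot>\<iota> a" "a\<in>A" "(a, b)\<in>r"
     "\<And>d. d\<in>underS r a ==> f a\<cdot>XA (d, a) = f d" using IH[of a] unfolding P_def by blast+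
   qed
   have ib: "\<iota> b\<in>Arr C" "Dom C (\<iota> b) = XO b" "Cod C (\<iota> b) = c" using co(2)[OF b] by auto
   have bF: "b\<in>Field r" using b A by blast
   from bF show ?thesis
   proof (cases rule: ordinal_cases)
    case zero
    then have bz: "b = z" using is_zero_unique[OF r z(1)] by blast
    have "P f b u" unfolding P_def using zero u e bz unfolding is_zero_def by simp
    then show ?thesis by blast
   next
    case (succ a)
    have a: "a\<in>underS r b" using succ unfolding is_succ_def by blast
    note fa = f[OF a] and sd = is_succD[OF succ]
    have X: "XA (a, b)\<in>Arr C" "Dom C (XA (a, b)) = XO a" "Cod C (XA (a, b)) = XO b"
     using X.chain_arr(2)[OF fa(5) b fa(6)] by auto
    have i: "\<iota> b\<cdot>XA (a, b) = \<iota> a" using co(3)[OF fa(5) b fa(6)] .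
    obtain g where g: "g\<in>Hom C (XO b) (Dom C p)" "g\<cdot>XA (a, b) = f a" "p\<cdot>g = v\<cdot>\<iota> b"
    proof -
     have "f a\<in>Hom C (Dom C (XA (a, b))) (Dom C p)" "v\<cdot>\<iota> b\<in>Hom C (Cod C (XA (a, b))) (Cod C p)"
      using fa(1-3) X v ib by auto
     moreover have "p\<cdot>f a = v\<cdot>\<iota> b\<cdot>XA (a, b)" unfolding fa(4) i[symmetric] using v ib X by simp
     ultimately have "\<exists>d\<in>Hom C (Cod C (XA (a, b))) (Dom C p). d\<cdot>XA (a, b) = f a \<and> p\<cdot>d = v\<cdot>\<iota> b"
      using step[OF b succ] unfolding has_lifting_def by blast
     then show ?thesis using that X(3) by auto
    qed
    have "g\<cdot>XA (d, b) = f d" if d: "d\<in>underS r b" for d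
    proof (cases "d = a")
     case True
     then show ?thesis using g by simp
    next
     case False
     have da: "(d, a)\<in>r" using sd d unfolding underS_iff by blast
     have "d\<in>underS r a" using da False unfolding underS_iff by simp
     then have "f d = f a\<cdot>XA (d, a)" using fa(7) by simp
     also have "... = g\<cdot>XA (d, b)"
      unfolding g(2)[symmetric] X.chain_arr(4)[OF f(5)[OF d] fa(5) b da fa(6)]
      using g(1) X X.chain_arr(2)[OF f(5)[OF d] fa(5) da] by simp
     finally show ?thesis by simp
    qed
    moreover have "b \<noteq> z" using a z(1) unfolding is_zero_def by blast
    ultimately have "P f b g" unfolding P_def using g by simp
    then show ?thesis by blast
   next
    case limit
    have uA: "underS r b \<subseteq> A" using A(2)[OF b] .
    have ne: "underS r b \<noteq> {}" "b \<noteq> z" using limit z(1) unfolding is_limit_element_def is_zero_def by blast+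
    interpret B: chain C "underS r b" "\<lambda>a b. (a, b)\<in>r" XO XA
     using ordinal_chain[OF r _ ne(1) F uA] uA A(1) by blast
    note lb = lim[OF b limit]
    have "is_cocone (ordinal_cat (underS r b) r) C XO XA (Dom C p) f"
     unfolding preorder_cocone_iff
    proof (intro conjI ballI impI)
     show "Dom C p\<in>Obj C" using p by simp
     show "f a\<in>Hom C (XO a) (Dom C p)" if "a\<in>underS r b" for a using f[OF that] by simp
     fix a d assume a: "a\<in>underS r b" and d: "d\<in>underS r b" and ad: "(a, d)\<in>r"
     show "f d\<cdot>XA (a, d) = f a"
     proof (cases "a = d")
      case True
      then show ?thesis using X.chain_arr(3)[OF f(5)[OF d]] f[OF d] by simp
     next
      case False
      then show ?thesis using f(7)[OF d, of a] ad unfolding underS_iff by simp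
     qed
    qed
    then obtain g where g: "g\<in>Arr C" "Dom C g = XO b" "Cod C g = Dom C p" "\<And>a. a\<in>underS r b ==> g\<cdot>XA (a, b) = f a"
     using is_colimit_ex[OF lb] by auto
    have "p\<cdot>g = v\<cdot>\<iota> b"
    proof (rule jointly_epicD[OF B.colimit_epic[OF lb]])
     fix a assume a: "a\<in>underS r b"
     note fa = f[OF a]
     have X: "XA (a, b)\<in>Arr C" "Dom C (XA (a, b)) = XO a" "Cod C (XA (a, b)) = XO b"
      using X.chain_arr(2)[OF fa(5) b fa(6)] by auto
     have "p\<cdot>g\<cdot>XA (a, b) = p\<cdot>(g\<cdot>XA (a, b))" using g(1-3) p X by simp
     also have "... = v\<cdot>(\<iota> b\<cdot>XA (a, b))" unfolding g(4)[OF a] fa(4) co(3)[OF fa(5) b fa(6)] ..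
     also have "... = v\<cdot>\<iota> b\<cdot>XA (a, b)" using v ib X by simp
     finally show "p\<cdot>g\<cdot>XA (a, b) = v\<cdot>\<iota> b\<cdot>XA (a, b)" .
    qed (use g(1-3) p v ib in auto)
    then have "P f b g" unfolding P_def using g ne by simp
    then show ?thesis by blast
   qed
  qed
 qed
 then obtain f where f: "P f b (f b)" for b by blast
 have f': "f a\<in>Arr C" "Dom C (f a) = XO a" "Cod C (f a) = Dom C p" "p\<cdot>f a = v\<cdot>\<iota> a"
  "\<And>d. d\<in>underS r a ==> f a\<cdot>XA (d, a) = f d" if "a\<in>A" for a
  using f[of a] that unfolding P_def by blast+
 have fz: "f z = u" using f[of z] z(2) unfolding P_def by blast
 have "is_cocone (ordinal_cat A r) C XO XA (Dom C p) f"
  unfolding preorder_cocone_iff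
 proof (intro conjI ballI impI)
  show "Dom C p\<in>Obj C" using p by simp
  show "f a\<in>Hom C (XO a) (Dom C p)" if "a\<in>A" for a using f'[OF that] by simp
  fix a d assume a: "a\<in>A" and d: "d\<in>A" and ad: "(a, d)\<in>r"
  show "f d\<cdot>XA (a, d) = f a"
  proof (cases "a = d")
   case True
   then show ?thesis using X.chain_arr(3)[OF d] f'[OF d] by simp
  next
   case False
   then show ?thesis using f'(5)[OF d, of a] ad unfolding underS_iff by simp
  qed
 qed
 then obtain d where d: "d\<in>Arr C" "Dom C d = c" "Cod C d = Dom C p" "\<And>a. a\<in>A ==> d\<cdot>\<iota> a = f a"
  using is_colimit_ex[OF col] by auto
 have "p\<cdot>d = v"
 proof (rule jointly_epicD[OF X.colimit_epic[OF col]])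
  fix a assume a: "a\<in>A"
  have i: "\<iota> a\<in>Arr C" "Dom C (\<iota> a) = XO a" "Cod C (\<iota> a) = c" using co(2)[OF a] by auto
  have "p\<cdot>d\<cdot>\<iota> a = p\<cdot>(d\<cdot>\<iota> a)" using p d(1-3) i by simp
  then show "p\<cdot>d\<cdot>\<iota> a = v\<cdot>\<iota> a" unfolding d(4)[OF a] f'(4)[OF a] .
 qed (use p d(1-3) v in auto)
 moreover have "d\<cdot>\<iota> z = u" using d(4)[OF z(2)] fz by simp
 moreover have "d\<in>Hom C (Cod C (\<iota> z)) (Dom C p)" using d(1-3) co(2)[OF z(2)] by simp
 ultimately show "\<exists>d\<in>Hom C (Cod C (\<iota> z)) (Dom C p). d\<cdot>\<iota> z = u \<and> p\<cdot>d = v" by blast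
qed

lemma (in model_category) cof_id:
 assumes "X\<in>Obj C" shows "\<i>\<d> X\<in>Cof \<M>"
proof (rule cofI)
 show "\<i>\<d> X\<in>Arr C" using assms by simp
 fix p assume p: "p\<in>Fib \<M> \<inter> Weq \<M>"
 show "has_lifting C (\<i>\<d> X) p"
  unfolding has_lifting_def
 proof (intro ballI impI)
  fix u v assume "u\<in>Hom C (Dom C (\<i>\<d> X)) (Dom C p)" "v\<in>Hom C (Cod C (\<i>\<d> X)) (Cod C p)" "p\<cdot>u = v\<cdot>\<i>\<d> X"
  then show "\<exists>d\<in>Hom C (Cod C (\<i>\<d> X)) (Dom C p). d\<cdot>\<i>\<d> X = u \<and> p\<cdot>d = v"
   using assms fib_arr[OF p] by (intro bexI[of _ u]) auto
 qed
qed

text \<open>Along a transfinite sequence of algebras, cofibrancy of the stages and the cofibration property of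
 the composites are propagated together.\<close>

lemma (in monoidal_model_category) sequence_underlying_cofibration:
 assumes U: "inaccessible U" and R: "commutative_monoid M R" and cat: "category (CAlg M R)"
  and r: "small_ordinal U r" and seq: "is_sequence r (CAlg M R) XO XA"
  and col: "is_colimit (ordinal_cat (Field r) r) (CAlg M R) XO XA c \<iota>" and z: "is_zero r z"
  and step: "\<And>a b. is_succ r a b ==> cofibrant M \<M> (Carrier (XO a)) ==> underlying (XA (a, b))\<in>Cof \<M>"
  and A: "cofibrant M \<M> (Carrier (XO z))"
 shows "underlying (\<iota> z)\<in>Cof \<M>"
proof -
 interpret CA: category "CAlg M R" by fact
 have r': "Well_order r" and sm: "small U (Field r)" using r unfolding small_ordinal_def by auto
 note w = Well_orderD[OF r']
 have F: "is_functor (ordinal_cat (Field r) r) (CAlg M R) XO XA"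
  and lim: "\<And>b. is_limit_element r b ==> is_colimit (ordinal_cat (underS r b) r) (CAlg M R) XO XA (XO b) (\<lambda>a. XA (a, b))"
  using seq unfolding is_sequence_def by blast+
 have zF: "z\<in>Field r" using z unfolding is_zero_def by blast
 interpret X: chain "CAlg M R" "Field r" "\<lambda>a b. (a, b)\<in>r" XO XA
  using CA.ordinal_chain[OF r' order_refl _ F] zF by blast
 have main: "underlying (j z)\<in>Cof \<M>"
  if T: "T \<subseteq> Field r" "z\<in>T" "\<And>b. b\<in>T ==> underS r b \<subseteq> T"
   and h: "\<And>b. b\<in>T ==> underlying (XA (z, b))\<in>Cof \<M>"
   and c: "is_colimit (ordinal_cat T r) (CAlg M R) XO XA d j" for T d j
 proof -
  have ch: "chain (CAlg M R) S (\<lambda>a b. (a, b)\<in>r) XO XA" if "S \<subseteq> Field r" "S \<noteq> {}" for S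
   by (rule CA.ordinal_chain[OF r' that F that(1)])
  have un: "is_colimit (ordinal_cat S r) M (\<lambda>a. Carrier (XO a)) (\<lambda>x. underlying (XA x)) (Carrier e) (\<lambda>a. underlying (k a))"
   if "S \<subseteq> Field r" "S \<noteq> {}" "is_colimit (ordinal_cat S r) (CAlg M R) XO XA e k" for S e k
   by (rule chain_colimit_underlying[OF ch[OF that(1,2)] R U cocomplete small_subset[OF sm that(1)] that(3)])
  have uF: "is_functor (ordinal_cat T r) M (\<lambda>a. Carrier (XO a)) (\<lambda>x. underlying (XA x))"
   unfolding preorder_functor_iff
  proof (intro conjI ballI impI)
   fix a assume a: "a\<in>T"
   then have aF: "a\<in>Field r" using T by blast
   show "Carrier (XO a)\<in>Obj M" using X.chain_arr(1)[OF aF] algebraD(1) monoidD(1) by (auto simp: CAlg_simps)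
   show "underlying (XA (a, a)) = \<i>\<d> (Carrier (XO a))" unfolding X.chain_arr(3)[OF aF] by (simp add: CAlg_simps)
   fix b assume b: "b\<in>T" and ab: "(a, b)\<in>r"
   have bF: "b\<in>Field r" using T b by blast
   show "underlying (XA (a, b))\<in>Hom M (Carrier (XO a)) (Carrier (XO b))"
    using underlying_arr(6-8)[of "XA (a, b)" R] X.chain_arr(2)[OF aF bF ab] by auto
   fix e assume e: "e\<in>T" and be: "(b, e)\<in>r"
   have eF: "e\<in>Field r" using T e by blast
   show "underlying (XA (a, e)) = underlying (XA (b, e))\<cdot>underlying (XA (a, b))"
    unfolding X.chain_arr(4)[OF aF bF eF ab be] by (rule underlying_comp)
  qed
  have Tne: "T \<noteq> {}" using T by blast
  note uc = un[OF T(1) Tne c]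
  have cocone: "j z\<in>Arr (CAlg M R)"
   using chain.cocone_arr(2)[OF ch[OF T(1) Tne] chain.colimit_cocone[OF ch[OF T(1) Tne] c] T(2)] by blast
  show ?thesis
  proof (rule cofI)
   show "underlying (j z)\<in>Arr M" using underlying_arr(6)[OF cocone] .
   fix p assume p: "p\<in>Fib \<M> \<inter> Weq \<M>"
   show "has_lifting M (underlying (j z)) p"
   proof (rule sequence_lifting[OF r' z T(2,1,3) uF _ uc fib_arr[OF p]])
    show "is_colimit (ordinal_cat (underS r b) r) M (\<lambda>a. Carrier (XO a)) (\<lambda>x. underlying (XA x)) (Carrier (XO b))
      (\<lambda>a. underlying (XA (a, b)))" if "b\<in>T" "is_limit_element r b" for b
    proof (rule un[OF _ _ lim[OF that(2)]])
     show "underS r b \<subseteq> Field r" using T(3)[OF that(1)] T(1) by blast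
     show "underS r b \<noteq> {}" using that(2) unfolding is_limit_element_def is_zero_def by blast
    qed
    fix a b assume b: "b\<in>T" and s: "is_succ r a b"
    have a: "a\<in>T" using T(3)[OF b] s unfolding is_succ_def by blast
    have "(z, a)\<in>r" "a\<in>Field r" using zero_least[OF r' z] a T(1) by blast+
    then have "Cod M (underlying (XA (z, a))) = Carrier (XO a)" "Dom M (underlying (XA (z, a))) = Carrier (XO z)"
     using underlying_arr(7,8)[of "XA (z, a)" R] X.chain_arr(2)[OF zF, of a] by auto
    then have "cofibrant M \<M> (Carrier (XO a))" using cofibrant_cod[OF _ h[OF a]] A by simp
    then show "has_lifting M (underlying (XA (a, b))) p" by (rule cof_lifting[OF step[OF s] p])
   qed
  qed
 qed
 have h: "b\<in>Field r ==> underlying (XA (z, b))\<in>Cof \<M>" for b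
 proof (induction b rule: wf_induct_rule[OF wf_strict[OF r']])
  case (1 b)
  have IH: "underlying (XA (z, a))\<in>Cof \<M>" if "a\<in>underS r b" for a
   using 1(1)[of a] that w(5)[of a b] unfolding underS_iff by blast
  from 1(2) show ?case
  proof (cases rule: ordinal_cases)
   case zero
   then have b: "b = z" using is_zero_unique[OF r' z] by blast
   have "Carrier (XO z)\<in>Obj M" using X.chain_arr(1)[OF zF] algebraD(1) monoidD(1) by (auto simp: CAlg_simps)
   then show ?thesis unfolding b X.chain_arr(3)[OF zF] using cof_id by (simp add: CAlg_simps)
  next
   case (succ a)
   have a: "a\<in>underS r b" using succ unfolding is_succ_def by blast
   have ab: "(a, b)\<in>r" "a\<in>Field r" using a w(5)[of a b] unfolding underS_iff by auto
   have za: "(z, a)\<in>r" using zero_least[OF r' z ab(2)] .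
   have arr: "Cod M (underlying (XA (z, a))) = Carrier (XO a)" "Dom M (underlying (XA (z, a))) = Carrier (XO z)"
    "Dom M (underlying (XA (a, b))) = Carrier (XO a)"
    using underlying_arr(7,8)[of "XA (z, a)" R] underlying_arr(7)[of "XA (a, b)" R] X.chain_arr(2)[OF zF ab(2) za]
     X.chain_arr(2)[OF ab(2) 1(2) ab(1)] by auto
   have "cofibrant M \<M> (Carrier (XO a))" using cofibrant_cod[OF _ IH[OF a]] A arr by simp
   note s = step[OF succ this]
   show ?thesis unfolding X.chain_arr(4)[OF zF ab(2) 1(2) za ab(1)] underlying_comp
    by (rule cof_comp[OF IH[OF a] s]) (simp add: arr)
  next
   case limit
   have zb: "z\<in>underS r b" using limit zero_least[OF r' z 1(2)] z unfolding is_limit_element_def underS_iff by blast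
   show ?thesis
   proof (rule main[OF _ zb _ _ lim[OF limit]])
    show "underS r b \<subseteq> Field r" using w(5) unfolding subset_iff underS_iff by blast
    show "underS r a \<subseteq> underS r b" if "a\<in>underS r b" for a
     using that w(2)[of _ a b] w(3)[of a b] unfolding subset_iff underS_iff by blast
   qed (rule IH)
  qed
 qed
 show ?thesis
 proof (rule main[OF order_refl zF _ h col])
  show "underS r b \<subseteq> Field r" for b using w(5) unfolding subset_iff underS_iff by blast
 qed
qed

lemma (in monoidal_model_category) cell_underlying_cofibration:
 assumes U: "inaccessible U" and R: "commutative_monoid M R" and cat: "category (CAlg M R)"
  and G: "\<And>p. p\<in>pushouts_of (CAlg M R) G ==> cofibrant M \<M> (Carrier (Dom (CAlg M R) p)) ==> underlying p\<in>Cof \<M>"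
  and f: "f\<in>cell U (CAlg M R) G" and A: "cofibrant M \<M> (Carrier (Dom (CAlg M R) f))"
 shows "underlying f\<in>Cof \<M>"
proof -
 obtain r :: "'u rel" and XO XA c \<iota> z where s: "small_ordinal U r" "is_sequence r (CAlg M R) XO XA"
  "\<And>a b. is_succ r a b ==> XA (a, b)\<in>pushouts_of (CAlg M R) G"
  "is_colimit (ordinal_cat (Field r) r) (CAlg M R) XO XA c \<iota>" "is_zero r z" "f = \<iota> z"
  using f unfolding cell_def by blast
 have r: "Well_order r" using s(1) unfolding small_ordinal_def by blast
 interpret CA: category "CAlg M R" by fact
 have F: "is_functor (ordinal_cat (Field r) r) (CAlg M R) XO XA" using s(2) unfolding is_sequence_def by blast
 have zF: "z\<in>Field r" using s(5) unfolding is_zero_def by blast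
 interpret X: chain "CAlg M R" "Field r" "\<lambda>a b. (a, b)\<in>r" XO XA
  using CA.ordinal_chain[OF r order_refl _ F] zF by blast
 have Dz: "Dom (CAlg M R) (\<iota> z) = XO z" using X.cocone_arr(2)[OF X.colimit_cocone[OF s(4)] zF] by blast
 show ?thesis unfolding s(6)
 proof (rule sequence_underlying_cofibration[OF U R cat s(1,2,4,5)])
  show "cofibrant M \<M> (Carrier (XO z))" using A unfolding s(6) Dz .
  fix a b assume ab: "is_succ r a b" and a: "cofibrant M \<M> (Carrier (XO a))"
  have "(a, b)\<in>r" using ab unfolding is_succ_def underS_iff by blast
  then have "Dom (CAlg M R) (XA (a, b)) = XO a" using X.chain_arr(2)[of a b] Well_orderD(5)[OF r] by blast
  then show "underlying (XA (a, b))\<in>Cof \<M>" using G[OF s(3)[OF ab]] a by simp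
 qed
qed

section \<open>Construction of transfinite sequences\<close>

lemma is_cocone_cong:
 assumes "\<And>i. i\<in>Obj D ==> FO i = FO' i" "\<And>a. a\<in>Arr D ==> FA a = FA' a" "\<And>i. i\<in>Obj D ==> \<iota> i = \<iota>' i"
  and D: "category D"
 shows "is_cocone D C FO FA c \<iota> \<longleftrightarrow> is_cocone D C FO' FA' c \<iota>'"
proof -
 have d: "Dom D a\<in>Obj D" "Cod D a\<in>Obj D" if "a\<in>Arr D" for a using category.dom_cod_closed[OF D that] by auto
 have "(\<forall>i\<in>Obj D. \<iota> i\<in>Hom C (FO i) c) \<longleftrightarrow> (\<forall>i\<in>Obj D. \<iota>' i\<in>Hom C (FO' i) c)" using assms(1,3) by simp
 moreover have "(\<forall>a\<in>Arr D. \<iota> (Cod D a) \<cdot>\<^bsub>C\<^esub> FA a = \<iota> (Dom D a)) \<longleftrightarrow> (\<forall>a\<in>Arr D. \<iota>' (Cod D a) \<cdot>\<^bsub>C\<^esub> FA' a = \<iota>' (Dom D a))"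
  using assms(2,3) d by simp
 ultimately show ?thesis unfolding is_cocone_def by simp
qed

lemma is_colimit_cong:
 assumes FO: "\<And>i. i\<in>Obj D ==> FO i = FO' i" and FA: "\<And>a. a\<in>Arr D ==> FA a = FA' a"
  and \<iota>: "\<And>i. i\<in>Obj D ==> \<iota> i = \<iota>' i" and D: "category D"
 shows "is_colimit D C FO FA c \<iota> \<longleftrightarrow> is_colimit D C FO' FA' c \<iota>'"
proof -
 have 1: "is_cocone D C FO' FA' c \<iota> \<longleftrightarrow> is_cocone D C FO' FA' c \<iota>'" using HOL.refl HOL.refl \<iota> D by (rule is_cocone_cong)
 have 2: "is_cocone D C FO FA Z \<kappa> \<longleftrightarrow> is_cocone D C FO' FA' Z \<kappa>" for Z \<kappa>
  using FO FA HOL.refl D by (rule is_cocone_cong)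
 have 3: "(u\<in>Hom C c Z \<and> (\<forall>i\<in>Obj D. u \<cdot>\<^bsub>C\<^esub> \<iota> i = \<kappa> i)) \<longleftrightarrow> (u\<in>Hom C c Z \<and> (\<forall>i\<in>Obj D. u \<cdot>\<^bsub>C\<^esub> \<iota>' i = \<kappa> i))"
  for u Z and \<kappa> using \<iota> by simp
 show ?thesis unfolding is_colimit_def 2 1 3 ..
qed

lemma category_ordinal_cat: "Well_order r ==> A \<subseteq> Field r ==> category (ordinal_cat A r)"
 by (rule category_preorder_cat) (blast intro: Well_orderD(1), rule Well_orderD(2))

lemma underS_trans: "Well_order r ==> a\<in>underS r b ==> d\<in>underS r a ==> d\<in>underS r b"
 using Well_orderD(2,3)[of r] unfolding underS_iff by blast

lemma underS_le: "Well_order r ==> a\<in>underS r b ==> (d, a)\<in>r ==> d\<in>underS r b"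
 using Well_orderD(2,3)[of r] unfolding underS_iff by blast

lemma underS_Field: "Well_order r ==> a\<in>underS r b ==> a\<in>Field r"
 unfolding underS_iff Field_def by blast

text \<open>A stage of the recursion consists of the object, the transition arrows from all earlier stages and the
 projection to the base; at limit stages the colimit is taken. The predicate \<open>St\<close> of a step may depend on
 the index and on the composite from the start, so that prescribed data given at the start can be treated
 one after the other.\<close>

lemma (in category) build_sequence:
 fixes U :: "'u set" and St :: "'u => 'm => 'm => 'm => 'm => bool"
 assumes U: "inaccessible U" "cocomplete U C" and r: "small_ordinal U r" and z: "is_zero r z" and p0: "p0\<in>Arr C"
  and step: "\<And>a x p. a\<in>Field r ==> x\<in>Arr C ==> p\<in>Arr C ==> Dom C x = Dom C p0 ==> Cod C x = Dom C p ==>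
   Cod C p = Cod C p0 ==> p\<cdot>x = p0 ==>
   \<exists>s p'. s\<in>Arr C \<and> Dom C s = Dom C p \<and> p'\<in>Arr C \<and> Dom C p' = Cod C s \<and> p'\<cdot>s = p \<and> St a x p s p'"
 obtains XO XA P where "is_sequence r C XO XA" "XO z = Dom C p0"
  "\<And>b. b\<in>Field r ==> P b\<in>Hom C (XO b) (Cod C p0)" "\<And>a b. (a, b)\<in>r ==> P b\<cdot>XA (a, b) = P a" "P z = p0"
  "\<And>a b. is_succ r a b ==> St a (XA (z, a)) (P a) (XA (a, b)) (P b)"
proof -
 have wo: "Well_order r" and sm: "small U (Field r)" using r unfolding small_ordinal_def by auto
 note w = Well_orderD[OF wo]
 let ?B = "Cod C p0"
 define O' T P' where "O' = (\<lambda>v :: 'o \<times> ('u => 'm) \<times> 'm. fst v)" and "T = (\<lambda>v :: 'o \<times> ('u => 'm) \<times> 'm. fst (snd v))"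
  and "P' = (\<lambda>v :: 'o \<times> ('u => 'm) \<times> 'm. snd (snd v))"
 have [simp]: "O' (X, t, p) = X" "T (X, t, p) = t" "P' (X, t, p) = p" for X t p by (auto simp: O'_def T_def P'_def)
 define FA where "FA = (\<lambda>(f :: 'u => 'o \<times> ('u => 'm) \<times> 'm) x. T (f (snd x)) (fst x))"
 define Pr where "Pr = (\<lambda>f b v. b\<in>Field r --> O' v\<in>Obj C \<and> P' v\<in>Arr C \<and> Dom C (P' v) = O' v \<and> Cod C (P' v) = ?B \<and>
  (\<forall>a\<in>underS r b. T v a\<in>Arr C \<and> Dom C (T v a) = O' (f a) \<and> Cod C (T v a) = O' v \<and> P' v\<cdot>T v a = P' (f a)) \<and>
  T v b = \<i>\<d> (O' v) \<and> (\<forall>a\<in>underS r b. \<forall>d\<in>underS r a. T v d = T v a\<cdot>T (f a) d) \<and>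
  (b = z --> O' v = Dom C p0 \<and> P' v = p0) \<and>
  (\<forall>a. is_succ r a b --> St a (T (f a) z) (P' (f a)) (T v a) (P' v)) \<and>
  (is_limit_element r b --> is_colimit (ordinal_cat (underS r b) r) C (\<lambda>a. O' (f a)) (FA f) (O' v) (T v)))"
 have "\<exists>f. \<forall>b. Pr f b (f b)"
 proof (rule dependent_wf_choice[OF wf_strict[OF wo]])
  fix f f' :: "'u => 'o \<times> ('u => 'm) \<times> 'm" and b v assume e: "\<And>a. (a, b)\<in>r - Id ==> f a = f' a"
  have e: "f a = f' a" if "a\<in>underS r b" for a using e[of a] that unfolding underS_iff by simp
  have s: "is_succ r a b ==> a\<in>underS r b" for a unfolding is_succ_def by blast
  have "underS r b \<subseteq> Field r" using underS_Field[OF wo] by blast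
  note cd = category_ordinal_cat[OF wo this]
  have co: "is_colimit (ordinal_cat (underS r b) r) C (\<lambda>a. O' (f a)) (FA f) (O' v) (T v) \<longleftrightarrow>
    is_colimit (ordinal_cat (underS r b) r) C (\<lambda>a. O' (f' a)) (FA f') (O' v) (T v)"
   by (rule is_colimit_cong[OF _ _ _ cd]) (use e in \<open>auto simp: FA_def\<close>)
  have 1: "(\<forall>a\<in>underS r b. T v a\<in>Arr C \<and> Dom C (T v a) = O' (f a) \<and> Cod C (T v a) = O' v \<and> P' v\<cdot>T v a = P' (f a)) \<longleftrightarrow>
   (\<forall>a\<in>underS r b. T v a\<in>Arr C \<and> Dom C (T v a) = O' (f' a) \<and> Cod C (T v a) = O' v \<and> P' v\<cdot>T v a = P' (f' a))"
   using e by simp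
  have 2: "(\<forall>a\<in>underS r b. \<forall>d\<in>underS r a. T v d = T v a\<cdot>T (f a) d) \<longleftrightarrow> (\<forall>a\<in>underS r b. \<forall>d\<in>underS r a. T v d = T v a\<cdot>T (f' a) d)"
   using e by simp
  have 3: "(\<forall>a. is_succ r a b --> St a (T (f a) z) (P' (f a)) (T v a) (P' v)) \<longleftrightarrow>
    (\<forall>a. is_succ r a b --> St a (T (f' a) z) (P' (f' a)) (T v a) (P' v))" using e[OF s] by auto
  show "Pr f b v = Pr f' b v" unfolding Pr_def co 1 2 3 ..
 next
  fix b and f :: "'u => 'o \<times> ('u => 'm) \<times> 'm" assume IH: "\<And>a. (a, b)\<in>r - Id ==> Pr f a (f a)"
  show "\<exists>v. Pr f b v"
  proof (cases "b\<in>Field r")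
   case False
   then show ?thesis unfolding Pr_def by blast
  next
   case bF: True
   have pr: "Pr f a (f a)" if "a\<in>underS r b" for a using IH[of a] that unfolding underS_iff by simp
   have A: "O' (f a)\<in>Obj C" "P' (f a)\<in>Arr C" "Dom C (P' (f a)) = O' (f a)" "Cod C (P' (f a)) = ?B"
    "T (f a) a = \<i>\<d> (O' (f a))" "a = z --> O' (f a) = Dom C p0 \<and> P' (f a) = p0" if "a\<in>underS r b" for a
    using pr[OF that] underS_Field[OF wo that] unfolding Pr_def by blast+
   have A2: "T (f a) d\<in>Arr C" "Dom C (T (f a) d) = O' (f d)" "Cod C (T (f a) d) = O' (f a)" "P' (f a)\<cdot>T (f a) d = P' (f d)"
    if "a\<in>underS r b" "(d, a)\<in>r" for a d
   proof -
    have "T (f a) d\<in>Arr C \<and> Dom C (T (f a) d) = O' (f d) \<and> Cod C (T (f a) d) = O' (f a) \<and> P' (f a)\<cdot>T (f a) d = P' (f d)"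
    proof (cases "d = a")
     case True
     then show ?thesis using A[OF that(1)] by simp
    next
     case False
     then have "d\<in>underS r a" using that(2) unfolding underS_iff by blast
     then show ?thesis using pr[OF that(1)] underS_Field[OF wo that(1)] unfolding Pr_def by blast
    qed
    then show "T (f a) d\<in>Arr C" "Dom C (T (f a) d) = O' (f d)" "Cod C (T (f a) d) = O' (f a)" "P' (f a)\<cdot>T (f a) d = P' (f d)"
     by auto
   qed
   have A3: "T (f a) e = T (f a) d\<cdot>T (f d) e" if a: "a\<in>underS r b" and d: "(d, a)\<in>r" and e: "(e, d)\<in>r" for a d e
   proof -
    have du: "d\<in>underS r b" by (rule underS_le[OF wo a d])
    consider "d = a" | "e = d" | "d\<in>underS r a" "e\<in>underS r d" using d e unfolding underS_iff by blast
    then show ?thesis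
    proof cases
     case 1
     then show ?thesis using A(5)[OF a] A2[OF a] e by simp
    next
     case 2
     then show ?thesis using A(5)[OF du] A2[OF a d] by simp
    next
     case 3
     then show ?thesis using pr[OF a] underS_Field[OF wo a] unfolding Pr_def by blast
    qed
   qed
   from bF show ?thesis
   proof (cases rule: ordinal_cases)
    case zero
    then have bz: "b = z" using is_zero_unique[OF wo z] by blast
    have u: "underS r b = {}" using zero unfolding is_zero_def by blast
    have "\<not> is_succ r a b" for a using u unfolding is_succ_def by blast
    moreover have "\<not> is_limit_element r b" using zero unfolding is_limit_element_def by blast
    ultimately have "Pr f b (Dom C p0, \<lambda>_. \<i>\<d> (Dom C p0), p0)" unfolding Pr_def u using p0 by simp
    then show ?thesis by blast
   next
    case (succ a)
    have a: "a\<in>underS r b" using succ unfolding is_succ_def by blast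
    note aF = underS_Field[OF wo a]
    have za: "(z, a)\<in>r" using zero_least[OF wo z aF] .
    have zu: "z\<in>underS r b" by (rule underS_le[OF wo a za])
    have below: "(d, a)\<in>r" if "d\<in>underS r b" for d using succ that unfolding is_succ_def by blast
    have fz: "O' (f z) = Dom C p0" "P' (f z) = p0" using A(6)[OF zu] by blast+
    obtain s p' where s: "s\<in>Arr C" "Dom C s = O' (f a)" "p'\<in>Arr C" "Dom C p' = Cod C s" "p'\<cdot>s = P' (f a)"
     "St a (T (f a) z) (P' (f a)) s p'"
     using step[OF aF A2(1)[OF a za] A(2)[OF a]] A2[OF a za] A[OF a] fz by auto
    define t where "t = (\<lambda>d. if d = b then \<i>\<d> (Cod C s) else s\<cdot>T (f a) d)"
    have ba: "b \<notin> underS r b" unfolding underS_iff by simp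
    have td: "t d = s\<cdot>T (f a) d" if "d\<in>underS r b" for d using that ba unfolding t_def by auto
    have ta: "t a = s" unfolding td[OF a] A(5)[OF a] using s by simp
    have "Cod C p' = ?B"
    proof -
     have "Cod C p' = Cod C (p'\<cdot>s)" using s(1-4) by simp
     then show ?thesis unfolding s(5) A(4)[OF a] .
    qed
    moreover have "T1": "t d\<in>Arr C \<and> Dom C (t d) = O' (f d) \<and> Cod C (t d) = Cod C s \<and> p'\<cdot>t d = P' (f d)"
     if d: "d\<in>underS r b" for d
    proof -
     note x = A2[OF a below[OF d]]
     have "p'\<cdot>(s\<cdot>T (f a) d) = (p'\<cdot>s)\<cdot>T (f a) d" using s(1-4) x by simp
     then show ?thesis unfolding td[OF d] s(5) x(4) using s(1-4) x(1-3) by simp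
    qed
    moreover have "t e = t d\<cdot>T (f d) e" if d: "d\<in>underS r b" and e: "e\<in>underS r d" for d e
    proof -
     have e': "(e, d)\<in>r" using e unfolding underS_iff by blast
     show ?thesis
      unfolding td[OF d] td[OF underS_trans[OF wo d e]] A3[OF a below[OF d] e']
      using s(1,2) A2[OF a below[OF d]] A2[OF d e'] by simp
    qed
    moreover have "a' = a" if "is_succ r a' b" for a'
     using is_succD[OF that] is_succD[OF succ] w(3) by blast
    moreover have "b \<noteq> z" using a z unfolding is_zero_def by blast
    moreover have "\<not> is_limit_element r b" using succ unfolding is_limit_element_def by blast
    moreover have "t b = \<i>\<d> (Cod C s)" unfolding t_def by simp
    ultimately have "Pr f b (Cod C s, t, p')"
     unfolding Pr_def using s ta by auto
    then show ?thesis by blast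
   next
    case limit
    have uF: "underS r b \<subseteq> Field r" using underS_Field[OF wo] by blast
    have ne: "underS r b \<noteq> {}" "b \<noteq> z" using limit z unfolding is_limit_element_def is_zero_def by blast+
    have ba: "b \<notin> underS r b" unfolding underS_iff by simp
    let ?D = "ordinal_cat (underS r b) r"
    note D = category_ordinal_cat[OF wo uF]
    have fn: "is_functor ?D C (\<lambda>a. O' (f a)) (FA f)"
     unfolding preorder_functor_iff FA_def fst_conv snd_conv
    proof (intro conjI ballI impI)
     show "O' (f a)\<in>Obj C" "T (f a) a = \<i>\<d> (O' (f a))" if "a\<in>underS r b" for a using A[OF that] by auto
     show "T (f d) a\<in>Hom C (O' (f a)) (O' (f d))" if "d\<in>underS r b" "(a, d)\<in>r" for a d
      using A2[OF that] by simp
     show "T (f c) a = T (f c) d\<cdot>T (f d) a" if "c\<in>underS r b" "(a, d)\<in>r" "(d, c)\<in>r" for a d c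
      using A3[OF that(1,3,2)] .
    qed
    obtain X \<iota> where X: "is_colimit ?D C (\<lambda>a. O' (f a)) (FA f) X \<iota>"
     using colimit_exists[OF U(2) D small_preorder_cat[OF U(1) small_subset[OF sm uF]] fn] by blast
    have co: "X\<in>Obj C" "\<And>a. a\<in>underS r b ==> \<iota> a\<in>Arr C \<and> Dom C (\<iota> a) = O' (f a) \<and> Cod C (\<iota> a) = X"
     "\<And>a d. a\<in>underS r b ==> d\<in>underS r b ==> (a, d)\<in>r ==> \<iota> d\<cdot>T (f d) a = \<iota> a"
     using X unfolding is_colimit_def preorder_cocone_iff FA_def fst_conv snd_conv in_Hom by blast+
    have "is_cocone ?D C (\<lambda>a. O' (f a)) (FA f) ?B (\<lambda>a. P' (f a))"
     unfolding preorder_cocone_iff FA_def fst_conv snd_conv using p0 A A2 by simp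
    then obtain p where p: "p\<in>Arr C" "Dom C p = X" "Cod C p = ?B" "\<And>a. a\<in>underS r b ==> p\<cdot>\<iota> a = P' (f a)"
     using is_colimit_ex[OF X] by auto
    define t where "t = (\<lambda>d. if d = b then \<i>\<d> X else \<iota> d)"
    have td: "t d = \<iota> d" if "d\<in>underS r b" for d using that ba unfolding t_def by auto
    have "is_colimit ?D C (\<lambda>a. O' (f a)) (FA f) X t \<longleftrightarrow> is_colimit ?D C (\<lambda>a. O' (f a)) (FA f) X \<iota>"
     by (rule is_colimit_cong[OF _ _ _ D]) (use td in auto)
    moreover have "t e = t d\<cdot>T (f d) e" if d: "d\<in>underS r b" and e: "e\<in>underS r d" for d e
     unfolding td[OF d] td[OF underS_trans[OF wo d e]]
     using co(3)[OF underS_trans[OF wo d e] d] e unfolding underS_iff by simp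
    moreover have "\<not> is_succ r a b" for a using limit unfolding is_limit_element_def by blast
    moreover have "t b = \<i>\<d> X" unfolding t_def by simp
    ultimately have "Pr f b (X, t, p)" unfolding Pr_def using X co(1,2) p ne(2) td by simp
    then show ?thesis by blast
   qed
  qed
 qed
 then obtain f where f: "\<And>b. Pr f b (f b)" by blast
 define XO XA P where "XO = (\<lambda>b. O' (f b))" and "XA = FA f" and "P = (\<lambda>b. P' (f b))"
 have F1: "XO b\<in>Obj C" "P b\<in>Hom C (XO b) ?B" "XA (b, b) = \<i>\<d> (XO b)" "b = z ==> XO b = Dom C p0" "b = z ==> P b = p0"
  "is_succ r a b ==> St a (XA (z, a)) (P a) (XA (a, b)) (P b)" if "b\<in>Field r" for a b
  using f[of b] that unfolding Pr_def XO_def XA_def P_def FA_def fst_conv snd_conv in_Hom by blast+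
 have F2: "XA (a, b)\<in>Hom C (XO a) (XO b) \<and> P b\<cdot>XA (a, b) = P a" if ab: "(a, b)\<in>r" for a b
 proof (cases "a = b")
  case True
  then show ?thesis using F1(1-3)[of b] w(5)[OF ab] by simp
 next
  case False
  then have "a\<in>underS r b" using ab unfolding underS_iff by blast
  then show ?thesis using f[of b] w(5)[OF ab] unfolding Pr_def XO_def XA_def P_def FA_def fst_conv snd_conv in_Hom by blast
 qed
 have F3: "XA (a, c) = XA (b, c)\<cdot>XA (a, b)" if ab: "(a, b)\<in>r" and bc: "(b, c)\<in>r" for a b c
 proof -
  have fl: "a\<in>Field r" "b\<in>Field r" "c\<in>Field r" using w(5) ab bc by blast+
  consider "a = b" | "b = c" | "b\<in>underS r c" "a\<in>underS r b" using ab bc unfolding underS_iff by blast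
  then show ?thesis
  proof cases
   case 1
   then show ?thesis using F1(3)[OF fl(2)] F2[OF bc] by simp
  next
   case 2
   then show ?thesis using F1(3)[OF fl(2)] F2[OF ab] by simp
  next
   case 3
   then show ?thesis using f[of c] fl(3) unfolding Pr_def XA_def FA_def fst_conv snd_conv by blast
  qed
 qed
 have seq: "is_sequence r C XO XA"
  unfolding is_sequence_def
 proof (intro conjI allI impI)
  show "is_functor (ordinal_cat (Field r) r) C XO XA"
   unfolding preorder_functor_iff using F1(1,3) F2 F3 by blast
  fix b assume b: "is_limit_element r b"
  then have "b\<in>Field r" unfolding is_limit_element_def by blast
  then have "is_colimit (ordinal_cat (underS r b) r) C XO XA (XO b) (T (f b))"
   using f[of b] b unfolding Pr_def XO_def XA_def by blast
  moreover have "(\<lambda>a. XA (a, b)) = T (f b)" unfolding XA_def FA_def by simp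
  ultimately show "is_colimit (ordinal_cat (underS r b) r) C XO XA (XO b) (\<lambda>a. XA (a, b))" by simp
 qed
 have zF: "z\<in>Field r" using z unfolding is_zero_def by blast
 show ?thesis
 proof (rule that[OF seq, of P])
  show "XO z = Dom C p0" "P z = p0" using F1(4,5)[OF zF] by auto
  show "P b\<in>Hom C (XO b) ?B" if "b\<in>Field r" for b by (rule F1(2)[OF that])
  show "P b\<cdot>XA (a, b) = P a" if "(a, b)\<in>r" for a b using F2[OF that] by blast
  fix a b assume s: "is_succ r a b"
  then have "b\<in>Field r" using w(5) unfolding is_succ_def underS_iff by blast
  from F1(6)[OF this s] show "St a (XA (z, a)) (P a) (XA (a, b)) (P b)" .
 qed
qed

lemma (in category) pushout_exists:
 fixes U :: "'u set"
 assumes U: "inaccessible U" "cocomplete U C" and f: "f\<in>Arr C" and g: "g\<in>Arr C" and d: "Dom C f = Dom C g"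
 obtains p q where "is_pushout C f g p q"
proof -
 let ?F = "\<lambda>b. if b then Cod C f else Cod C g" and ?Rel = "{(True, f, False, g)}"
 have wf: "glue_relations C UNIV ?F ?Rel" unfolding glue_relations_def using f g d by auto
 obtain c \<iota> where G: "is_glue C UNIV ?F ?Rel c \<iota>"
  using glue_exists[OF U small_finite[OF U(1)] small_finite[OF U(1)] wf] by auto
 note h = is_glue_hom(1-3)[OF G] is_glue_hom(4)[OF G] and e = is_glue_epic[OF G wf]
 have \<iota>: "\<iota> True\<in>Arr C" "Dom C (\<iota> True) = Cod C f" "Cod C (\<iota> True) = c"
  "\<iota> False\<in>Arr C" "Dom C (\<iota> False) = Cod C g" "Cod C (\<iota> False) = c" using h(1-3)[of True] h(1-3)[of False] by auto
 have rel: "\<iota> True\<cdot>f = \<iota> False\<cdot>g" using is_glue_rel[OF G] by blast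
 have "is_pushout C f g (\<iota> True) (\<iota> False)"
  unfolding is_pushout_def
 proof (intro conjI ballI impI)
  fix Z a b assume Z: "Z\<in>Obj C" and a: "a\<in>Hom C (Cod C f) Z" and b: "b\<in>Hom C (Cod C g) Z" and eq: "a\<cdot>f = b\<cdot>g"
  obtain u where u: "u\<in>Arr C" "Dom C u = c" "Cod C u = Z" "\<And>i. i\<in>UNIV ==> u\<cdot>\<iota> i = (if i then a else b)"
   by (rule is_glue_ex[OF G Z, of "\<lambda>i. if i then a else b"]) (use a b eq in auto)
  show "\<exists>!u. u\<in>Hom C (Cod C (\<iota> True)) Z \<and> u\<cdot>\<iota> True = a \<and> u\<cdot>\<iota> False = b"
  proof (rule ex1I[of _ u])
   show "u\<in>Hom C (Cod C (\<iota> True)) Z \<and> u\<cdot>\<iota> True = a \<and> u\<cdot>\<iota> False = b" using u(1-3) u(4)[of True] u(4)[of False] \<iota> by simp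
   fix v assume v: "v\<in>Hom C (Cod C (\<iota> True)) Z \<and> v\<cdot>\<iota> True = a \<and> v\<cdot>\<iota> False = b"
   show "v = u"
   proof (rule jointly_epicD[OF e])
    show "v\<cdot>\<iota> i = u\<cdot>\<iota> i" for i using v u(4)[of i] by (cases i) auto
   qed (use u(1-3) v \<iota> in auto)
  qed
 qed (use f g d \<iota> rel in auto)
 then show ?thesis using that by blast
qed

section \<open>The small object argument\<close>

text \<open>This is where the regularity of the inaccessible cardinal enters.\<close>

lemma small_UNION:
 fixes U :: "'u set"
 assumes U: "inaccessible U" and I: "small U I" and A: "\<And>i. i\<in>I ==> small U (A i)"
 shows "small U (\<Union>i\<in>I. A i)"
proof -
 have "stable |U|"
  by (rule regularCard_stable[OF card_of_Card_order]) (use U inaccessible_infinite[OF U] in \<open>auto simp: inaccessible_def Field_card_of\<close>)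
 from stable_UNION[OF this, of I A] show ?thesis using I A unfolding small_def by blast
qed

lemma succ_exists:
 assumes r: "Well_order r" and ab: "a \<noteq> b" "(a, b)\<in>r"
 obtains c where "is_succ r a c"
proof -
 note w = Well_orderD[OF r]
 have "b\<in>{c. a \<noteq> c \<and> (a, c)\<in>r}" using ab by simp
 then obtain c where c: "c\<in>{c. a \<noteq> c \<and> (a, c)\<in>r}" "\<And>d. (d, c)\<in>r - Id ==> d \<notin> {c. a \<noteq> c \<and> (a, c)\<in>r}"
  by (rule wfE_min[OF wf_strict[OF r]]) blast
 have "(d, a)\<in>r" if "d\<in>underS r c" for d
 proof -
  have d: "(d, c)\<in>r - Id" using that unfolding underS_iff by simp
  then have "\<not> (a \<noteq> d \<and> (a, d)\<in>r)" using c(2) by blast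
  moreover have "d\<in>Field r" "a\<in>Field r" using d ab w(5) by blast+
  ultimately show ?thesis using w(4)[of a d] w(1)[of a] by blast
 qed
 moreover have "a\<in>underS r c" using c(1) unfolding underS_iff by simp
 ultimately show ?thesis using that[of c] unfolding is_succ_def by blast
qed

lemma zero_exists:
 assumes r: "Well_order r" and ne: "Field r \<noteq> {}"
 obtains z where "is_zero r z"
proof -
 obtain b where "b\<in>Field r" using ne by blast
 then obtain z where z: "z\<in>Field r" "\<And>d. (d, z)\<in>r - Id ==> d \<notin> Field r"
  by (rule wfE_min[OF wf_strict[OF r]]) blast
 have "d \<notin> underS r z" for d
 proof
  assume "d\<in>underS r z"
  then have "(d, z)\<in>r - Id" unfolding underS_iff by simp
  then show False using z(2) Well_orderD(5)[OF r] by blast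
 qed
 then have "is_zero r z" using z(1) unfolding is_zero_def by blast
 then show ?thesis by (rule that)
qed

text \<open>The successor cardinal of a small upper bound of the given cardinals is regular, so that small
 families in it are bounded.\<close>

lemma filtered_ordinal_exists:
 fixes U :: "'u set" and k :: "'i => 'u rel"
 assumes U: "inaccessible U" and I: "small U I" and k: "\<And>i. i\<in>I ==> Card_order (k i) \<and> small U (Field (k i))"
 obtains r :: "'u rel" where "small_ordinal U r" "Field r \<noteq> {}" "\<And>a. a\<in>Field r ==> \<exists>b\<in>Field r. a \<noteq> b \<and> (a, b)\<in>r"
  "\<And>i. i\<in>I ==> is_filtered (k i) r"
proof -
 obtain e :: "nat => 'u" where e: "inj_on e UNIV" "e ` UNIV \<subseteq> U"
  using small_embedding[OF small_nat[OF U, of UNIV]] by blast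
 let ?K = "(\<Union>i\<in>I. Field (k i)) \<union> range e"
 have Ks: "small U ?K"
 proof -
  have "small U (Field (k i))" if "i\<in>I" for i using k[OF that] by blast
  then have "small U ((\<Union>i\<in>I. Field (k i)) <+> range e)"
   by (intro small_Plus[OF U small_UNION[OF U I] small_image[OF small_nat[OF U]]])
  from small_image[OF this, of "case_sum id id"] show ?thesis
  proof (rule small_subset, intro subsetI)
   fix x assume "x\<in>?K"
   then have "x\<in>case_sum id id ` (Inl ` (\<Union>i\<in>I. Field (k i)) \<union> Inr ` range e)"
    unfolding image_Un image_image by simp
   then show "x\<in>case_sum id id ` ((\<Union>i\<in>I. Field (k i)) <+> range e)" unfolding Plus_def .
  qed
 qed
 have Kinf: "infinite ?K" using e(1) finite_imageD[of e UNIV] by auto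
 let ?s = "cardSuc |?K|"
 have sC: "Card_order ?s" by (rule cardSuc_Card_order) (rule card_of_Card_order)
 have "?s \<le>o |Pow ?K|" by (rule cardSuc_least[OF card_of_Card_order card_of_Card_order card_of_Pow])
 moreover have "|Pow ?K| <o |U|" using U Ks unfolding inaccessible_def small_def by blast
 ultimately have sU: "?s <o |U|" by (rule ordLeq_ordLess_trans)
 have "small U (Field ?s)" unfolding small_def
  by (rule ordIso_ordLess_trans[OF card_of_Field_ordIso[OF sC] sU])
 then obtain g :: "_ => 'u" where g: "inj_on g (Field ?s)" "g ` Field ?s \<subseteq> U" using small_embedding by blast
 define V where "V = g ` Field ?s"
 have Vs: "|V| =o ?s"
  unfolding V_def using ordIso_transitive[OF ordIso_symmetric[OF card_of_ordIsoI[OF inj_on_imp_bij_betw[OF g(1)]]] card_of_Field_ordIso[OF sC]] .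
 have Ci: "Cinfinite |?K|" using Kinf unfolding cinfinite_def Field_card_of by (rule conjI) (rule card_of_card_order_on)
 have Cs: "Cinfinite ?s" using Cinfinite_cardSuc[OF Ci] .
 have reg: "regularCard |V|"
  using regularCard_ordIso[OF ordIso_symmetric[OF Vs] Cs regularCard_cardSuc[OF Ci]] .
 have Vinf: "infinite V"
  using Cinfinite_cong[OF ordIso_symmetric[OF Vs] Cs] unfolding cinfinite_def Field_card_of by (rule conjunct1)
 let ?r = "|V|"
 have F: "Field ?r = V" by (rule Field_card_of)
 have wo: "Well_order ?r" by (rule card_of_Well_order)
 have V: "small U V" unfolding small_def using ordIso_ordLess_trans[OF Vs sU] .
 have lim: "\<exists>b\<in>Field ?r. a \<noteq> b \<and> (a, b)\<in>?r" if "a\<in>Field ?r" for a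
  using infinite_Card_order_limit[OF card_of_Card_order _ that] Vinf unfolding F by blast
 have "is_filtered (k i) ?r" if i: "i\<in>I" for i
  unfolding is_filtered_def
 proof (intro conjI allI impI ballI)
  show "Field ?r \<noteq> {}" using Vinf F by auto
  show "\<exists>b\<in>Field ?r. a \<noteq> b \<and> (a, b)\<in>?r" if "a\<in>Field ?r" for a by (rule lim[OF that])
  fix A assume A: "A \<subseteq> Field ?r" "|A| \<le>o k i"
  have ki: "Card_order (k i)" using k[OF i] by blast
  have "k i \<le>o |?K|"
   using ordIso_ordLeq_trans[OF ordIso_symmetric[OF card_of_Field_ordIso[OF ki]] card_of_mono1[of "Field (k i)" ?K]] i by blast
  then have "|A| \<le>o |?K|" using A(2) ordLeq_transitive by blast
  then have "|A| <o ?s" using cardSuc_greater[OF card_of_Card_order] ordLeq_ordLess_trans by blast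
  then have "|A| <o |V|" using ordLess_ordIso_trans ordIso_symmetric[OF Vs] by blast
  then have "\<not> |A| =o |V|" using not_ordLess_ordIso by blast
  then have "\<not> cofinal A ?r" using reg A(1) unfolding regularCard_def by blast
  then obtain b where b: "b\<in>Field ?r" "\<And>a. a\<in>A ==> \<not> (b \<noteq> a \<and> (b, a)\<in>?r)" unfolding cofinal_def by blast
  have "(a, b)\<in>?r" if "a\<in>A" for a
  proof -
   have "a\<in>Field ?r" using A(1) that by blast
   then show ?thesis using Well_orderD(4)[OF wo, of a b] Well_orderD(1)[OF wo, of b] b(1) b(2)[OF that] by blast
  qed
  then show "\<exists>b\<in>Field ?r. \<forall>a\<in>A. (a, b)\<in>?r" using b(1) by blast
 qed
 moreover have "small_ordinal U ?r" unfolding small_ordinal_def by (rule conjI[OF wo]) (unfold F, rule V)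
 moreover have "Field ?r \<noteq> {}" using Vinf F by auto
 ultimately show ?thesis using that[of ?r] lim by blast
qed

context category
begin

text \<open>The sequence with a single stage.\<close>

lemma id_cell:
 assumes X: "X\<in>Obj C" and U: "inaccessible (U :: 'u set)"
 shows "\<i>\<d> X\<in>cell U C I"
proof -
 define a :: 'u where "a = undefined"
 let ?r = "{(a, a)}"
 have F: "Field ?r = {a}" unfolding Field_def by auto
 have wo: "Well_order ?r"
  unfolding well_order_on_def linear_order_on_def partial_order_on_def preorder_on_def F
  by (auto simp: refl_on_def trans_def antisym_def total_on_def)
 have u: "underS ?r b = {}" for b unfolding underS_def by auto
 have ns: "\<not> is_succ ?r b c" for b c unfolding is_succ_def u by blast
 have nl: "\<not> is_limit_element ?r b" for b unfolding is_limit_element_def is_zero_def u by blast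
 let ?XO = "\<lambda>_ :: 'u. X" and ?XA = "\<lambda>_ :: 'u \<times> 'u. \<i>\<d> X"
 have seq: "is_sequence ?r C ?XO ?XA"
  unfolding is_sequence_def preorder_functor_iff using X nl by simp
 have col: "is_colimit (ordinal_cat (Field ?r) ?r) C ?XO ?XA X (\<lambda>_. \<i>\<d> X)"
  unfolding is_colimit_def preorder_cocone_iff F preorder_cat_simps
 proof (intro conjI allI impI)
  fix Z \<kappa> assume a: "Z\<in>Obj C \<and> (\<forall>b\<in>{a}. \<kappa> b\<in>Hom C X Z) \<and> (\<forall>b\<in>{a}. \<forall>c\<in>{a}. (b, c)\<in>?r --> \<kappa> c\<cdot>\<i>\<d> X = \<kappa> b)"
  show "\<exists>!u. u\<in>Hom C X Z \<and> (\<forall>i\<in>{a}. u\<cdot>\<i>\<d> X = \<kappa> i)"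
  proof (rule ex1I[of _ "\<kappa> a"])
   have k: "\<kappa> a\<in>Arr C" "Dom C (\<kappa> a) = X" "Cod C (\<kappa> a) = Z" using a by auto
   then have e: "\<kappa> a\<cdot>\<i>\<d> X = \<kappa> a" by simp
   show "\<kappa> a\<in>Hom C X Z \<and> (\<forall>i\<in>{a}. \<kappa> a\<cdot>\<i>\<d> X = \<kappa> i)" using k e by simp
   fix u assume u: "u\<in>Hom C X Z \<and> (\<forall>i\<in>{a}. u\<cdot>\<i>\<d> X = \<kappa> i)"
   then have "u\<cdot>\<i>\<d> X = \<kappa> a" "u\<in>Arr C" "Dom C u = X" by auto
   then show "u = \<kappa> a" using comp_id(1)[of u] by metis
  qed
 qed (use X in simp_all)
 have "small U (Field ?r)" unfolding F by (rule small_finite[OF U]) simp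
 with wo have "small_ordinal U ?r" unfolding small_ordinal_def by (rule conjI)
 moreover have "is_zero ?r a" unfolding is_zero_def u F by simp
 ultimately show ?thesis
  unfolding cell_def mem_Collect_eq using seq col ns
  by (intro exI[of _ ?r] exI[of _ ?XO] exI[of _ ?XA] exI[of _ X] exI[of _ "\<lambda>_. \<i>\<d> X"] exI[of _ a]) blast
qed

text \<open>The squares are enumerated by a small well-order without greatest element, and the square with index \<open>a\<close>,
 pushed forward to stage \<open>a\<close>, is solved at the successor of \<open>a\<close>. Indices without a square repeat a fixed one;
 if there is no square at all, nothing is attached.\<close>

lemma attach_all:
 fixes U :: "'u set"
 assumes U: "inaccessible U" "cocomplete U C" "locally_small U C" and I: "I \<subseteq> Arr C" "small U I" and p0: "p0\<in>Arr C"
 obtains s p where "s\<in>cell U C I" "s\<in>Arr C" "Dom C s = Dom C p0" "p\<in>Arr C" "Dom C p = Cod C s" "p\<cdot>s = p0"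
  "\<And>i u v. i\<in>I ==> u\<in>Hom C (Dom C i) (Dom C p0) ==> v\<in>Hom C (Cod C i) (Cod C p0) ==> p0\<cdot>u = v\<cdot>i ==>
    \<exists>d\<in>Hom C (Cod C i) (Cod C s). d\<cdot>i = s\<cdot>u \<and> p\<cdot>d = v"
proof -
 let ?X = "Dom C p0" and ?B = "Cod C p0"
 have o: "?X\<in>Obj C" "?B\<in>Obj C" using p0 by auto
 define T where "T = {(i, u, v). i\<in>I \<and> u\<in>Hom C (Dom C i) ?X \<and> v\<in>Hom C (Cod C i) ?B \<and> p0\<cdot>u = v\<cdot>i}"
 show ?thesis
 proof (cases "T = {}")
  case True
  have "\<i>\<d> ?X\<in>cell U C I" by (rule id_cell[OF o(1) U(1)])
  then show ?thesis
  proof (rule that[of "\<i>\<d> ?X" p0])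
   fix i u v assume "i\<in>I" "u\<in>Hom C (Dom C i) ?X" "v\<in>Hom C (Cod C i) ?B" "p0\<cdot>u = v\<cdot>i"
   then have "(i, u, v)\<in>T" unfolding T_def by blast
   then show "\<exists>d\<in>Hom C (Cod C i) (Cod C (\<i>\<d> ?X)). d\<cdot>i = \<i>\<d> ?X\<cdot>u \<and> p0\<cdot>d = v" using True by blast
  qed (use o p0 in auto)
 next
  case False
  then obtain \<tau>0 where \<tau>0: "\<tau>0\<in>T" by blast
  have Ts: "small U T"
  proof -
   have s: "small U (Hom C (Dom C i) ?X \<times> Hom C (Cod C i) ?B)" if "i\<in>I" for i
   proof (rule small_Times[OF U(1)])
    have "i\<in>Arr C" using I(1) that by blast
    then have "Dom C i\<in>Obj C" "Cod C i\<in>Obj C" by auto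
    then show "small U (Hom C (Dom C i) ?X)" "small U (Hom C (Cod C i) ?B)" using U(3) o unfolding locally_small_def by blast+
   qed
   have "small U (\<Union>i\<in>I. {i} \<times> (Hom C (Dom C i) ?X \<times> Hom C (Cod C i) ?B))"
    by (rule small_UNION[OF U(1) I(2) small_Times[OF U(1) small_finite[OF U(1)] s]]) auto
   then show ?thesis by (rule small_subset) (auto simp: T_def)
  qed
  then have "small U (T <+> (UNIV :: nat set))" by (rule small_Plus[OF U(1) _ small_nat[OF U(1)]])
  then obtain e :: "_ => 'u" where e: "inj_on e (T <+> (UNIV :: nat set))" using small_embedding by blast
  define V where "V = e ` (T <+> (UNIV :: nat set))"
  have Vs: "small U V" unfolding V_def using small_image \<open>small U (T <+> UNIV)\<close> by blast
  have Vinf: "infinite V" unfolding V_def using finite_imageD[OF _ e] by (auto simp: finite_Plus_iff)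
  \<comment> \<open>Indices that do not come from a square are sent to \<open>\<tau>0\<close>.\<close>
  define sq where "sq = (\<lambda>a. if \<exists>\<tau>\<in>T. a = e (Inl \<tau>) then THE \<tau>. \<tau>\<in>T \<and> a = e (Inl \<tau>) else \<tau>0)"
  have sqe: "sq (e (Inl \<tau>)) = \<tau>" if "\<tau>\<in>T" for \<tau>
  proof -
   have "(THE \<tau>'. \<tau>'\<in>T \<and> e (Inl \<tau>) = e (Inl \<tau>')) = \<tau>"
    by (rule the_equality) (use that inj_onD[OF e] in auto)
   then show ?thesis unfolding sq_def using that by auto
  qed
  have sqT: "sq a\<in>T" for a
  proof (cases "\<exists>\<tau>\<in>T. a = e (Inl \<tau>)")
   case True
   then obtain \<tau> where "\<tau>\<in>T" "a = e (Inl \<tau>)" by blast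
   then show ?thesis using sqe by simp
  next
   case False
   then have "sq a = \<tau>0" unfolding sq_def by simp
   then show ?thesis using \<tau>0 by simp
  qed
  let ?r = "|V|"
  have F: "Field ?r = V" by (rule Field_card_of)
  have wo: "Well_order ?r" by (rule card_of_Well_order)
  have "small U (Field ?r)" unfolding F by (rule Vs)
  with wo have so: "small_ordinal U ?r" unfolding small_ordinal_def by (rule conjI)
  have "Field ?r \<noteq> {}" using Vinf F by auto
  then obtain z where z: "is_zero ?r z" using zero_exists[OF wo] by blast
  have zF: "z\<in>Field ?r" using z unfolding is_zero_def by blast
  define St where "St = (\<lambda>a x (p :: 'm) s p'. case sq a of (i, u, v) => \<exists>q. is_pushout C (x\<cdot>u) i s q \<and> p'\<cdot>q = v)"
  obtain XO XA P where X: "is_sequence ?r C XO XA" "XO z = Dom C p0"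
   "\<And>b. b\<in>Field ?r ==> P b\<in>Hom C (XO b) (Cod C p0)" "\<And>a b. (a, b)\<in>?r ==> P b\<cdot>XA (a, b) = P a" "P z = p0"
   "\<And>a b. is_succ ?r a b ==> St a (XA (z, a)) (P a) (XA (a, b)) (P b)"
  proof (rule build_sequence[OF U(1,2) so z p0, of St])
   fix a x p assume a: "x\<in>Arr C" "p\<in>Arr C" "Dom C x = ?X" "Cod C x = Dom C p" "Cod C p = ?B" "p\<cdot>x = p0"
   obtain i u v where s: "sq a = (i, u, v)" by (cases "sq a")
   have \<tau>: "i\<in>Arr C" "u\<in>Arr C" "Dom C u = Dom C i" "Cod C u = ?X" "v\<in>Arr C" "Dom C v = Cod C i" "Cod C v = ?B"
    "p0\<cdot>u = v\<cdot>i" using sqT[of a] I(1) unfolding s T_def by auto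
   have f: "x\<cdot>u\<in>Arr C" "Dom C (x\<cdot>u) = Dom C i" "Cod C (x\<cdot>u) = Dom C p" using a \<tau> by auto
   obtain y q where po: "is_pushout C (x\<cdot>u) i y q" by (rule pushout_exists[OF U(1,2) f(1) \<tau>(1) f(2)])
   then have y: "y\<in>Arr C" "Dom C y = Dom C p" using f unfolding is_pushout_def by auto
   have "p\<cdot>(x\<cdot>u) = p\<cdot>x\<cdot>u" using a(1-5) \<tau>(1-7) by simp
   then have e: "p\<cdot>(x\<cdot>u) = v\<cdot>i" unfolding a(6) \<tau>(8) .
   have "p\<in>Hom C (Cod C (x\<cdot>u)) ?B" "v\<in>Hom C (Cod C i) ?B" using f a \<tau> by auto
   then obtain p' where p': "p'\<in>Hom C (Cod C y) ?B" "p'\<cdot>y = p" "p'\<cdot>q = v"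
    using po e o(2) unfolding is_pushout_def by blast
   then have "St a x p y p'" unfolding St_def s using po by auto
   then show "\<exists>s p'. s\<in>Arr C \<and> Dom C s = Dom C p \<and> p'\<in>Arr C \<and> Dom C p' = Cod C s \<and> p'\<cdot>s = p \<and> St a x p s p'"
    using y p' by auto
  qed blast
  have fn: "is_functor (ordinal_cat (Field ?r) ?r) C XO XA" using X(1) unfolding is_sequence_def by blast
  interpret X: chain C "Field ?r" "\<lambda>a b. (a, b)\<in>?r" XO XA using ordinal_chain[OF wo order_refl _ fn] zF by blast
  obtain c \<iota> where col: "is_colimit (ordinal_cat (Field ?r) ?r) C XO XA c \<iota>"
   using colimit_exists[OF U(2) X.shape small_preorder_cat[OF U(1)] fn] Vs F by auto
  note co = X.cocone_arr[OF X.colimit_cocone[OF col]]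
  have "is_cocone (ordinal_cat (Field ?r) ?r) C XO XA ?B P" unfolding preorder_cocone_iff using o X(3,4) by blast
  then obtain p where p: "p\<in>Arr C" "Dom C p = c" "Cod C p = ?B" "\<And>b. b\<in>Field ?r ==> p\<cdot>\<iota> b = P b"
   using is_colimit_ex[OF col] by auto
  have push: "XA (a, b)\<in>pushouts_of C I" if ab: "is_succ ?r a b" for a b
  proof -
   obtain i u v where s: "sq a = (i, u, v)" by (cases "sq a")
   have "i\<in>I" using sqT[of a] unfolding s T_def by blast
   moreover obtain q where "is_pushout C (XA (z, a)\<cdot>u) i (XA (a, b)) q" using X(6)[OF ab] unfolding St_def s by auto
   ultimately show ?thesis unfolding pushouts_of_def by blast
  qed
  have iz: "\<iota> z\<in>Arr C" "Dom C (\<iota> z) = ?X" "Cod C (\<iota> z) = c" using co(2)[OF zF] X(2) by auto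
  have "\<iota> z\<in>cell U C I"
   unfolding cell_def mem_Collect_eq using so X(1) push col z by blast
  then show ?thesis
  proof (rule that[of "\<iota> z" p])
   fix i u v assume i: "i\<in>I" and u: "u\<in>Hom C (Dom C i) ?X" and v: "v\<in>Hom C (Cod C i) ?B" and e: "p0\<cdot>u = v\<cdot>i"
   have \<tau>: "(i, u, v)\<in>T" unfolding T_def using i u v e by blast
   define a where "a = e (Inl (i, u, v))"
   have "a\<in>V" unfolding V_def a_def using \<tau> by blast
   then have aF: "a\<in>Field ?r" unfolding F .
   have s: "sq a = (i, u, v)" unfolding a_def by (rule sqe[OF \<tau>])
   obtain b0 where "a \<noteq> b0" "(a, b0)\<in>?r"
    using infinite_Card_order_limit[OF card_of_Card_order _ aF] Vinf unfolding F by blast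
   then obtain b where ab: "is_succ ?r a b" using succ_exists[OF wo] by blast
   have ab': "(a, b)\<in>?r" "b\<in>Field ?r" using ab Well_orderD(5)[OF wo] unfolding is_succ_def underS_iff by blast+
   have za: "(z, a)\<in>?r" by (rule zero_least[OF wo z aF])
   obtain q where q: "is_pushout C (XA (z, a)\<cdot>u) i (XA (a, b)) q" "P b\<cdot>q = v" using X(6)[OF ab] unfolding St_def s by auto
   have ia: "i\<in>Arr C" using i I by blast
   have xz: "XA (z, a)\<in>Arr C" "Dom C (XA (z, a)) = ?X" "Cod C (XA (z, a)) = XO a"
    and xa: "XA (a, b)\<in>Arr C" "Dom C (XA (a, b)) = XO a" "Cod C (XA (a, b)) = XO b"
    using X.chain_arr(2)[OF zF aF za] X.chain_arr(2)[OF aF ab'(2,1)] X(2) by auto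
   have qa: "q\<in>Arr C" "Dom C q = Cod C i" "Cod C q = XO b" "XA (a, b)\<cdot>(XA (z, a)\<cdot>u) = q\<cdot>i"
    using q(1) xa unfolding is_pushout_def by auto
   have ib: "\<iota> b\<in>Arr C" "Dom C (\<iota> b) = XO b" "Cod C (\<iota> b) = c" using co(2)[OF ab'(2)] by auto
   have u': "u\<in>Arr C" "Dom C u = Dom C i" "Cod C u = ?X" using u by auto
   have "\<iota> b\<cdot>q\<cdot>i = \<iota> b\<cdot>(q\<cdot>i)" using ib qa(1-3) ia by simp
   also have "... = (\<iota> b\<cdot>XA (a, b))\<cdot>XA (z, a)\<cdot>u" unfolding qa(4)[symmetric] using ib xa xz u' by simp
   also have "... = \<iota> z\<cdot>u" unfolding co(3)[OF aF ab'(2,1)] co(3)[OF zF aF za] ..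
   finally have 1: "\<iota> b\<cdot>q\<cdot>i = \<iota> z\<cdot>u" .
   have "p\<cdot>(\<iota> b\<cdot>q) = p\<cdot>\<iota> b\<cdot>q" using p(1-3) ib qa(1-3) by simp
   then have "p\<cdot>(\<iota> b\<cdot>q) = v" unfolding p(4)[OF ab'(2)] q(2) .
   then show "\<exists>d\<in>Hom C (Cod C i) (Cod C (\<iota> z)). d\<cdot>i = \<iota> z\<cdot>u \<and> p\<cdot>d = v"
    using 1 ib qa(1-3) iz by (intro bexI[of _ "\<iota> b\<cdot>q"]) auto
  qed (use iz p X(5) zF in auto)
 qed
qed

end

text \<open>Each step of the sequence solves all squares from the generators at that stage. The length is filtered
 for all bounds on the domains of the generators, so a square to the colimit factors through some stage, and
 is solved at the next one. The steps are cell complexes instead of single pushouts.\<close>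

lemma (in cofibrantly_generated) small_object_argument:
 assumes U: "inaccessible U" and f: "f\<in>Arr C"
 obtains r XO XA c \<iota> z q where "small_ordinal U r" "is_sequence r C XO XA" "is_colimit (ordinal_cat (Field r) r) C XO XA c \<iota>"
  "is_zero r z" "\<And>a b. is_succ r a b ==> XA (a, b)\<in>cell U C I"
  "XO z = Dom C f" "q\<in>Fib \<M> \<inter> Weq \<M>" "Dom C q = c" "Cod C q = Cod C f" "q\<cdot>\<iota> z = f"
proof -
 let ?Q = "\<lambda>i k. Card_order k \<and> small U (Field k) \<and> (\<forall>r XO XA c \<iota>. small_ordinal U r \<and> is_filtered k r \<and> is_sequence r C XO XA \<and>
    (\<forall>a b. is_succ r a b --> XA (a, b)\<in>cell U C I) \<and>
    is_colimit (ordinal_cat (Field r) r) C XO XA c \<iota> -->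
     (\<forall>f\<in>Hom C (Dom C i) c. \<exists>b\<in>Field r. \<exists>g\<in>Hom C (Dom C i) (XO b). f = \<iota> b\<cdot>g))"
 have "\<exists>k :: 'u rel. ?Q i k" if i: "i\<in>I" for i
 proof -
  obtain k :: "'u rel" where k: "Card_order k" "small U (Field k)" and K: "(\<forall>r XO XA c \<iota>. small_ordinal U r \<and> is_filtered k r \<and> is_sequence r C XO XA \<and>
    (\<forall>a b. is_succ r a b --> XA (a, b)\<in>cell U C I) \<and>
    is_colimit (ordinal_cat (Field r) r) C XO XA c \<iota> -->
     (\<forall>f\<in>Hom C (Dom C i) c. \<exists>b\<in>Field r. \<exists>g\<in>Hom C (Dom C i) (XO b). f = \<iota> b\<cdot>g) \<and>
     (\<forall>a\<in>Field r. \<forall>b\<in>Field r. \<forall>g\<in>Hom C (Dom C i) (XO a). \<forall>g'\<in>Hom C (Dom C i) (XO b).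
       \<iota> a\<cdot>g = \<iota> b\<cdot>g' -->
       (\<exists>d\<in>Field r. (a, d)\<in>r \<and> (b, d)\<in>r \<and> XA (a, d)\<cdot>g = XA (b, d)\<cdot>g')))"
   using domains_small(1)[OF i] unfolding small_rel_def by blast
  show ?thesis
  proof (intro exI[of _ k] conjI allI impI)
   fix r XO XA c \<iota> assume a: "small_ordinal U r \<and> is_filtered k r \<and> is_sequence r C XO XA \<and>
    (\<forall>a b. is_succ r a b --> XA (a, b)\<in>cell U C I) \<and> is_colimit (ordinal_cat (Field r) r) C XO XA c \<iota>"
   show "\<forall>f\<in>Hom C (Dom C i) c. \<exists>b\<in>Field r. \<exists>g\<in>Hom C (Dom C i) (XO b). f = \<iota> b\<cdot>g"
    using K[rule_format, OF a] by (rule conjunct1)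
  qed (rule k)+
 qed
 then obtain k where k: "\<And>i. i\<in>I ==> ?Q i (k i)" by metis
 obtain r :: "'u rel" where r: "small_ordinal U r" "Field r \<noteq> {}" "\<And>a. a\<in>Field r ==> \<exists>b\<in>Field r. a \<noteq> b \<and> (a, b)\<in>r"
  "\<And>i. i\<in>I ==> is_filtered (k i) r"
  using filtered_ordinal_exists[OF U generators(3), of k] k by blast
 have wo: "Well_order r" and sm: "small U (Field r)" using r(1) unfolding small_ordinal_def by auto
 obtain z where z: "is_zero r z" using zero_exists[OF wo r(2)] by blast
 let ?B = "Cod C f"
 define St where "St = (\<lambda>(a :: 'u) (x :: 'm) p s p'. s\<in>cell U C I \<and> (\<forall>i u v. i\<in>I --> u\<in>Hom C (Dom C i) (Dom C p) -->
   v\<in>Hom C (Cod C i) (Cod C p) --> p\<cdot>u = v\<cdot>i --> (\<exists>d\<in>Hom C (Cod C i) (Cod C s). d\<cdot>i = s\<cdot>u \<and> p'\<cdot>d = v)))"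
 obtain XO XA P where X: "is_sequence r C XO XA" "XO z = Dom C f"
  "\<And>b. b\<in>Field r ==> P b\<in>Hom C (XO b) ?B" "\<And>a b. (a, b)\<in>r ==> P b\<cdot>XA (a, b) = P a" "P z = f"
  "\<And>a b. is_succ r a b ==> St a (XA (z, a)) (P a) (XA (a, b)) (P b)"
 proof (rule build_sequence[OF U cocomplete r(1) z f, of St])
  fix a x p assume p: "p\<in>Arr C"
  obtain s p' where s: "s\<in>cell U C I" "s\<in>Arr C" "Dom C s = Dom C p" "p'\<in>Arr C" "Dom C p' = Cod C s" "p'\<cdot>s = p"
   "\<And>i u v. i\<in>I ==> u\<in>Hom C (Dom C i) (Dom C p) ==> v\<in>Hom C (Cod C i) (Cod C p) ==> p\<cdot>u = v\<cdot>i ==>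
     \<exists>d\<in>Hom C (Cod C i) (Cod C s). d\<cdot>i = s\<cdot>u \<and> p'\<cdot>d = v"
   by (rule attach_all[OF U cocomplete locally_small generators(1,3) p]) blast
  have "St a x p s p'" unfolding St_def using s(1,7) by blast
  then show "\<exists>s p'. s\<in>Arr C \<and> Dom C s = Dom C p \<and> p'\<in>Arr C \<and> Dom C p' = Cod C s \<and> p'\<cdot>s = p \<and> St a x p s p'"
   using s(2-6) by blast
 qed blast
 have zF: "z\<in>Field r" using z unfolding is_zero_def by blast
 have fn: "is_functor (ordinal_cat (Field r) r) C XO XA" using X(1) unfolding is_sequence_def by blast
 interpret X: chain C "Field r" "\<lambda>a b. (a, b)\<in>r" XO XA using ordinal_chain[OF wo order_refl _ fn] zF by blast
 obtain c \<iota> where col: "is_colimit (ordinal_cat (Field r) r) C XO XA c \<iota>"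
  using colimit_exists[OF cocomplete X.shape small_preorder_cat[OF U sm] fn] by blast
 note co = X.cocone_arr[OF X.colimit_cocone[OF col]]
 have Bo: "?B\<in>Obj C" using f by simp
 have "is_cocone (ordinal_cat (Field r) r) C XO XA ?B P" unfolding preorder_cocone_iff using Bo X(3,4) by blast
 then obtain q where q: "q\<in>Arr C" "Dom C q = c" "Cod C q = ?B" "\<And>b. b\<in>Field r ==> q\<cdot>\<iota> b = P b"
  using is_colimit_ex[OF col] by auto
 have cells: "XA (a, b)\<in>cell U C I" if "is_succ r a b" for a b using X(6)[OF that] unfolding St_def by blast
 have "q\<in>inj_arrows C I"
  unfolding inj_arrows_def mem_Collect_eq
 proof (intro conjI ballI)
  fix i assume i: "i\<in>I"
  have ia: "i\<in>Arr C" using i generators(1) by blast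
  show "has_lifting C i q"
   unfolding has_lifting_def q(2,3)
  proof (intro ballI impI)
   fix u v assume u: "u\<in>Hom C (Dom C i) c" and v: "v\<in>Hom C (Cod C i) ?B" and e: "q\<cdot>u = v\<cdot>i"
   obtain b g where b: "b\<in>Field r" and g: "g\<in>Hom C (Dom C i) (XO b)" "u = \<iota> b\<cdot>g"
    using k[OF i] r(1) r(4)[OF i] X(1) cells col u by blast
   obtain b0 where "b0\<in>Field r" "b \<noteq> b0" "(b, b0)\<in>r" using r(3)[OF b] by blast
   then obtain d where bd: "is_succ r b d" using succ_exists[OF wo] by blast
   have bd': "(b, d)\<in>r" "d\<in>Field r" using bd Well_orderD(5)[OF wo] unfolding is_succ_def underS_iff by blast+
   have ib: "\<iota> b\<in>Arr C" "Dom C (\<iota> b) = XO b" "Cod C (\<iota> b) = c" and id: "\<iota> d\<in>Arr C" "Dom C (\<iota> d) = XO d" "Cod C (\<iota> d) = c"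
    using co(2)[OF b] co(2)[OF bd'(2)] by auto
   have x: "XA (b, d)\<in>Arr C" "Dom C (XA (b, d)) = XO b" "Cod C (XA (b, d)) = XO d" using X.chain_arr(2)[OF b bd'(2,1)] by auto
   have g': "g\<in>Arr C" "Dom C g = Dom C i" "Cod C g = XO b" using g(1) by auto
   have Pb: "Dom C (P b) = XO b" "Cod C (P b) = ?B" using X(3)[OF b] by auto
   have "P b\<cdot>g = q\<cdot>(\<iota> b\<cdot>g)" unfolding q(4)[OF b, symmetric] using q(1-3) ib g' by simp
   then have "P b\<cdot>g = v\<cdot>i" unfolding g(2)[symmetric] e .
   then obtain w where w: "w\<in>Hom C (Cod C i) (XO d)" "w\<cdot>i = XA (b, d)\<cdot>g" "P d\<cdot>w = v"
    using X(6)[OF bd] i g(1) v unfolding St_def Pb x(3) by blast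
   have w': "w\<in>Arr C" "Dom C w = Cod C i" "Cod C w = XO d" using w(1) by auto
   have "\<iota> d\<cdot>w\<cdot>i = \<iota> d\<cdot>(w\<cdot>i)" using id w' ia by simp
   also have "... = \<iota> d\<cdot>XA (b, d)\<cdot>g" unfolding w(2) using id x g' by simp
   also have "... = u" unfolding co(3)[OF b bd'(2,1)] g(2) ..
   finally have 1: "\<iota> d\<cdot>w\<cdot>i = u" .
   have "q\<cdot>(\<iota> d\<cdot>w) = q\<cdot>\<iota> d\<cdot>w" using q(1-3) id w' by simp
   then have "q\<cdot>(\<iota> d\<cdot>w) = v" unfolding q(4)[OF bd'(2)] w(3) .
   then show "\<exists>d\<in>Hom C (Cod C i) c. d\<cdot>i = u \<and> q\<cdot>d = v"
    using 1 id w' by (intro bexI[of _ "\<iota> d\<cdot>w"]) auto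
  qed
 qed (rule q(1))
 then have "q\<in>Fib \<M> \<inter> Weq \<M>" unfolding trivial_fib_eq .
 then show ?thesis using that[of r XO XA c \<iota> z q] r(1) X(1,2,5) col z cells q zF by simp
qed

section \<open>Cofibrations of algebras\<close>

theorem proposition3p5:
  fixes U :: "'u set"
    and M :: "('o, 'm) smcat"
    and \<M> :: "'m model_structure"
    and I J :: "'m set"
    and \<N> :: "('o, 'm) cmon \<Rightarrow> ('o, 'm) calg_arr model_structure"
    and R :: "('o, 'm) cmon"
    and \<phi> :: "('o, 'm) calg_arr"
  assumes "inaccessible U"
    and "monoidal_model_category U M \<M>"
    and "cofibrantly_generated U M \<M> I J"
    and "strong_commutative_monoid_axiom M \<M>"
    and "\<And>R'. commutative_monoid M R' \<Longrightarrow> inherited_model_structure U M \<M> I J R' (\<N> R')"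
    and "commutative_monoid M R"
    and "\<phi> \<in> Cof (\<N> R)"
    and "cofibrant M \<M> (Carrier (Dom (CAlg M R) \<phi>))"
  shows "underlying \<phi> \<in> Cof \<M>"
proof -
 interpret monoidal_model_category U M \<M> by fact
 interpret G: cofibrantly_generated U M \<M> I J by fact
 let ?G = "tensor_Sym_arr M R ` I" and ?C = "CAlg M R"
 interpret A: cofibrantly_generated U "CAlg M R" "\<N> R" "tensor_Sym_arr M R ` I" "tensor_Sym_arr M R ` J"
  using assms(5)[OF assms(6)] unfolding inherited_model_structure_def by blast
 note cat = A.category_axioms
 have I: "h\<in>Cof \<M>" if "h\<in>I" for h
 proof (rule cofI)
  show "h\<in>Arr M" using G.generators(1) that by blast
  show "has_lifting M h p" if "p\<in>Fib \<M> \<inter> Weq \<M>" for p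
   using that \<open>h\<in>I\<close> unfolding G.trivial_fib_eq inj_arrows_def by blast
 qed
 \<comment> \<open>The generators of the model structure on \<open>B\<close>-algebras are arrows of \<open>CAlg M B\<close>; so their ends, the free
  algebras, are commutative algebras.\<close>
 have free: "commutative_algebra M B (tensor_alg M B (Sym M (Dom M h))) \<and> commutative_algebra M B (tensor_alg M B (Sym M (Cod M h)))"
  if "h\<in>I" "commutative_monoid M B" for h and B :: "('o, 'm) cmon"
 proof -
  have "cofibrantly_generated U (CAlg M B) (\<N> B) (tensor_Sym_arr M B ` I) (tensor_Sym_arr M B ` J)"
   using assms(5)[OF that(2)] unfolding inherited_model_structure_def by blast
  then have "tensor_Sym_arr M B h\<in>Arr (CAlg M B)" using cofibrantly_generated.generators(1) that(1) by blast
  then show ?thesis unfolding tensor_Sym_arr_def CAlg_simps by blast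
 qed
 have push: "underlying p\<in>Cof \<M>" if p: "p\<in>pushouts_of ?C ?G" "cofibrant M \<M> (Carrier (Dom ?C p))" for p
 proof -
  obtain h f q where h: "h\<in>I" and po: "is_pushout ?C f (tensor_Sym_arr M R h) p q"
   using p(1) unfolding pushouts_of_def by blast
  show ?thesis
   by (rule pushout_generator_cofibration[OF assms(1,4,6) I[OF h] free[OF h] po p(2) cat])
 qed
 have \<phi>: "\<phi>\<in>Arr ?C" using assms(7) by (rule A.cof_arr)
 obtain r XO XA c \<iota> z q where S: "small_ordinal U r" "is_sequence r ?C XO XA" "is_colimit (ordinal_cat (Field r) r) ?C XO XA c \<iota>"
  "is_zero r z" "\<And>a b. is_succ r a b ==> XA (a, b)\<in>cell U ?C ?G"
  "XO z = Dom ?C \<phi>" "q\<in>Fib (\<N> R) \<inter> Weq (\<N> R)" "Dom ?C q = c" "Cod ?C q = Cod ?C \<phi>" "q \<cdot>\<^bsub>?C\<^esub> \<iota> z = \<phi>"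
  by (rule A.small_object_argument[OF assms(1) \<phi>]) blast
 have q: "q\<in>Arr ?C" using S(7) by (rule A.fib_arr)
 have wo: "Well_order r" and zF: "z\<in>Field r" using S(1,4) unfolding small_ordinal_def is_zero_def by blast+
 interpret X: chain ?C "Field r" "\<lambda>a b. (a, b)\<in>r" XO XA
  using A.ordinal_chain[OF wo order_refl] S(2) zF unfolding is_sequence_def by blast
 have \<iota>: "\<iota> z\<in>Arr ?C" "Dom ?C (\<iota> z) = Dom ?C \<phi>" "Cod ?C (\<iota> z) = c"
  using X.cocone_arr(2)[OF X.colimit_cocone[OF S(3)] zF] S(6) by auto
 have \<iota>cof: "underlying (\<iota> z)\<in>Cof \<M>"
 proof (rule sequence_underlying_cofibration[OF assms(1,6) cat S(1-4)])
  show "cofibrant M \<M> (Carrier (XO z))" unfolding S(6) by (rule assms(8))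
  fix a b assume ab: "is_succ r a b" and a: "cofibrant M \<M> (Carrier (XO a))"
  have "(a, b)\<in>r" using ab unfolding is_succ_def underS_iff by blast
  then have "Dom ?C (XA (a, b)) = XO a" using X.chain_arr(2)[of a b] Well_orderD(5)[OF wo] by blast
  then show "underlying (XA (a, b))\<in>Cof \<M>"
   using cell_underlying_cofibration[OF assms(1,6) cat push S(5)[OF ab]] a by simp
 qed
 obtain d where d: "d\<in>Arr ?C" "Dom ?C d = Cod ?C \<phi>" "Cod ?C d = c" "d \<cdot>\<^bsub>?C\<^esub> \<phi> = \<iota> z" "q \<cdot>\<^bsub>?C\<^esub> d = Idn ?C (Cod ?C \<phi>)"
  by (rule A.has_liftingE[OF A.cof_lifting[OF assms(7) S(7)] \<phi> q \<iota>(1), of "Idn ?C (Cod ?C \<phi>)"])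
   (use S(8-10) \<iota> \<phi> q in simp_all)
 note u\<phi> = underlying_arr(6-8)[OF \<phi>] and u\<iota> = underlying_arr(6-8)[OF \<iota>(1)] and ud = underlying_arr(6-8)[OF d(1)]
  and uq = underlying_arr(6-8)[OF q]
 have e: "underlying d \<cdot>\<^bsub>M\<^esub> underlying \<phi> = underlying (\<iota> z)" "underlying q \<cdot>\<^bsub>M\<^esub> underlying (\<iota> z) = underlying \<phi>"
  "underlying q \<cdot>\<^bsub>M\<^esub> underlying d = Idn M (Carrier (Cod ?C \<phi>))"
  unfolding underlying_comp[where R = R, symmetric] d(4,5) S(10) by (simp_all add: CAlg_simps)
 have o: "Carrier (Dom ?C \<phi>)\<in>Obj M" using dom_obj[OF u\<phi>(1)] u\<phi>(2) by simp
 have "is_retract M (underlying \<phi>) (underlying (\<iota> z))"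
  by (rule is_retractI[of _ _ _ "Idn M (Carrier (Dom ?C \<phi>))" "Idn M (Carrier (Dom ?C \<phi>))" "underlying d" "underlying q"])
   (use u\<phi> u\<iota> ud uq \<iota>(2,3) d(2,3) S(8,9) o e in simp_all)
 then show ?thesis using retracts(3) \<iota>cof by blast
qed

end
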